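(* Let $U\subset S^{n\times n}$ be a convex neighborhood, and let $F:U\to\mathbb R$ be smooth and uniformly convex on $U$ with convexity constant $\Lambda>0$. For every $M\ge 0$ there exists $\omega>0$, depending only on $n,\Lambda,M$ (and on the fixed data $U$, $F$), such that the following holds. Suppose $u\in W^{2,\infty}(B_1)$ satisfies $D^2u(B_1)\subset U$ and $\|D^2u\|_{L^\infty(B_1)}=M$, and $u$ is a critical point of $$\int_{B_1}F(D^2u)\,dx$$ under compactly supported variations. If $D^2u$ has small oscillation in $B_1$ with modulus $\omega$, i.e. $$\|D^2u-(D^2u)_1\|_{L^\infty(B_1)}\le\omega,$$ then $u$ is smooth in $B_1$.
   Context: $B_1\subset\mathbb R^n$ is the open unit ball centered at the origin; $S^{n\times n}$ is the space of real symmetric $n\times n$ matrices; repeated indices are summed from $1$ to $n$. $(f)_1$ denotes the average of $f$ over $B_1$. The condition $D^2u(B_1)\subset U$ means $D^2u(x)\in U$ for a.e. $x\in B_1$ (distributional Hessian). "$F$ smooth on $U$" is understood to mean $C^\infty$ with all derivatives bounded on bounded subsets of $U$. Uniform convexity with constant $\Lambda$ means $\frac{\partial^2F}{\partial u_{kl}\partial u_{ij}}(\xi)\sigma_{ij}\sigma_{kl}=\frac{d^2}{ds^2}F(\xi+s\sigma)\big|_{s=0}\ge\Lambda\|\sigma\|^2$ for all $\xi\in U$, $\sigma\in S^{n\times n}$. A critical point under compactly supported variations is a $u$ for which the first variation vanishes, i.e. $\int_{B_1}\frac{\partial F}{\partial u_{ij}}(D^2u)\,\eta_{ij}\,dx=0$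 for all $\eta\in C_0^\infty(B_1)$, where $\eta_{ij}=\partial_i\partial_j\eta$ and $\frac{\partial F}{\partial u_{ij}}(\xi)\sigma_{ij}=\frac{d}{ds}F(\xi+s\sigma)\big|_{s=0}$. *)

theory Defs
  imports "HOL-Analysis.Analysis" "HOL-Probability.Essential_Supremum"
begin

section \<open>Smooth functions\<close>

definition dderiv :: "'a::real_normed_vector \<Rightarrow> ('a \<Rightarrow> real) \<Rightarrow> 'a \<Rightarrow> real"
  where "dderiv v f x = deriv (\<lambda>s::real. f (x + s *\<^sub>R v)) 0"

definition iter_dderiv :: "'a::real_normed_vector list \<Rightarrow> ('a \<Rightarrow> real) \<Rightarrow> 'a \<Rightarrow> real"
  where "iter_dderiv vs f = foldr dderiv vs f"

text \<open>
  \<open>C\<^sup>\<infinity>\<close> on a set \<open>A\<close> that is relatively open in the linear subspace \<open>V\<close>: the directional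
  derivatives of all orders, in directions from \<open>V\<close>, exist and are continuous on \<open>A\<close>.
  Directions outside \<open>V\<close> must not occur: \<open>f\<close> carries no information off \<open>V\<close>.
\<close>

definition smooth_along :: "'a::real_normed_vector set \<Rightarrow> 'a set \<Rightarrow> ('a \<Rightarrow> real) \<Rightarrow> bool"
  where "smooth_along V A f \<longleftrightarrow>
    (\<forall>vs \<in> lists V. continuous_on A (iter_dderiv vs f) \<and>
       (\<forall>v\<in>V. \<forall>x\<in>A. (\<lambda>s::real. iter_dderiv vs f (x + s *\<^sub>R v)) field_differentiable at 0))"

abbreviation smooth_on :: "'a::real_normed_vector set \<Rightarrow> ('a \<Rightarrow> real) \<Rightarrow> bool"
  where "smooth_on A f \<equiv> smooth_along UNIV A f"

definition test_function :: "'a::real_normed_vector set \<Rightarrow> ('a \<Rightarrow> real) \<Rightarrow> bool"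
  where "test_function \<Omega> \<eta> \<longleftrightarrow>
    smooth_on UNIV \<eta> \<and> (\<exists>K. compact K \<and> K \<subseteq> \<Omega> \<and> (\<forall>x. x \<notin> K \<longrightarrow> \<eta> x = 0))"

definition partials :: "'n list \<Rightarrow> (real^'n \<Rightarrow> real) \<Rightarrow> real^'n \<Rightarrow> real"
  where "partials \<alpha> f = iter_dderiv (map (\<lambda>i. axis i 1) \<alpha>) f"

definition hessian :: "(real^'n \<Rightarrow> real) \<Rightarrow> real^'n \<Rightarrow> real^'n^'n"
  where "hessian f x = (\<chi> i j. partials [i, j] f x)"

section \<open>Sobolev functions\<close>

definition locally_integrable :: "'a::euclidean_space set \<Rightarrow> ('a \<Rightarrow> real) \<Rightarrow> bool"
  where "locally_integrable \<Omega> f \<longleftrightarrow> (\<forall>K. compact K \<and> K \<subseteq> \<Omega> \<longrightarrow> integrable (lebesgue_on K) f)"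

definition Linf_norm :: "'a::euclidean_space set \<Rightarrow> ('a \<Rightarrow> 'b::real_normed_vector) \<Rightarrow> ereal"
  where "Linf_norm \<Omega> f = esssup (lebesgue_on \<Omega>) (\<lambda>x. ereal (norm (f x)))"

definition Linf :: "'a::euclidean_space set \<Rightarrow> ('a \<Rightarrow> 'b::real_normed_vector) set"
  where "Linf \<Omega> = {f \<in> borel_measurable (lebesgue_on \<Omega>). Linf_norm \<Omega> f < \<infinity>}"

text \<open>
  \<open>w\<close> is the distributional derivative \<open>\<partial>\<^sub>\<alpha> u\<close> in \<open>\<Omega>\<close>; the list \<open>\<alpha>\<close> of coordinate indices,
  with repetitions, plays the role of a multi-index.
\<close>

definition weak_partials ::
    "(real^'n) set \<Rightarrow> 'n list \<Rightarrow> (real^'n \<Rightarrow> real) \<Rightarrow> (real^'n \<Rightarrow> real) \<Rightarrow> bool"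
  where "weak_partials \<Omega> \<alpha> u w \<longleftrightarrow>
    locally_integrable \<Omega> u \<and> locally_integrable \<Omega> w \<and>
    (\<forall>\<eta>. test_function \<Omega> \<eta> \<longrightarrow>
       (\<integral>x. u x * partials \<alpha> \<eta> x \<partial>lebesgue_on \<Omega>)
         = (-1) ^ length \<alpha> * (\<integral>x. w x * \<eta> x \<partial>lebesgue_on \<Omega>))"

definition weak_hessian :: "(real^'n) set \<Rightarrow> (real^'n \<Rightarrow> real) \<Rightarrow> (real^'n \<Rightarrow> real^'n^'n) \<Rightarrow> bool"
  where "weak_hessian \<Omega> u H \<longleftrightarrow> (\<forall>i j. weak_partials \<Omega> [i, j] u (\<lambda>x. H x $ i $ j))"

definition W_inf :: "nat \<Rightarrow> (real^'n) set \<Rightarrow> (real^'n \<Rightarrow> real) set"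
  where "W_inf k \<Omega> =
    {u \<in> Linf \<Omega>. \<forall>\<alpha>. length \<alpha> \<le> k \<longrightarrow> (\<exists>w \<in> Linf \<Omega>. weak_partials \<Omega> \<alpha> u w)}"

definition average :: "'a::euclidean_space set \<Rightarrow> ('a \<Rightarrow> 'b::euclidean_space) \<Rightarrow> 'b"
  where "average \<Omega> f = (1 / measure lebesgue \<Omega>) *\<^sub>R (\<integral>x. f x \<partial>lebesgue_on \<Omega>)"

section \<open>The functional\<close>

definition sym_matrices :: "(real^'n^'n) set"
  where "sym_matrices = {A. transpose A = A}"

text \<open>
  In the following definitions \<open>U\<close> is relatively open in \<^const>\<open>sym_matrices\<close> and only the values
  of \<open>F\<close> on \<open>U\<close> matter. The norm on \<^typ>\<open>real^'n^'n\<close> is the Frobenius norm.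
\<close>

definition smooth_integrand :: "(real^'n^'n) set \<Rightarrow> (real^'n^'n \<Rightarrow> real) \<Rightarrow> bool"
  where "smooth_integrand U F \<longleftrightarrow> smooth_along sym_matrices U F \<and>
    (\<forall>K \<sigma>s. K \<subseteq> U \<and> bounded K \<and> \<sigma>s \<in> lists sym_matrices \<longrightarrow> bounded (iter_dderiv \<sigma>s F ` K))"

definition uniformly_convex :: "(real^'n^'n) set \<Rightarrow> real \<Rightarrow> (real^'n^'n \<Rightarrow> real) \<Rightarrow> bool"
  where "uniformly_convex U \<Lambda> F \<longleftrightarrow>
    (\<forall>\<xi>\<in>U. \<forall>\<sigma>\<in>sym_matrices.
       (deriv ^^ 2) (\<lambda>s::real. F (\<xi> + s *\<^sub>R \<sigma>)) 0 \<ge> \<Lambda> * (norm \<sigma>)\<^sup>2)"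

text \<open>
  Vanishing first variation of \<open>\<integral>\<^sub>\<Omega> F(D\<^sup>2u) dx\<close>, where \<open>H\<close> is the distributional Hessian
  \<open>D\<^sup>2u\<close>; the integrand is \<open>F\<^sub>i\<^sub>j(D\<^sup>2u) \<eta>\<^sub>i\<^sub>j\<close>.
\<close>

definition critical_point ::
    "(real^'n) set \<Rightarrow> (real^'n^'n \<Rightarrow> real) \<Rightarrow> (real^'n \<Rightarrow> real^'n^'n) \<Rightarrow> bool"
  where "critical_point \<Omega> F H \<longleftrightarrow>
    (\<forall>\<eta>. test_function \<Omega> \<eta> \<longrightarrow> (\<integral>x. dderiv (hessian \<eta> x) F (H x) \<partial>lebesgue_on \<Omega>) = 0)"

end

theory Submission
  imports Defs
begin

text \<open>Let \<open>H\<close> be the Hessian. Testing the linear-in-\<open>\<eta>\<close> Euler equation with \<open>m\<close>-fold difference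
quotients of \<open>\<zeta>\<^bsup>2m\<^esup> \<delta>\<^sup>m u\<close> and using convexity bounds \<open>\<integral>\<zeta>\<^bsup>2m\<^esup> |\<delta>\<^sup>m H|\<^sup>2\<close> by lower order terms and by the
remainder \<open>\<delta>\<^sup>m (DF \<circ> H) - D\<^sup>2F(H) \<delta>\<^sup>m H\<close>. That remainder contains only products of at least two
differences, so Gagliardo--Nirenberg interpolation, carried out at the discrete level against the oscillation
\<open>\<omega>\<close> of \<open>H\<close>, bounds its weighted \<open>L\<^sup>2\<close> norm by \<open>C \<omega>\<close> times that of \<open>\<delta>\<^sup>m H\<close>, with \<open>C\<close> independent of the
cutoff; for small \<open>\<omega>\<close> it is absorbed. Letting the step tend to \<open>0\<close> gives interior \<open>H\<^sup>m\<close> estimates, but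
the admissible \<open>\<omega>\<close> depends on \<open>m\<close>. So the estimate is used once, for a single \<open>m\<close> large enough to make
\<open>H\<close> locally Lipschitz; then the oscillation of \<open>H\<close> on small balls is as small as any \<open>m\<close> requires, and
the estimate applies at all orders. The bounds hold uniformly for mollifications of \<open>u\<close>, which
therefore converge to a smooth representative.\<close>


section \<open>Smooth functions\<close>

text \<open>Finite steps are used because absorption needs a finite left side: for fixed
  \<open>h\<close> the difference quotients of the bounded Hessian are bounded, so every energy is
  finite before anything is known about derivatives. The obstacle is the order of quantifiers:
  \<omega> has to be fixed before the ball, the cutoff and its Lipschitz constant, since the second
  use of the estimate takes place on balls that depend on the solution. Hence every inequality
  separates a leading constant, free of the cutoff, from an additive one that may depend on the ball
  and the cutoff but not on the step. Differences are taken in one coordinate direction at a time;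
  mixed derivatives are recovered by integration by parts, at the price of an order exponential in
  the number of derivatives wanted. Since \<open>F\<close> lives on symmetric matrices only, it is
  replaced by its composition with the symmetric part, and its derivatives are used only on
  \<open>U \<inter> cball 0 M\<close>, which is how \<omega> comes to depend on
  \<open>M\<close>.\<close>

definition dir_differentiable :: "('a::real_normed_vector \<Rightarrow> real) \<Rightarrow> bool"
 where "dir_differentiable f \<longleftrightarrow> continuous_on UNIV f \<and>
  (\<forall>v x. (\<lambda>s::real. f (x + s *\<^sub>R v)) field_differentiable at 0)"

lemma iter_dderiv_Nil [simp]: "iter_dderiv [] f = f"
 by (simp add: iter_dderiv_def)

lemma iter_dderiv_Cons [simp]: "iter_dderiv (v # vs) f = dderiv v (iter_dderiv vs f)"
 by (simp add: iter_dderiv_def)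

lemma iter_dderiv_append: "iter_dderiv (vs @ ws) f = iter_dderiv vs (iter_dderiv ws f)"
 by (simp add: iter_dderiv_def)

abbreviation smooth :: "('a::real_normed_vector \<Rightarrow> real) \<Rightarrow> bool"
 where "smooth \<equiv> smooth_on UNIV"

lemma smooth_UNIV_iff:
 fixes f :: "'a::real_normed_vector \<Rightarrow> real"
 shows "smooth f \<longleftrightarrow> (\<forall>vs. dir_differentiable (iter_dderiv vs f))"
 by (auto simp: smooth_along_def dir_differentiable_def)

text \<open>Smoothness is the largest class of continuous, directionally differentiable functions
  closed under \<open>dderiv\<close>. Exhibiting any such class containing \<open>f\<close> proves
  smoothness without formulas for higher derivatives.\<close>

lemma smooth_coinduct:
 fixes f :: "'a::real_normed_vector \<Rightarrow> real"
 assumes "P f" and "\<And>g. P g \<Longrightarrow> dir_differentiable g" and "\<And>g v. P g \<Longrightarrow> P (dderiv v g)"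
 shows "smooth f"
proof -
 have "P (iter_dderiv vs f)" for vs by (induction vs) (auto intro: assms)
 thus ?thesis using assms(2) by (simp add: smooth_UNIV_iff)
qed

lemma smooth_dir_differentiable: "smooth f \<Longrightarrow> dir_differentiable f"
 by (metis smooth_UNIV_iff iter_dderiv_Nil)

lemma smooth_dderiv: "smooth f \<Longrightarrow> smooth (dderiv v f)"
 unfolding smooth_UNIV_iff
 by (metis iter_dderiv_append iter_dderiv_Cons iter_dderiv_Nil)

lemma smooth_iter_dderiv: "smooth f \<Longrightarrow> smooth (iter_dderiv vs f)"
 by (induction vs) (auto intro: smooth_dderiv)

lemma smooth_continuous: "smooth f \<Longrightarrow> continuous_on S f"
 by (meson continuous_on_subset dir_differentiable_def smooth_dir_differentiable subset_UNIV)

abbreviation borel_fun :: "('a::topological_space \<Rightarrow> 'b::topological_space) \<Rightarrow> bool"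
 where "borel_fun f \<equiv> f \<in> borel_measurable borel"

lemma smooth_borel [measurable]:
 fixes f :: "'a::euclidean_space \<Rightarrow> real"
 shows "smooth f \<Longrightarrow> borel_fun f"
 by (simp add: borel_measurable_continuous_onI smooth_continuous)

section \<open>Calculus of directional derivatives\<close>

lemma deriv_shift:
 fixes f :: "real \<Rightarrow> real"
 shows "((\<lambda>s. f (t + s)) has_real_derivative D) (at 0) \<longleftrightarrow> (f has_real_derivative D) (at t)"
 using DERIV_shift[of f D 0 t] by (simp add: add.commute)

lemma line_derivative:
 fixes f :: "'a::real_normed_vector \<Rightarrow> real"
 assumes "(\<lambda>s. f ((x + t *\<^sub>R v) + s *\<^sub>R v)) field_differentiable at 0"
 shows "((\<lambda>s. f (x + s *\<^sub>R v)) has_real_derivative dderiv v f (x + t *\<^sub>R v)) (at t)"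
proof -
 have "((\<lambda>s. f (x + (t + s) *\<^sub>R v)) has_real_derivative dderiv v f (x + t *\<^sub>R v)) (at 0)"
  using assms unfolding field_differentiable_derivI dderiv_def
  by (metis (no_types, lifting) ext DERIV_deriv_iff_field_differentiable add.assoc scaleR_left_distrib)
 thus ?thesis by (rule deriv_shift[THEN iffD1])
qed

lemma dir_differentiable_line:
 "dir_differentiable f \<Longrightarrow>
  ((\<lambda>s. f (x + s *\<^sub>R v)) has_real_derivative dderiv v f (x + t *\<^sub>R v)) (at t within S)"
 by (rule has_field_derivative_at_within, rule line_derivative) (simp add: dir_differentiable_def)

lemma dderivI:
 "((\<lambda>s. f (x + s *\<^sub>R v)) has_real_derivative D) (at 0) \<Longrightarrow> dderiv v f x = D"
 unfolding dderiv_def by (rule DERIV_imp_deriv)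

lemma dir_differentiable_at0:
 "dir_differentiable f \<Longrightarrow> ((\<lambda>s. f (x + s *\<^sub>R v)) has_real_derivative dderiv v f x) (at 0)"
 using dir_differentiable_line[of f x v 0 UNIV] by simp

lemma dir_differentiableI:
 assumes "continuous_on UNIV f" "\<And>v x. ((\<lambda>s. f (x + s *\<^sub>R v)) has_real_derivative D v x) (at 0)"
 shows "dir_differentiable f"
 using assms by (auto simp: dir_differentiable_def field_differentiable_def)

lemma dderiv_add:
 assumes "dir_differentiable f" "dir_differentiable g"
 shows "dderiv v (\<lambda>x. f x + g x) = (\<lambda>x. dderiv v f x + dderiv v g x)"
 by (rule ext, rule dderivI) (intro DERIV_add dir_differentiable_at0 assms)

lemma dderiv_mult:
 assumes "dir_differentiable f" "dir_differentiable g"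
 shows "dderiv v (\<lambda>x. f x * g x) = (\<lambda>x. dderiv v f x * g x + f x * dderiv v g x)"
proof (rule ext, rule dderivI)
 fix x
 show "((\<lambda>s. f (x + s *\<^sub>R v) * g (x + s *\<^sub>R v)) has_real_derivative
    dderiv v f x * g x + f x * dderiv v g x) (at 0)"
  using DERIV_mult[OF dir_differentiable_at0[OF assms(1)] dir_differentiable_at0[OF assms(2)], of x v x v]
  by (simp add: algebra_simps)
qed

lemma dderiv_const: "dderiv v (\<lambda>x. c) = (\<lambda>x. 0)"
 by (rule ext, rule dderivI) simp

lemma dderiv_compose:
 assumes "dir_differentiable f" "\<And>t. (\<phi> has_real_derivative \<phi>' t) (at t)"
 shows "dderiv v (\<lambda>x. \<phi> (f x)) = (\<lambda>x. \<phi>' (f x) * dderiv v f x)"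
proof (rule ext, rule dderivI)
 fix x
 show "((\<lambda>s. \<phi> (f (x + s *\<^sub>R v))) has_real_derivative \<phi>' (f x) * dderiv v f x) (at 0)"
  using DERIV_chain2[OF assms(2) dir_differentiable_at0[OF assms(1), of x v]] by simp
qed

text \<open>Product and chain rules express a derivative by members of the same algebra, so the
  algebra generated by smooth functions is a witness for the coinduction. In \<open>compose\<close>
  the outer function is given as a sequence in which each term is the derivative of the preceding
  one; differentiation raises the index and multiplies by \<open>dderiv v f\<close>.\<close>

inductive smooth_alg :: "('a::real_normed_vector \<Rightarrow> real) \<Rightarrow> bool" where
 base: "smooth f \<Longrightarrow> smooth_alg f"
| add: "smooth_alg f \<Longrightarrow> smooth_alg g \<Longrightarrow> smooth_alg (\<lambda>x. f x + g x)"
| mult: "smooth_alg f \<Longrightarrow> smooth_alg g \<Longrightarrow> smooth_alg (\<lambda>x. f x * g x)"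
| compose: "smooth_alg f \<Longrightarrow> (\<And>n t. (\<phi> n has_real_derivative \<phi> (Suc n) t) (at t)) \<Longrightarrow>
  smooth_alg (\<lambda>x. \<phi> (n::nat) (f x))"

lemma smooth_alg_closed: "smooth_alg f \<Longrightarrow> dir_differentiable f \<and> (\<forall>v. smooth_alg (dderiv v f))"
proof (induction rule: smooth_alg.induct)
 case (base f)
 thus ?case by (auto intro: smooth_alg.base smooth_dderiv smooth_dir_differentiable)
next
 case (add f g)
 hence "dir_differentiable (\<lambda>x. f x + g x)"
  by (auto simp: dir_differentiable_def intro!: continuous_on_add field_differentiable_add)
 with add show ?case by (simp add: dderiv_add smooth_alg.add)
next
 case (mult f g)
 hence "dir_differentiable (\<lambda>x. f x * g x)"
  by (auto simp: dir_differentiable_def intro!: continuous_on_mult field_differentiable_mult)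
 with mult show ?case by (simp add: dderiv_mult smooth_alg.add smooth_alg.mult)
next
 case (compose f \<phi> n)
 have "continuous_on UNIV (\<phi> n)"
  using compose(2) by (meson DERIV_isCont continuous_at_imp_continuous_on)
 moreover have "continuous_on UNIV f" using compose by (simp add: dir_differentiable_def)
 ultimately have "continuous_on UNIV (\<lambda>x. \<phi> n (f x))"
  using continuous_on_compose2 by blast
 hence "dir_differentiable (\<lambda>x. \<phi> n (f x))"
 proof (rule dir_differentiableI)
  fix v x
  show "((\<lambda>s. \<phi> n (f (x + s *\<^sub>R v))) has_real_derivative \<phi> (Suc n) (f x) * dderiv v f x) (at 0)"
   using DERIV_chain2[OF compose(2) dir_differentiable_at0[of f x v], of n] compose.IH by simp
 qed
 moreover have "smooth_alg (dderiv v (\<lambda>x. \<phi> n (f x)))" for v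
 proof -
  have "smooth_alg (\<lambda>x. \<phi> (Suc n) (f x) * dderiv v f x)"
   using smooth_alg.mult[OF smooth_alg.compose[of f \<phi> "Suc n", OF compose(1,2)], of "dderiv v f"]
    compose.IH by simp
  moreover have "dderiv v (\<lambda>x. \<phi> n (f x)) = (\<lambda>x. \<phi> (Suc n) (f x) * dderiv v f x)"
   using compose by (intro dderiv_compose) auto
  ultimately show ?thesis by simp
 qed
 ultimately show ?case by blast
qed

lemma smooth_alg_smooth: "smooth_alg f \<Longrightarrow> smooth f"
 using smooth_coinduct[of smooth_alg f] smooth_alg_closed by blast

lemma smooth_add: "smooth f \<Longrightarrow> smooth g \<Longrightarrow> smooth (\<lambda>x. f x + g x)"
 by (rule smooth_alg_smooth[OF smooth_alg.add[OF smooth_alg.base smooth_alg.base]])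

lemma smooth_mult: "smooth f \<Longrightarrow> smooth g \<Longrightarrow> smooth (\<lambda>x. f x * g x)"
 by (rule smooth_alg_smooth[OF smooth_alg.mult[OF smooth_alg.base smooth_alg.base]])

lemma smooth_compose:
 "smooth f \<Longrightarrow> (\<And>n t. (\<phi> n has_real_derivative \<phi> (Suc n) t) (at t)) \<Longrightarrow>
  smooth (\<lambda>x. \<phi> (n::nat) (f x))"
 by (rule smooth_alg_smooth[OF smooth_alg.compose[OF smooth_alg.base]])

lemma smooth_const: "smooth (\<lambda>x. c)"
 by (rule smooth_coinduct[where P="\<lambda>f. \<exists>c. f = (\<lambda>x. c)"])
  (auto simp: dderiv_const dir_differentiable_def)

lemma smooth_inner: "smooth (\<lambda>x::'a::real_inner. x \<bullet> b)"
proof (rule smooth_coinduct[where P="\<lambda>f. (\<exists>c. f = (\<lambda>x. c)) \<or> f = (\<lambda>x. x \<bullet> b)"])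
 have *: "((\<lambda>s. (x + s *\<^sub>R v) \<bullet> b) has_real_derivative v \<bullet> b) (at 0)" for v x :: 'a
  by (auto intro!: derivative_eq_intros simp: inner_add_left)
 show "dir_differentiable g" if "(\<exists>c. g = (\<lambda>x. c)) \<or> g = (\<lambda>x. x \<bullet> b)" for g :: "'a \<Rightarrow> real"
  using that dir_differentiableI[OF continuous_on_inner[OF continuous_on_id continuous_on_const] *]
   smooth_dir_differentiable[OF smooth_const] by auto
 show "(\<exists>c. dderiv v g = (\<lambda>x. c)) \<or> dderiv v g = (\<lambda>x. x \<bullet> b)"
  if "(\<exists>c. g = (\<lambda>x. c)) \<or> g = (\<lambda>x. x \<bullet> b)" for g :: "'a \<Rightarrow> real" and v
 proof -
  have "dderiv v (\<lambda>x. x \<bullet> b) = (\<lambda>x. v \<bullet> b)" by (rule ext, rule dderivI, rule *)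
  thus ?thesis using that by (auto simp: dderiv_const)
 qed
qed auto

lemma smooth_cmult: "smooth f \<Longrightarrow> smooth (\<lambda>x. c * f x)"
 by (intro smooth_mult smooth_const)

lemma smooth_diff:
 assumes "smooth f" "smooth g" shows "smooth (\<lambda>x. f x - g x)"
 using smooth_add[OF assms(1) smooth_cmult[OF assms(2), of "-1"]] by simp

lemma smooth_power: "smooth f \<Longrightarrow> smooth (\<lambda>x. f x ^ n)"
 by (induction n) (auto intro: smooth_const smooth_mult)

lemma smooth_sum: "(\<And>i. i \<in> I \<Longrightarrow> smooth (f i)) \<Longrightarrow> smooth (\<lambda>x. \<Sum>i\<in>I. f i x)"
 by (induction I rule: infinite_finite_induct) (auto intro: smooth_const smooth_add)

lemma dderiv_cmult: "dir_differentiable f \<Longrightarrow> dderiv v (\<lambda>x. c * f x) = (\<lambda>x. c * dderiv v f x)"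
 by (subst dderiv_mult) (auto simp: dderiv_const dir_differentiable_def)

lemma dderiv_diff:
 assumes "dir_differentiable f" "dir_differentiable g"
 shows "dderiv v (\<lambda>x. f x - g x) = (\<lambda>x. dderiv v f x - dderiv v g x)"
 by (rule ext, rule dderivI) (intro DERIV_diff dir_differentiable_at0 assms)

lemma iter_dderiv_add:
 assumes "smooth f" "smooth g"
 shows "iter_dderiv vs (\<lambda>x. f x + g x) = (\<lambda>x. iter_dderiv vs f x + iter_dderiv vs g x)"
 using assms
 by (induction vs) (auto simp: dderiv_add smooth_dir_differentiable smooth_iter_dderiv)

lemma iter_dderiv_cmult:
 assumes "smooth f"
 shows "iter_dderiv vs (\<lambda>x. c * f x) = (\<lambda>x. c * iter_dderiv vs f x)"
 using assms
 by (induction vs) (auto simp: dderiv_cmult smooth_dir_differentiable smooth_iter_dderiv)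

lemma iter_dderiv_const0: "iter_dderiv vs (\<lambda>x. 0) = (\<lambda>x. 0)"
 by (induction vs) (auto simp: dderiv_const)

lemma iter_dderiv_sum:
 assumes "\<And>i. i \<in> I \<Longrightarrow> smooth (f i)"
 shows "iter_dderiv vs (\<lambda>x. \<Sum>i\<in>I. f i x) = (\<lambda>x. \<Sum>i\<in>I. iter_dderiv vs (f i) x)"
 using assms
 by (induction I rule: infinite_finite_induct) (auto simp: iter_dderiv_const0 iter_dderiv_add smooth_sum)

lemma dderiv_affine:
 fixes f :: "'a::real_normed_vector \<Rightarrow> real"
 shows "dderiv v (\<lambda>x. f (a *\<^sub>R x + b)) = (\<lambda>x. dderiv (a *\<^sub>R v) f (a *\<^sub>R x + b))"
 by (simp add: dderiv_def fun_eq_iff algebra_simps)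

lemma smooth_affine:
 fixes f :: "'a::real_normed_vector \<Rightarrow> real"
 assumes "smooth f"
 shows "smooth (\<lambda>x. f (a *\<^sub>R x + b))"
proof (rule smooth_coinduct[where P="\<lambda>g. \<exists>f. smooth f \<and> g = (\<lambda>x. f (a *\<^sub>R x + b))"])
 fix g :: "'a \<Rightarrow> real" and v
 assume "\<exists>f. smooth f \<and> g = (\<lambda>x. f (a *\<^sub>R x + b))"
 then obtain f where f: "smooth f" and g: "g = (\<lambda>x. f (a *\<^sub>R x + b))" by blast
 have "continuous_on UNIV g" unfolding g
  by (rule continuous_on_compose2[OF smooth_continuous[OF f, of UNIV]]) (auto intro!: continuous_intros)
 moreover have "(\<lambda>s. g (x + s *\<^sub>R w)) field_differentiable at 0" for x w
 proof -
  have "(\<lambda>s. f ((a *\<^sub>R x + b) + s *\<^sub>R (a *\<^sub>R w))) field_differentiable at 0"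
   using smooth_dir_differentiable[OF f] unfolding dir_differentiable_def by blast
  thus ?thesis by (simp add: g algebra_simps)
 qed
 ultimately show "dir_differentiable g" by (simp add: dir_differentiable_def)
 show "\<exists>f. smooth f \<and> dderiv v g = (\<lambda>x. f (a *\<^sub>R x + b))"
  using f smooth_dderiv unfolding g dderiv_affine by blast
qed (use assms in blast)

lemma smooth_translate:
 fixes f :: "'a::real_normed_vector \<Rightarrow> real"
 shows "smooth f \<Longrightarrow> smooth (\<lambda>x. f (x + b))"
 using smooth_affine[of f 1 b] by simp

lemma dderiv_translate:
 fixes f :: "'a::real_normed_vector \<Rightarrow> real"
 shows "dderiv v (\<lambda>x. f (x + b)) = (\<lambda>x. dderiv v f (x + b))"
 using dderiv_affine[of v f 1 b] by simp

subsection \<open>Linearity and symmetry of directional derivatives\<close>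

lemma dderiv_scaleR:
 assumes "(\<lambda>s. f (x + s *\<^sub>R v)) field_differentiable at 0"
 shows "dderiv (c *\<^sub>R v) f x = c * dderiv v f x"
proof (rule dderivI)
 have D: "((\<lambda>s. f (x + s *\<^sub>R v)) has_real_derivative dderiv v f x) (at (c * 0))"
  using assms by (simp add: dderiv_def DERIV_deriv_iff_field_differentiable)
 have g: "((\<lambda>s. c * s) has_real_derivative c) (at 0)" by (auto intro!: derivative_eq_intros)
 have "((\<lambda>s. (\<lambda>r. f (x + r *\<^sub>R v)) (c * s)) has_real_derivative dderiv v f x * c) (at 0)"
  by (rule DERIV_chain2[where g="\<lambda>s. c * s" and f="\<lambda>r. f (x + r *\<^sub>R v)"]) (use D g in simp_all)
 thus "((\<lambda>s. f (x + s *\<^sub>R (c *\<^sub>R v))) has_real_derivative c * dderiv v f x) (at 0)"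
  by (simp add: mult.commute)
qed

text \<open>The increment along \<open>v + w\<close> is split at \<open>x + s v\<close>; the mean value theorem on the second
 leg and continuity of the derivative along \<open>w\<close> give its contribution.\<close>

lemma dderiv_plus:
 fixes f :: "'a::real_normed_vector \<Rightarrow> real"
 assumes "open A" "x \<in> A" "continuous_on A (dderiv w f)"
  and diff: "\<And>y z. y \<in> A \<Longrightarrow> (\<lambda>s. f (y + s *\<^sub>R z)) field_differentiable at 0"
 shows "dderiv (v + w) f x = dderiv v f x + dderiv w f x"
proof (rule dderivI)
 have D: "((\<lambda>s. f (y + s *\<^sub>R z)) has_real_derivative dderiv z f y) (at 0)" if "y \<in> A" for y z
  using diff[OF that, of z] by (simp add: dderiv_def DERIV_deriv_iff_field_differentiable)
 have lim1: "((\<lambda>s. (f (x + s *\<^sub>R v) - f x) / s) \<longlongrightarrow> dderiv v f x) (at 0)"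
  using D[OF assms(2), of v] by (simp add: DERIV_def)
 have lim2: "((\<lambda>s. (f (x + s *\<^sub>R v + s *\<^sub>R w) - f (x + s *\<^sub>R v)) / s) \<longlongrightarrow> dderiv w f x) (at 0)"
 proof (rule LIM_I)
  fix e :: real assume e: "e > 0"
  have "isCont (dderiv w f) x" using assms by (simp add: continuous_on_eq_continuous_at)
  then obtain d1 where d1: "d1 > 0" "\<And>y. dist y x < d1 \<Longrightarrow> \<bar>dderiv w f y - dderiv w f x\<bar> < e / 2"
   using e unfolding continuous_at_eps_delta by (metis dist_real_def half_gt_zero)
  obtain d2 where d2: "d2 > 0" "ball x d2 \<subseteq> A" using assms open_contains_ball by blast
  define d where "d = min d1 d2 / (norm v + norm w + 1)"
  have "d > 0" using d1 d2 by (simp add: d_def add_nonneg_pos)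
  moreover have "norm ((f (x + s *\<^sub>R v + s *\<^sub>R w) - f (x + s *\<^sub>R v)) / s - dderiv w f x) < e"
   if s: "s \<noteq> 0" "norm (s - 0) < d" for s
  proof -
   let ?y = "\<lambda>r. x + s *\<^sub>R v + r *\<^sub>R w"
   have near: "dist (?y r) x < min d1 d2" if "r \<in> closed_segment 0 s" for r
   proof -
    have r: "\<bar>r\<bar> \<le> \<bar>s\<bar>" using that by (auto simp: closed_segment_eq_real_ivl split: if_splits)
    have "dist (?y r) x \<le> \<bar>s\<bar> * norm v + \<bar>r\<bar> * norm w"
     using norm_triangle_ineq[of "s *\<^sub>R v" "r *\<^sub>R w"] by (simp add: dist_norm algebra_simps)
    also have "\<dots> \<le> \<bar>s\<bar> * (norm v + norm w + 1)"
     using mult_right_mono[OF r, of "norm w"] by (simp add: algebra_simps)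
    also have "\<dots> < min d1 d2" using s(2) by (simp add: d_def pos_less_divide_eq add_nonneg_pos)
    finally show ?thesis .
   qed
   have "norm ((f (?y s) - s * dderiv w f x) - (f (?y 0) - 0 * dderiv w f x)) \<le> e / 2 * norm (s - 0)"
   proof (rule field_differentiable_bound[where S = "closed_segment 0 s"])
    fix r assume r: "r \<in> closed_segment 0 s"
    have "((\<lambda>r. f (?y r)) has_real_derivative dderiv w f (?y r)) (at r)"
     by (rule line_derivative, rule diff) (use near[OF r] d2 in \<open>auto simp: dist_commute\<close>)
    thus "((\<lambda>r. f (?y r) - r * dderiv w f x) has_real_derivative dderiv w f (?y r) - dderiv w f x) (at r within closed_segment 0 s)"
     using DERIV_diff[OF _ DERIV_cmult_right[OF DERIV_ident], of _ _ r UNIV "dderiv w f x"] by (simp add: has_field_derivative_at_within)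
    show "norm (dderiv w f (?y r) - dderiv w f x) \<le> e / 2" using d1(2)[of "?y r"] near[OF r] by simp
   qed auto
   moreover have "(a - b) / s - D = ((a - s * D) - (b - 0 * D)) / s" for a b D :: real using s(1) by (simp add: field_simps)
   from this[of "f (?y s)" "f (?y 0)"]
   have "(f (?y s) - f (x + s *\<^sub>R v)) / s - dderiv w f x = ((f (?y s) - s * dderiv w f x) - (f (?y 0) - 0 * dderiv w f x)) / s"
    by (simp only: scaleR_zero_left add_0_right)
   ultimately have "norm ((f (?y s) - f (x + s *\<^sub>R v)) / s - dderiv w f x) \<le> e / 2"
    using s(1) by (simp only: norm_divide) (simp add: pos_divide_le_eq)
   thus ?thesis using e by simp
  qed
  ultimately show "\<exists>d>0. \<forall>s. s \<noteq> 0 \<and> norm (s - 0) < d \<longrightarrow>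
    norm ((f (x + s *\<^sub>R v + s *\<^sub>R w) - f (x + s *\<^sub>R v)) / s - dderiv w f x) < e" by blast
 qed
 have "(\<lambda>s. (f (x + s *\<^sub>R v) - f x) / s + (f (x + s *\<^sub>R v + s *\<^sub>R w) - f (x + s *\<^sub>R v)) / s)
  = (\<lambda>s. (f (x + s *\<^sub>R (v + w)) - f x) / s)"
  by (auto simp: fun_eq_iff algebra_simps add_divide_distrib diff_divide_distrib)
 with tendsto_add[OF lim1 lim2]
 show "((\<lambda>s. f (x + s *\<^sub>R (v + w))) has_real_derivative dderiv v f x + dderiv w f x) (at 0)"
  by (simp add: DERIV_def)
qed

lemma dderiv_sum_scaleR:
 fixes f :: "'a::real_normed_vector \<Rightarrow> real"
 assumes "open A" "x \<in> A" "\<And>w. continuous_on A (dderiv w f)"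
  and diff: "\<And>y z. y \<in> A \<Longrightarrow> (\<lambda>s. f (y + s *\<^sub>R z)) field_differentiable at 0"
 shows "dderiv (\<Sum>i\<in>I. c i *\<^sub>R v i) f x = (\<Sum>i\<in>I. c i * dderiv (v i) f x)"
proof (induction I rule: infinite_finite_induct)
 case (insert i I)
 thus ?case
  by (simp add: dderiv_plus[OF assms(1-3) diff] dderiv_scaleR[OF diff] \<open>x \<in> A\<close>)
qed (auto intro!: dderivI)

lemma dderiv_Basis:
 fixes f :: "'a::euclidean_space \<Rightarrow> real"
 assumes "open A" "x \<in> A" "\<And>w. continuous_on A (dderiv w f)"
  and diff: "\<And>y z. y \<in> A \<Longrightarrow> (\<lambda>s. f (y + s *\<^sub>R z)) field_differentiable at 0"
 shows "dderiv v f x = (\<Sum>b\<in>Basis. (v \<bullet> b) * dderiv b f x)"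
 using dderiv_sum_scaleR[OF assms, of "\<lambda>b. v \<bullet> b" "\<lambda>b. b" Basis] by (simp add: euclidean_representation)

lemma smooth_dderiv_Basis:
 fixes f :: "'a::euclidean_space \<Rightarrow> real"
 assumes "smooth f"
 shows "dderiv v f = (\<lambda>x. \<Sum>b\<in>Basis. (v \<bullet> b) * dderiv b f x)"
proof
 show "dderiv v f x = (\<Sum>b\<in>Basis. (v \<bullet> b) * dderiv b f x)" for x
  using dderiv_Basis[OF open_UNIV UNIV_I, of f v x] smooth_continuous[OF smooth_dderiv[OF assms]]
   smooth_dir_differentiable[OF assms] by (auto simp: dir_differentiable_def)
qed

text \<open>For sequences the step is \<open>1::nat\<close>.\<close>

definition fdiff :: "'a::plus \<Rightarrow> ('a \<Rightarrow> 'b::minus) \<Rightarrow> 'a \<Rightarrow> 'b"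
 where "fdiff v f = (\<lambda>x. f (x + v) - f x)"

lemma smooth_fdiff:
 fixes f :: "'a::real_normed_vector \<Rightarrow> real"
 shows "smooth f \<Longrightarrow> smooth (fdiff v f)"
 unfolding fdiff_def by (intro smooth_diff smooth_translate)

lemma dderiv_fdiff:
 assumes "smooth f"
 shows "dderiv w (fdiff v f) = fdiff v (dderiv w f)"
 unfolding fdiff_def
 by (subst dderiv_diff) (auto simp: dderiv_translate assms smooth_dir_differentiable smooth_translate)

lemma fdiff_MVT:
 assumes "smooth f" "t > 0"
 obtains z where "0 < z" "z < t" "fdiff (t *\<^sub>R v) f x = t * dderiv v f (x + z *\<^sub>R v)"
proof -
 obtain z where "0 < z" "z < t" "f (x + t *\<^sub>R v) - f (x + 0 *\<^sub>R v) = (t - 0) * dderiv v f (x + z *\<^sub>R v)"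
  using MVT2[of 0 t "\<lambda>r. f (x + r *\<^sub>R v)" "\<lambda>r. dderiv v f (x + r *\<^sub>R v)"]
   dir_differentiable_line[OF smooth_dir_differentiable[OF assms(1)]] assms(2) by blast
 with that show ?thesis by (simp add: fdiff_def)
qed

lemma fdiff_commute:
 fixes f :: "'a::ab_semigroup_add \<Rightarrow> 'b::ab_group_add"
 shows "fdiff v (fdiff w f) = fdiff w (fdiff v f)"
 by (simp add: fdiff_def fun_eq_iff algebra_simps)

text \<open>The second difference over a small parallelogram does not depend on the order of its two
  steps. The mean value theorem applied in either order turns it into \<open>t * t\<close> times one
  of the mixed derivatives at a nearby point; continuity of both then gives equality at
  \<open>x\<close>.\<close>

lemma dderiv_commute:
 assumes f: "smooth f"
 shows "dderiv v (dderiv w f) = dderiv w (dderiv v f)"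
proof
 fix x
 have *: "\<exists>z y. dist z x < d \<and> dist y x < d \<and> dderiv v (dderiv w f) z = dderiv w (dderiv v f) y"
  if "d > 0" for d
 proof -
  define t where "t = d / (norm v + norm w + 1)"
  have t: "t > 0" using that by (simp add: t_def add_nonneg_pos)
  have near: "dist (x + a *\<^sub>R v + b *\<^sub>R w) x < d" if "0 < a" "a < t" "0 < b" "b < t" for a b
  proof -
   have "dist (x + a *\<^sub>R v + b *\<^sub>R w) x \<le> a * norm v + b * norm w"
    using norm_triangle_ineq[of "a *\<^sub>R v" "b *\<^sub>R w"] that by (simp add: dist_norm algebra_simps)
   also have "\<dots> \<le> t * norm v + t * norm w"
    using that by (intro add_mono mult_right_mono) auto
   also have "\<dots> < t * (norm v + norm w + 1)" using t by (simp add: algebra_simps)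
   also have "\<dots> = d" by (simp add: t_def add_nonneg_pos less_imp_neq[THEN not_sym])
   finally show ?thesis .
  qed
  obtain a where a: "0 < a" "a < t" "fdiff (t *\<^sub>R v) (fdiff (t *\<^sub>R w) f) x = t * dderiv v (fdiff (t *\<^sub>R w) f) (x + a *\<^sub>R v)"
   using fdiff_MVT[OF smooth_fdiff[OF f] t] .
  obtain b where b: "0 < b" "b < t" "fdiff (t *\<^sub>R w) (dderiv v f) (x + a *\<^sub>R v) = t * dderiv w (dderiv v f) (x + a *\<^sub>R v + b *\<^sub>R w)"
   using fdiff_MVT[OF smooth_dderiv[OF f] t] .
  obtain c where c: "0 < c" "c < t" "fdiff (t *\<^sub>R w) (fdiff (t *\<^sub>R v) f) x = t * dderiv w (fdiff (t *\<^sub>R v) f) (x + c *\<^sub>R w)"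
   using fdiff_MVT[OF smooth_fdiff[OF f] t] .
  obtain e where e: "0 < e" "e < t" "fdiff (t *\<^sub>R v) (dderiv w f) (x + c *\<^sub>R w) = t * dderiv v (dderiv w f) (x + c *\<^sub>R w + e *\<^sub>R v)"
   using fdiff_MVT[OF smooth_dderiv[OF f] t] .
  have "t * (t * dderiv w (dderiv v f) (x + a *\<^sub>R v + b *\<^sub>R w)) = fdiff (t *\<^sub>R v) (fdiff (t *\<^sub>R w) f) x"
   unfolding a(3) dderiv_fdiff[OF f] b(3) ..
  also have "\<dots> = fdiff (t *\<^sub>R w) (fdiff (t *\<^sub>R v) f) x" by (rule fdiff_commute[THEN fun_cong])
  also have "\<dots> = t * (t * dderiv v (dderiv w f) (x + c *\<^sub>R w + e *\<^sub>R v))"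
   unfolding c(3) dderiv_fdiff[OF f] e(3) ..
  finally have "t * (t * dderiv w (dderiv v f) (x + a *\<^sub>R v + b *\<^sub>R w)) = t * (t * dderiv v (dderiv w f) (x + c *\<^sub>R w + e *\<^sub>R v))" .
  hence "dderiv v (dderiv w f) (x + e *\<^sub>R v + c *\<^sub>R w) = dderiv w (dderiv v f) (x + a *\<^sub>R v + b *\<^sub>R w)"
   using t by (simp add: add.commute add.left_commute)
  thus ?thesis using near a b c e by blast
 qed
 have cont: "isCont (dderiv v (dderiv w f)) x" "isCont (dderiv w (dderiv v f)) x"
  using smooth_continuous[OF smooth_dderiv[OF smooth_dderiv[OF f]], of UNIV]
  by (auto simp: continuous_on_eq_continuous_at)
 have "\<forall>n. \<exists>z y. dist z x < inverse (real (Suc n)) \<and> dist y x < inverse (real (Suc n)) \<and> dderiv v (dderiv w f) z = dderiv w (dderiv v f) y"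
  by (intro allI *) simp
 then obtain z y where zy: "\<And>n. dist (z n) x < inverse (real (Suc n))" "\<And>n. dist (y n) x < inverse (real (Suc n))"
  "\<And>n. dderiv v (dderiv w f) (z n) = dderiv w (dderiv v f) (y n)"
  unfolding choice_iff by blast
 have lim: "u \<longlonglongrightarrow> x" if "\<And>n. dist (u n) x < inverse (real (Suc n))" for u
  unfolding tendsto_dist_iff[of u] using less_imp_le[OF that]
  by (intro tendsto_sandwich[OF always_eventually always_eventually tendsto_const LIMSEQ_inverse_real_of_nat] allI zero_le_dist)
 show "dderiv v (dderiv w f) x = dderiv w (dderiv v f) x"
  using isCont_tendsto_compose[OF cont(1) lim[of z, OF zy(1)]] isCont_tendsto_compose[OF cont(2) lim[of y, OF zy(2)]]
  unfolding zy(3) by (rule LIMSEQ_unique)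
qed

lemma iter_dderiv_dderiv_commute:
 "smooth f \<Longrightarrow> iter_dderiv vs (dderiv v f) = dderiv v (iter_dderiv vs f)"
 by (induction vs) (auto simp: dderiv_commute smooth_iter_dderiv)

lemma iter_dderiv_commute:
 "smooth f \<Longrightarrow> iter_dderiv vs (iter_dderiv ws f) = iter_dderiv ws (iter_dderiv vs f)"
 by (induction ws) (auto simp: iter_dderiv_dderiv_commute smooth_iter_dderiv)

lemma dderiv_local_cong:
 fixes f g :: "'a::real_normed_vector \<Rightarrow> real"
 assumes "open A" "\<And>x. x \<in> A \<Longrightarrow> f x = g x" "x \<in> A"
 shows "dderiv v f x = dderiv v g x"
 unfolding dderiv_def
proof (rule deriv_cong_ev)
 have "((\<lambda>s. x + s *\<^sub>R v) \<longlongrightarrow> x + 0 *\<^sub>R v) (nhds 0)" by (intro tendsto_intros filterlim_ident)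
 hence "eventually (\<lambda>s. x + s *\<^sub>R v \<in> A) (nhds 0)" using assms by (intro topological_tendstoD) auto
 thus "eventually (\<lambda>s. f (x + s *\<^sub>R v) = g (x + s *\<^sub>R v)) (nhds 0)"
  by eventually_elim (rule assms(2))
qed simp

lemma iter_dderiv_local_cong:
 fixes f g :: "'a::real_normed_vector \<Rightarrow> real"
 assumes "open A" "\<And>x. x \<in> A \<Longrightarrow> f x = g x" "x \<in> A"
 shows "iter_dderiv vs f x = iter_dderiv vs g x"
 using assms(3)
proof (induction vs arbitrary: x)
 case (Cons v vs)
 thus ?case unfolding iter_dderiv_Cons by (intro dderiv_local_cong[OF assms(1)]) auto
qed (use assms in auto)

lemma iter_dderiv_vanish_outside:
 assumes "closed K" "\<And>x. x \<notin> K \<Longrightarrow> f x = 0" "x \<notin> K"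
 shows "iter_dderiv vs f x = 0"
 using iter_dderiv_local_cong[of "- K" f "\<lambda>x. 0" x vs] assms by (simp add: iter_dderiv_const0 open_Compl)

lemma dderiv_vanish_outside: "closed K \<Longrightarrow> (\<And>x. x \<notin> K \<Longrightarrow> f x = 0) \<Longrightarrow> x \<notin> K \<Longrightarrow> dderiv v f x = 0"
 using iter_dderiv_vanish_outside[of K f x "[v]"] by simp


section \<open>Mollifiers\<close>

lemma poly_mult_exp_tendsto_0: "((\<lambda>x::real. poly p x * exp (- x)) \<longlongrightarrow> 0) at_top"
proof -
 have "((\<lambda>x::real. \<Sum>i\<le>degree p. coeff p i * (x ^ i / exp x)) \<longlongrightarrow> (\<Sum>i\<le>degree p. coeff p i * 0)) at_top"
  by (intro tendsto_intros tendsto_power_div_exp_0)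
 thus ?thesis
  by (simp add: poly_altdef sum_distrib_right exp_minus divide_inverse mult.assoc)
qed

text \<open>The functions p(1/t) exp(-1/t), extended by 0, form a family closed under
  differentiation; \<open>flat 1\<close> is the classical smooth function that vanishes to infinite
  order at 0.\<close>

definition flat :: "real poly \<Rightarrow> real \<Rightarrow> real"
 where "flat p t = (if t > 0 then poly p (1 / t) * exp (- (1 / t)) else 0)"

text \<open>With s = 1/t one has ds/dt = -s^2, so p(s) exp(-s) has derivative s^2 (p - p')(s)
  exp(-s). At t = 0 the right-hand quotient is a polynomial in s times exp(-s), which tends to
  0.\<close>

lemma flat_DERIV: "(flat p has_real_derivative flat ([:0, 0, 1:] * (p - pderiv p)) t) (at t)"
proof -
 consider "t < 0" | "t = 0" | "t > 0" by linarith
 thus ?thesis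
 proof cases
  case 1
  hence "eventually (\<lambda>s. flat p s = 0) (nhds t)"
   by (intro eventually_mono[OF order_tendstoD(2)[OF filterlim_ident 1]]) (auto simp: flat_def)
  thus ?thesis using 1 DERIV_cong_ev[of t t "flat p" "\<lambda>_. 0" 0 0] by (simp add: flat_def)
 next
  case 3
  have "((\<lambda>t. poly p (1 / t) * exp (- (1 / t))) has_real_derivative
    poly ([:0, 0, 1:] * (p - pderiv p)) (1 / t) * exp (- (1 / t))) (at t)"
   using 3 by (auto intro!: derivative_eq_intros DERIV_chain2[OF poly_DERIV]
     simp: field_simps power2_eq_square)
  moreover have "eventually (\<lambda>s. flat p s = poly p (1 / s) * exp (- (1 / s))) (nhds t)"
   by (intro eventually_mono[OF order_tendstoD(1)[OF filterlim_ident 3]]) (auto simp: flat_def)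
  ultimately show ?thesis using 3 DERIV_cong_ev[of t t "flat p"] by (auto simp: flat_def)
 next
  case 2
  have "((\<lambda>s. flat p s / s) \<longlongrightarrow> 0) (at_right 0)"
  proof (rule Lim_transform_eventually)
   show "((\<lambda>s::real. poly ([:0, 1:] * p) (inverse s) * exp (- inverse s)) \<longlongrightarrow> 0) (at_right 0)"
    by (rule filterlim_compose[OF poly_mult_exp_tendsto_0 filterlim_inverse_at_top_right])
   show "eventually (\<lambda>s. poly ([:0, 1:] * p) (inverse s) * exp (- inverse s) = flat p s / s) (at_right 0)"
    using eventually_at_right_less[of "0::real"] by eventually_elim (simp add: flat_def divide_inverse)
  qed
  moreover have "((\<lambda>s. flat p s / s) \<longlongrightarrow> 0) (at_left 0)"
  proof (rule Lim_transform_eventually[OF tendsto_const])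
   show "eventually (\<lambda>s. 0 = flat p s / s) (at_left 0)"
    using eventually_at_left[of "-1" "0::real" "\<lambda>s. 0 = flat p s / s"] by (auto simp: flat_def intro!: exI[of _ "-1"])
  qed
  ultimately have "((\<lambda>s. flat p s / s) \<longlongrightarrow> 0) (at 0)"
   by (simp add: filterlim_at_split)
  thus ?thesis using 2 by (simp add: DERIV_def flat_def)
 qed
qed

fun flat_poly :: "nat \<Rightarrow> real poly" where
 "flat_poly 0 = 1"
| "flat_poly (Suc n) = [:0, 0, 1:] * (flat_poly n - pderiv (flat_poly n))"

definition bump :: "'a::euclidean_space \<Rightarrow> real"
 where "bump x = flat 1 (1 - x \<bullet> x)"

lemma smooth_bump: "smooth (bump :: 'a::euclidean_space \<Rightarrow> real)"
proof -
 have "smooth (\<lambda>x::'a. \<Sum>b\<in>Basis. (x \<bullet> b) * (x \<bullet> b))"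
  by (intro smooth_sum smooth_mult smooth_inner)
 hence "smooth (\<lambda>x::'a. x \<bullet> x)" by (simp add: euclidean_inner[symmetric])
 hence "smooth (\<lambda>x::'a. 1 - x \<bullet> x)" by (intro smooth_diff smooth_const)
 hence "smooth (\<lambda>x::'a. flat (flat_poly 0) (1 - x \<bullet> x))"
  by (rule smooth_compose[where \<phi>="\<lambda>n. flat (flat_poly n)"]) (use flat_DERIV in simp)
 thus ?thesis by (simp add: bump_def[abs_def])
qed

lemma bump_nonneg: "bump x \<ge> 0"
 by (simp add: bump_def flat_def)

lemma bump_pos_iff: "bump x > 0 \<longleftrightarrow> norm x < 1"
 using abs_square_less_1[of "norm x"]
 by (simp add: bump_def flat_def flip: power2_norm_eq_inner)

lemma bump_eq_0: "norm x \<ge> 1 \<Longrightarrow> bump x = 0"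
 using bump_pos_iff[of x] bump_nonneg[of x] by linarith

subsection \<open>Smooth functions of compact support\<close>

lemma test_functionE:
 assumes "test_function \<Omega> \<eta>"
 obtains K where "smooth \<eta>" "compact K" "K \<subseteq> \<Omega>" "\<And>x. x \<notin> K \<Longrightarrow> \<eta> x = 0"
 using assms by (auto simp: test_function_def)

lemma test_function_smooth: "test_function \<Omega> \<eta> \<Longrightarrow> smooth \<eta>"
 by (simp add: test_function_def)

lemma test_function_mono: "test_function \<Omega> \<eta> \<Longrightarrow> \<Omega> \<subseteq> \<Omega>' \<Longrightarrow> test_function \<Omega>' \<eta>"
 by (auto simp: test_function_def)

lemma test_function_iter_dderiv: "test_function \<Omega> \<eta> \<Longrightarrow> test_function \<Omega> (iter_dderiv vs \<eta>)"
 unfolding test_function_def using iter_dderiv_vanish_outside[OF compact_imp_closed]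
 by (metis smooth_iter_dderiv)

lemma test_function_dderiv: "test_function \<Omega> \<eta> \<Longrightarrow> test_function \<Omega> (dderiv v \<eta>)"
 using test_function_iter_dderiv[of \<Omega> \<eta> "[v]"] by simp

lemma test_function_mult_left:
 assumes "test_function \<Omega> \<eta>" "smooth f" shows "test_function \<Omega> (\<lambda>x. \<eta> x * f x)"
proof -
 obtain K where "compact K" "K \<subseteq> \<Omega>" "\<And>x. x \<notin> K \<Longrightarrow> \<eta> x = 0" using test_functionE[OF assms(1)] by metis
 thus ?thesis using assms by (auto simp: test_function_def intro!: smooth_mult exI[of _ K])
qed

lemma test_function_bounded:
 fixes \<eta> :: "'a::euclidean_space \<Rightarrow> real"
 assumes "test_function \<Omega> \<eta>"
 obtains B where "B \<ge> 0" "\<And>x. \<bar>\<eta> x\<bar> \<le> B"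
proof -
 obtain K where K: "smooth \<eta>" "compact K" "\<And>x. x \<notin> K \<Longrightarrow> \<eta> x = 0"
  using test_functionE[OF assms] by metis
 have "compact (\<eta> ` K)" using K by (intro compact_continuous_image smooth_continuous)
 hence "bounded (\<eta> ` K)" by (rule compact_imp_bounded)
 then obtain B where B: "\<forall>x\<in>K. \<bar>\<eta> x\<bar> \<le> B" by (auto simp: bounded_iff)
 have "\<bar>\<eta> x\<bar> \<le> max B 0" for x
 proof (cases "x \<in> K")
  case True
  thus ?thesis using B by (simp add: le_max_iff_disj)
 qed (simp add: K(3))
 thus ?thesis using that[of "max B 0"] by auto
qed

lemma ball_cball_borel [measurable]:
 fixes a :: "'a::euclidean_space"
 shows "ball a r \<in> sets borel" "cball a r \<in> sets borel"
 by auto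

lemma integrable_indicator_bounded:
 fixes S :: "'a::euclidean_space set"
 assumes "S \<in> sets borel" "bounded S"
 shows "integrable lborel (indicator S :: 'a \<Rightarrow> real)"
 using assms emeasure_bounded_finite[of S] by (intro integrable_real_indicator) auto

lemma integrable_bounded_support:
 fixes f :: "'a::euclidean_space \<Rightarrow> 'b::{banach, second_countable_topology}"
 assumes "borel_fun f" "bounded S" "\<And>x. norm (f x) \<le> B" "\<And>x. x \<notin> S \<Longrightarrow> f x = 0"
 shows "integrable lborel f"
proof -
 obtain r where r: "S \<subseteq> cball 0 r" using assms(2) unfolding bounded_iff by (auto simp: subset_iff)
 show ?thesis
 proof (rule integrableI_bounded_set[of "cball 0 r" _ _ B])
  show "AE x in lborel. x \<notin> cball 0 r \<longrightarrow> f x = 0" using assms(4) r by (intro AE_I2) blast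
 qed (use assms emeasure_bounded_finite[of "cball (0::'a) r"] in auto)
qed

lemma test_function_integrable:
 fixes \<eta> :: "'a::euclidean_space \<Rightarrow> real"
 assumes "test_function \<Omega> \<eta>"
 shows "integrable lborel \<eta>"
proof -
 obtain K where K: "smooth \<eta>" "compact K" "\<And>x. x \<notin> K \<Longrightarrow> \<eta> x = 0"
  using test_functionE[OF assms] by metis
 obtain B where B: "\<And>x. \<bar>\<eta> x\<bar> \<le> B" using test_function_bounded[OF assms] by blast
 show ?thesis
  by (rule integrable_bounded_support[of _ K B])
   (use K B in \<open>auto intro: compact_imp_bounded smooth_borel\<close>)
qed

subsection \<open>Translation and reflection\<close>

lemma nn_integral_translate:
 fixes f :: "'a::euclidean_space \<Rightarrow> ennreal"
 assumes [measurable]: "borel_fun f"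
 shows "(\<integral>\<^sup>+x. f (x + a) \<partial>lborel) = (\<integral>\<^sup>+x. f x \<partial>lborel)"
proof -
 have "(\<integral>\<^sup>+x. f x \<partial>lborel) = (\<integral>\<^sup>+x. f x \<partial>distr lborel borel ((+) a))"
  by (simp add: lborel_distr_plus)
 also have "\<dots> = (\<integral>\<^sup>+x. f (a + x) \<partial>lborel)"
  by (rule nn_integral_distr) auto
 finally show ?thesis by (simp add: add.commute)
qed

lemma integral_translate:
 fixes f :: "'a::euclidean_space \<Rightarrow> real"
 assumes [measurable]: "borel_fun f"
 shows "(\<integral>x. f (x + a) \<partial>lborel) = (\<integral>x. f x \<partial>lborel)"
proof -
 have "(\<integral>x. f x \<partial>lborel) = (\<integral>x. f x \<partial>distr lborel borel ((+) a))"
  by (simp add: lborel_distr_plus)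
 also have "\<dots> = (\<integral>x. f (a + x) \<partial>lborel)"
  by (rule integral_distr) auto
 finally show ?thesis by (simp add: add.commute)
qed

lemma integrable_translate:
 fixes f :: "'a::euclidean_space \<Rightarrow> real"
 assumes "integrable lborel f"
 shows "integrable lborel (\<lambda>x. f (x + a))"
proof -
 have "integrable (distr lborel borel ((+) a)) f" using assms by (simp add: lborel_distr_plus)
 hence "integrable lborel (\<lambda>x. f (a + x))" by (subst (asm) integrable_distr_eq) (use assms in auto)
 thus ?thesis by (simp add: add.commute)
qed

lemma lborel_distr_reflect: "distr lborel borel (\<lambda>y. x - y) = lborel" for x :: "'a::euclidean_space"
 using lborel_affine[of "-1" x] by (simp add: density_1)

lemma integral_reflect:
 fixes f :: "'a::euclidean_space \<Rightarrow> real"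
 assumes [measurable]: "borel_fun f"
 shows "(\<integral>y. f (x - y) \<partial>lborel) = (\<integral>y. f y \<partial>lborel)"
proof -
 have "(\<integral>y. f y \<partial>lborel) = (\<integral>y. f y \<partial>distr lborel borel (\<lambda>y. x - y))"
  by (simp add: lborel_distr_reflect)
 also have "\<dots> = (\<integral>y. f (x - y) \<partial>lborel)"
  by (rule integral_distr) auto
 finally show ?thesis by simp
qed

lemma integrable_reflect:
 fixes f :: "'a::euclidean_space \<Rightarrow> real"
 assumes "integrable lborel f"
 shows "integrable lborel (\<lambda>y. f (x - y))"
proof -
 have "integrable (distr lborel borel (\<lambda>y. x - y)) f" using assms by (simp add: lborel_distr_reflect)
 thus ?thesis by (subst (asm) integrable_distr_eq) (use assms in auto)
qed

subsection \<open>Taylor estimates along a line\<close>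

text \<open>The mean value inequality is used for \<open>F'\<close> and then for
  \<open>F t - t * F' 0\<close>; this gives the constant \<open>B\<close> instead of the sharp
  \<open>B / 2\<close>.\<close>

lemma quadratic_remainder:
 fixes F :: "real \<Rightarrow> real"
 assumes "\<And>t. t \<in> closed_segment 0 s \<Longrightarrow> (F has_real_derivative F' t) (at t)"
  and "\<And>t. t \<in> closed_segment 0 s \<Longrightarrow> (F' has_real_derivative F'' t) (at t)"
  and "\<And>t. t \<in> closed_segment 0 s \<Longrightarrow> \<bar>F'' t\<bar> \<le> B"
 shows "\<bar>F s - F 0 - s * F' 0\<bar> \<le> B * s\<^sup>2"
proof -
 let ?S = "closed_segment 0 s"
 have S: "convex ?S" "0 \<in> ?S" "s \<in> ?S" by auto
 have abs_le: "\<bar>t\<bar> \<le> \<bar>s\<bar>" if "t \<in> ?S" for t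
  using that by (auto simp: closed_segment_eq_real_ivl split: if_splits)
 have "B \<ge> 0" using assms(3)[OF S(2)] by linarith
 have *: "norm (F' t - F' 0) \<le> B * \<bar>s\<bar>" if "t \<in> ?S" for t
 proof -
  have "norm (F' t - F' 0) \<le> B * norm (t - 0)"
   using assms(2,3) S that
   by (intro field_differentiable_bound[OF S(1), of F' F'' B]) (auto intro: has_field_derivative_at_within)
  also have "\<dots> \<le> B * \<bar>s\<bar>" using abs_le[OF that] \<open>B \<ge> 0\<close> by (auto intro: mult_left_mono)
  finally show ?thesis .
 qed
 have "norm ((F s - s * F' 0) - (F 0 - 0 * F' 0)) \<le> (B * \<bar>s\<bar>) * norm (s - 0)"
 proof (rule field_differentiable_bound[OF S(1), of "\<lambda>t. F t - t * F' 0" "\<lambda>t. F' t - F' 0"])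
  show "((\<lambda>t. F t - t * F' 0) has_field_derivative F' t - F' 0) (at t within ?S)" if "t \<in> ?S" for t
   using has_field_derivative_at_within[OF assms(1)[OF that], of ?S]
   by (auto intro!: derivative_eq_intros)
 qed (use * S in auto)
 thus ?thesis by (simp add: power2_eq_square algebra_simps)
qed

lemma smooth_quadratic_remainder:
 assumes "smooth g" "\<And>t. \<bar>t\<bar> \<le> \<bar>s\<bar> \<Longrightarrow> \<bar>dderiv v (dderiv v g) (x + t *\<^sub>R v)\<bar> \<le> B"
 shows "\<bar>g (x + s *\<^sub>R v) - g x - s * dderiv v g x\<bar> \<le> B * s\<^sup>2"
proof -
 have "\<bar>(\<lambda>t. g (x + t *\<^sub>R v)) s - (\<lambda>t. g (x + t *\<^sub>R v)) 0 - s * (\<lambda>t. dderiv v g (x + t *\<^sub>R v)) 0\<bar> \<le> B * s\<^sup>2"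
 proof (rule quadratic_remainder)
  fix t assume "t \<in> closed_segment 0 s"
  hence "\<bar>t\<bar> \<le> \<bar>s\<bar>" by (auto simp: closed_segment_eq_real_ivl split: if_splits)
  thus "\<bar>dderiv v (dderiv v g) (x + t *\<^sub>R v)\<bar> \<le> B" by (rule assms(2))
 qed (intro dir_differentiable_line smooth_dir_differentiable smooth_dderiv assms)+
 thus ?thesis by simp
qed

text \<open>Converse of Taylor's estimate: a linear approximation with quadratic error determines
  the derivative. It serves to differentiate integrals and limits, because a quadratic bound that is
  uniform in a parameter survives integration and passage to the limit.\<close>

lemma DERIV_quadratic_remainder:
 fixes F :: "real \<Rightarrow> real"
 assumes "d > 0" "\<And>s. \<bar>s\<bar> < d \<Longrightarrow> \<bar>F s - F 0 - s * D\<bar> \<le> B * s\<^sup>2"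
 shows "(F has_real_derivative D) (at 0)"
 unfolding DERIV_def
proof (rule LIM_I)
 fix e :: real assume "e > 0"
 define r where "r = min d (e / (\<bar>B\<bar> + 1))"
 have "r > 0" using assms(1) \<open>e > 0\<close> by (simp add: r_def)
 moreover have "norm ((F (0 + s) - F 0) / s - D) < e" if "s \<noteq> 0" "norm (s - 0) < r" for s
 proof -
  have "(F (0 + s) - F 0) / s - D = (F s - F 0 - s * D) / s" using that by (simp add: field_simps)
  hence "\<bar>(F (0 + s) - F 0) / s - D\<bar> \<le> (B * s\<^sup>2) / \<bar>s\<bar>"
   using assms(2)[of s] that by (simp add: r_def divide_right_mono)
  also have "\<dots> \<le> (\<bar>B\<bar> * s\<^sup>2) / \<bar>s\<bar>" by (intro divide_right_mono mult_right_mono) auto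
  also have "\<dots> = \<bar>B\<bar> * \<bar>s\<bar>" using that by (cases "s > 0") (auto simp: power2_eq_square)
  also have "\<dots> \<le> (\<bar>B\<bar> + 1) * \<bar>s\<bar>" by (intro mult_right_mono) auto
  also have "\<dots> < e" using that by (simp add: r_def pos_less_divide_eq mult.commute)
  finally show ?thesis by simp
 qed
 ultimately show "\<exists>r>0. \<forall>s. s \<noteq> 0 \<and> norm (s - 0) < r \<longrightarrow> norm ((F (0 + s) - F 0) / s - D) < e" by blast
qed

subsection \<open>Convolution\<close>

definition conv :: "('a::euclidean_space \<Rightarrow> real) \<Rightarrow> ('a \<Rightarrow> real) \<Rightarrow> 'a \<Rightarrow> real"
 where "conv f g x = (\<integral>y. f y * g (x - y) \<partial>lborel)"

lemma integrable_conv_integrand: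
 assumes f: "integrable lborel f" and g: "test_function UNIV g"
 shows "integrable lborel (\<lambda>y. f y * g (x - y))"
proof -
 obtain B where B: "\<And>x. \<bar>g x\<bar> \<le> B" using test_function_bounded[OF g] by blast
 have [measurable]: "borel_fun g" using g by (simp add: smooth_borel test_function_smooth)
 show ?thesis
 proof (rule Bochner_Integration.integrable_bound[of _ "\<lambda>y. B * f y"])
  have "\<bar>f y * g (x - y)\<bar> \<le> \<bar>B * f y\<bar>" for y
   using mult_right_mono[OF B[of "x - y"], of "\<bar>f y\<bar>"] B[of 0] by (simp add: abs_mult mult.commute)
  thus "AE y in lborel. norm (f y * g (x - y)) \<le> norm (B * f y)" by simp
 qed (use f in auto)
qed

lemma continuous_conv:
 fixes f g :: "'a::euclidean_space \<Rightarrow> real"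
 assumes f: "integrable lborel f" and g: "test_function UNIV g"
 shows "continuous_on UNIV (conv f g)"
 unfolding continuous_on_sequentially
proof (intro allI ballI impI)
 fix X :: "nat \<Rightarrow> 'a" and x assume X: "(\<forall>n. X n \<in> UNIV) \<and> X \<longlonglongrightarrow> x"
 obtain B where B: "B \<ge> 0" "\<And>x. \<bar>g x\<bar> \<le> B" using test_function_bounded[OF g] by blast
 have [measurable]: "borel_fun g" using g by (simp add: smooth_borel test_function_smooth)
 have "(\<lambda>n. (\<integral>y. f y * g (X n - y) \<partial>lborel)) \<longlonglongrightarrow> (\<integral>y. f y * g (x - y) \<partial>lborel)"
 proof (rule integral_dominated_convergence[where w="\<lambda>y. B * \<bar>f y\<bar>"])
  show "AE y in lborel. (\<lambda>n. f y * g (X n - y)) \<longlonglongrightarrow> f y * g (x - y)"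
  proof (rule AE_I2, rule tendsto_mult_left)
   fix y
   have "isCont g (x - y)" using smooth_continuous[OF test_function_smooth[OF g], of UNIV]
    by (simp add: continuous_on_eq_continuous_at)
   thus "(\<lambda>n. g (X n - y)) \<longlonglongrightarrow> g (x - y)"
    by (rule isCont_tendsto_compose) (use X in \<open>auto intro!: tendsto_diff\<close>)
  qed
  show "AE y in lborel. norm (f y * g (X n - y)) \<le> B * \<bar>f y\<bar>" for n
   using mult_right_mono[OF B(2)] by (intro AE_I2) (simp add: abs_mult mult.commute[of "\<bar>f _\<bar>"])
 qed (use f in auto)
 thus "(conv f g \<circ> X) \<longlonglongrightarrow> conv f g x" by (simp add: o_def conv_def)
qed

text \<open>The Taylor remainder of \<open>g\<close> is at most \<open>B * s\<^sup>2\<close> at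
  every point, so weighting by \<open>f\<close> and integrating leaves a quadratic remainder with
  constant \<open>B\<close> times the L1 norm of \<open>f\<close>.\<close>

lemma conv_DERIV:
 assumes f: "integrable lborel f" and g: "test_function UNIV g"
 shows "((\<lambda>s. conv f g (x + s *\<^sub>R v)) has_real_derivative conv f (dderiv v g) x) (at 0)"
proof -
 obtain B where B: "B \<ge> 0" "\<And>x. \<bar>dderiv v (dderiv v g) x\<bar> \<le> B"
  using test_function_bounded[OF test_function_dderiv[OF test_function_dderiv[OF g]]] by blast
 define C where "C = B * (\<integral>y. \<bar>f y\<bar> \<partial>lborel)"
 note int = integrable_conv_integrand[OF f g] integrable_conv_integrand[OF f test_function_dderiv[OF g]]
 have "\<bar>conv f g (x + s *\<^sub>R v) - conv f g (x + 0 *\<^sub>R v) - s * conv f (dderiv v g) x\<bar> \<le> C * s\<^sup>2" for s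
 proof -
  have "conv f g (x + s *\<^sub>R v) - conv f g (x + 0 *\<^sub>R v) - s * conv f (dderiv v g) x
   = (\<integral>y. f y * g (x + s *\<^sub>R v - y) - f y * g (x - y) - s * (f y * dderiv v g (x - y)) \<partial>lborel)"
   unfolding conv_def using int by simp
  moreover have "norm (\<integral>y. f y * g (x + s *\<^sub>R v - y) - f y * g (x - y) - s * (f y * dderiv v g (x - y)) \<partial>lborel)
    \<le> (\<integral>y. \<bar>f y\<bar> * (B * s\<^sup>2) \<partial>lborel)"
  proof (rule Bochner_Integration.integral_norm_bound_integral)
   fix y
   have "\<bar>g (x - y + s *\<^sub>R v) - g (x - y) - s * dderiv v g (x - y)\<bar> \<le> B * s\<^sup>2"
    by (rule smooth_quadratic_remainder[OF test_function_smooth[OF g] B(2)])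
   hence "\<bar>f y\<bar> * \<bar>g (x - y + s *\<^sub>R v) - g (x - y) - s * dderiv v g (x - y)\<bar> \<le> \<bar>f y\<bar> * (B * s\<^sup>2)"
    by (intro mult_left_mono) auto
   thus "norm (f y * g (x + s *\<^sub>R v - y) - f y * g (x - y) - s * (f y * dderiv v g (x - y)))
     \<le> \<bar>f y\<bar> * (B * s\<^sup>2)"
    unfolding abs_mult[symmetric] by (simp add: algebra_simps)
  qed (use int f in auto)
  ultimately show ?thesis by (simp add: C_def mult.assoc mult.left_commute)
 qed
 thus ?thesis using DERIV_quadratic_remainder[of 1 "\<lambda>s. conv f g (x + s *\<^sub>R v)"] by auto
qed

lemma dderiv_conv:
 "integrable lborel f \<Longrightarrow> test_function UNIV g \<Longrightarrow> dderiv v (conv f g) = conv f (dderiv v g)"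
 by (rule ext, rule dderivI, rule conv_DERIV)

lemma iter_dderiv_conv:
 "integrable lborel f \<Longrightarrow> test_function UNIV g \<Longrightarrow> iter_dderiv vs (conv f g) = conv f (iter_dderiv vs g)"
 by (induction vs) (auto simp: dderiv_conv test_function_iter_dderiv)

lemma smooth_conv:
 assumes f: "integrable lborel f" and g: "test_function UNIV g"
 shows "smooth (conv f g)"
proof -
 have "dir_differentiable (conv f h)" if "test_function UNIV h" for h
  by (rule dir_differentiableI[OF continuous_conv conv_DERIV]) (use f that in auto)
 thus ?thesis using assms
  by (auto simp: smooth_UNIV_iff iter_dderiv_conv test_function_iter_dderiv)
qed

subsection \<open>Approximate identities\<close>

text \<open>Dividing by the actual integral of the scaled bump normalises the mass without a change
  of variables.\<close>

definition mollifier :: "real \<Rightarrow> 'a::euclidean_space \<Rightarrow> real"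
 where "mollifier e x = bump (x /\<^sub>R e) / integral\<^sup>L lborel (\<lambda>y::'a. bump (y /\<^sub>R e))"

lemma test_function_scaled_bump:
 assumes "r > 0"
 shows "test_function UNIV (\<lambda>x. bump ((x - x0) /\<^sub>R r))"
  and "\<And>x. bump ((x - x0) /\<^sub>R r) > 0 \<longleftrightarrow> dist x0 x < r"
proof -
 have "smooth (\<lambda>x. bump (inverse r *\<^sub>R x + (- inverse r *\<^sub>R x0)))"
  by (rule smooth_affine[OF smooth_bump])
 hence 1: "smooth (\<lambda>x. bump ((x - x0) /\<^sub>R r))" by (simp add: scaleR_diff_right)
 show 2: "bump ((x - x0) /\<^sub>R r) > 0 \<longleftrightarrow> dist x0 x < r" for x
 proof -
  have "norm ((x - x0) /\<^sub>R r) = norm (x - x0) / r" using assms by (simp add: divide_inverse mult.commute)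
  thus ?thesis using assms unfolding bump_pos_iff by (simp add: dist_norm norm_minus_commute)
 qed
 have "bump ((x - x0) /\<^sub>R r) = 0" if "x \<notin> cball x0 r" for x
  using 2[of x] bump_nonneg[of "(x - x0) /\<^sub>R r"] that by auto
 with 1 show "test_function UNIV (\<lambda>x. bump ((x - x0) /\<^sub>R r))"
  by (auto simp: test_function_def intro!: exI[of _ "cball x0 r"])
qed

lemma scaled_bump_integral_pos:
 assumes "e > 0"
 shows "integral\<^sup>L lborel (\<lambda>y::'a::euclidean_space. bump (y /\<^sub>R e)) > 0"
proof -
 let ?b = "\<lambda>y::'a. bump (y /\<^sub>R e)"
 have tf: "test_function UNIV ?b"
  using test_function_scaled_bump(1)[OF assms, of "0::'a"] by simp
 have pos: "?b x > 0 \<longleftrightarrow> dist 0 x < e" for x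
  using test_function_scaled_bump(2)[OF assms, of x "0::'a"] by simp
 have int: "integrable lborel ?b" by (rule test_function_integrable[OF tf])
 have "(\<integral>y. ?b y \<partial>lborel) \<noteq> 0"
 proof
  assume "(\<integral>y. ?b y \<partial>lborel) = 0"
  hence "AE y in lborel. ?b y = 0"
   using integral_nonneg_eq_0_iff_AE[OF int] by (simp add: bump_nonneg)
  hence "AE y in lborel. y \<notin> ball (0::'a) e"
   by eventually_elim (use pos in \<open>metis less_irrefl mem_ball\<close>)
  hence "emeasure lborel (ball (0::'a) e) = 0"
   by (subst (asm) AE_iff_measurable[of "ball 0 e"]) auto
  thus False using content_ball_pos[OF assms, of "0::'a"] by (simp add: measure_def)
 qed
 moreover have "(\<integral>y. ?b y \<partial>lborel) \<ge> 0" by (simp add: bump_nonneg)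
 ultimately show ?thesis by simp
qed

lemma
 assumes "e > 0"
 shows test_function_mollifier: "test_function UNIV (mollifier e :: 'a::euclidean_space \<Rightarrow> real)"
  and mollifier_nonneg: "\<And>x::'a. mollifier e x \<ge> 0"
  and mollifier_eq_0: "\<And>x::'a. norm x \<ge> e \<Longrightarrow> mollifier e x = 0"
  and mollifier_integral: "integral\<^sup>L lborel (mollifier e :: 'a \<Rightarrow> real) = 1"
proof -
 note p = scaled_bump_integral_pos[OF assms, where 'a='a]
 show "test_function UNIV (mollifier e :: 'a \<Rightarrow> real)"
  using test_function_mult_left[OF test_function_scaled_bump(1)[OF assms, of "0::'a"] smooth_const]
  by (simp add: mollifier_def[abs_def] divide_inverse)
 show "mollifier e x \<ge> 0" for x :: 'a
  using p by (simp add: mollifier_def bump_nonneg)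
 show "mollifier e x = 0" if "norm x \<ge> e" for x :: 'a
  using that assms by (simp add: mollifier_def bump_eq_0 field_simps)
 show "integral\<^sup>L lborel (mollifier e :: 'a \<Rightarrow> real) = 1"
  using p by (simp add: mollifier_def[abs_def])
qed


lemma mollifier_translate_integral:
 assumes "e > 0"
 shows "integrable lborel (\<lambda>y::'a::euclidean_space. mollifier e (x - y))"
  and "integral\<^sup>L lborel (\<lambda>y::'a. mollifier e (x - y)) = 1"
proof -
 show "integrable lborel (\<lambda>y::'a. mollifier e (x - y))"
  by (rule integrable_reflect[OF test_function_integrable[OF test_function_mollifier[OF assms]]])
 show "integral\<^sup>L lborel (\<lambda>y::'a. mollifier e (x - y)) = 1"
  using integral_reflect[of "mollifier e :: 'a \<Rightarrow> real" x] mollifier_integral[OF assms, where 'a='a]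
   smooth_borel[OF test_function_smooth[OF test_function_mollifier[OF assms]]] by metis
qed

text \<open>A mollification is an average with a probability weight supported within distance
  \<open>e\<close>. Taking \<open>c\<close> to be the value at \<open>x\<close>, 0 or 1/2 turns this
  into closeness, a sup bound or the range of a plateau function.\<close>

lemma conv_mollifier_bound:
 fixes f :: "'a::euclidean_space \<Rightarrow> real"
 assumes "integrable lborel f" "e > 0" "\<And>y. dist x y < e \<Longrightarrow> \<bar>f y - c\<bar> \<le> B"
 shows "\<bar>conv f (mollifier e) x - c\<bar> \<le> B"
proof -
 note m = mollifier_translate_integral[OF assms(2), of x]
 have int: "integrable lborel (\<lambda>y. f y * mollifier e (x - y))"
  by (intro integrable_conv_integrand test_function_mollifier assms)
 have "conv f (mollifier e) x - c = (\<integral>y. f y * mollifier e (x - y) - c * mollifier e (x - y) \<partial>lborel)"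
  unfolding conv_def using int m by simp
 also have "norm \<dots> \<le> (\<integral>y. B * mollifier e (x - y) \<partial>lborel)"
 proof (rule Bochner_Integration.integral_norm_bound_integral)
  show "norm (f y * mollifier e (x - y) - c * mollifier e (x - y)) \<le> B * mollifier e (x - y)" for y
  proof (cases "dist x y < e")
   case True
   thus ?thesis using mollifier_nonneg[OF assms(2), of "x - y"] assms(3)[OF True]
    by (simp add: abs_mult mult_right_mono flip: left_diff_distrib)
  next
   case False
   thus ?thesis using mollifier_eq_0[OF assms(2), of "x - y"] by (simp add: dist_norm)
  qed
 qed (use int m in auto)
 finally show ?thesis using m by simp
qed

text \<open>Young's inequality for L1, by Tonelli and translation invariance. The extended integral
  on the left is what makes the convolution integrable afterwards.\<close>

lemma conv_nn_integral_le:
 fixes f g :: "'a::euclidean_space \<Rightarrow> real"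
 assumes f: "integrable lborel f" and g: "test_function UNIV g" and g0: "\<And>x. g x \<ge> 0"
 shows "(\<integral>\<^sup>+x. ennreal \<bar>conv f g x\<bar> \<partial>lborel) \<le> ennreal ((\<integral>x. \<bar>f x\<bar> \<partial>lborel) * (\<integral>x. g x \<partial>lborel))"
proof -
 have [measurable]: "borel_fun g" using g by (simp add: smooth_borel test_function_smooth)
 have [measurable]: "borel_fun f" using f by auto
 note gi = test_function_integrable[OF g]
 have "(\<integral>\<^sup>+x. ennreal \<bar>conv f g x\<bar> \<partial>lborel) \<le> (\<integral>\<^sup>+x. (\<integral>\<^sup>+y. ennreal (\<bar>f y\<bar> * g (x - y)) \<partial>lborel) \<partial>lborel)"
 proof (rule nn_integral_mono)
  fix x
  have "ennreal \<bar>conv f g x\<bar> \<le> (\<integral>\<^sup>+y. ennreal (norm (f y * g (x - y))) \<partial>lborel)"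
   using integral_norm_bound_ennreal[OF integrable_conv_integrand[OF f g, of x]] by (simp add: conv_def)
  thus "ennreal \<bar>conv f g x\<bar> \<le> (\<integral>\<^sup>+y. ennreal (\<bar>f y\<bar> * g (x - y)) \<partial>lborel)"
   using g0 by (simp add: abs_mult)
 qed
 also have "\<dots> = (\<integral>\<^sup>+y. (\<integral>\<^sup>+x. ennreal (\<bar>f y\<bar> * g (x - y)) \<partial>lborel) \<partial>lborel)"
  by (rule lborel_pair.Fubini') measurable
 also have "\<dots> = (\<integral>\<^sup>+y. ennreal \<bar>f y\<bar> * ennreal (\<integral>x. g x \<partial>lborel) \<partial>lborel)"
 proof (rule nn_integral_cong)
  fix y
  have "(\<integral>\<^sup>+x. ennreal (\<bar>f y\<bar> * g (x - y)) \<partial>lborel) = ennreal \<bar>f y\<bar> * (\<integral>\<^sup>+x. ennreal (g (x - y)) \<partial>lborel)"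
   using g0 by (simp add: ennreal_mult nn_integral_cmult)
  also have "(\<integral>\<^sup>+x. ennreal (g (x - y)) \<partial>lborel) = ennreal (\<integral>x. g x \<partial>lborel)"
   using nn_integral_translate[of "\<lambda>x. ennreal (g x)" "- y"] nn_integral_eq_integral[OF gi] g0 by simp
  finally show "(\<integral>\<^sup>+x. ennreal (\<bar>f y\<bar> * g (x - y)) \<partial>lborel) = ennreal \<bar>f y\<bar> * ennreal (\<integral>x. g x \<partial>lborel)" .
 qed
 also have "\<dots> = ennreal (\<integral>x. \<bar>f x\<bar> \<partial>lborel) * ennreal (\<integral>x. g x \<partial>lborel)"
  using nn_integral_eq_integral[of lborel "\<lambda>x. \<bar>f x\<bar>"] f by (simp add: nn_integral_multc)
 also have "\<dots> = ennreal ((\<integral>x. \<bar>f x\<bar> \<partial>lborel) * (\<integral>x. g x \<partial>lborel))"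
  using g0 by (intro ennreal_mult[symmetric]) auto
 finally show ?thesis .
qed

lemma conv_L1:
 fixes f :: "'a::euclidean_space \<Rightarrow> real"
 assumes f: "integrable lborel f" and e: "e > 0"
 shows "integrable lborel (conv f (mollifier e))"
  and "(\<integral>x. \<bar>conv f (mollifier e) x\<bar> \<partial>lborel) \<le> (\<integral>x. \<bar>f x\<bar> \<partial>lborel)"
proof -
 note le = conv_nn_integral_le[OF f test_function_mollifier[OF e] mollifier_nonneg[OF e],
   unfolded mollifier_integral[OF e] mult_1_right]
 have [measurable]: "borel_fun (conv f (mollifier e))"
  by (intro smooth_borel smooth_conv f test_function_mollifier e)
 show int: "integrable lborel (conv f (mollifier e))"
  by (rule integrableI_bounded) (use le_less_trans[OF le ennreal_less_top] in auto)
 show "(\<integral>x. \<bar>conv f (mollifier e) x\<bar> \<partial>lborel) \<le> (\<integral>x. \<bar>f x\<bar> \<partial>lborel)"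
  using le nn_integral_eq_integral[of lborel "\<lambda>x. \<bar>conv f (mollifier e) x\<bar>"] int by simp
qed

lemma conv_diff:
 assumes "integrable lborel f" "integrable lborel g" "test_function UNIV h"
 shows "conv (\<lambda>x. f x - g x) h x = conv f h x - conv g h x"
 using assms by (simp add: conv_def left_diff_distrib integrable_conv_integrand)

text \<open>A measurable function is almost everywhere a limit of continuous ones. Truncating these
  at the level \<open>M\<close> makes them dominated, so they converge in L1 on bounded sets while
  keeping the bound.\<close>

lemma continuous_approx_L1:
 fixes f :: "'a::euclidean_space \<Rightarrow> real"
 assumes [measurable]: "borel_fun f" and M: "\<And>x. \<bar>f x\<bar> \<le> M" and "d > 0"
 obtains g where "continuous_on UNIV g" "\<And>x. \<bar>g x\<bar> \<le> M"
  "(\<integral>x. indicator (cball 0 r) x * \<bar>f x - g x\<bar> \<partial>lborel) < d"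
proof -
 have "f \<in> borel_measurable lebesgue" by (rule measurable_completion) simp
 hence "f measurable_on UNIV" by (rule lebesgue_measurable_imp_measurable_on_real) auto
 then obtain N G where N: "negligible N" "\<And>n. continuous_on UNIV (G n)"
  "\<And>x. x \<notin> N \<Longrightarrow> (\<lambda>n. G n x) \<longlonglongrightarrow> f x"
  unfolding measurable_on_def by auto
 define g where "g n x = max (- M) (min M (G n x))" for n x
 have M0: "M \<ge> 0" using M[of 0] by linarith
 have cont: "continuous_on UNIV (g n)" for n
  unfolding g_def[abs_def] by (intro continuous_intros N)
 have bnd: "\<bar>g n x\<bar> \<le> M" for n x using M0 by (auto simp: g_def)
 have [measurable]: "borel_fun (g n)" for n
  by (rule borel_measurable_continuous_onI[OF cont])
 have "AE x in lebesgue. x \<notin> N" using N(1) by (intro AE_not_in) (simp add: negligible_iff_null_sets)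
 hence "AE x in lebesgue. (\<lambda>n. g n x) \<longlonglongrightarrow> f x"
 proof eventually_elim
  case (elim x)
  have "(\<lambda>n. max (- M) (min M (G n x))) \<longlonglongrightarrow> max (- M) (min M (f x))"
   by (intro tendsto_max tendsto_min tendsto_const N elim)
  moreover have "max (- M) (min M (f x)) = f x" using M[of x] by (auto simp: abs_le_iff)
  ultimately show ?case by (simp add: g_def)
 qed
 hence ae: "AE x in lborel. (\<lambda>n. g n x) \<longlonglongrightarrow> f x"
  by (subst (asm) AE_completion_iff) auto
 have "(\<lambda>n. \<integral>x. indicator (cball 0 r) x * \<bar>f x - g n x\<bar> \<partial>lborel) \<longlonglongrightarrow> (\<integral>x. 0 \<partial>(lborel :: 'a measure))"
 proof (rule integral_dominated_convergence[where w="\<lambda>x. indicator (cball 0 r) x *\<^sub>R (2 * M)"])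
  show "AE x in lborel. (\<lambda>n. indicator (cball 0 r) x * \<bar>f x - g n x\<bar>) \<longlonglongrightarrow> 0"
   using ae
  proof eventually_elim
   case (elim x)
   have "(\<lambda>n. indicator (cball 0 r) x * \<bar>f x - g n x\<bar>) \<longlonglongrightarrow> indicator (cball 0 r) x * \<bar>f x - f x\<bar>"
    by (intro tendsto_intros elim)
   thus ?case by simp
  qed
  show "AE x in lborel. norm (indicator (cball 0 r) x * \<bar>f x - g n x\<bar>) \<le> indicator (cball 0 r) x *\<^sub>R (2 * M)" for n
  proof (rule AE_I2)
   fix x
   have "\<bar>f x - g n x\<bar> \<le> 2 * M" using M[of x] bnd[of n x] by linarith
   thus "norm (indicator (cball 0 r) x * \<bar>f x - g n x\<bar>) \<le> indicator (cball 0 r) x *\<^sub>R (2 * M)"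
    by (auto simp: indicator_def)
  qed
  show "integrable lborel (\<lambda>x::'a. indicator (cball 0 r) x *\<^sub>R (2 * M))"
   by (intro integrable_indicator_bounded integrable_scaleR_left) auto
 qed auto
 hence "eventually (\<lambda>n. (\<integral>x. indicator (cball 0 r) x * \<bar>f x - g n x\<bar> \<partial>lborel) < d) sequentially"
  using order_tendstoD(2)[of _ 0] \<open>d > 0\<close> by auto
 then obtain n where "(\<integral>x. indicator (cball 0 r) x * \<bar>f x - g n x\<bar> \<partial>lborel) < d"
  by (auto simp: eventually_sequentially)
 with that cont bnd show ?thesis by blast
qed

text \<open>\<open>f\<close> is split into \<open>h + k\<close> with \<open>h\<close> small in L1
  and \<open>k\<close> continuous on a ball. Mollification does not enlarge the L1 norm of
  \<open>h\<close> and moves \<open>k\<close> uniformly little. The radii \<open>r\<close>,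
  \<open>r + 1\<close>, \<open>r + 2\<close> leave room for \<open>e < 1\<close>: outside
  \<open>cball 0 (r + 1)\<close> the mollification of \<open>f\<close> vanishes, and inside it only
  \<open>cball 0 (r + 2)\<close> is seen.\<close>

lemma conv_mollifier_L1_tendsto:
 fixes f :: "'a::euclidean_space \<Rightarrow> real"
 assumes [measurable]: "borel_fun f" and M: "\<And>x. \<bar>f x\<bar> \<le> M"
  and supp: "\<And>x. norm x > r \<Longrightarrow> f x = 0" and "d > 0"
 obtains e0 where "e0 > 0"
  "\<And>e. 0 < e \<Longrightarrow> e < e0 \<Longrightarrow> (\<integral>x. \<bar>conv f (mollifier e) x - f x\<bar> \<partial>lborel) < d"
proof -
 let ?I = "\<lambda>s. indicator (cball 0 s) :: 'a \<Rightarrow> real"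
 define V where "V = measure lborel (cball (0::'a) (r + 1))"
 have V: "V \<ge> 0" by (simp add: V_def)
 have fint: "integrable lborel f"
  by (rule integrable_bounded_support[of _ "cball 0 r" M]) (use M supp in \<open>auto simp: not_le\<close>)
 obtain g where g: "continuous_on UNIV g" "\<And>x. \<bar>g x\<bar> \<le> M"
  and gd: "(\<integral>x. ?I (r + 2) x * \<bar>f x - g x\<bar> \<partial>lborel) < d / 4"
  using continuous_approx_L1[OF assms(1) M, of "d / 4" "r + 2"] \<open>d > 0\<close> by auto
 have [measurable]: "borel_fun g" by (rule borel_measurable_continuous_onI[OF g(1)])
 define h where "h x = ?I (r + 2) x * (f x - g x)" for x
 define k where "k x = ?I (r + 2) x * g x" for x
 have [measurable]: "borel_fun h" "borel_fun k"
  unfolding h_def[abs_def] k_def[abs_def]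
  by (intro borel_measurable_times borel_measurable_diff borel_measurable_indicator; simp)+
 have hint: "integrable lborel h"
 proof (rule integrable_bounded_support[of _ "cball 0 (r + 2)" "2 * M"])
  show "norm (h x) \<le> 2 * M" for x using M[of x] g(2)[of x] by (auto simp: h_def indicator_def)
 qed (auto simp: h_def)
 have kint: "integrable lborel k"
 proof (rule integrable_bounded_support[of _ "cball 0 (r + 2)" M])
  show "norm (k x) \<le> M" for x using M[of x] g(2)[of x] by (auto simp: k_def indicator_def)
 qed (auto simp: k_def)
 have f_eq: "f x = h x + k x" for x using supp[of x] by (auto simp: h_def k_def indicator_def algebra_simps)
 have hd: "(\<integral>x. \<bar>h x\<bar> \<partial>lborel) < d / 4" using gd by (simp add: h_def abs_mult)
 have "uniformly_continuous_on (cball 0 (r + 2)) g"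
  by (intro compact_uniformly_continuous continuous_on_subset[OF g(1)]) auto
 \<comment> \<open>The tolerance is scaled by the volume \<open>V\<close>, so that the uniform error
   contributes at most \<open>d / 4\<close>; two more quarters go to \<open>h\<close> and its
   mollification.\<close>
 then obtain d1 where d1: "d1 > 0" "\<And>x y. x \<in> cball 0 (r + 2) \<Longrightarrow> y \<in> cball 0 (r + 2) \<Longrightarrow> dist x y < d1 \<Longrightarrow>
   \<bar>g x - g y\<bar> \<le> d / (4 * (V + 1))"
  using \<open>d > 0\<close> V unfolding uniformly_continuous_on_def dist_real_def
  by (metis (no_types, opaque_lifting) add_nonneg_pos divide_pos_pos less_eq_real_def mult_pos_pos zero_less_numeral zero_less_one)
 show thesis
 proof (rule that[of "min 1 d1"])
  show "min 1 d1 > 0" using d1 by simp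
  fix e :: real assume e: "0 < e" "e < min 1 d1"
  let ?c = "\<lambda>f. conv f (mollifier e)"
  have fc: "?c f x = ?c h x + ?c k x" for x
   using conv_diff[OF fint hint test_function_mollifier[OF e(1)], of x]
   by (simp add: f_eq[abs_def])
  have bound: "\<bar>?c f x - f x\<bar> \<le> \<bar>?c h x\<bar> + \<bar>h x\<bar> + ?I (r + 1) x * (d / (4 * (V + 1)))" for x
  proof (cases "x \<in> cball 0 (r + 1)")
   case True
   have "\<bar>?c k x - k x\<bar> \<le> d / (4 * (V + 1))"
   proof (rule conv_mollifier_bound[OF kint e(1)])
    fix y assume "dist x y < e"
    hence "norm y \<le> norm x + e" using norm_triangle_sub[of y x] by (simp add: dist_norm norm_minus_commute)
    hence "x \<in> cball 0 (r + 2)" "y \<in> cball 0 (r + 2)" using True e by auto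
    thus "\<bar>k y - k x\<bar> \<le> d / (4 * (V + 1))"
     using d1(2)[of y x] \<open>dist x y < e\<close> e by (simp add: k_def dist_commute)
   qed
   thus ?thesis using True fc[of x] f_eq[of x] by simp
  next
   case False
   have "\<bar>?c f x - 0\<bar> \<le> 0"
   proof (rule conv_mollifier_bound[OF fint e(1)])
    fix y assume "dist x y < e"
    hence "norm x \<le> norm y + e" using norm_triangle_sub[of x y] by (simp add: dist_norm)
    thus "\<bar>f y - 0\<bar> \<le> 0" using False e supp[of y] by auto
   qed
   moreover have "f x = 0" using False supp[of x] by auto
   ultimately show ?thesis using d1 False by simp
  qed
  have Vint: "integrable lborel (?I (r + 1))" "(\<integral>x. ?I (r + 1) x \<partial>lborel) = V"
   by (auto simp: V_def intro: integrable_indicator_bounded)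
  have "(\<integral>x. \<bar>?c f x - f x\<bar> \<partial>lborel) \<le> (\<integral>x. \<bar>?c h x\<bar> + \<bar>h x\<bar> + ?I (r + 1) x * (d / (4 * (V + 1))) \<partial>lborel)"
   by (rule integral_mono) (use bound conv_L1(1)[OF fint e(1)] conv_L1(1)[OF hint e(1)] fint hint Vint in auto)
  also have "\<dots> = (\<integral>x. \<bar>?c h x\<bar> \<partial>lborel) + (\<integral>x. \<bar>h x\<bar> \<partial>lborel) + V * (d / (4 * (V + 1)))"
   using conv_L1(1)[OF hint e(1)] hint Vint by simp
  also have "\<dots> \<le> d / 4 + d / 4 + d / 4"
  proof (intro add_mono)
   show "V * (d / (4 * (V + 1))) \<le> d / 4" using V \<open>d > 0\<close> by (simp add: field_simps)
  qed (use conv_L1(2)[OF hint e(1)] hd in linarith)+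
  also have "\<dots> < d" using \<open>d > 0\<close> by simp
  finally show "(\<integral>x. \<bar>?c f x - f x\<bar> \<partial>lborel) < d" .
 qed
qed

text \<open>The sum of the finitely many L1 errors tends to 0, so one subsequence of the radii makes
  the sum, hence each summand, converge almost everywhere. A common sequence is wanted because all
  entries of a Hessian must converge simultaneously.\<close>

lemma conv_mollifier_AE:
 fixes f :: "'i \<Rightarrow> 'a::euclidean_space \<Rightarrow> real"
 assumes "finite I" "\<And>i. i \<in> I \<Longrightarrow> borel_fun (f i)" "\<And>i x. i \<in> I \<Longrightarrow> \<bar>f i x\<bar> \<le> M"
  and "\<And>i x. i \<in> I \<Longrightarrow> norm x > r \<Longrightarrow> f i x = 0"
 obtains e where "\<And>n. e n > 0" "e \<longlonglongrightarrow> 0"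
  "AE x in lborel. \<forall>i\<in>I. (\<lambda>n. conv (f i) (mollifier (e n)) x) \<longlonglongrightarrow> f i x"
proof -
 define e where "e n = inverse (real (Suc n))" for n
 have e: "e n > 0" "e \<longlonglongrightarrow> 0" for n
  unfolding e_def using LIMSEQ_inverse_real_of_nat by auto
 define u where "u n x = (\<Sum>i\<in>I. \<bar>conv (f i) (mollifier (e n)) x - f i x\<bar>)" for n x
 have fint: "integrable lborel (f i)" if "i \<in> I" for i
  by (rule integrable_bounded_support[of _ "cball 0 r" M]) (use assms that in \<open>auto simp: not_le\<close>)
 have term_int: "integrable lborel (\<lambda>x. \<bar>conv (f i) (mollifier (e n)) x - f i x\<bar>)" if "i \<in> I" for i n
  using conv_L1(1)[OF fint[OF that] e(1), of n] fint[OF that] by auto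
 have uint: "integrable lborel (u n)" for n unfolding u_def using term_int by auto
 have lim: "(\<lambda>n. (\<integral>x. \<bar>conv (f i) (mollifier (e n)) x - f i x\<bar> \<partial>lborel)) \<longlonglongrightarrow> 0" if i: "i \<in> I" for i
 proof (rule LIMSEQ_I)
  fix d :: real assume "d > 0"
  obtain e0 where e0: "e0 > 0" "\<And>e. 0 < e \<Longrightarrow> e < e0 \<Longrightarrow> (\<integral>x. \<bar>conv (f i) (mollifier e) x - f i x\<bar> \<partial>lborel) < d"
   using conv_mollifier_L1_tendsto[of "f i" M r d] assms i \<open>d > 0\<close> by metis
  have "eventually (\<lambda>n. e n < e0) sequentially" using order_tendstoD(2)[OF e(2) e0(1)] .
  then obtain N where "\<And>n. n \<ge> N \<Longrightarrow> e n < e0" by (auto simp: eventually_sequentially)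
  thus "\<exists>N. \<forall>n\<ge>N. norm ((\<integral>x. \<bar>conv (f i) (mollifier (e n)) x - f i x\<bar> \<partial>lborel) - 0) < d"
   using e0(2) e(1) by auto
 qed
 have norm_u: "norm (u n x) = u n x" for n x by (simp add: u_def sum_nonneg)
 have "(\<lambda>n. (\<Sum>i\<in>I. (\<integral>x. \<bar>conv (f i) (mollifier (e n)) x - f i x\<bar> \<partial>lborel))) \<longlonglongrightarrow> (\<Sum>i\<in>I. 0)"
  by (intro tendsto_sum lim)
 hence "(\<lambda>n. (\<integral>x. norm (u n x) \<partial>lborel)) \<longlonglongrightarrow> 0"
  using term_int unfolding norm_u by (simp add: u_def)
 from tendsto_L1_AE_subseq[OF uint this] obtain s where s: "strict_mono s" "AE x in lborel. (\<lambda>n. u (s n) x) \<longlonglongrightarrow> 0"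
  by blast
 show thesis
 proof (rule that[of "e \<circ> s"])
  show "(e \<circ> s) \<longlonglongrightarrow> 0" by (rule LIMSEQ_subseq_LIMSEQ[OF e(2) s(1)])
  show "AE x in lborel. \<forall>i\<in>I. (\<lambda>n. conv (f i) (mollifier ((e \<circ> s) n)) x) \<longlonglongrightarrow> f i x"
   using s(2)
  proof eventually_elim
   case (elim x)
   show ?case
   proof
    fix i assume i: "i \<in> I"
    have "(\<lambda>n. \<bar>conv (f i) (mollifier (e (s n))) x - f i x\<bar>) \<longlonglongrightarrow> 0"
    proof (rule tendsto_sandwich[OF _ _ tendsto_const elim])
     show "\<forall>\<^sub>F n in sequentially. \<bar>conv (f i) (mollifier (e (s n))) x - f i x\<bar> \<le> u (s n) x"
      unfolding u_def using i assms(1) by (intro always_eventually allI member_le_sum) auto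
    qed auto
    hence "(\<lambda>n. conv (f i) (mollifier (e (s n))) x - f i x) \<longlonglongrightarrow> 0"
     by (simp add: tendsto_rabs_zero_iff)
    thus "(\<lambda>n. conv (f i) (mollifier ((e \<circ> s) n)) x) \<longlonglongrightarrow> f i x"
     by (simp add: LIM_zero_iff)
   qed
  qed
 qed (use e in auto)
qed


section \<open>Difference quotients and interpolation\<close>

definition dquot :: "real \<Rightarrow> 'a::real_normed_vector \<Rightarrow> ('a \<Rightarrow> real) \<Rightarrow> 'a \<Rightarrow> real"
 where "dquot h v f = (\<lambda>x. (f (x + h *\<^sub>R v) - f x) / h)"

lemma dquot_pow_measurable [measurable]:
 fixes f :: "'a::euclidean_space \<Rightarrow> real"
 assumes "borel_fun f"
 shows "borel_fun ((dquot h v ^^ j) f)"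
proof (induction j)
 case (Suc j)
 hence [measurable]: "borel_fun ((dquot h v ^^ j) f)" .
 show ?case by (simp add: dquot_def[of h v "(dquot h v ^^ j) f"])
qed (use assms in simp)

lemma dquot_pow_bound:
 assumes "h > 0" "\<And>x. \<bar>f x\<bar> \<le> B"
 shows "\<bar>(dquot h v ^^ j) f x\<bar> \<le> (2 / h) ^ j * B"
proof (induction j arbitrary: x)
 case (Suc j)
 let ?g = "(dquot h v ^^ j) f"
 have "\<bar>?g (x + h *\<^sub>R v) - ?g x\<bar> \<le> \<bar>?g (x + h *\<^sub>R v)\<bar> + \<bar>?g x\<bar>" by simp
 also have "\<dots> \<le> (2 / h) ^ j * B + (2 / h) ^ j * B" by (intro add_mono Suc.IH)
 finally have "\<bar>?g (x + h *\<^sub>R v) - ?g x\<bar> \<le> 2 * ((2 / h) ^ j * B)" by (simp only: mult_2)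
 from divide_right_mono[OF this less_imp_le[OF assms(1)]]
 have "\<bar>?g (x + h *\<^sub>R v) - ?g x\<bar> / h \<le> (2 * ((2 / h) ^ j * B)) / h" .
 moreover have "(2 * ((2 / h) ^ j * B)) / h = (2 / h) ^ Suc j * B" by simp
 ultimately have "\<bar>?g (x + h *\<^sub>R v) - ?g x\<bar> / \<bar>h\<bar> \<le> (2 / h) ^ Suc j * B"
  using assms(1) by (simp only: abs_of_pos)
 thus ?case by (simp only: funpow.simps o_def dquot_def[of h v ?g] abs_divide)
qed (use assms in simp)

text \<open>Translation invariance moves the shift from \<open>F\<close> to \<open>g\<close>; a
  bounded function times an integrable one makes each product integrable.\<close>

lemma dquot_summation_by_parts:
 fixes F g :: "'a::euclidean_space \<Rightarrow> real"
 assumes [measurable]: "borel_fun F" and g: "integrable lborel g"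
  and "\<And>x. \<bar>F x\<bar> \<le> B"
 shows "(\<integral>x. g x * dquot h v F x \<partial>lborel) = (\<integral>x. F x * ((g (x - h *\<^sub>R v) - g x) / h) \<partial>lborel)"
  and "integrable lborel (\<lambda>x. g x * dquot h v F x)"
  and "integrable lborel (\<lambda>x. F x * ((g (x - h *\<^sub>R v) - g x) / h))"
proof -
 have bm: "integrable lborel (\<lambda>x. g' x * F' x)" if "integrable lborel g'" "borel_fun F'"
  "\<And>x. \<bar>F' x\<bar> \<le> B" for g' F' :: "'a \<Rightarrow> real"
 proof (rule Bochner_Integration.integrable_bound[of _ "\<lambda>y. B * g' y"])
  have "\<bar>g' y * F' y\<bar> \<le> \<bar>B * g' y\<bar>" for y
   using mult_left_mono[OF that(3)[of y], of "\<bar>g' y\<bar>"] that(3)[of y] by (simp add: abs_mult mult.commute)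
  thus "AE y in lborel. norm (g' y * F' y) \<le> norm (B * g' y)" by simp
 qed (use that in auto)
 have i1: "integrable lborel (\<lambda>x. g x * F (x + h *\<^sub>R v))" by (rule bm[OF g]) (use assms in auto)
 have i2: "integrable lborel (\<lambda>x. g x * F x)" by (rule bm[OF g]) (use assms in auto)
 have i3: "integrable lborel (\<lambda>x. g (x - h *\<^sub>R v) * F x)"
  using bm[OF integrable_translate[OF g, of "- h *\<^sub>R v"]] assms by simp
 have [measurable]: "borel_fun g" using g by auto
 have "(\<integral>x. g (x - h *\<^sub>R v) * F x \<partial>lborel) = (\<integral>x. g x * F (x + h *\<^sub>R v) \<partial>lborel)"
  using integral_translate[of "\<lambda>x. g (x - h *\<^sub>R v) * F x" "h *\<^sub>R v"] by simp
 hence "(\<integral>x. (g x * F (x + h *\<^sub>R v) - g x * F x) / h \<partial>lborel) = (\<integral>x. (g (x - h *\<^sub>R v) * F x - g x * F x) / h \<partial>lborel)"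
  using i1 i2 i3 by simp
 moreover have "(\<lambda>x. (g x * F (x + h *\<^sub>R v) - g x * F x) / h) = (\<lambda>x. g x * dquot h v F x)"
  by (auto simp: dquot_def fun_eq_iff right_diff_distrib diff_divide_distrib)
 moreover have "(\<lambda>x. (g (x - h *\<^sub>R v) * F x - g x * F x) / h) = (\<lambda>x. F x * ((g (x - h *\<^sub>R v) - g x) / h))"
  by (auto simp: fun_eq_iff algebra_simps diff_divide_distrib)
 moreover have "integrable lborel (\<lambda>x. (g x * F (x + h *\<^sub>R v) - g x * F x) / h)"
  "integrable lborel (\<lambda>x. (g (x - h *\<^sub>R v) * F x - g x * F x) / h)" using i1 i2 i3 by auto
 ultimately show "(\<integral>x. g x * dquot h v F x \<partial>lborel) = (\<integral>x. F x * ((g (x - h *\<^sub>R v) - g x) / h) \<partial>lborel)"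
  "integrable lborel (\<lambda>x. g x * dquot h v F x)"
  "integrable lborel (\<lambda>x. F x * ((g (x - h *\<^sub>R v) - g x) / h))" by simp_all
qed

section \<open>Pointwise inequalities for the interpolation estimate\<close>

lemma power_diff_bound:
 fixes x y :: real
 assumes "0 \<le> x" "x \<le> Z" "0 \<le> y" "y \<le> Z"
 shows "\<bar>x ^ Suc k - y ^ Suc k\<bar> \<le> real (Suc k) * Z ^ k * \<bar>x - y\<bar>"
proof -
 have "norm (x ^ Suc k - y ^ Suc k) \<le> (real (Suc k) * Z ^ k) * norm (x - y)"
 proof (rule field_differentiable_bound[of "{0..Z}" "\<lambda>t. t ^ Suc k" "\<lambda>t. real (Suc k) * t ^ k"])
  show "((\<lambda>t. t ^ Suc k) has_field_derivative real (Suc k) * t ^ k) (at t within {0..Z})" for t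
   by (rule has_field_derivative_at_within) (use DERIV_pow[of "Suc k" t] in simp)
  show "norm (real (Suc k) * t ^ k) \<le> real (Suc k) * Z ^ k" if "t \<in> {0..Z}" for t
   using that by (auto simp: abs_mult intro!: mult_left_mono power_mono)
 qed (use assms in auto)
 thus ?thesis by simp
qed

lemma power_add_bound:
 fixes p q :: real
 assumes "p \<ge> 0" "q \<ge> 0"
 shows "(p + q) ^ k \<le> 2 ^ k * (p ^ k + q ^ k)"
proof -
 have "(p + q) ^ k \<le> (2 * max p q) ^ k" using assms by (intro power_mono) auto
 also have "\<dots> = 2 ^ k * max p q ^ k" by (simp add: power_mult_distrib)
 also have "max p q ^ k \<le> p ^ k + q ^ k" using assms by (auto simp: max_def)
 finally show ?thesis by simp
qed

text \<open>The function \<open>|b|\<^bsup>p-2\<^esup>b\<close> for \<open>p = 2m/j\<close>, written with roots to keep exponents natural.\<close>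

definition sroot :: "nat \<Rightarrow> nat \<Rightarrow> real \<Rightarrow> real"
 where "sroot m j b = sgn b * root j \<bar>b\<bar> ^ (2 * m - j)"

lemma sroot_mult:
 assumes "0 < j" "j \<le> m"
 shows "sroot m j b * b = root j \<bar>b\<bar> ^ (2 * m)"
proof -
 have "sgn b * b = root j \<bar>b\<bar> ^ j" using assms by (simp add: sgn_if)
 hence "sroot m j b * b = root j \<bar>b\<bar> ^ (2 * m - j) * root j \<bar>b\<bar> ^ j"
  by (simp add: sroot_def mult.commute mult.left_commute)
 also have "\<dots> = root j \<bar>b\<bar> ^ (2 * m - j + j)" by (simp only: power_add)
 finally show ?thesis using assms by simp
qed

lemma sroot_abs: "\<bar>sroot m j b\<bar> \<le> root j \<bar>b\<bar> ^ (2 * m - j)"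
 by (cases "b = 0") (auto simp: sroot_def abs_mult sgn_if real_root_ge_zero)

text \<open>As a function of |b| = r^j, the power r^(2m-j) has derivative at most a multiple of
  r^(2m-2j), which gives the factor when the signs agree. For opposite signs |b| + |b'| = |b - b'|,
  so the sizes may simply be added.\<close>

lemma sroot_lipschitz:
 assumes "0 < j" "j \<le> m" "root j \<bar>b\<bar> \<le> B" "root j \<bar>b'\<bar> \<le> B"
 shows "\<bar>sroot m j b - sroot m j b'\<bar> \<le> 2 * real m * B ^ (2 * m - 2 * j) * \<bar>b - b'\<bar>"
proof -
 have same: "x ^ (2 * m - j) - y ^ (2 * m - j) \<le> 2 * real m * B ^ (2 * m - 2 * j) * (x ^ j - y ^ j)"
  if "0 \<le> y" "y \<le> x" "x \<le> B" for x y
 proof -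
  obtain k where k: "2 * m - j = Suc k" using assms(1,2) by (cases "2 * m - j") auto
  have kj: "k = (2 * m - 2 * j) + (j - 1)" using k assms(1,2) by linarith
  have "x ^ Suc k - y ^ Suc k \<le> real (Suc k) * x ^ k * (x - y)"
   using power_diff_bound[of x x y k] that by linarith
  also have "\<dots> \<le> 2 * real m * x ^ k * (x - y)"
   using that k by (intro mult_right_mono) auto
  also have "\<dots> = 2 * real m * x ^ (2 * m - 2 * j) * (x ^ (j - 1) * (x - y))"
   by (simp add: kj power_add)
  also have "\<dots> \<le> 2 * real m * B ^ (2 * m - 2 * j) * (x ^ j - y ^ j)"
  proof (intro mult_mono)
   have "x ^ (j - 1) * y \<ge> y ^ (j - 1) * y" using that by (intro mult_right_mono power_mono) auto
   thus "x ^ (j - 1) * (x - y) \<le> x ^ j - y ^ j"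
    using assms(1) by (cases j) (auto simp: algebra_simps)
  qed (use that in \<open>auto intro: power_mono\<close>)
  finally show ?thesis using k by simp
 qed
 have B: "B \<ge> 0" using assms(3) real_root_ge_zero[of "\<bar>b\<bar>" j] by linarith
 have m1: "1 \<le> 2 * real m" using assms by linarith
 have pw: "root j \<bar>c\<bar> ^ j = \<bar>c\<bar>" for c using assms(1) by simp
 have core: "\<bar>sroot m j b - sroot m j b'\<bar> \<le> 2 * real m * B ^ (2 * m - 2 * j) * \<bar>b - b'\<bar>"
  if le: "\<bar>b'\<bar> \<le> \<bar>b\<bar>" and r: "root j \<bar>b\<bar> \<le> B" for b b'
 proof -
  let ?r = "root j \<bar>b\<bar>" and ?r' = "root j \<bar>b'\<bar>"
  have rr: "0 \<le> ?r'" "?r' \<le> ?r" using le assms(1) by auto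
  show ?thesis
  proof (cases "sgn b = sgn b' \<or> b' = 0")
   case True
   hence "\<bar>sroot m j b - sroot m j b'\<bar> = \<bar>sgn b\<bar> * \<bar>?r ^ (2 * m - j) - ?r' ^ (2 * m - j)\<bar>"
   proof
    assume "b' = 0" thus ?thesis using assms(1,2) by (simp add: sroot_def abs_mult)
   qed (simp add: sroot_def abs_mult flip: right_diff_distrib)
   also have "\<dots> \<le> 1 * (?r ^ (2 * m - j) - ?r' ^ (2 * m - j))"
    using power_mono[OF rr(2,1), of "2 * m - j"] by (intro mult_mono) (auto simp: sgn_if)
   also have "\<dots> \<le> 2 * real m * B ^ (2 * m - 2 * j) * (?r ^ j - ?r' ^ j)"
    using same[OF rr r] by simp
   also have "?r ^ j - ?r' ^ j \<le> \<bar>b - b'\<bar>" unfolding pw by linarith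
   finally show ?thesis using B by (simp add: mult_left_mono)
  next
   case False
   have split: "c ^ (2 * m - j) = c ^ (2 * m - 2 * j) * c ^ j" for c :: real
    using assms(2) by (simp flip: power_add)
   have "\<bar>sroot m j b - sroot m j b'\<bar> \<le> ?r ^ (2 * m - j) + ?r' ^ (2 * m - j)"
    using sroot_abs[of m j b] sroot_abs[of m j b'] by linarith
   also have "\<dots> \<le> B ^ (2 * m - 2 * j) * \<bar>b\<bar> + B ^ (2 * m - 2 * j) * \<bar>b'\<bar>"
    unfolding split pw using rr r by (intro add_mono mult_right_mono power_mono) auto
   also have "\<dots> = 1 * B ^ (2 * m - 2 * j) * \<bar>b - b'\<bar>"
    using False by (auto simp: sgn_if algebra_simps split: if_splits)
   also have "\<dots> \<le> 2 * real m * B ^ (2 * m - 2 * j) * \<bar>b - b'\<bar>"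
    using B m1 by (intro mult_right_mono) auto
   finally show ?thesis .
  qed
 qed
 show ?thesis
 proof (cases "\<bar>b'\<bar> \<le> \<bar>b\<bar>")
  case True thus ?thesis using core assms by blast
 next
  case False thus ?thesis using core[of b b'] assms by (simp add: abs_minus_commute)
 qed
qed

text \<open>Young's inequality with natural exponents, by comparing \<open>w\<close> with
  \<open>\<kappa> * t\<close>: in each case one of the two right-hand terms alone dominates the
  product. The crude constant \<open>(1 / \<kappa>) ^ N\<close> serves all \<open>i\<close> at
  once.\<close>

lemma young_power:
 fixes t w \<delta> :: real
 assumes "t \<ge> 0" "w \<ge> 0" "0 < \<kappa>" "\<kappa> \<le> 1" "0 < i" "i \<le> N"
 shows "t ^ (N - i) * w ^ i \<le> \<kappa> * t ^ N + (1 / \<kappa>) ^ N * w ^ N"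
proof (cases "w \<le> \<kappa> * t")
 case True
 have "t ^ (N - i) * w ^ i \<le> t ^ (N - i) * (\<kappa> * t) ^ i"
  using assms True by (intro mult_left_mono power_mono) auto
 also have "\<dots> = \<kappa> ^ i * t ^ N" using assms by (simp add: power_mult_distrib flip: power_add)
 also have "\<dots> \<le> \<kappa> * t ^ N" using assms power_decreasing[of 1 i \<kappa>] by (intro mult_right_mono) auto
 finally show ?thesis using assms by (simp add: add_increasing2)
next
 case False
 have "t \<le> (1 / \<kappa>) * w" using False assms by (simp add: field_simps)
 hence "t ^ (N - i) * w ^ i \<le> ((1 / \<kappa>) * w) ^ (N - i) * w ^ i"
  using assms by (intro mult_right_mono power_mono) auto
 also have "\<dots> = (1 / \<kappa>) ^ (N - i) * w ^ N" using assms by (simp only: power_mult_distrib mult.assoc flip: power_add) simp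
 also have "\<dots> \<le> (1 / \<kappa>) ^ N * w ^ N" using assms by (intro mult_right_mono power_increasing) auto
 finally show ?thesis using assms by (simp add: add_increasing)
qed

text \<open>Here \<open>z\<close>, \<open>z'\<close> are values of the cutoff at two points one step
  apart, \<open>a\<close> is the difference quotient of order \<open>j - 1\<close> at the first
  point, and \<open>b\<close>, \<open>b'\<close> are those of order \<open>j\<close> at both. The
  bounds by 2 hold for quotients of a function with values in [-1, 1]; they make changes of the
  cutoff harmless. For \<open>j = 1\<close> the bound on \<open>a\<close> is stated separately,
  because \<open>root 0\<close> is 0.\<close>

abbreviation interp_data :: "nat \<Rightarrow> real \<Rightarrow> real \<Rightarrow> real \<Rightarrow> real \<Rightarrow> real \<Rightarrow> real \<Rightarrow> real \<Rightarrow> bool"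
 where "interp_data j L h z z' a b b' \<equiv> 0 < h \<and> h \<le> 1 \<and> 0 \<le> z \<and> 0 \<le> z' \<and> \<bar>z - z'\<bar> \<le> L * h \<and>
  (j = 1 \<longrightarrow> \<bar>a\<bar> \<le> 1) \<and> h * root (j - 1) \<bar>a\<bar> \<le> 2 \<and> h * root j \<bar>b\<bar> \<le> 2 \<and> h * root j \<bar>b'\<bar> \<le> 2 \<and>
  h * root (Suc j) \<bar>(b - b') / h\<bar> \<le> 2"

text \<open>The left side is the integrand left by summation by parts. The factor of
  \<open>A\<close> contains the quotient of order \<open>j + 1\<close> alone; the last term is
  present only where one of the cutoff values is positive, so that it integrates to a multiple of a
  volume.\<close>

abbreviation interp_bound :: "nat \<Rightarrow> nat \<Rightarrow> real \<Rightarrow> real \<Rightarrow> real \<Rightarrow> real \<Rightarrow> real \<Rightarrow> real \<Rightarrow> real \<Rightarrow> real \<Rightarrow> real \<Rightarrow> bool"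
 where "interp_bound m j \<epsilon> A C h z z' a b b' \<equiv> \<bar>a\<bar> * \<bar>z' ^ (2 * m) * sroot m j b' - z ^ (2 * m) * sroot m j b\<bar> / h
  \<le> \<epsilon> * ((z * root (j - 1) \<bar>a\<bar>) ^ (2 * m) + (z * root j \<bar>b\<bar>) ^ (2 * m) + (z' * root j \<bar>b'\<bar>) ^ (2 * m))
   + A * (z' * root (Suc j) \<bar>(b - b') / h\<bar>) ^ (2 * m) + (if z > 0 \<or> z' > 0 then C else 0)"

text \<open>All quantities are measured by the homogeneous sizes \<open>t\<close> (orders
  \<open>j - 1\<close> and \<open>j\<close>) and \<open>w\<close> (order \<open>j + 1\<close>).
  Where the difference hits the power, the term is t^(N-j-1) w^(j+1) and Young's inequality splits
  it; where it hits the cutoff, one power of \<open>t\<close> is lost and the factor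
  \<open>L\<close> goes into the constant. \<open>A\<close> is fixed before \<open>L\<close>, which
  makes it independent of the cutoff.\<close>

lemma interpolation_pointwise:
 assumes "0 < j" "j < m" "\<epsilon> > 0"
 obtains A where "A \<ge> 0" "\<And>L. L \<ge> 0 \<Longrightarrow> \<exists>C\<ge>0. \<forall>h z z' a b b'. interp_data j L h z z' a b b' \<longrightarrow>
   interp_bound m j \<epsilon> A C h z z' a b b'"
proof -
 define N where "N = 2 * m"
 \<comment> \<open>Two terms of size \<open>\<delta> * t ^ N\<close> arise below, and bounding
   \<open>t ^ N\<close> with each root weighted by the cutoff at its own point costs
   \<open>2 ^ N\<close>; hence the divisor \<open>2 * 2 ^ N\<close>. The minimum with 1 keeps the
   parameters of Young's inequality at most 1.\<close>
 define \<delta> where "\<delta> = min (\<epsilon> / (2 * 2 ^ N)) 1"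
 define \<kappa> where "\<kappa> = \<delta> / real N"
 define K where "K = real N * (1 / \<kappa>) ^ N"
 have N: "N > 0" "real N \<ge> 1" using assms by (auto simp: N_def)
 have \<delta>: "\<delta> > 0" "2 * \<delta> * 2 ^ N \<le> \<epsilon>" "\<delta> \<le> 1"
  using assms(3) by (auto simp: \<delta>_def min_def field_simps)
 have \<kappa>: "0 < \<kappa>" "\<kappa> \<le> 1" "real N * \<kappa> = \<delta>" using \<delta> N by (auto simp: \<kappa>_def field_simps)
 have K: "K \<ge> 0" using \<kappa> by (simp add: K_def)
 show thesis
 proof (rule that[of "K * 2 ^ N"])
  fix L :: real assume L: "L \<ge> 0"
  \<comment> \<open>Young's inequality with second factor 1 and exponents \<open>N - 1\<close> and
    1, applied to the term in which the cutoff is differenced, produces this constant.\<close>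
  define C1 where "C1 = real N * L * (1 / (\<delta> / (real N * L + 1))) ^ N"
  define C where "C = \<epsilon> * (3 * (2 * L) ^ N) + K * 2 ^ N * (2 * L) ^ N + C1"
  have C1: "C1 \<ge> 0" using L N \<delta> by (simp add: C1_def)
  have C: "C \<ge> 0" using assms(3) L K C1 by (simp add: C_def)
  show "\<exists>C\<ge>0. \<forall>h z z' a b b'. interp_data j L h z z' a b b' \<longrightarrow>
   interp_bound m j \<epsilon> (K * 2 ^ N) C h z z' a b b'"
  proof (intro exI[of _ C] conjI C allI impI; (elim conjE)?)
   fix h z z' a b b' :: real
   assume h: "0 < h" "h \<le> 1" and z: "0 \<le> z" "0 \<le> z'" "\<bar>z - z'\<bar> \<le> L * h"
    and a1: "j = 1 \<longrightarrow> \<bar>a\<bar> \<le> 1" and ha: "h * root (j - 1) \<bar>a\<bar> \<le> 2"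
    and hb: "h * root j \<bar>b\<bar> \<le> 2" "h * root j \<bar>b'\<bar> \<le> 2"
    and hc: "h * root (Suc j) \<bar>(b - b') / h\<bar> \<le> 2"
   define \<alpha> \<beta> \<beta>' \<gamma> where ab: "\<alpha> = root (j - 1) \<bar>a\<bar>" "\<beta> = root j \<bar>b\<bar>" "\<beta>' = root j \<bar>b'\<bar>"
    "\<gamma> = root (Suc j) \<bar>(b - b') / h\<bar>"
   define Z B t w where ZB: "Z = max z z'" "B = max \<beta> \<beta>'" "t = max z z' * max \<alpha> (max \<beta> \<beta>')" "w = max z z' * \<gamma>"
   have nn: "\<alpha> \<ge> 0" "\<beta> \<ge> 0" "\<beta>' \<ge> 0" "\<gamma> \<ge> 0" "Z \<ge> 0" "B \<ge> 0" "t \<ge> 0" "w \<ge> 0"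
    unfolding ab ZB using z by (auto simp: le_max_iff_disj real_root_ge_zero)
   have ta: "Z ^ (j - 1) * \<bar>a\<bar> \<le> t ^ (j - 1)"
   proof (cases "j = 1")
    case False
    hence "\<alpha> ^ (j - 1) = \<bar>a\<bar>" using assms(1) by (simp add: ab)
    hence "Z ^ (j - 1) * \<bar>a\<bar> = (Z * \<alpha>) ^ (j - 1)" by (simp add: power_mult_distrib)
    also have "\<dots> \<le> t ^ (j - 1)" unfolding ZB using nn z by (intro power_mono mult_left_mono) (auto simp: ZB)
    finally show ?thesis .
   qed (use a1 in simp)
   have tB: "Z * B \<le> t" unfolding ZB using z by (intro mult_left_mono) auto
   have wc: "Z ^ (j + 1) * \<bar>(b - b') / h\<bar> = w ^ (j + 1)"
   proof -
    have "\<gamma> ^ Suc j = \<bar>(b - b') / h\<bar>" unfolding ab by (rule real_root_pow_pos2) auto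
    thus ?thesis by (simp only: ZB power_mult_distrib Suc_eq_plus1)
   qed
   have diff: "\<bar>z' ^ N * sroot m j b' - z ^ N * sroot m j b\<bar>
    \<le> Z ^ N * (real N * B ^ (N - 2 * j) * \<bar>b - b'\<bar>) + (real N * Z ^ (N - 1) * (L * h)) * B ^ (N - j)"
   proof -
    have "z' ^ N * sroot m j b' - z ^ N * sroot m j b
     = z ^ N * (sroot m j b' - sroot m j b) + (z' ^ N - z ^ N) * sroot m j b'"
     by (simp add: algebra_simps)
    also have "\<bar>\<dots>\<bar> \<le> z ^ N * \<bar>sroot m j b' - sroot m j b\<bar> + \<bar>z' ^ N - z ^ N\<bar> * \<bar>sroot m j b'\<bar>"
     using z by (intro order.trans[OF abs_triangle_ineq]) (simp add: abs_mult)
    also have "\<dots> \<le> Z ^ N * (real N * B ^ (N - 2 * j) * \<bar>b - b'\<bar>) + (real N * Z ^ (N - 1) * (L * h)) * B ^ (N - j)"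
    proof (intro add_mono mult_mono)
     show "\<bar>sroot m j b' - sroot m j b\<bar> \<le> real N * B ^ (N - 2 * j) * \<bar>b - b'\<bar>"
      using sroot_lipschitz[of j m b' B b] assms by (simp add: N_def ab ZB abs_minus_commute)
     have "\<bar>z' ^ Suc (N - 1) - z ^ Suc (N - 1)\<bar> \<le> real (Suc (N - 1)) * Z ^ (N - 1) * \<bar>z' - z\<bar>"
      using z by (intro power_diff_bound) (auto simp: ZB)
     also have "\<dots> \<le> real N * Z ^ (N - 1) * (L * h)"
      using z N nn by (intro mult_mono) auto
     finally show "\<bar>z' ^ N - z ^ N\<bar> \<le> real N * Z ^ (N - 1) * (L * h)" using N by simp
     have "\<bar>sroot m j b'\<bar> \<le> \<beta>' ^ (N - j)"
      using sroot_abs[of m j b'] by (simp add: N_def ab)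
     also have "\<dots> \<le> B ^ (N - j)" using nn by (intro power_mono) (auto simp: ZB)
     finally show "\<bar>sroot m j b'\<bar> \<le> B ^ (N - j)" .
    qed (use z nn L h in \<open>auto simp: ZB intro!: power_mono\<close>)
    finally show ?thesis .
   qed
   have "\<bar>a\<bar> * \<bar>z' ^ N * sroot m j b' - z ^ N * sroot m j b\<bar> / h
    \<le> \<bar>a\<bar> * (Z ^ N * (real N * B ^ (N - 2 * j) * \<bar>b - b'\<bar>) + (real N * Z ^ (N - 1) * (L * h)) * B ^ (N - j)) / h"
    using diff h by (intro divide_right_mono mult_left_mono) auto
   also have "\<dots> = real N * ((Z ^ (j - 1) * \<bar>a\<bar>) * (Z * B) ^ (N - 2 * j) * (Z ^ (j + 1) * \<bar>(b - b') / h\<bar>))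
     + real N * L * ((Z ^ (j - 1) * \<bar>a\<bar>) * (Z * B) ^ (N - j))"
   proof -
    have e1: "Z ^ N = Z ^ (j - 1) * Z ^ (N - 2 * j) * Z ^ (j + 1)"
     using assms by (simp only: N_def flip: power_add) (simp)
    have e2: "Z ^ (N - 1) = Z ^ (j - 1) * Z ^ (N - j)"
     using assms by (simp only: N_def flip: power_add) (simp)
    show ?thesis unfolding e1 e2 power_mult_distrib using h by (simp add: field_simps)
   qed
   also have "\<dots> \<le> real N * (t ^ (j - 1) * t ^ (N - 2 * j) * w ^ (j + 1)) + real N * L * (t ^ (j - 1) * t ^ (N - j))"
    unfolding wc using ta tB nn L
    by (intro add_mono mult_left_mono mult_right_mono mult_mono power_mono) auto
   also have "\<dots> = real N * (t ^ (N - (j + 1)) * w ^ (j + 1)) + real N * L * t ^ (N - 1)"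
    using assms by (simp add: N_def flip: power_add)
   also have "\<dots> \<le> real N * (\<kappa> * t ^ N + (1 / \<kappa>) ^ N * w ^ N) + (\<delta> * t ^ N + (if Z > 0 then C1 else 0))"
   proof (rule add_mono)
    show "real N * (t ^ (N - (j + 1)) * w ^ (j + 1)) \<le> real N * (\<kappa> * t ^ N + (1 / \<kappa>) ^ N * w ^ N)"
     using nn \<kappa> assms by (intro mult_left_mono young_power) (auto simp: N_def)
    show "real N * L * t ^ (N - 1) \<le> \<delta> * t ^ N + (if Z > 0 then C1 else 0)"
    proof (cases "Z > 0")
     case False
     hence "t = 0" using nn(5) by (simp add: ZB max_def split: if_splits)
     thus ?thesis using False N assms by (auto simp: N_def power_0_left)
    next
     case True
     define q where "q = \<delta> / (real N * L + 1)"
     have l: "0 < q" "q \<le> 1" "real N * L * q \<le> \<delta>"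
     proof -
      have p: "real N * L + 1 > 0" "real N * L \<ge> 0" using L by (auto simp: add_nonneg_pos)
      thus "0 < q" "q \<le> 1" using \<delta> by (auto simp: q_def field_simps)
      have "real N * L * \<delta> \<le> (real N * L + 1) * \<delta>" using \<delta> by (intro mult_right_mono) auto
      thus "real N * L * q \<le> \<delta>" using p by (simp add: q_def field_simps)
     qed
     have "t ^ (N - 1) * 1 ^ 1 \<le> q * t ^ N + (1 / q) ^ N * 1 ^ N"
      using nn l N by (intro young_power) auto
     hence "real N * L * t ^ (N - 1) \<le> real N * L * (q * t ^ N + (1 / q) ^ N)"
      using L N by (intro mult_left_mono) auto
     also have "\<dots> = (real N * L * q) * t ^ N + C1" by (simp add: C1_def q_def algebra_simps)
     also have "\<dots> \<le> \<delta> * t ^ N + C1" using l nn by (intro add_mono mult_right_mono) auto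
     finally show ?thesis using True by simp
    qed
   qed
   also have "\<dots> = 2 * \<delta> * t ^ N + K * w ^ N + (if Z > 0 then C1 else 0)"
   proof -
    have "real N * (\<kappa> * t ^ N + (1 / \<kappa>) ^ N * w ^ N) = (real N * \<kappa>) * t ^ N + K * w ^ N"
     unfolding K_def by (simp only: distrib_left mult.assoc)
    thus ?thesis by (simp add: \<kappa>(3))
   qed
   finally have main: "\<bar>a\<bar> * \<bar>z' ^ N * sroot m j b' - z ^ N * sroot m j b\<bar> / h
     \<le> 2 * \<delta> * t ^ N + K * w ^ N + (if Z > 0 then C1 else 0)" .
   \<comment> \<open>The larger cutoff value exceeds the other by at most \<open>L * h\<close>, and
     \<open>h * r\<close> is at most 2, so replacing \<open>Z\<close> by either value costs only
     \<open>2 * L\<close>, independently of \<open>h\<close>.\<close>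
   have shift: "(Z * r) ^ N \<le> 2 ^ N * ((y * r) ^ N + (if Z > 0 then (2 * L) ^ N else 0))"
    if "0 \<le> r" "h * r \<le> 2" "y = z \<or> y = z'" for r y
   proof (cases "Z > 0")
    case True
    have "Z \<le> y + L * h" using that(3) z by (auto simp: ZB)
    hence "Z * r \<le> y * r + L * (h * r)" using that(1) mult_right_mono[of Z "y + L * h" r] by (simp add: algebra_simps)
    also have "\<dots> \<le> y * r + 2 * L" using mult_left_mono[OF that(2) L] by simp
    finally have "(Z * r) ^ N \<le> (y * r + 2 * L) ^ N" using that(1) nn by (intro power_mono) auto
    also have "\<dots> \<le> 2 ^ N * ((y * r) ^ N + (2 * L) ^ N)"
     using that z L by (intro power_add_bound) auto
    finally show ?thesis using True by simp
   next
    case False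
    hence "Z = 0" "y = 0" using nn(5) that(3) z by (auto simp: ZB max_def split: if_splits)
    thus ?thesis using N by (simp add: power_0_left)
   qed
   have tN: "t ^ N \<le> 2 ^ N * ((z * \<alpha>) ^ N + (z * \<beta>) ^ N + (z' * \<beta>') ^ N + (if Z > 0 then 3 * (2 * L) ^ N else 0))"
   proof -
    have "t ^ N \<le> (Z * \<alpha>) ^ N + (Z * \<beta>) ^ N + (Z * \<beta>') ^ N"
    proof -
     have "t = Z * \<alpha> \<or> t = Z * \<beta> \<or> t = Z * \<beta>'" by (auto simp: ZB max_def)
     thus ?thesis using nn by (auto intro: add_increasing add_increasing2)
    qed
    also have "\<dots> \<le> 2 ^ N * ((z * \<alpha>) ^ N + (if Z > 0 then (2 * L) ^ N else 0)) + 2 ^ N * ((z * \<beta>) ^ N + (if Z > 0 then (2 * L) ^ N else 0))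
      + 2 ^ N * ((z' * \<beta>') ^ N + (if Z > 0 then (2 * L) ^ N else 0))"
     using nn ha hb by (intro add_mono shift) (auto simp: ab)
    finally show ?thesis by (simp add: algebra_simps split: if_splits)
   qed
   have wN: "w ^ N \<le> 2 ^ N * ((z' * \<gamma>) ^ N + (if Z > 0 then (2 * L) ^ N else 0))"
   proof -
    have "w = Z * \<gamma>" by (simp only: ZB)
    moreover have "h * \<gamma> \<le> 2" using hc by (simp only: ab)
    ultimately show ?thesis using shift[of \<gamma> z'] nn(4) by simp
   qed
   let ?S = "(z * \<alpha>) ^ N + (z * \<beta>) ^ N + (z' * \<beta>') ^ N"
   have S0: "?S \<ge> 0" using nn z by auto
   have "2 * \<delta> * t ^ N \<le> 2 * \<delta> * (2 ^ N * (?S + (if Z > 0 then 3 * (2 * L) ^ N else 0)))"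
    using tN \<delta> by (intro mult_left_mono) auto
   also have "\<dots> = 2 * \<delta> * 2 ^ N * (?S + (if Z > 0 then 3 * (2 * L) ^ N else 0))" by simp
   also have "\<dots> \<le> \<epsilon> * (?S + (if Z > 0 then 3 * (2 * L) ^ N else 0))"
    using \<delta> S0 L by (intro mult_right_mono) auto
   finally have 1: "2 * \<delta> * t ^ N \<le> \<epsilon> * (?S + (if Z > 0 then 3 * (2 * L) ^ N else 0))" .
   have 2: "K * w ^ N \<le> K * (2 ^ N * ((z' * \<gamma>) ^ N + (if Z > 0 then (2 * L) ^ N else 0)))"
    using wN K by (intro mult_left_mono) auto
   have "\<bar>a\<bar> * \<bar>z' ^ N * sroot m j b' - z ^ N * sroot m j b\<bar> / h
     \<le> \<epsilon> * ?S + K * 2 ^ N * (z' * \<gamma>) ^ N + (if Z > 0 then C else 0)"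
    using main 1 2 by (cases "Z > 0") (auto simp: C_def algebra_simps)
   moreover have "Z > 0 \<longleftrightarrow> z > 0 \<or> z' > 0" by (auto simp: ZB)
   ultimately show "interp_bound m j \<epsilon> (K * 2 ^ N) C h z z' a b b'" by (simp only: ab N_def)
  qed
 qed (use K in simp)
qed

section \<open>Cutoffs and weighted integrals of difference quotients\<close>

definition cutoff :: "real \<Rightarrow> 'a::euclidean_space \<Rightarrow> real \<Rightarrow> ('a \<Rightarrow> real) \<Rightarrow> bool"
 where "cutoff L x0 R \<zeta> \<longleftrightarrow> L \<ge> 0 \<and> (\<forall>x. 0 \<le> \<zeta> x \<and> \<zeta> x \<le> 1) \<and>
  (\<forall>x y. \<bar>\<zeta> x - \<zeta> y\<bar> \<le> L * dist x y) \<and> (\<forall>x. x \<notin> cball x0 R \<longrightarrow> \<zeta> x = 0)"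

abbreviation vol :: "'a::euclidean_space \<Rightarrow> real \<Rightarrow> real"
 where "vol x0 R \<equiv> measure lborel (cball x0 R)"

lemma cutoff_measurable [measurable_dest]: "cutoff L x0 R \<zeta> \<Longrightarrow> borel_fun \<zeta>"
proof -
 assume c: "cutoff L x0 R \<zeta>"
 have "L-lipschitz_on UNIV \<zeta>" using c by (auto simp: cutoff_def lipschitz_on_def dist_real_def)
 thus ?thesis by (intro borel_measurable_continuous_onI lipschitz_on_continuous_on)
qed

abbreviation wint :: "nat \<Rightarrow> ('a::euclidean_space \<Rightarrow> real) \<Rightarrow> ('a \<Rightarrow> real) \<Rightarrow> real"
 where "wint k \<zeta> f \<equiv> \<integral>x. \<zeta> x ^ k * f x \<partial>lborel"

abbreviation wsq :: "nat \<Rightarrow> ('a::euclidean_space \<Rightarrow> real) \<Rightarrow> ('a \<Rightarrow> real) \<Rightarrow> real"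
 where "wsq k \<zeta> f \<equiv> wint k \<zeta> (\<lambda>x. (f x)\<^sup>2)"

lemma cutoff_power_integrable:
 assumes "cutoff L x0 R \<zeta>" "borel_fun g" "\<And>x. \<bar>g x\<bar> \<le> B" "k > 0"
 shows "integrable lborel (\<lambda>x. \<zeta> x ^ k * g x)"
proof (rule integrable_bounded_support[of _ "cball x0 R" B])
 note [measurable] = cutoff_measurable[OF assms(1)] assms(2)
 show "borel_fun (\<lambda>x. \<zeta> x ^ k * g x)" by measurable
 show "norm (\<zeta> x ^ k * g x) \<le> B" for x
 proof -
  have "\<bar>\<zeta> x ^ k\<bar> \<le> 1" using assms(1) by (auto simp: cutoff_def power_abs intro: power_le_one)
  hence "\<bar>\<zeta> x ^ k\<bar> * \<bar>g x\<bar> \<le> 1 * B" using assms(3) by (intro mult_mono) auto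
  thus ?thesis by (simp add: abs_mult)
 qed
qed (use assms in \<open>auto simp: cutoff_def\<close>)

text \<open>The p-th power of a weighted L^p norm of the quotient of order \<open>j\<close>, with p
  = 2m/j: the Gagliardo--Nirenberg scale between the sup norm and L2. For \<open>j = 0\<close> the
  convention that \<open>root 0\<close> is 0 makes it vanish when \<open>m\<close> is
  positive.\<close>

definition wnorm :: "nat \<Rightarrow> nat \<Rightarrow> ('a::euclidean_space \<Rightarrow> real) \<Rightarrow> real \<Rightarrow> 'a \<Rightarrow> ('a \<Rightarrow> real) \<Rightarrow> real"
 where "wnorm m j \<zeta> h v f = (\<integral>x. (\<zeta> x * root j \<bar>(dquot h v ^^ j) f x\<bar>) ^ (2 * m) \<partial>lborel)"

lemma root_dquot_bound:
 assumes "h > 0" "\<And>x. \<bar>f x\<bar> \<le> 1"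
 shows "h * root j \<bar>(dquot h v ^^ j) f x\<bar> \<le> 2"
proof (cases "j = 0")
 case False
 have "root j \<bar>(dquot h v ^^ j) f x\<bar> \<le> root j ((2 / h) ^ j)"
  using dquot_pow_bound[of h f 1 j v x] assms False by (intro real_root_le_mono) auto
 also have "\<dots> = 2 / h" using False assms by (simp add: real_root_power_cancel)
 finally show ?thesis using assms by (simp add: field_simps)
qed simp

lemma wnorm_integrable:
 assumes c: "cutoff L x0 R \<zeta>" and h: "h > 0" and f: "borel_fun f" "\<And>x. \<bar>f x\<bar> \<le> 1" and "m > 0"
 shows "integrable lborel (\<lambda>x. (\<zeta> x * root j \<bar>(dquot h v ^^ j) f x\<bar>) ^ (2 * m))"
proof -
 note [measurable] = dquot_pow_measurable[OF f(1), where h=h and v=v and j=j]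
 have "integrable lborel (\<lambda>x. \<zeta> x ^ (2 * m) * root j \<bar>(dquot h v ^^ j) f x\<bar> ^ (2 * m))"
 proof (rule cutoff_power_integrable[OF c, of _ "(2 / h) ^ (2 * m)"])
  have "root j \<bar>(dquot h v ^^ j) f x\<bar> \<le> 2 / h" for x
   using root_dquot_bound[OF h f(2), where j=j and v=v and x=x] h by (simp add: field_simps)
  thus "\<bar>root j \<bar>(dquot h v ^^ j) f x\<bar> ^ (2 * m)\<bar> \<le> (2 / h) ^ (2 * m)" for x
   unfolding power_abs by (intro power_mono) (auto simp: real_root_ge_zero)
 qed (use assms in \<open>auto simp: root_abs_power\<close>)
 thus ?thesis by (simp add: power_mult_distrib)
qed

lemma wnorm_nonneg: "wnorm m j \<zeta> h v f \<ge> 0"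
 unfolding wnorm_def by (intro Bochner_Integration.integral_nonneg) (simp add: power_mult)

lemma integral_combination:
 fixes p q r u i k :: "'a \<Rightarrow> real"
 assumes "integrable M p" "integrable M q" "integrable M r" "integrable M u" "integrable M i" "integrable M k"
 shows "(\<integral>x. \<epsilon> * (p x + q x + r x) + A * u x + C * (i x + k x) \<partial>M) =
  \<epsilon> * (integral\<^sup>L M p + integral\<^sup>L M q + integral\<^sup>L M r) + A * integral\<^sup>L M u + C * (integral\<^sup>L M i + integral\<^sup>L M k)"
 using assms by simp

abbreviation wnorm_interp ::
 "nat \<Rightarrow> nat \<Rightarrow> real \<Rightarrow> real \<Rightarrow> real \<Rightarrow> ('a::euclidean_space \<Rightarrow> real) \<Rightarrow> real \<Rightarrow> 'a \<Rightarrow> ('a \<Rightarrow> real) \<Rightarrow> bool"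
 where "wnorm_interp m j \<epsilon> A C \<zeta> h v f \<equiv> wnorm m j \<zeta> h v f
  \<le> \<epsilon> * ((if j = 1 then 0 else wnorm m (j - 1) \<zeta> h v f) + 2 * wnorm m j \<zeta> h v f) + A * wnorm m (Suc j) \<zeta> h v f + C"

text \<open>With \<open>g\<close> equal to the cutoff power times \<open>sroot\<close>, the weighted
  norm is the integral of \<open>g\<close> against one more difference of the quotient of order
  \<open>j - 1\<close>. Summation by parts moves that difference onto \<open>g\<close>, where the
  pointwise estimate applies; translation invariance removes the shifts.\<close>

lemma interpolation_step:
 assumes "0 < j" "j < m" "\<epsilon> > 0"
 obtains A where "A \<ge> 0" "\<And>L x0 R. \<exists>C\<ge>0. \<forall>h v f \<zeta>. 0 < h \<and> h \<le> 1 \<and> norm v \<le> 1 \<and>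
  cutoff L (x0::'a::euclidean_space) R \<zeta> \<and> borel_fun f \<and> (\<forall>x. \<bar>f x\<bar> \<le> 1) \<longrightarrow>
  wnorm_interp m j \<epsilon> A C \<zeta> h v f"
proof -
 obtain A where A: "A \<ge> 0" and pw: "\<And>L. L \<ge> 0 \<Longrightarrow> \<exists>C\<ge>0. \<forall>h z z' a b b'. interp_data j L h z z' a b b' \<longrightarrow>
   interp_bound m j \<epsilon> A C h z z' a b b'"
  using interpolation_pointwise[OF assms] by metis
 show thesis
 proof (rule that[OF A])
  fix L R :: real and x0 :: 'a
  define S where "S = cball x0 R"
  show "\<exists>C\<ge>0. \<forall>h v f \<zeta>. 0 < h \<and> h \<le> 1 \<and> norm v \<le> 1 \<and>
  cutoff L x0 R \<zeta> \<and> borel_fun f \<and> (\<forall>x. \<bar>f x\<bar> \<le> 1) \<longrightarrow>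
  wnorm_interp m j \<epsilon> A C \<zeta> h v f"
  proof (cases "L \<ge> 0")
   case False
   thus ?thesis by (intro exI[of _ 0]) (auto simp: cutoff_def)
  next
   case True
   obtain C where C: "C \<ge> 0" and pw': "\<And>h z z' a b b'. 0 < h \<Longrightarrow> h \<le> 1 \<Longrightarrow> 0 \<le> z \<Longrightarrow> 0 \<le> z' \<Longrightarrow>
   \<bar>z - z'\<bar> \<le> L * h \<Longrightarrow> (j = 1 \<longrightarrow> \<bar>a\<bar> \<le> 1) \<Longrightarrow> h * root (j - 1) \<bar>a\<bar> \<le> 2 \<Longrightarrow> h * root j \<bar>b\<bar> \<le> 2 \<Longrightarrow> h * root j \<bar>b'\<bar> \<le> 2 \<Longrightarrow>
   h * root (Suc j) \<bar>(b - b') / h\<bar> \<le> 2 \<Longrightarrow>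
   interp_bound m j \<epsilon> A C h z z' a b b'"
    using pw[OF True] by metis
   show ?thesis
   proof (intro exI[of _ "2 * C * measure lborel S"] conjI allI impI; (elim conjE)?)
    fix h :: real and v :: 'a and f \<zeta> :: "'a \<Rightarrow> real"
    assume h: "0 < h" "h \<le> 1" and v: "norm v \<le> 1" and c: "cutoff L x0 R \<zeta>"
     and f: "borel_fun f" "\<forall>x. \<bar>f x\<bar> \<le> 1"
    define F where "F i = (dquot h v ^^ i) f" for i
    define r where "r i x = root i \<bar>F i x\<bar>" for i x
    define g where "g x = \<zeta> x ^ (2 * m) * sroot m j (F j x)" for x
    define s where "s x = x - h *\<^sub>R v" for x :: 'a
    have Fm [measurable]: "borel_fun (F i)" for i
     unfolding F_def by (rule dquot_pow_measurable[OF f(1)])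
    have FS: "F (Suc i) = dquot h v (F i)" for i by (simp add: F_def)
    have Fb: "\<bar>F i x\<bar> \<le> (2 / h) ^ i" for i x
     using dquot_pow_bound[of h f 1 i v x] h f by (simp add: F_def)
    have rb: "h * r i x \<le> 2" for i x unfolding r_def F_def by (rule root_dquot_bound) (use h f in auto)
    have J: "wnorm m i \<zeta> h v f = (\<integral>x. (\<zeta> x * r i x) ^ (2 * m) \<partial>lborel)"
     and Ji: "integrable lborel (\<lambda>x. (\<zeta> x * r i x) ^ (2 * m))" for i
     using wnorm_integrable[OF c h(1) f(1), of m i v] f assms by (auto simp: wnorm_def r_def F_def)
    have cz: "0 \<le> \<zeta> x" "\<bar>\<zeta> x - \<zeta> y\<bar> \<le> L * dist x y" "x \<notin> S \<Longrightarrow> \<zeta> x = 0" for x y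
     using c by (auto simp: cutoff_def S_def)
    have sgm [measurable]: "borel_fun (\<lambda>x. sroot m j (F j x))"
     unfolding sroot_def by measurable
    have srb: "\<bar>sroot m j (F j x)\<bar> \<le> (2 / h) ^ (2 * m - j)" for x
    proof (rule order.trans[OF sroot_abs power_mono])
     show "root j \<bar>F j x\<bar> \<le> 2 / h" using rb[of j x] h by (simp add: r_def field_simps)
    qed (simp add: real_root_ge_zero)
    have gint: "integrable lborel g" unfolding g_def[abs_def]
     by (rule cutoff_power_integrable[OF c sgm srb]) (use assms in auto)
    have "wnorm m j \<zeta> h v f = (\<integral>x. g x * F j x \<partial>lborel)"
     unfolding J g_def mult.assoc using assms
     by (simp add: sroot_mult r_def power_mult_distrib)
    also have "\<dots> = (\<integral>x. g x * dquot h v (F (j - 1)) x \<partial>lborel)"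
     using FS[of "j - 1"] assms by simp
    also have "\<dots> = (\<integral>x. F (j - 1) x * ((g (s x) - g x) / h) \<partial>lborel)"
     unfolding s_def by (rule dquot_summation_by_parts(1)[OF Fm gint Fb])
    also have "\<dots> \<le> (\<integral>x. \<epsilon> * ((if j = 1 then 0 else (\<zeta> x * r (j - 1) x) ^ (2 * m)) + (\<zeta> x * r j x) ^ (2 * m) + (\<zeta> (s x) * r j (s x)) ^ (2 * m))
       + A * (\<zeta> (s x) * r (Suc j) (s x)) ^ (2 * m) + C * (indicator S x + indicator S (s x)) \<partial>lborel)"
    proof (rule integral_mono)
     show "integrable lborel (\<lambda>x. F (j - 1) x * ((g (s x) - g x) / h))"
      unfolding s_def by (rule dquot_summation_by_parts(3)[OF Fm gint Fb])
     have i1: "integrable lborel (\<lambda>x. (\<zeta> (s x) * r i (s x)) ^ (2 * m))" for i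
      using integrable_translate[OF Ji[of i], of "- h *\<^sub>R v"] by (simp add: s_def)
     have i2: "integrable lborel (indicator S :: 'a \<Rightarrow> real)"
      unfolding S_def by (intro integrable_indicator_bounded) auto
     have i3: "integrable lborel (\<lambda>x. indicator S (s x) :: real)"
      using integrable_translate[OF i2, of "- h *\<^sub>R v"] by (simp add: s_def)
     have i4: "integrable lborel (\<lambda>x. if j = 1 then 0 else (\<zeta> x * r (j - 1) x) ^ (2 * m))"
      by (cases "j = 1") (use Ji[of "j - 1"] in auto)
     show "integrable lborel (\<lambda>x. \<epsilon> * ((if j = 1 then 0 else (\<zeta> x * r (j - 1) x) ^ (2 * m)) + (\<zeta> x * r j x) ^ (2 * m) + (\<zeta> (s x) * r j (s x)) ^ (2 * m))
       + A * (\<zeta> (s x) * r (Suc j) (s x)) ^ (2 * m) + C * (indicator S x + indicator S (s x)))"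
      by (intro Bochner_Integration.integrable_add integrable_mult_right i1 i2 i3 i4 Ji)
     fix x
     have c': "(F j x - F j (s x)) / h = F (Suc j) (s x)" by (simp add: FS dquot_def s_def)
     have "F (j - 1) x * ((g (s x) - g x) / h) \<le> \<bar>F (j - 1) x\<bar> * \<bar>g (s x) - g x\<bar> / h"
      using h abs_ge_self[of "F (j - 1) x * ((g (s x) - g x) / h)"] by (simp add: abs_mult)
     also have "\<dots> \<le> \<epsilon> * ((\<zeta> x * root (j - 1) \<bar>F (j - 1) x\<bar>) ^ (2 * m) + (\<zeta> x * root j \<bar>F j x\<bar>) ^ (2 * m) + (\<zeta> (s x) * root j \<bar>F j (s x)\<bar>) ^ (2 * m))
      + A * (\<zeta> (s x) * root (Suc j) \<bar>(F j x - F j (s x)) / h\<bar>) ^ (2 * m)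
      + (if \<zeta> x > 0 \<or> \<zeta> (s x) > 0 then C else 0)"
      unfolding g_def
     proof (rule pw')
      have "dist x (s x) \<le> h" using v h by (simp add: s_def dist_norm mult_left_le)
      thus "\<bar>\<zeta> x - \<zeta> (s x)\<bar> \<le> L * h"
       using cz(2)[of x "s x"] mult_left_mono[of "dist x (s x)" h L] True by linarith
      show "h * root (Suc j) \<bar>(F j x - F j (s x)) / h\<bar> \<le> 2"
       unfolding c' using rb[of "Suc j" "s x"] by (simp only: r_def)
      show "j = 1 \<longrightarrow> \<bar>F (j - 1) x\<bar> \<le> 1" using f by (simp add: F_def)
     qed (use h cz rb in \<open>auto simp: r_def\<close>)
     also have "\<dots> \<le> \<epsilon> * ((if j = 1 then 0 else (\<zeta> x * r (j - 1) x) ^ (2 * m)) + (\<zeta> x * r j x) ^ (2 * m) + (\<zeta> (s x) * r j (s x)) ^ (2 * m))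
       + A * (\<zeta> (s x) * r (Suc j) (s x)) ^ (2 * m) + C * (indicator S x + indicator S (s x))"
     proof (intro add_mono)
      show "(if \<zeta> x > 0 \<or> \<zeta> (s x) > 0 then C else 0) \<le> C * (indicator S x + indicator S (s x))"
       using cz(3)[of x] cz(3)[of "s x"] C by (auto simp: indicator_def)
     qed (use assms in \<open>auto simp: r_def c' power_0_left\<close>)
     finally show "F (j - 1) x * ((g (s x) - g x) / h) \<le> \<dots>" .
    qed
    also have "\<dots> = \<epsilon> * ((if j = 1 then 0 else wnorm m (j - 1) \<zeta> h v f) + 2 * wnorm m j \<zeta> h v f)
      + A * wnorm m (Suc j) \<zeta> h v f + 2 * C * measure lborel S"
    proof -
     have i1: "integrable lborel (\<lambda>x. (\<zeta> (s x) * r i (s x)) ^ (2 * m))" for i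
      using integrable_translate[OF Ji[of i], of "- h *\<^sub>R v"] by (simp add: s_def)
     have i2: "integrable lborel (indicator S :: 'a \<Rightarrow> real)"
      unfolding S_def by (intro integrable_indicator_bounded) auto
     have i3: "integrable lborel (\<lambda>x. indicator S (s x) :: real)"
      using integrable_translate[OF i2, of "- h *\<^sub>R v"] by (simp add: s_def)
     have t1: "(\<integral>x. (\<zeta> (s x) * r i (s x)) ^ (2 * m) \<partial>lborel) = wnorm m i \<zeta> h v f" for i
      using integral_translate[OF borel_measurable_integrable[OF Ji[of i], unfolded measurable_lborel2], of "- h *\<^sub>R v"] by (simp add: s_def J)
     have t2: "(\<integral>x. indicator S (s x) \<partial>lborel) = measure lborel S"
      using integral_translate[of "indicator S :: 'a \<Rightarrow> real" "- h *\<^sub>R v"] by (simp add: s_def S_def)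
     have i4: "integrable lborel (\<lambda>x. if j = 1 then 0 else (\<zeta> x * r (j - 1) x) ^ (2 * m))"
      by (cases "j = 1") (use Ji[of "j - 1"] in auto)
     have t3: "(\<integral>x. (if j = 1 then 0 else (\<zeta> x * r (j - 1) x) ^ (2 * m)) \<partial>lborel) =
       (if j = 1 then 0 else wnorm m (j - 1) \<zeta> h v f)"
      by (cases "j = 1") (auto simp: J)
     have t4: "(\<integral>x. indicator S x \<partial>lborel) = measure lborel S" by (simp add: S_def)
     show ?thesis
      unfolding integral_combination[OF i4 Ji i1 i1 i2 i3] t1 t2 t3 t4 by (simp add: J algebra_simps)
    qed
    finally show "wnorm_interp m j \<epsilon> A (2 * C * measure lborel S) \<zeta> h v f" .
   qed (use C in simp)
  qed
 qed
qed

definition admissible :: "real \<Rightarrow> 'a::euclidean_space \<Rightarrow> real \<Rightarrow> real \<Rightarrow> 'a \<Rightarrow> ('a \<Rightarrow> real) \<Rightarrow> ('a \<Rightarrow> real) \<Rightarrow> bool"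
 where "admissible L x0 R h v f \<zeta> \<longleftrightarrow> 0 < h \<and> h \<le> 1 \<and> norm v \<le> 1 \<and>
  cutoff L x0 R \<zeta> \<and> borel_fun f \<and> (\<forall>x. \<bar>f x\<bar> \<le> 1)"

text \<open>Order \<open>j - 1\<close> is already bounded by order \<open>j\<close>, so in the
  interpolation step all terms with the small factor are multiples of the left side, up to
  constants, and can be absorbed. At the lowest order the missing term is 0.\<close>

lemma interpolation_next:
 assumes "0 < j" "j < m"
 shows "\<exists>A\<ge>0. \<forall>L (x0::'a::euclidean_space) R. \<exists>C\<ge>0. \<forall>h v f \<zeta>. admissible L x0 R h v f \<zeta> \<longrightarrow>
  wnorm m j \<zeta> h v f \<le> A * wnorm m (Suc j) \<zeta> h v f + C"
 using assms
proof (induction j)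
 case (Suc j)
 let ?W = "\<lambda>i \<zeta> h v f. wnorm m i \<zeta> h (v::'a) f"
 have "\<exists>B\<ge>0. \<forall>L (x0::'a) R. \<exists>C\<ge>0. \<forall>h v f \<zeta>. admissible L x0 R h v f \<zeta> \<longrightarrow>
  (if Suc j = 1 then 0 else ?W j \<zeta> h v f) \<le> B * ?W (Suc j) \<zeta> h v f + C"
 proof (cases "j = 0")
  case True
  show ?thesis by (rule exI[of _ 0]) (use True in auto)
 next
  case False
  thus ?thesis using Suc by simp
 qed
 then obtain B where B: "B \<ge> 0" "\<And>L (x0::'a) R. \<exists>C\<ge>0. \<forall>h v f \<zeta>. admissible L x0 R h v f \<zeta> \<longrightarrow>
  (if Suc j = 1 then 0 else ?W j \<zeta> h v f) \<le> B * ?W (Suc j) \<zeta> h v f + C" by blast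
 \<comment> \<open>The terms to be absorbed add up to \<open>e * (B + 2)\<close> times the left
   side; this choice makes the factor one half.\<close>
 define e where "e = 1 / (2 * (B + 2))"
 have e: "e > 0" "e * (B + 2) = 1 / 2" using B(1) by (auto simp: e_def field_simps)
 have sj: "0 < Suc j" "Suc j < m" using Suc by auto
 obtain A where A: "A \<ge> 0" and step: "\<And>L (x0::'a) R. \<exists>C\<ge>0. \<forall>h v f \<zeta>. 0 < h \<and> h \<le> 1 \<and> norm v \<le> 1 \<and>
  cutoff L x0 R \<zeta> \<and> borel_fun f \<and> (\<forall>x. \<bar>f x\<bar> \<le> 1) \<longrightarrow>
  ?W (Suc j) \<zeta> h v f \<le> e * ((if Suc j = 1 then 0 else ?W (Suc j - 1) \<zeta> h v f) + 2 * ?W (Suc j) \<zeta> h v f)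
   + A * ?W (Suc (Suc j)) \<zeta> h v f + C"
  using interpolation_step[OF sj e(1)] by metis
 show ?case
 proof (rule exI[of _ "2 * A"], intro conjI allI)
  fix L R :: real and x0 :: 'a
  obtain C1 where C1: "C1 \<ge> 0" "\<And>h v f \<zeta>. admissible L x0 R h v f \<zeta> \<Longrightarrow>
  (if Suc j = 1 then 0 else ?W j \<zeta> h v f) \<le> B * ?W (Suc j) \<zeta> h v f + C1" using B(2) by blast
  obtain C2 where C2: "C2 \<ge> 0" "\<And>h v f \<zeta>. admissible L x0 R h v f \<zeta> \<Longrightarrow>
   ?W (Suc j) \<zeta> h v f \<le> e * ((if Suc j = 1 then 0 else ?W j \<zeta> h v f) + 2 * ?W (Suc j) \<zeta> h v f)
   + A * ?W (Suc (Suc j)) \<zeta> h v f + C2" using step[of L x0 R] unfolding admissible_def diff_Suc_1 by blast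
  have "?W (Suc j) \<zeta> h v f \<le> 2 * A * ?W (Suc (Suc j)) \<zeta> h v f + 2 * (e * C1 + C2)"
   if ad: "admissible L x0 R h v f \<zeta>" for h v f \<zeta>
  proof -
   have "?W (Suc j) \<zeta> h v f \<le> e * ((B * ?W (Suc j) \<zeta> h v f + C1) + 2 * ?W (Suc j) \<zeta> h v f) + A * ?W (Suc (Suc j)) \<zeta> h v f + C2"
    by (rule order.trans[OF C2(2)[OF ad]]) (intro add_mono mult_left_mono C1(2)[OF ad] order_refl less_imp_le[OF e(1)])
   also have "\<dots> = (e * (B + 2)) * ?W (Suc j) \<zeta> h v f + e * C1 + A * ?W (Suc (Suc j)) \<zeta> h v f + C2"
    by (simp only: algebra_simps)
   finally show ?thesis unfolding e(2) by simp
  qed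
  moreover have "2 * (e * C1 + C2) \<ge> 0" using e C1 C2 by simp
  ultimately show "\<exists>C\<ge>0. \<forall>h v f \<zeta>. admissible L x0 R h v f \<zeta> \<longrightarrow>
   ?W (Suc j) \<zeta> h v f \<le> 2 * A * ?W (Suc (Suc j)) \<zeta> h v f + C" by blast
 qed (use A in simp)
qed simp

text \<open>Gagliardo--Nirenberg interpolation between the sup norm and the top order. The constant
 \<open>A\<close> of the leading term does not depend on the cutoff.\<close>

theorem interpolation:
 assumes "0 < j" "j \<le> m"
 shows "\<exists>A\<ge>0. \<forall>L (x0::'a::euclidean_space) R. \<exists>C\<ge>0. \<forall>h v f \<zeta>. admissible L x0 R h v f \<zeta> \<longrightarrow>
  wnorm m j \<zeta> h v f \<le> A * wnorm m m \<zeta> h v f + C"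
 using assms(2,1)
proof (induction rule: inc_induct)
 case base
 show ?case by (rule exI[of _ 1]) auto
next
 case (step j)
 then obtain A where A: "A \<ge> 0" "\<And>L (x0::'a) R. \<exists>C\<ge>0. \<forall>h v f \<zeta>. admissible L x0 R h v f \<zeta> \<longrightarrow>
  wnorm m (Suc j) \<zeta> h v f \<le> A * wnorm m m \<zeta> h v f + C" by auto
 obtain B where B: "B \<ge> 0" "\<And>L (x0::'a) R. \<exists>C\<ge>0. \<forall>h v f \<zeta>. admissible L x0 R h v f \<zeta> \<longrightarrow>
  wnorm m j \<zeta> h v f \<le> B * wnorm m (Suc j) \<zeta> h v f + C"
  using interpolation_next[of j m] step by blast
 show ?case
 proof (rule exI[of _ "B * A"], intro conjI allI)
  fix L R :: real and x0 :: 'a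
  obtain C1 where C1: "C1 \<ge> 0" "\<And>h v f \<zeta>. admissible L x0 R h v f \<zeta> \<Longrightarrow>
  wnorm m (Suc j) \<zeta> h v f \<le> A * wnorm m m \<zeta> h v f + C1" using A(2) by blast
  obtain C2 where C2: "C2 \<ge> 0" "\<And>h v f \<zeta>. admissible L x0 R h v f \<zeta> \<Longrightarrow>
   wnorm m j \<zeta> h v f \<le> B * wnorm m (Suc j) \<zeta> h v f + C2" using B(2) by blast
  have "wnorm m j \<zeta> h v f \<le> B * A * wnorm m m \<zeta> h v f + (B * C1 + C2)"
   if ad: "admissible L x0 R h v f \<zeta>" for h v f \<zeta>
   using C2(2)[OF ad] mult_left_mono[OF C1(2)[OF ad] B(1)] by (simp add: algebra_simps)
  moreover have "B * C1 + C2 \<ge> 0" using B C1 C2 by simp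
  ultimately show "\<exists>C\<ge>0. \<forall>h v f \<zeta>. admissible L x0 R h v f \<zeta> \<longrightarrow>
   wnorm m j \<zeta> h v f \<le> B * A * wnorm m m \<zeta> h v f + C" by blast
 qed (use A B in simp)
qed

text \<open>Translating the integrand is harmless if the weight is moved along: the Lipschitz bound
  replaces \<zeta> at \<open>x\<close> by its value at \<open>x + y\<close> at cost
  \<open>L * S * h\<close>, and the power \<open>h ^ q\<close> so gained is paired with the
  scale-invariant bound \<open>G\<close>.\<close>

lemma cutoff_shift:
 assumes c: "cutoff L x0 R \<zeta>" and S: "S \<ge> 0" "norm y \<le> S * h" "h > 0"
  and g: "\<And>x. g x \<ge> 0" "\<And>x. x \<in> cball x0 R \<Longrightarrow> h ^ q * g (x + y) \<le> G"
  and int: "integrable lborel (\<lambda>x. \<zeta> x ^ q * g x)" "integrable lborel (\<lambda>x. \<zeta> x ^ q * g (x + y))" and q: "q > 0"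
 shows "wint q \<zeta> (\<lambda>x. g (x + y)) \<le> 2 ^ q * wint q \<zeta> (\<lambda>x. g x)
  + 2 ^ q * (L * S) ^ q * G * vol x0 R"
proof -
 let ?I = "indicator (cball x0 R) :: 'a \<Rightarrow> real"
 have cz: "0 \<le> \<zeta> x" "\<bar>\<zeta> x - \<zeta> y\<bar> \<le> L * dist x y" "x \<notin> cball x0 R \<Longrightarrow> \<zeta> x = 0" "L \<ge> 0" for x y
  using c by (auto simp: cutoff_def)
 have i: "integrable lborel (\<lambda>x. \<zeta> (x + y) ^ q * g (x + y))" using integrable_translate[OF int(1), of y] by simp
 have iI: "integrable lborel ?I" by (rule integrable_indicator_bounded) auto
 have "wint q \<zeta> (\<lambda>x. g (x + y)) \<le> (\<integral>x. 2 ^ q * (\<zeta> (x + y) ^ q * g (x + y)) + (2 ^ q * (L * S) ^ q * G) * ?I x \<partial>lborel)"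
 proof (rule integral_mono)
  show "integrable lborel (\<lambda>x. 2 ^ q * (\<zeta> (x + y) ^ q * g (x + y)) + (2 ^ q * (L * S) ^ q * G) * ?I x)"
   using i iI by auto
  fix x
  show "\<zeta> x ^ q * g (x + y) \<le> 2 ^ q * (\<zeta> (x + y) ^ q * g (x + y)) + (2 ^ q * (L * S) ^ q * G) * ?I x"
  proof (cases "x \<in> cball x0 R")
   case True
   have "dist x (x + y) = norm y" by (simp add: dist_norm)
   hence "\<zeta> x \<le> \<zeta> (x + y) + L * norm y" using cz(2)[of x "x + y"] by auto
   also have "\<dots> \<le> \<zeta> (x + y) + L * S * h" using mult_left_mono[OF S(2) cz(4)] by simp
   finally have "\<zeta> x ^ q \<le> (\<zeta> (x + y) + L * S * h) ^ q" using cz(1) by (intro power_mono)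
   also have "\<dots> \<le> 2 ^ q * (\<zeta> (x + y) ^ q + (L * S * h) ^ q)"
    using cz S by (intro power_add_bound) auto
   finally have "\<zeta> x ^ q * g (x + y) \<le> 2 ^ q * (\<zeta> (x + y) ^ q + (L * S * h) ^ q) * g (x + y)"
    using g(1) by (intro mult_right_mono)
   also have "\<dots> = 2 ^ q * (\<zeta> (x + y) ^ q * g (x + y)) + 2 ^ q * (L * S) ^ q * (h ^ q * g (x + y))"
    by (simp add: algebra_simps power_mult_distrib)
   also have "\<dots> \<le> 2 ^ q * (\<zeta> (x + y) ^ q * g (x + y)) + 2 ^ q * (L * S) ^ q * G"
    using g(2)[OF True] cz S by (intro add_left_mono mult_left_mono) auto
   finally show ?thesis using True by simp
  next
   case False
   thus ?thesis using cz(1)[of "x + y"] cz(3)[of x] g(1)[of "x + y"] q by (simp add: power_0_left)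
  qed
 qed (rule int)
 also have "\<dots> = 2 ^ q * (\<integral>x. \<zeta> (x + y) ^ q * g (x + y) \<partial>lborel) + (2 ^ q * (L * S) ^ q * G) * vol x0 R"
  using i iI by simp
 also have "(\<integral>x. \<zeta> (x + y) ^ q * g (x + y) \<partial>lborel) = wint q \<zeta> (\<lambda>x. g x)"
  using integral_translate[of "\<lambda>x. \<zeta> x ^ q * g x" y] int(1) by auto
 finally show ?thesis .
qed


section \<open>Differences of a composition\<close>

lemma fdiff_pow_Suc: "(fdiff v ^^ Suc j) f = (fdiff v ^^ j) (fdiff v f)"
 by (simp add: funpow_swap1)

lemma fdiff_pow_shift:
 fixes f :: "'a::ab_semigroup_add \<Rightarrow> real"
 shows "(fdiff v ^^ j) (\<lambda>k. f (k + a)) = (\<lambda>k. (fdiff v ^^ j) f (k + a))"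
 by (induction j) (auto simp: fdiff_def fun_eq_iff ac_simps)

lemma fdiff_pow_add:
 fixes f g :: "'a::plus \<Rightarrow> real"
 shows "(fdiff v ^^ j) (\<lambda>k. f k + g k) = (\<lambda>k. (fdiff v ^^ j) f k + (fdiff v ^^ j) g k)"
 by (induction j) (auto simp: fdiff_def fun_eq_iff)

lemma fdiff_pow_cmult:
 fixes f :: "'a::plus \<Rightarrow> real"
 shows "(fdiff v ^^ j) (\<lambda>k. c * f k) = (\<lambda>k. c * (fdiff v ^^ j) f k)"
 by (induction j) (auto simp: fdiff_def fun_eq_iff algebra_simps)

lemma fdiff_pow_sum:
 fixes f :: "'i \<Rightarrow> 'a::plus \<Rightarrow> real"
 shows "(fdiff v ^^ j) (\<lambda>k. \<Sum>i\<in>I. f i k) = (\<lambda>k. \<Sum>i\<in>I. (fdiff v ^^ j) (f i) k)"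
 by (induction j) (auto simp: fdiff_def fun_eq_iff sum_subtractf)

lemma fdiff_pow_const:
 "(fdiff v ^^ Suc j) (\<lambda>k. c::real) = (\<lambda>k. 0)"
 by (induction j) (auto simp: fdiff_def fun_eq_iff)

text \<open>A difference of order \<open>i\<close> at \<open>k\<close> uses the terms k, ..., k + i,
  so the triangle \<open>i + k \<le> n\<close> concerns terms up to index \<open>n\<close> only. The
  geometric weight \<open>Y ^ i\<close> is compatible with products.\<close>

definition diff_bounded :: "nat \<Rightarrow> real \<Rightarrow> real \<Rightarrow> (nat \<Rightarrow> real) \<Rightarrow> bool"
 where "diff_bounded n A Y a \<longleftrightarrow> (\<forall>i k. i + k \<le> n \<longrightarrow> \<bar>(fdiff 1 ^^ i) a k\<bar> \<le> A * Y ^ i)"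

lemma diff_bounded_fdiff:
 "diff_bounded (Suc n) A Y a \<Longrightarrow> diff_bounded n (A * Y) Y (fdiff 1 a)"
 unfolding diff_bounded_def
proof (intro allI impI)
 fix i k assume *: "\<forall>i k. i + k \<le> Suc n \<longrightarrow> \<bar>(fdiff 1 ^^ i) a k\<bar> \<le> A * Y ^ i" "i + k \<le> n"
 hence "\<bar>(fdiff 1 ^^ Suc i) a k\<bar> \<le> A * Y ^ Suc i" by (auto dest!: spec[of _ "Suc i"] simp del: funpow.simps power_Suc)
 thus "\<bar>(fdiff 1 ^^ i) (fdiff 1 a) k\<bar> \<le> A * Y * Y ^ i"
  unfolding fdiff_pow_Suc by (simp add: mult.assoc)
qed

lemma diff_bounded_shift:
 "diff_bounded (Suc n) A Y a \<Longrightarrow> diff_bounded n A Y (\<lambda>k. a (k + 1))"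
 unfolding diff_bounded_def fdiff_pow_shift by auto

lemma diff_bounded_mono: "diff_bounded n A Y a \<Longrightarrow> m \<le> n \<Longrightarrow> diff_bounded m A Y a"
 unfolding diff_bounded_def by (meson le_trans)

text \<open>Discrete Leibniz rule: one factor is differenced at a time, the other being shifted or
  left alone. Each order doubles the number of terms, and every term keeps the total weight
  \<open>Y ^ i\<close>.\<close>

lemma diff_bounded_mult:
 assumes "diff_bounded n A Y a" "diff_bounded n B Y b" "i + k \<le> n" "A \<ge> 0" "B \<ge> 0" "Y \<ge> 0"
 shows "\<bar>(fdiff 1 ^^ i) (\<lambda>k. a k * b k) k\<bar> \<le> 2 ^ i * (A * B) * Y ^ i"
 using assms
proof (induction i arbitrary: a b A B n)
 case 0
 hence "\<bar>a k\<bar> \<le> A" "\<bar>b k\<bar> \<le> B" unfolding diff_bounded_def by (force dest: spec[of _ 0])+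
 thus ?case using 0 by (simp add: abs_mult mult_mono)
next
 case (Suc i)
 then obtain n' where n: "n = Suc n'" "i + k \<le> n'" by (cases n) auto
 have eq: "fdiff 1 (\<lambda>k. a k * b k) = (\<lambda>k. fdiff 1 a k * b (k + 1) + a k * fdiff 1 b k)"
  by (auto simp: fdiff_def algebra_simps)
 have "(fdiff 1 ^^ Suc i) (\<lambda>k. a k * b k) k
  = (fdiff 1 ^^ i) (\<lambda>k. fdiff 1 a k * b (k + 1)) k + (fdiff 1 ^^ i) (\<lambda>k. a k * fdiff 1 b k) k"
  unfolding fdiff_pow_Suc eq fdiff_pow_add by simp
 also have "\<bar>\<dots>\<bar> \<le> 2 ^ i * (A * Y * B) * Y ^ i + 2 ^ i * (A * (B * Y)) * Y ^ i"
 proof (intro order.trans[OF abs_triangle_ineq] add_mono)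
  show "\<bar>(fdiff 1 ^^ i) (\<lambda>k. fdiff 1 a k * b (k + 1)) k\<bar> \<le> 2 ^ i * (A * Y * B) * Y ^ i"
   by (rule Suc.IH[of n']) (use Suc.prems n diff_bounded_fdiff diff_bounded_shift in auto)
  show "\<bar>(fdiff 1 ^^ i) (\<lambda>k. a k * fdiff 1 b k) k\<bar> \<le> 2 ^ i * (A * (B * Y)) * Y ^ i"
   by (rule Suc.IH[of n']) (use Suc.prems n diff_bounded_fdiff diff_bounded_mono[of n A Y a n'] in auto)
 qed
 finally show ?case by (simp add: mult.commute mult.left_commute)
qed

lemma fdiff_pow_integral:
 fixes \<phi> :: "nat \<Rightarrow> real \<Rightarrow> real"
 assumes "\<And>k. continuous_on {0..1} (\<phi> k)"
 shows "continuous_on {0..1} (\<lambda>t. (fdiff 1 ^^ i) (\<lambda>k. \<phi> k t) k)"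
  and "(fdiff 1 ^^ i) (\<lambda>k. integral {0..1} (\<phi> k)) k = integral {0..1} (\<lambda>t. (fdiff 1 ^^ i) (\<lambda>k. \<phi> k t) k)"
proof -
 have *: "continuous_on {0..1} (\<lambda>t. (fdiff 1 ^^ i) (\<lambda>k. \<phi> k t) k) \<and>
  (fdiff 1 ^^ i) (\<lambda>k. integral {0..1} (\<phi> k)) k = integral {0..1} (\<lambda>t. (fdiff 1 ^^ i) (\<lambda>k. \<phi> k t) k)"
 proof (induction i arbitrary: k)
  case 0
  thus ?case using assms by simp
 next
  case (Suc i)
  have S: "(fdiff 1 ^^ Suc i) f k = (fdiff 1 ^^ i) f (k + 1) - (fdiff 1 ^^ i) f k" for f :: "nat \<Rightarrow> real"
   by (simp add: fdiff_def)
  show ?case unfolding S using Suc[of k] Suc[of "k + 1"]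
   by (auto intro!: continuous_on_diff simp: integrable_continuous_interval integral_diff)
 qed
 thus "continuous_on {0..1} (\<lambda>t. (fdiff 1 ^^ i) (\<lambda>k. \<phi> k t) k)"
  "(fdiff 1 ^^ i) (\<lambda>k. integral {0..1} (\<phi> k)) k = integral {0..1} (\<lambda>t. (fdiff 1 ^^ i) (\<lambda>k. \<phi> k t) k)"
  by auto
qed

text \<open>\<open>U\<close> is open, so that derivatives in all directions make sense;
  \<open>K0\<close> is the set in which values actually lie. Its convexity keeps segments between
  values inside, and boundedness of each derivative on it takes the place of compactness.\<close>

locale bounded_smooth =
 fixes U K0 :: "'e::euclidean_space set" and F :: "'e \<Rightarrow> real"
 assumes U: "open U" "K0 \<subseteq> U" "convex K0" and F: "smooth_on U F"
  and bdd: "\<And>vs. \<exists>C. \<forall>\<xi>\<in>K0. \<bar>iter_dderiv vs F \<xi>\<bar> \<le> C"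
begin

definition bound :: "'e list \<Rightarrow> real"
 where "bound vs = (SOME C. C \<ge> 0 \<and> (\<forall>\<xi>\<in>K0. \<bar>iter_dderiv vs F \<xi>\<bar> \<le> C))"

lemma bound: "bound vs \<ge> 0" "\<xi> \<in> K0 \<Longrightarrow> \<bar>iter_dderiv vs F \<xi>\<bar> \<le> bound vs"
proof -
 obtain C where "\<forall>\<xi>\<in>K0. \<bar>iter_dderiv vs F \<xi>\<bar> \<le> C" using bdd by blast
 hence "\<exists>C. C \<ge> 0 \<and> (\<forall>\<xi>\<in>K0. \<bar>iter_dderiv vs F \<xi>\<bar> \<le> C)"
  by (intro exI[of _ "max C 0"]) (auto simp: le_max_iff_disj)
 from someI_ex[OF this] show "bound vs \<ge> 0" "\<xi> \<in> K0 \<Longrightarrow> \<bar>iter_dderiv vs F \<xi>\<bar> \<le> bound vs"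
  unfolding bound_def by auto
qed

lemma cont: "continuous_on U (iter_dderiv vs F)"
 and diff: "x \<in> U \<Longrightarrow> (\<lambda>s. iter_dderiv vs F (x + s *\<^sub>R v)) field_differentiable at 0"
 using F by (auto simp: smooth_along_def)

lemma dderiv_expand: "x \<in> U \<Longrightarrow> dderiv v (iter_dderiv vs F) x = (\<Sum>b\<in>Basis. (v \<bullet> b) * iter_dderiv (b # vs) F x)"
 using dderiv_Basis[OF U(1), of x "iter_dderiv vs F" v] cont[of "_ # vs"] diff by simp

declare iter_dderiv_Cons [simp del] One_nat_def [simp del]

lemma segment_in:
 assumes "x \<in> K0" "y \<in> K0" "0 \<le> t" "t \<le> 1"
 shows "x + t *\<^sub>R (y - x) \<in> K0"
proof -
 have "(1 - t) *\<^sub>R x + t *\<^sub>R y \<in> K0" using assms U(3) by (simp add: convex_alt)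
 thus ?thesis by (simp add: algebra_simps)
qed

lemma cont_segment:
 assumes "x \<in> K0" "y \<in> K0"
 shows "continuous_on {0..1} (\<lambda>t. iter_dderiv vs F (x + t *\<^sub>R (y - x)))"
 by (rule continuous_on_compose2[OF cont]) (use segment_in[OF assms] U(2) in \<open>auto intro!: continuous_intros\<close>)

text \<open>Integrating the derivative along the segment represents an increment as averaged partial
  derivatives times increments of the argument, a product to which the discrete Leibniz rule
  applies.\<close>

lemma increment_integral:
 assumes "x \<in> K0" "y \<in> K0"
 shows "iter_dderiv vs F y - iter_dderiv vs F x
  = (\<Sum>b\<in>Basis. integral {0..1} (\<lambda>t. iter_dderiv (b # vs) F (x + t *\<^sub>R (y - x))) * ((y - x) \<bullet> b))"
proof -
 let ?g = "\<lambda>t. \<Sum>b\<in>Basis. ((y - x) \<bullet> b) * iter_dderiv (b # vs) F (x + t *\<^sub>R (y - x))"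
 have "(?g has_integral (iter_dderiv vs F (x + 1 *\<^sub>R (y - x)) - iter_dderiv vs F (x + 0 *\<^sub>R (y - x)))) {0..1}"
 proof (rule fundamental_theorem_of_calculus)
  fix t :: real assume "t \<in> {0..1}"
  hence in_U: "x + t *\<^sub>R (y - x) \<in> U" using segment_in[OF assms] U(2) by auto
  have "((\<lambda>t. iter_dderiv vs F (x + t *\<^sub>R (y - x))) has_real_derivative dderiv (y - x) (iter_dderiv vs F) (x + t *\<^sub>R (y - x))) (at t)"
   by (rule line_derivative[OF diff[OF in_U]])
  thus "((\<lambda>t. iter_dderiv vs F (x + t *\<^sub>R (y - x))) has_vector_derivative ?g t) (at t within {0..1})"
   unfolding dderiv_expand[OF in_U]
   by (simp add: has_real_derivative_iff_has_vector_derivative has_vector_derivative_at_within)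
 qed simp
 hence "iter_dderiv vs F y - iter_dderiv vs F x = integral {0..1} ?g" by (simp add: integral_unique)
 also have "\<dots> = (\<Sum>b\<in>Basis. integral {0..1} (\<lambda>t. ((y - x) \<bullet> b) * iter_dderiv (b # vs) F (x + t *\<^sub>R (y - x))))"
  by (intro integral_sum integrable_continuous_interval continuous_on_mult continuous_on_const cont_segment assms) auto
 also have "\<dots> = (\<Sum>b\<in>Basis. integral {0..1} (\<lambda>t. iter_dderiv (b # vs) F (x + t *\<^sub>R (y - x))) * ((y - x) \<bullet> b))"
  by (simp add: mult.commute)
 finally show ?thesis .
qed

lemma increment_bound:
 assumes "x \<in> K0" "y \<in> K0"
 shows "\<bar>iter_dderiv vs F y - iter_dderiv vs F x\<bar> \<le> (\<Sum>b\<in>Basis. bound (b # vs)) * norm (y - x)"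
proof -
 have *: "norm (integral {0..1} (\<lambda>t. iter_dderiv (b # vs) F (x + t *\<^sub>R (y - x)))) \<le> bound (b # vs) * (1 - 0)" for b
  by (rule integral_bound[OF _ cont_segment[OF assms]]) (auto simp del: iter_dderiv_Cons intro!: bound(2) segment_in assms)
 have "\<bar>iter_dderiv vs F y - iter_dderiv vs F x\<bar> \<le> (\<Sum>b\<in>Basis. bound (b # vs) * norm (y - x))"
  unfolding increment_integral[OF assms]
 proof (rule order.trans[OF sum_abs sum_mono])
  fix b :: 'e assume "b \<in> Basis"
  thus "\<bar>integral {0..1} (\<lambda>t. iter_dderiv (b # vs) F (x + t *\<^sub>R (y - x))) * ((y - x) \<bullet> b)\<bar> \<le> bound (b # vs) * norm (y - x)"
   using *[of b] Basis_le_norm[of b "y - x"] bound(1) unfolding abs_mult by (intro mult_mono) auto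
 qed
 thus ?thesis by (simp add: sum_distrib_right)
qed

text \<open>\<open>Y\<^sup>i\<close> controls the \<open>i\<close>-th differences, so every term of the Faa di Bruno expansion with at
 least two factors carries the weight \<open>\<omega>\<^sup>2 Y\<^sup>j\<close>.\<close>

definition admissible_seq :: "nat \<Rightarrow> real \<Rightarrow> real \<Rightarrow> 'e set \<Rightarrow> (nat \<Rightarrow> 'e) \<Rightarrow> bool"
 where "admissible_seq j \<omega> Y K X \<longleftrightarrow> 0 \<le> \<omega> \<and> \<omega> \<le> 1 \<and> 0 \<le> Y \<and> K \<subseteq> K0 \<and> convex K \<and>
  (\<forall>\<xi>\<in>K. \<forall>\<eta>\<in>K. norm (\<xi> - \<eta>) \<le> \<omega>) \<and> (\<forall>k. X k \<in> K) \<and>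
  (\<forall>b\<in>Basis. \<forall>i k. 1 \<le> i \<longrightarrow> i + k \<le> j \<longrightarrow> \<bar>(fdiff 1 ^^ i) (\<lambda>k. X k \<bullet> b) k\<bar> \<le> \<omega> * Y ^ i)"

abbreviation chain_error :: "nat \<Rightarrow> 'e list \<Rightarrow> ('e \<Rightarrow> real) \<Rightarrow> (nat \<Rightarrow> 'e) \<Rightarrow> real"
 where "chain_error j vs G X \<equiv> (fdiff 1 ^^ j) (\<lambda>k. iter_dderiv vs G (X k)) 0
  - (\<Sum>b\<in>Basis. iter_dderiv (b # vs) G (X 0) * (fdiff 1 ^^ j) (\<lambda>k. X k \<bullet> b) 0)"

text \<open>One difference of the composition is a sum of averaged partial derivatives
  \<open>a b\<close> times \<open>dX b\<close>. Subtracting the partial derivative at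
  \<open>X 0\<close> leaves a factor whose differences are of size \<omega>: order 0 by the diameter
  of \<open>K\<close>, positive orders by the induction hypothesis. The factor \<open>dX b\<close>
  is of size \<omega> as well, so the product is quadratic, while the subtracted part is the linear
  term in \<open>chain_error\<close>.\<close>

lemma composition_step:
 assumes IH: "\<And>i vs. 0 < i \<Longrightarrow> i < j \<Longrightarrow> \<exists>C\<ge>0. \<forall>X \<omega> Y K. admissible_seq i \<omega> Y K X \<longrightarrow>
   \<bar>(fdiff 1 ^^ i) (\<lambda>k. iter_dderiv vs F (X k)) 0\<bar> \<le> C * \<omega> * Y ^ i"
  and "0 < j"
 shows "\<exists>C\<ge>0. \<forall>X \<omega> Y K. admissible_seq j \<omega> Y K X \<longrightarrow>
   \<bar>chain_error j vs F X\<bar> \<le> C * \<omega>\<^sup>2 * Y ^ j"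
proof -
 obtain n where j: "j = Suc n" using \<open>0 < j\<close> by (cases j) auto
 define P where "P i b C \<longleftrightarrow> C \<ge> 0 \<and> (\<forall>X \<omega> Y K. admissible_seq i \<omega> Y K X \<longrightarrow>
   \<bar>(fdiff 1 ^^ i) (\<lambda>k. iter_dderiv (b # vs) F (X k)) 0\<bar> \<le> C * \<omega> * Y ^ i)" for i b C
 define c where "c i b = (SOME C. P i b C)" for i b
 have P: "P i b (c i b)" if "0 < i" "i < j" for i b
  unfolding c_def by (rule someI_ex) (unfold P_def, rule IH[OF that])
 have c: "\<And>i b. 0 < i \<Longrightarrow> i < j \<Longrightarrow> c i b \<ge> 0"
  "\<And>i b X \<omega> Y K. 0 < i \<Longrightarrow> i < j \<Longrightarrow> admissible_seq i \<omega> Y K X \<Longrightarrow>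
   \<bar>(fdiff 1 ^^ i) (\<lambda>k. iter_dderiv (b # vs) F (X k)) 0\<bar> \<le> c i b * \<omega> * Y ^ i"
  using P unfolding P_def by blast+
 define D where "D b = (\<Sum>b'\<in>Basis. bound (b' # b # vs)) + (\<Sum>i\<in>{0<..<j}. c i b)" for b
 have D0: "D b \<ge> 0" for b unfolding D_def using bound(1) c(1) by (intro add_nonneg_nonneg sum_nonneg) auto
 show ?thesis
 proof (intro exI[of _ "\<Sum>b\<in>Basis. 2 ^ n * D b"] conjI allI impI)
  fix X \<omega> Y K assume ad: "admissible_seq j \<omega> Y K X"
  hence \<omega>: "0 \<le> \<omega>" "\<omega> \<le> 1" "0 \<le> Y" and K: "K \<subseteq> K0" "convex K" "\<And>\<xi> \<eta>. \<xi> \<in> K \<Longrightarrow> \<eta> \<in> K \<Longrightarrow> norm (\<xi> - \<eta>) \<le> \<omega>"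
   and X: "\<And>k. X k \<in> K" and Xd: "\<And>b i k. b \<in> Basis \<Longrightarrow> 1 \<le> i \<Longrightarrow> i + k \<le> j \<Longrightarrow> \<bar>(fdiff 1 ^^ i) (\<lambda>k. X k \<bullet> b) k\<bar> \<le> \<omega> * Y ^ i"
   unfolding admissible_seq_def by auto
  have XK0: "X k \<in> K0" for k using X K by blast
  define Xt where "Xt t k = X k + t *\<^sub>R (X (k + 1) - X k)" for t k
  define \<phi> where "\<phi> b k t = iter_dderiv (b # vs) F (Xt t k)" for b k t
  define a where "a b k = integral {0..1} (\<phi> b k)" for b k
  define G0 where "G0 b = iter_dderiv (b # vs) F (X 0)" for b
  define dX where "dX b = fdiff 1 (\<lambda>k. X k \<bullet> b)" for b
  have XtK: "Xt t k \<in> K" if "t \<in> {0..1}" for t k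
  proof -
   have "(1 - t) *\<^sub>R X k + t *\<^sub>R X (k + 1) \<in> K" using K(2) X that by (auto simp: convex_alt)
   thus ?thesis by (simp add: Xt_def algebra_simps)
  qed
  have \<phi>c: "continuous_on {0..1} (\<phi> b k)" for b k
   unfolding \<phi>_def Xt_def by (rule cont_segment[OF XK0 XK0])
  \<comment> \<open>Points interpolated between neighbours stay in the convex set \<open>K\<close>
    and obey the same difference bounds. The price is one node: the interpolated sequence is
    admissible up to \<open>n\<close> and not up to \<open>j\<close>.\<close>
  have ad_t: "admissible_seq i \<omega> Y K (\<lambda>k'. Xt t (k' + k))" if "t \<in> {0..1}" "i + k \<le> n" for t i k
   unfolding admissible_seq_def
  proof (intro conjI ballI allI impI \<omega> K XtK that)
   fix b i' k' assume b: "b \<in> (Basis :: 'e set)" and i': "1 \<le> i'" "i' + k' \<le> i"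
   have "(\<lambda>k'. Xt t (k' + k) \<bullet> b) = (\<lambda>k'. (1 - t) * (X (k' + k) \<bullet> b) + t * (X (k' + (k + 1)) \<bullet> b))"
    by (auto simp: Xt_def inner_add_left inner_diff_left algebra_simps)
   hence "(fdiff 1 ^^ i') (\<lambda>k'. Xt t (k' + k) \<bullet> b) k'
    = (1 - t) * (fdiff 1 ^^ i') (\<lambda>k. X k \<bullet> b) (k' + k) + t * (fdiff 1 ^^ i') (\<lambda>k. X k \<bullet> b) (k' + (k + 1))"
    by (simp only: fdiff_pow_add fdiff_pow_cmult fdiff_pow_shift[where f="\<lambda>k. X k \<bullet> b"])
   also have "\<bar>\<dots>\<bar> \<le> (1 - t) * (\<omega> * Y ^ i') + t * (\<omega> * Y ^ i')"
    using \<open>t \<in> {0..1}\<close> \<open>i + k \<le> n\<close> i' b j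
    by (intro order.trans[OF abs_triangle_ineq] add_mono) (auto simp: abs_mult intro!: mult_left_mono Xd)
   finally show "\<bar>(fdiff 1 ^^ i') (\<lambda>k'. Xt t (k' + k) \<bullet> b) k'\<bar> \<le> \<omega> * Y ^ i'"
    by (simp add: algebra_simps)
  qed
  \<comment> \<open>Order 0 is where subtracting \<open>G0 b\<close> matters; in positive orders the
    constant drops out and the difference passes under the integral.\<close>
  have a_bd: "diff_bounded n (D b * \<omega>) Y (\<lambda>k. a b k + - G0 b)" for b
   unfolding diff_bounded_def
  proof (intro allI impI)
   fix i k assume ik: "i + k \<le> n"
   have bc: "0 \<le> (\<Sum>b'\<in>Basis. bound (b' # b # vs))" "0 \<le> (\<Sum>i\<in>{0<..<j}. c i b)"
    using bound(1) c(1) by (auto intro!: sum_nonneg)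
   show "\<bar>(fdiff 1 ^^ i) (\<lambda>k. a b k + - G0 b) k\<bar> \<le> D b * \<omega> * Y ^ i"
   proof (cases "i = 0")
    case True
    have "norm (integral {0..1} (\<lambda>t. \<phi> b k t - G0 b)) \<le> (\<Sum>b'\<in>Basis. bound (b' # b # vs)) * \<omega> * (1 - 0)"
    proof (rule integral_bound)
     fix t :: real assume t: "t \<in> {0..1}"
     have "norm (\<phi> b k t - G0 b) \<le> (\<Sum>b'\<in>Basis. bound (b' # b # vs)) * norm (Xt t k - X 0)"
      unfolding \<phi>_def G0_def real_norm_def using XtK[OF t] XK0 K(1) by (intro increment_bound) auto
     also have "\<dots> \<le> (\<Sum>b'\<in>Basis. bound (b' # b # vs)) * \<omega>"
      using bc K(3)[OF XtK[OF t] X] by (intro mult_left_mono) auto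
     finally show "norm (\<phi> b k t - G0 b) \<le> (\<Sum>b'\<in>Basis. bound (b' # b # vs)) * \<omega>" .
    qed (auto intro!: continuous_on_diff \<phi>c)
    moreover have "integral {0..1} (\<lambda>t. \<phi> b k t - G0 b) = a b k - G0 b"
     unfolding a_def using integrable_continuous_interval[OF \<phi>c] by (subst integral_diff) auto
    ultimately have "\<bar>a b k - G0 b\<bar> \<le> (\<Sum>b'\<in>Basis. bound (b' # b # vs)) * \<omega>" by simp
    also have "\<dots> \<le> D b * \<omega>" unfolding D_def using bc \<omega> by (intro mult_right_mono) auto
    finally show ?thesis using True by simp
   next
    case False
    then obtain i' where i': "i = Suc i'" by (cases i) auto
    have "(fdiff 1 ^^ i) (\<lambda>k. a b k + - G0 b) k = (fdiff 1 ^^ i) (a b) k"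
     unfolding fdiff_pow_add i' fdiff_pow_const by simp
    also have "\<dots> = integral {0..1} (\<lambda>t. (fdiff 1 ^^ i) (\<lambda>k. \<phi> b k t) k)"
     unfolding a_def by (rule fdiff_pow_integral(2)[OF \<phi>c])
    also have "norm \<dots> \<le> (c i b * \<omega> * Y ^ i) * (1 - 0)"
    proof (rule integral_bound[OF _ fdiff_pow_integral(1)[OF \<phi>c]])
     fix t :: real assume t: "t \<in> {0..1}"
     have "\<bar>(fdiff 1 ^^ i) (\<lambda>k'. iter_dderiv (b # vs) F (Xt t (k' + k))) 0\<bar> \<le> c i b * \<omega> * Y ^ i"
      by (rule c(2)[OF _ _ ad_t[OF t ik]]) (use False ik j in auto)
     thus "norm ((fdiff 1 ^^ i) (\<lambda>k. \<phi> b k t) k) \<le> c i b * \<omega> * Y ^ i"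
      using fdiff_pow_shift[of i 1 "\<lambda>k. \<phi> b k t" k] by (simp add: \<phi>_def)
    qed simp
    also have "\<dots> \<le> D b * \<omega> * Y ^ i"
    proof -
     have "c i b \<le> (\<Sum>i\<in>{0<..<j}. c i b)" using False ik j c(1) by (intro member_le_sum) auto
     hence "c i b \<le> D b" using bc by (simp add: D_def)
     thus ?thesis using \<omega> by (auto intro!: mult_right_mono)
    qed
    finally show ?thesis by simp
   qed
  qed
  have dX_bd: "diff_bounded n (\<omega> * Y) Y (dX b)" if "b \<in> Basis" for b
   unfolding diff_bounded_def
  proof (intro allI impI)
   fix i k assume "i + k \<le> n"
   hence "\<bar>(fdiff 1 ^^ Suc i) (\<lambda>k. X k \<bullet> b) k\<bar> \<le> \<omega> * Y ^ Suc i" using j that by (intro Xd) auto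
   thus "\<bar>(fdiff 1 ^^ i) (dX b) k\<bar> \<le> \<omega> * Y * Y ^ i" unfolding dX_def fdiff_pow_Suc by (simp add: mult.assoc)
  qed
  have "fdiff 1 (\<lambda>k. iter_dderiv vs F (X k)) = (\<lambda>k. \<Sum>b\<in>Basis. (a b k + - G0 b) * dX b k + G0 b * dX b k)"
  proof
   fix k :: nat
   show "fdiff 1 (\<lambda>k. iter_dderiv vs F (X k)) k = (\<Sum>b\<in>Basis. (a b k + - G0 b) * dX b k + G0 b * dX b k)"
   proof -
    have "\<phi> b k = (\<lambda>t. iter_dderiv (b # vs) F (X k + t *\<^sub>R (X (k + 1) - X k)))" for b
     by (rule ext) (simp only: \<phi>_def Xt_def)
    moreover have "(X (k + 1) - X k) \<bullet> b = dX b k" for b by (simp add: dX_def fdiff_def inner_diff_left)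
    ultimately have "fdiff 1 (\<lambda>k. iter_dderiv vs F (X k)) k = (\<Sum>b\<in>Basis. a b k * dX b k)"
     using increment_integral[OF XK0[of k] XK0[of "k + 1"], of vs] by (simp add: fdiff_def a_def)
    moreover have "a b k * dX b k = (a b k + - G0 b) * dX b k + G0 b * dX b k" for b
     by (simp add: algebra_simps)
    ultimately show ?thesis by (simp only:)
   qed
  qed
  hence "(fdiff 1 ^^ j) (\<lambda>k. iter_dderiv vs F (X k)) 0
   = (\<Sum>b\<in>Basis. (fdiff 1 ^^ n) (\<lambda>k. (a b k + - G0 b) * dX b k) 0 + G0 b * (fdiff 1 ^^ n) (dX b) 0)"
   unfolding j fdiff_pow_Suc by (simp only: fdiff_pow_sum fdiff_pow_add fdiff_pow_cmult)
  also have "\<dots> = (\<Sum>b\<in>Basis. (fdiff 1 ^^ n) (\<lambda>k. (a b k + - G0 b) * dX b k) 0)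
   + (\<Sum>b\<in>Basis. iter_dderiv (b # vs) F (X 0) * (fdiff 1 ^^ j) (\<lambda>k. X k \<bullet> b) 0)"
   unfolding j fdiff_pow_Suc dX_def G0_def by (simp add: sum.distrib)
  finally have "\<bar>chain_error j vs F X\<bar>
   = \<bar>\<Sum>b\<in>Basis. (fdiff 1 ^^ n) (\<lambda>k. (a b k + - G0 b) * dX b k) 0\<bar>" by simp
  also have "\<dots> \<le> (\<Sum>b\<in>Basis. 2 ^ n * (D b * \<omega> * (\<omega> * Y)) * Y ^ n)"
   using D0 \<omega> by (intro order.trans[OF sum_abs sum_mono] diff_bounded_mult[OF a_bd dX_bd]) auto
  also have "\<dots> = (\<Sum>b\<in>Basis. 2 ^ n * D b) * \<omega>\<^sup>2 * Y ^ j"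
   unfolding sum_distrib_right by (intro sum.cong refl) (simp add: j power2_eq_square)
  finally show "\<bar>chain_error j vs F X\<bar>
    \<le> (\<Sum>b\<in>Basis. 2 ^ n * D b) * \<omega>\<^sup>2 * Y ^ j" .
 qed (use D0 in \<open>auto intro!: sum_nonneg\<close>)
qed

text \<open>Strong induction on the order: the quadratic remainder is at most linear because
  \<omega> is at most 1, and the linear term is of size \<omega> by admissibility.\<close>

lemma composition_bound:
 assumes "0 < j"
 shows "\<exists>C\<ge>0. \<forall>X \<omega> Y K. admissible_seq j \<omega> Y K X \<longrightarrow>
   \<bar>(fdiff 1 ^^ j) (\<lambda>k. iter_dderiv vs F (X k)) 0\<bar> \<le> C * \<omega> * Y ^ j"
 using assms
proof (induction j arbitrary: vs rule: less_induct)
 case (less j)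
 obtain C where C: "C \<ge> 0" "\<And>X \<omega> Y K. admissible_seq j \<omega> Y K X \<Longrightarrow>
   \<bar>chain_error j vs F X\<bar> \<le> C * \<omega>\<^sup>2 * Y ^ j"
  using composition_step[OF less.IH less.prems, of vs] by blast
 show ?case
 proof (intro exI[of _ "C + (\<Sum>b\<in>Basis. bound (b # vs))"] conjI allI impI)
  fix X \<omega> Y K assume ad: "admissible_seq j \<omega> Y K X"
  hence \<omega>: "0 \<le> \<omega>" "\<omega> \<le> 1" "0 \<le> Y" and XK0: "X 0 \<in> K0"
   and Xd: "\<And>b. b \<in> Basis \<Longrightarrow> \<bar>(fdiff 1 ^^ j) (\<lambda>k. X k \<bullet> b) 0\<bar> \<le> \<omega> * Y ^ j"
   using less.prems unfolding admissible_seq_def by auto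
  let ?S = "\<Sum>b\<in>Basis. iter_dderiv (b # vs) F (X 0) * (fdiff 1 ^^ j) (\<lambda>k. X k \<bullet> b) 0"
  have "\<bar>?S\<bar> \<le> (\<Sum>b\<in>Basis. bound (b # vs) * (\<omega> * Y ^ j))"
   by (rule order.trans[OF sum_abs sum_mono], unfold abs_mult, intro mult_mono bound Xd XK0) auto
  moreover have "C * \<omega>\<^sup>2 * Y ^ j \<le> C * \<omega> * Y ^ j"
   using C(1) \<omega> by (intro mult_right_mono mult_left_mono) (auto simp: power2_eq_square mult_left_le)
  ultimately show "\<bar>(fdiff 1 ^^ j) (\<lambda>k. iter_dderiv vs F (X k)) 0\<bar> \<le> (C + (\<Sum>b\<in>Basis. bound (b # vs))) * \<omega> * Y ^ j"
   using C(2)[OF ad] by (simp add: distrib_right sum_distrib_right mult.assoc)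
 qed (use C(1) bound(1) in \<open>auto intro!: add_nonneg_nonneg sum_nonneg\<close>)
qed

lemma composition_remainder:
 assumes "0 < j"
 shows "\<exists>C\<ge>0. \<forall>X \<omega> Y K. admissible_seq j \<omega> Y K X \<longrightarrow>
   \<bar>chain_error j vs F X\<bar> \<le> C * \<omega>\<^sup>2 * Y ^ j"
 using composition_step[OF composition_bound assms] by blast

end

declare iter_dderiv_Cons [simp] One_nat_def [simp]


section \<open>The energy estimate\<close>

declare smooth_borel [measurable del]

text \<open>The L2 adjoint of \<open>dquot\<close>, with the sign included: no factor (-1)^m appears
  when \<open>m\<close> differences are moved across.\<close>

definition dquot_adj :: "real \<Rightarrow> 'a::real_normed_vector \<Rightarrow> ('a \<Rightarrow> real) \<Rightarrow> 'a \<Rightarrow> real"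
 where "dquot_adj h v g = (\<lambda>x. (g (x - h *\<^sub>R v) - g x) / h)"

lemma dquot_adj_pow_integral:
 fixes F g :: "'a::euclidean_space \<Rightarrow> real"
 assumes F: "borel_fun F" "\<And>x. \<bar>F x\<bar> \<le> B" and h: "h > 0" and "integrable lborel g"
 shows "(\<integral>x. F x * (dquot_adj h v ^^ m) g x \<partial>lborel) = (\<integral>x. (dquot h v ^^ m) F x * g x \<partial>lborel)"
 using assms(4)
proof (induction m arbitrary: g)
 case (Suc m)
 have i: "integrable lborel (dquot_adj h v g)"
  using integrable_translate[OF Suc.prems, of "- h *\<^sub>R v"] Suc.prems by (simp add: dquot_adj_def)
 have "(\<integral>x. F x * (dquot_adj h v ^^ Suc m) g x \<partial>lborel) = (\<integral>x. (dquot h v ^^ m) F x * dquot_adj h v g x \<partial>lborel)"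
  unfolding funpow_Suc_right o_def by (rule Suc.IH[OF i])
 also have "\<dots> = (\<integral>x. g x * dquot h v ((dquot h v ^^ m) F) x \<partial>lborel)"
  unfolding dquot_adj_def
  by (rule dquot_summation_by_parts(1)[OF dquot_pow_measurable[OF F(1)] Suc.prems dquot_pow_bound[OF h F(2)], symmetric])
 finally show ?case by (simp add: mult.commute)
qed simp

lemma smooth_dquot:
 fixes f :: "'a::real_normed_vector \<Rightarrow> real"
 assumes "smooth f" shows "smooth (dquot h v f)"
 using smooth_cmult[OF smooth_fdiff[OF assms], of "1 / h" "h *\<^sub>R v"] by (simp add: dquot_def fdiff_def)

lemma dderiv_dquot:
 assumes "smooth f" shows "dderiv w (dquot h v f) = dquot h v (dderiv w f)"
 using dderiv_cmult[OF smooth_dir_differentiable[OF smooth_fdiff[OF assms]], of w "1 / h" "h *\<^sub>R v"]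
  dderiv_fdiff[OF assms, of w "h *\<^sub>R v"] by (simp add: dquot_def fdiff_def)

lemma smooth_dquot_pow:
 fixes f :: "'a::real_normed_vector \<Rightarrow> real"
 shows "smooth f \<Longrightarrow> smooth ((dquot h v ^^ j) f)"
 by (induction j) (auto intro: smooth_dquot)

lemma dderiv_dquot_pow:
 "smooth f \<Longrightarrow> dderiv w ((dquot h v ^^ j) f) = (dquot h v ^^ j) (dderiv w f)"
 by (induction j) (auto simp: dderiv_dquot smooth_dquot_pow)

lemma dquot_adj_eq: "dquot_adj h v f = (\<lambda>x. - dquot (- h) v f x)"
 by (simp add: dquot_adj_def dquot_def fun_eq_iff)

lemma smooth_dquot_adj:
 fixes f :: "'a::real_normed_vector \<Rightarrow> real"
 assumes "smooth f" shows "smooth (dquot_adj h v f)"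
 using smooth_cmult[OF smooth_dquot[OF assms], of "-1" "- h" v] by (simp add: dquot_adj_eq)

lemma dderiv_dquot_adj:
 assumes "smooth f" shows "dderiv w (dquot_adj h v f) = dquot_adj h v (dderiv w f)"
 using dderiv_cmult[OF smooth_dir_differentiable[OF smooth_dquot[OF assms]], of w "-1" "- h" v]
  dderiv_dquot[OF assms, of w "- h" v] by (simp add: dquot_adj_eq)

lemma smooth_dquot_adj_pow:
 fixes f :: "'a::real_normed_vector \<Rightarrow> real"
 shows "smooth f \<Longrightarrow> smooth ((dquot_adj h v ^^ j) f)"
 by (induction j) (auto intro: smooth_dquot_adj)

lemma dderiv_dquot_adj_pow:
 "smooth f \<Longrightarrow> dderiv w ((dquot_adj h v ^^ j) f) = (dquot_adj h v ^^ j) (dderiv w f)"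
 by (induction j) (auto simp: dderiv_dquot_adj smooth_dquot_adj_pow)

lemma dquot_adj_pow_support:
 assumes "\<And>x. x \<notin> cball x0 R \<Longrightarrow> g x = 0" "h > 0" "norm v \<le> 1" "x \<notin> cball x0 (R + real m * h)"
 shows "(dquot_adj h v ^^ m) g x = 0"
 using assms(4)
proof (induction m arbitrary: x)
 case (Suc m)
 have "norm (h *\<^sub>R v) \<le> h" using assms(2,3) by (simp add: mult_left_le)
 hence "dist x0 x \<le> dist x0 (x - h *\<^sub>R v) + h"
  using dist_triangle[of x0 x "x - h *\<^sub>R v"] by (simp add: dist_norm)
 hence "x - h *\<^sub>R v \<notin> cball x0 (R + real m * h)" "x \<notin> cball x0 (R + real m * h)"
  using Suc.prems assms(2) by (auto simp: algebra_simps)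
 thus ?case using Suc.IH by (simp add: dquot_adj_def[of h v "(dquot_adj h v ^^ m) g"])
qed (use assms(1) in simp)

section \<open>Difference quotients on a grid line\<close>

lemma dquot_pow_cmult: "(dquot h v ^^ j) (\<lambda>x. c * f x) = (\<lambda>x. c * (dquot h v ^^ j) f x)"
 by (induction j) (auto simp: dquot_def fun_eq_iff algebra_simps)

lemma dquot_pow_minus_const:
 "j > 0 \<Longrightarrow> (dquot h v ^^ j) (\<lambda>x. f x - c) = (dquot h v ^^ j) f"
proof (induction j)
 case (Suc j)
 thus ?case by (cases "j = 0") (auto simp: dquot_def fun_eq_iff)
qed simp

lemma dquot_pow_Suc:
 "(dquot h v ^^ Suc j) f x = ((dquot h v ^^ j) f (x + h *\<^sub>R v) - (dquot h v ^^ j) f x) / h"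
 by (simp add: dquot_def[of h v "(dquot h v ^^ j) f"])

abbreviation node :: "'a::real_vector \<Rightarrow> real \<Rightarrow> 'a \<Rightarrow> nat \<Rightarrow> 'a"
 where "node x h v k \<equiv> x + real k *\<^sub>R (h *\<^sub>R v)"

text \<open>Along the grid line through \<open>x\<close> a difference quotient is a scaled
  difference of a sequence; this is the bridge to the composition estimates, which concern
  sequences.\<close>

lemma dquot_pow_eq_fdiff:
 assumes "h \<noteq> 0"
 shows "(dquot h v ^^ j) f (node x h v k) = (1 / h) ^ j * (fdiff 1 ^^ j) (\<lambda>k. f (node x h v k)) k"
proof (induction j arbitrary: k)
 case (Suc j)
 let ?g = "(dquot h v ^^ j) f" and ?d = "(fdiff 1 ^^ j) (\<lambda>k. f (node x h v k))"
 have e: "x + real k *\<^sub>R (h *\<^sub>R v) + h *\<^sub>R v = x + real (k + 1) *\<^sub>R (h *\<^sub>R v)" by (simp add: algebra_simps)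
 have "(dquot h v ^^ Suc j) f (node x h v k) = (?g (x + real (k + 1) *\<^sub>R (h *\<^sub>R v)) - ?g (node x h v k)) / h"
  by (simp only: funpow.simps o_def dquot_def[of h v ?g] e)
 also have "\<dots> = (1 / h) ^ Suc j * (?d (k + 1) - ?d k)"
  unfolding Suc.IH by (simp add: algebra_simps diff_divide_distrib)
 finally show ?case by (simp only: funpow.simps o_def fdiff_def[of 1 ?d])
qed simp

lemma dquot_pow_local_bound:
 assumes "h > 0" "\<And>i. i \<le> j \<Longrightarrow> \<bar>f (node x h v i)\<bar> \<le> B"
 shows "\<bar>(dquot h v ^^ j) f x\<bar> \<le> (2 / h) ^ j * B"
proof -
 have "\<bar>(dquot h v ^^ j) f (node x h v k)\<bar> \<le> (2 / h) ^ j * B" if "k + j \<le> n"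
  "\<And>i. i \<le> n \<Longrightarrow> \<bar>f (node x h v i)\<bar> \<le> B" for k n
  using that
 proof (induction j arbitrary: k)
  case (Suc j)
  let ?g = "(dquot h v ^^ j) f"
  have e: "x + real k *\<^sub>R (h *\<^sub>R v) + h *\<^sub>R v = x + real (k + 1) *\<^sub>R (h *\<^sub>R v)" by (simp add: algebra_simps)
  have "\<bar>?g (x + real (k + 1) *\<^sub>R (h *\<^sub>R v)) - ?g (node x h v k)\<bar> \<le> (2 / h) ^ j * B + (2 / h) ^ j * B"
   by (rule order.trans[OF abs_triangle_ineq4]) (intro add_mono Suc.IH; use Suc.prems in simp)
  from divide_right_mono[OF this less_imp_le[OF assms(1)]]
  have "\<bar>?g (x + real (k + 1) *\<^sub>R (h *\<^sub>R v)) - ?g (node x h v k)\<bar> / h \<le> (2 * ((2 / h) ^ j * B)) / h"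
   by (simp only: mult_2)
  moreover have "(2 * ((2 / h) ^ j * B)) / h = (2 / h) ^ Suc j * B" by simp
  ultimately have "\<bar>?g (x + real (k + 1) *\<^sub>R (h *\<^sub>R v)) - ?g (node x h v k)\<bar> / h \<le> (2 / h) ^ Suc j * B"
   by (simp only:)
  thus ?case using assms(1) by (simp only: funpow.simps o_def dquot_def[of h v ?g] e abs_divide abs_of_pos)
 qed simp
 from this[of 0 j] assms(2) show ?thesis by simp
qed

lemma dquot_pow_tendsto:
 assumes "\<And>i. i \<le> j \<Longrightarrow> (\<lambda>k. f k (node x h v i)) \<longlonglongrightarrow> g (node x h v i)"
 shows "(\<lambda>k. (dquot h v ^^ j) (f k) x) \<longlonglongrightarrow> (dquot h v ^^ j) g x"
proof -
 have "(\<lambda>k. (dquot h v ^^ j) (f k) (node x h v i)) \<longlonglongrightarrow> (dquot h v ^^ j) g (node x h v i)"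
  if "i + j \<le> n" "\<And>i. i \<le> n \<Longrightarrow> (\<lambda>k. f k (node x h v i)) \<longlonglongrightarrow> g (node x h v i)" for i n
  using that
 proof (induction j arbitrary: i)
  case (Suc j)
  have e: "x + real i *\<^sub>R (h *\<^sub>R v) + h *\<^sub>R v = x + real (i + 1) *\<^sub>R (h *\<^sub>R v)" by (simp add: algebra_simps)
  have "(\<lambda>k. ((dquot h v ^^ j) (f k) (x + real (i + 1) *\<^sub>R (h *\<^sub>R v)) - (dquot h v ^^ j) (f k) (node x h v i)) / h)
   \<longlonglongrightarrow> ((dquot h v ^^ j) g (x + real (i + 1) *\<^sub>R (h *\<^sub>R v)) - (dquot h v ^^ j) g (node x h v i)) / h"
   unfolding divide_inverse by (intro tendsto_mult_right tendsto_diff Suc.IH; use Suc.prems in simp)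
  thus ?case by (simp only: dquot_pow_Suc e)
 qed simp
 from this[of 0 j] assms show ?thesis by simp
qed

section \<open>Limits and averages of difference quotients\<close>

lemma AE_translate:
 fixes a :: "'a::euclidean_space"
 assumes "AE x in lborel. P x"
 shows "AE x in lborel. P (x + a)"
proof -
 have "distr lborel lborel ((+) a) = lborel"
  using lborel_distr_plus[of a] by (simp cong: distr_cong)
 hence "AE x in distr lborel lborel ((+) a). P x" using assms by (simp only:)
 moreover have "(+) a \<in> lborel \<rightarrow>\<^sub>M lborel" by simp
 ultimately have "AE x in lborel. P (a + x)" using AE_distrD by blast
 thus ?thesis by (simp only: add.commute)
qed

text \<open>The integral of the squared deviation of \<phi> from its mean is nonnegative.\<close>

lemma square_integral_le:
 fixes \<phi> :: "real \<Rightarrow> real"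
 assumes "continuous_on {0..1} \<phi>"
 shows "(integral {0..1} \<phi>)\<^sup>2 \<le> integral {0..1} (\<lambda>t. (\<phi> t)\<^sup>2)"
proof -
 define c where "c = integral {0..1} \<phi>"
 have i: "\<phi> integrable_on {0..1}" "(\<lambda>t. (\<phi> t)\<^sup>2) integrable_on {0..1}"
  using assms by (auto intro!: integrable_continuous_interval continuous_intros)
 have "0 \<le> integral {0..1} (\<lambda>t. (\<phi> t - c)\<^sup>2)"
  using assms by (intro Henstock_Kurzweil_Integration.integral_nonneg integrable_continuous_interval continuous_intros) auto
 also have "(\<lambda>t. (\<phi> t - c)\<^sup>2) = (\<lambda>t. (\<phi> t)\<^sup>2 - (2 * c) * \<phi> t + c\<^sup>2)"
  by (auto simp: power2_eq_square algebra_simps)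
 also have "integral {0..1} \<dots> = integral {0..1} (\<lambda>t. (\<phi> t)\<^sup>2 - (2 * c) * \<phi> t) + integral {0..1::real} (\<lambda>t. c\<^sup>2)"
  using i by (intro Henstock_Kurzweil_Integration.integral_add integrable_diff integrable_on_mult_right) auto
 also have "\<dots> = integral {0..1} (\<lambda>t. (\<phi> t)\<^sup>2) - integral {0..1} (\<lambda>t. (2 * c) * \<phi> t) + c\<^sup>2"
  using i by (subst Henstock_Kurzweil_Integration.integral_diff) (auto intro: integrable_on_mult_right)
 also have "\<dots> = integral {0..1} (\<lambda>t. (\<phi> t)\<^sup>2) - c\<^sup>2"
  by (simp add: c_def power2_eq_square)
 finally show ?thesis by (simp add: c_def)
qed

text \<open>A difference quotient is the mean over \<open>t\<close> in [0, 1] of the derivative at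
  \<open>x + (t * h) *\<^sub>R v\<close>. Jensen's inequality puts the square inside the mean, and
  Tonelli reduces the claim to the bound for a single \<open>t\<close>.\<close>

lemma dquot_average_bound:
 fixes g :: "'a::euclidean_space \<Rightarrow> real"
 assumes g: "smooth g" and [measurable]: "borel_fun Z" and Z: "\<And>x. Z x \<ge> 0" and h: "h > 0"
  and le: "\<And>t. 0 \<le> t \<Longrightarrow> t \<le> 1 \<Longrightarrow> (\<integral>\<^sup>+x. ennreal (Z x * (dderiv v g (x + (t * h) *\<^sub>R v))\<^sup>2) \<partial>lborel) \<le> C"
 shows "(\<integral>\<^sup>+x. ennreal (Z x * (dquot h v g x)\<^sup>2) \<partial>lborel) \<le> C"
proof -
 let ?\<phi> = "\<lambda>x t. dderiv v g (x + (t * h) *\<^sub>R v)"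
 have sm: "continuous_on UNIV (dderiv v g)" by (intro smooth_continuous smooth_dderiv g)
 have [measurable]: "borel_fun (dderiv v g)" by (intro smooth_borel smooth_dderiv g)
 have \<phi>c: "continuous_on {0..1} (?\<phi> x)" for x
  by (rule continuous_on_compose2[OF sm]) (auto intro!: continuous_intros)
 have pw: "ennreal ((dquot h v g x)\<^sup>2) \<le> (\<integral>\<^sup>+t. ennreal (indicator {0..1} t * (?\<phi> x t)\<^sup>2) \<partial>lborel)" for x
 proof -
  have "(?\<phi> x has_integral (g (x + (1 * h) *\<^sub>R v) / h - g (x + (0 * h) *\<^sub>R v) / h)) {0..1}"
  proof (rule fundamental_theorem_of_calculus)
   fix t :: real
   have "((\<lambda>s. g (x + s *\<^sub>R v)) has_real_derivative dderiv v g (x + (t * h) *\<^sub>R v)) (at (t * h))"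
    by (rule dir_differentiable_line[OF smooth_dir_differentiable[OF g]])
   moreover have "((\<lambda>t. t * h) has_real_derivative h) (at t)" by (auto intro!: derivative_eq_intros)
   ultimately have "((\<lambda>t. (\<lambda>s. g (x + s *\<^sub>R v)) (t * h)) has_real_derivative ?\<phi> x t * h) (at t)"
    by (rule DERIV_chain2[where g="\<lambda>t. t * h" and f="\<lambda>s. g (x + s *\<^sub>R v)"])
   from DERIV_cdivide[OF this, of h]
   show "((\<lambda>t. g (x + (t * h) *\<^sub>R v) / h) has_vector_derivative ?\<phi> x t) (at t within {0..1})"
    using h by (simp add: has_real_derivative_iff_has_vector_derivative has_vector_derivative_at_within)
  qed simp
  hence dq: "dquot h v g x = integral {0..1} (?\<phi> x)"
   by (simp add: dquot_def diff_divide_distrib integral_unique)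
  have "((\<lambda>t. (?\<phi> x t)\<^sup>2) has_integral integral {0..1} (\<lambda>t. (?\<phi> x t)\<^sup>2)) {0..1}"
   by (intro integrable_integral integrable_continuous_interval continuous_on_power \<phi>c)
  hence "((\<lambda>t. indicator {0..1} t * (?\<phi> x t)\<^sup>2) has_integral integral {0..1} (\<lambda>t. (?\<phi> x t)\<^sup>2)) UNIV"
   by (subst (asm) has_integral_restrict_UNIV[symmetric]) (auto elim!: has_integral_eq[rotated])
  hence "(\<integral>\<^sup>+t. ennreal (indicator {0..1} t * (?\<phi> x t)\<^sup>2) \<partial>lborel) = ennreal (integral {0..1} (\<lambda>t. (?\<phi> x t)\<^sup>2))"
   by (intro nn_integral_has_integral_lborel) auto
  thus ?thesis using square_integral_le[OF \<phi>c, of x] dq by (simp add: ennreal_leI)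
 qed
 have "(\<integral>\<^sup>+x. ennreal (Z x * (dquot h v g x)\<^sup>2) \<partial>lborel)
  \<le> (\<integral>\<^sup>+x. \<integral>\<^sup>+t. ennreal (Z x) * ennreal (indicator {0..1} t * (?\<phi> x t)\<^sup>2) \<partial>lborel \<partial>lborel)"
 proof (rule nn_integral_mono)
  fix x
  have "ennreal (Z x * (dquot h v g x)\<^sup>2) = ennreal (Z x) * ennreal ((dquot h v g x)\<^sup>2)"
   using Z by (simp add: ennreal_mult)
  also have "\<dots> \<le> ennreal (Z x) * (\<integral>\<^sup>+t. ennreal (indicator {0..1} t * (?\<phi> x t)\<^sup>2) \<partial>lborel)"
   by (intro mult_left_mono pw) auto
  also have "\<dots> = (\<integral>\<^sup>+t. ennreal (Z x) * ennreal (indicator {0..1} t * (?\<phi> x t)\<^sup>2) \<partial>lborel)"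
   by (intro nn_integral_cmult[symmetric]) measurable
  finally show "ennreal (Z x * (dquot h v g x)\<^sup>2) \<le> \<dots>" .
 qed
 also have "\<dots> = (\<integral>\<^sup>+t. \<integral>\<^sup>+x. ennreal (Z x) * ennreal (indicator {0..1} t * (?\<phi> x t)\<^sup>2) \<partial>lborel \<partial>lborel)"
  by (rule lborel_pair.Fubini'[symmetric]) measurable
 also have "\<dots> \<le> (\<integral>\<^sup>+t. C * indicator {0..1::real} t \<partial>lborel)"
 proof (rule nn_integral_mono)
  fix t :: real
  show "(\<integral>\<^sup>+x. ennreal (Z x) * ennreal (indicator {0..1} t * (?\<phi> x t)\<^sup>2) \<partial>lborel) \<le> C * indicator {0..1} t"
   using le[of t] Z by (cases "t \<in> {0..1}") (auto simp: ennreal_mult)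
 qed
 also have "\<dots> = C" by (subst nn_integral_cmult_indicator) auto
 finally show ?thesis .
qed


text \<open>At a fixed step the quotients involve finitely many translates, all inside the ball of
  radius \<open>R + r + d\<close>. Almost everywhere convergence therefore passes to them, and the
  majorant may depend on the step.\<close>

lemma dquot_pow_square_integral_tendsto:
 fixes x0 :: "'a::euclidean_space"
 assumes c: "cutoff L x0 R \<zeta>" and h: "h > 0" "real j * h \<le> r" and v: "norm v \<le> 1" and q: "q > 0"
  and u: "\<And>k. borel_fun (u k)" "\<And>k x. x \<in> ball x0 (R + r + d) \<Longrightarrow> \<bar>u k x\<bar> \<le> M" "d > 0"
  and H: "borel_fun H"
  and lim: "AE x in lborel. x \<in> ball x0 (R + r + d) \<longrightarrow> (\<lambda>k. u k x) \<longlonglongrightarrow> H x"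
 shows "(\<lambda>k. wsq q \<zeta> ((dquot h v ^^ j) (u k))) \<longlonglongrightarrow> wsq q \<zeta> ((dquot h v ^^ j) H)"
  and "\<And>\<Phi> B. borel_fun \<Phi> \<Longrightarrow> (\<And>x. \<bar>\<Phi> x\<bar> \<le> B) \<Longrightarrow>
   (\<lambda>k. wint q \<zeta> (\<lambda>x. (\<Phi> x * (dquot h v ^^ j) (u k) x))) \<longlonglongrightarrow> wint q \<zeta> (\<lambda>x. (\<Phi> x * (dquot h v ^^ j) H x))"
proof -
 have cz: "0 \<le> \<zeta> x" "\<zeta> x \<le> 1" "x \<notin> cball x0 R \<Longrightarrow> \<zeta> x = 0" for x using c by (auto simp: cutoff_def)
 have [measurable]: "borel_fun \<zeta>" by (rule cutoff_measurable[OF c])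
 have um [measurable]: "borel_fun ((dquot h v ^^ j) (u k))" for k by (rule dquot_pow_measurable[OF u(1)])
 have [measurable]: "borel_fun ((dquot h v ^^ j) H)" by (rule dquot_pow_measurable[OF H])
 have near: "x + real i *\<^sub>R (h *\<^sub>R v) \<in> ball x0 (R + r + d)" if "x \<in> cball x0 R" "i \<le> j" for x i
 proof -
  have "norm (real i *\<^sub>R (h *\<^sub>R v)) = real i * h * norm v" using h by simp
  also have "\<dots> \<le> real j * h * 1" using that h v by (intro mult_mono) auto
  also have "\<dots> \<le> r" using h by simp
  finally have "dist x (node x h v i) \<le> r" unfolding dist_norm by simp
  thus ?thesis using that u(3) dist_triangle[of x0 "x + real i *\<^sub>R (h *\<^sub>R v)" x] by (simp add: dist_commute)
 qed
 have bd: "\<bar>(dquot h v ^^ j) (u k) x\<bar> \<le> (2 / h) ^ j * M" if "x \<in> cball x0 R" for k x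
  by (rule dquot_pow_local_bound[OF h(1)]) (use near[OF that] u(2) in auto)
 have "AE x in lborel. \<forall>i\<in>{..j}. x + real i *\<^sub>R (h *\<^sub>R v) \<in> ball x0 (R + r + d) \<longrightarrow>
   (\<lambda>k. u k (node x h v i)) \<longlonglongrightarrow> H (node x h v i)"
  by (intro AE_finite_allI AE_translate[OF lim]) auto
 hence conv: "AE x in lborel. x \<in> cball x0 R \<longrightarrow> (\<lambda>k. (dquot h v ^^ j) (u k) x) \<longlonglongrightarrow> (dquot h v ^^ j) H x"
  by eventually_elim (use near in \<open>auto intro!: dquot_pow_tendsto simp del: scaleR_scaleR\<close>)
 let ?I = "indicator (cball x0 R) :: 'a \<Rightarrow> real"
 have Ii: "integrable lborel ?I" by (rule integrable_indicator_bounded) auto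
 show "(\<lambda>k. wsq q \<zeta> ((dquot h v ^^ j) (u k))) \<longlonglongrightarrow> wsq q \<zeta> ((dquot h v ^^ j) H)"
 proof (rule integral_dominated_convergence[where w="\<lambda>x. ((2 / h) ^ j * M)\<^sup>2 * ?I x"])
  show "integrable lborel (\<lambda>x. ((2 / h) ^ j * M)\<^sup>2 * ?I x)" using Ii by simp
  show "AE x in lborel. (\<lambda>k. \<zeta> x ^ q * ((dquot h v ^^ j) (u k) x)\<^sup>2) \<longlonglongrightarrow> \<zeta> x ^ q * ((dquot h v ^^ j) H x)\<^sup>2"
   using conv
  proof eventually_elim
   case (elim x)
   thus ?case using cz(3)[of x] q by (cases "x \<in> cball x0 R") (auto intro!: tendsto_intros simp: power_0_left)
  qed
  show "AE x in lborel. norm (\<zeta> x ^ q * ((dquot h v ^^ j) (u k) x)\<^sup>2) \<le> ((2 / h) ^ j * M)\<^sup>2 * ?I x" for k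
  proof (rule AE_I2)
   fix x
   show "norm (\<zeta> x ^ q * ((dquot h v ^^ j) (u k) x)\<^sup>2) \<le> ((2 / h) ^ j * M)\<^sup>2 * ?I x"
   proof (cases "x \<in> cball x0 R")
    case True
    have "\<zeta> x ^ q * \<bar>(dquot h v ^^ j) (u k) x\<bar>\<^sup>2 \<le> 1 * ((2 / h) ^ j * M)\<^sup>2"
     using cz bd[OF True] by (intro mult_mono power_mono power_le_one) auto
    thus ?thesis using True cz(1)[of x] by simp
   qed (use cz(3)[of x] q in \<open>simp add: power_0_left\<close>)
  qed
 qed measurable
 fix \<Phi> :: "'a \<Rightarrow> real" and B assume \<Phi>: "borel_fun \<Phi>" "\<And>x. \<bar>\<Phi> x\<bar> \<le> B"
 note [measurable] = \<Phi>(1)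
 have B: "B \<ge> 0" using \<Phi>(2)[of 0] by linarith
 show "(\<lambda>k. wint q \<zeta> (\<lambda>x. (\<Phi> x * (dquot h v ^^ j) (u k) x))) \<longlonglongrightarrow> wint q \<zeta> (\<lambda>x. (\<Phi> x * (dquot h v ^^ j) H x))"
 proof (rule integral_dominated_convergence[where w="\<lambda>x. (B * ((2 / h) ^ j * M)) * ?I x"])
  show "integrable lborel (\<lambda>x. (B * ((2 / h) ^ j * M)) * ?I x)" using Ii by simp
  show "AE x in lborel. (\<lambda>k. \<zeta> x ^ q * (\<Phi> x * (dquot h v ^^ j) (u k) x)) \<longlonglongrightarrow> \<zeta> x ^ q * (\<Phi> x * (dquot h v ^^ j) H x)"
   using conv
  proof eventually_elim
   case (elim x)
   thus ?case using cz(3)[of x] q by (cases "x \<in> cball x0 R") (auto intro!: tendsto_intros simp: power_0_left)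
  qed
  show "AE x in lborel. norm (\<zeta> x ^ q * (\<Phi> x * (dquot h v ^^ j) (u k) x)) \<le> (B * ((2 / h) ^ j * M)) * ?I x" for k
  proof (rule AE_I2)
   fix x
   show "norm (\<zeta> x ^ q * (\<Phi> x * (dquot h v ^^ j) (u k) x)) \<le> (B * ((2 / h) ^ j * M)) * ?I x"
   proof (cases "x \<in> cball x0 R")
    case True
    have "\<zeta> x ^ q * (\<bar>\<Phi> x\<bar> * \<bar>(dquot h v ^^ j) (u k) x\<bar>) \<le> 1 * (B * ((2 / h) ^ j * M))"
     using cz bd[OF True] \<Phi>(2) B by (intro mult_mono power_le_one) auto
    thus ?thesis using True cz(1)[of x] by (simp add: abs_mult)
   qed (use cz(3)[of x] q in \<open>simp add: power_0_left\<close>)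
  qed
 qed measurable
qed

lemma cutoff_bounded_integrable:
 assumes c: "cutoff L x0 R \<zeta>" and q: "q > 0" and g: "borel_fun g" "\<And>x. x \<in> cball x0 R \<Longrightarrow> \<bar>g x\<bar> \<le> B"
 shows "integrable lborel (\<lambda>x. \<zeta> x ^ q * g x)"
proof -
 note [measurable] = cutoff_measurable[OF c] g(1)
 have "integrable lborel (\<lambda>x. \<zeta> x ^ q * (indicator (cball x0 R) x * g x))"
  by (rule cutoff_power_integrable[OF c, of _ "max B 0"])
   (use g(2) q in \<open>auto simp: indicator_def le_max_iff_disj\<close>)
 moreover have "\<zeta> x ^ q * (indicator (cball x0 R) x * g x) = \<zeta> x ^ q * g x" for x
  using c q by (auto simp: cutoff_def indicator_def power_0_left)
 ultimately show ?thesis by simp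
qed

text \<open>A difference quotient of \<open>g\<close> is an average of translates of its derivative; the cutoff is
 compared with its translates.\<close>

lemma cutoff_dquot_bound:
 fixes x0 :: "'a::euclidean_space"
 assumes c: "cutoff L x0 R \<zeta>" and h: "h > 0" and v: "norm v \<le> 1" and q: "q > 0" and g: "smooth g"
  and S: "S \<ge> 0" "norm y \<le> S * h"
  and G: "\<And>t x. 0 \<le> t \<Longrightarrow> t \<le> 1 \<Longrightarrow> x \<in> cball x0 R \<Longrightarrow> h ^ q * (dderiv v g (x + y + (t * h) *\<^sub>R v))\<^sup>2 \<le> G"
 shows "(\<integral>\<^sup>+x. ennreal (\<zeta> x ^ q * (dquot h v g (x + y))\<^sup>2) \<partial>lborel) \<le>
  ennreal (2 ^ q * wsq q \<zeta> (dderiv v g) + 2 ^ q * (L * (S + 1)) ^ q * G * vol x0 R)"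
proof -
 note [measurable] = cutoff_measurable[OF c]
 have cz: "0 \<le> \<zeta> x" "x \<notin> cball x0 R \<Longrightarrow> \<zeta> x = 0" for x using c by (auto simp: cutoff_def)
 have gy: "smooth (\<lambda>x. g (x + y))" by (rule smooth_translate[OF g])
 have dsm: "continuous_on UNIV (dderiv v g)" by (intro smooth_continuous smooth_dderiv g)
 have [measurable]: "borel_fun (dderiv v g)" by (intro smooth_borel smooth_dderiv g)
 have dq: "dquot h v g (x + y) = dquot h v (\<lambda>x. g (x + y)) x" for x by (simp add: dquot_def algebra_simps)
 show ?thesis unfolding dq
 proof (rule dquot_average_bound[OF gy _ _ h])
  fix t :: real assume t: "0 \<le> t" "t \<le> 1"
  define z where "z = y + (t * h) *\<^sub>R v"
  have "norm ((t * h) *\<^sub>R v) \<le> 1 * h" using t h v mult_mono[of "t * h" "1 * h" "norm v" 1] by simp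
  hence z: "norm z \<le> (S + 1) * h" using S(2) norm_triangle_ineq[of y "(t * h) *\<^sub>R v"] by (simp add: z_def algebra_simps)
  have "compact ((\<lambda>x. (dderiv v g x)\<^sup>2) ` cball x0 (R + norm z))"
   by (intro compact_continuous_image continuous_on_power continuous_on_subset[OF dsm]) auto
  hence "bounded ((\<lambda>x. (dderiv v g x)\<^sup>2) ` cball x0 (R + norm z))" by (rule compact_imp_bounded)
  then obtain B where "\<forall>x\<in>cball x0 (R + norm z). \<bar>(dderiv v g x)\<^sup>2\<bar> \<le> B" by (auto simp: bounded_iff)
  hence B: "x \<in> cball x0 (R + norm z) \<Longrightarrow> \<bar>(dderiv v g x)\<^sup>2\<bar> \<le> B" for x by blast
  have zin: "x + z \<in> cball x0 (R + norm z)" if "x \<in> cball x0 R" for x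
   using that dist_triangle[of x0 "x + z" x] by (simp add: dist_norm)
  have sub: "x \<in> cball x0 (R + norm z)" if "x \<in> cball x0 R" for x
   using that norm_ge_zero[of z] unfolding mem_cball by linarith
  have i1: "integrable lborel (\<lambda>x. \<zeta> x ^ q * (dderiv v g x)\<^sup>2)"
   by (rule cutoff_bounded_integrable[OF c q _ B[OF sub]]) measurable
  have i2: "integrable lborel (\<lambda>x. \<zeta> x ^ q * (dderiv v g (x + z))\<^sup>2)"
   by (rule cutoff_bounded_integrable[OF c q _ B[OF zin]]) measurable
  have "wint q \<zeta> (\<lambda>x. (dderiv v g (x + z))\<^sup>2) \<le> 2 ^ q * wsq q \<zeta> (dderiv v g) + 2 ^ q * (L * (S + 1)) ^ q * G * vol x0 R"
   by (rule cutoff_shift[OF c _ z h _ _ i1 i2 q]) (use S G[OF t] in \<open>auto simp: z_def add.assoc\<close>)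
  moreover have "(\<integral>\<^sup>+x. ennreal (\<zeta> x ^ q * (dderiv v g (x + z))\<^sup>2) \<partial>lborel) = ennreal (wint q \<zeta> (\<lambda>x. (dderiv v g (x + z))\<^sup>2))"
   by (rule nn_integral_eq_integral[OF i2]) (use cz in auto)
  ultimately show "(\<integral>\<^sup>+x. ennreal (\<zeta> x ^ q * (dderiv v (\<lambda>x. g (x + y)) (x + (t * h) *\<^sub>R v))\<^sup>2) \<partial>lborel) \<le>
  ennreal (2 ^ q * wsq q \<zeta> (dderiv v g) + 2 ^ q * (L * (S + 1)) ^ q * G * vol x0 R)"
   by (simp add: dderiv_translate z_def add.assoc add.commute[of y] ennreal_leI)
 qed (use cz in auto)
qed

text \<open>The crude bound (2/h)^j M of a quotient becomes independent of the step after
  multiplication by h^j. This is the scale-invariant bound that \<open>cutoff_shift\<close> asks for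
  when the weight has exponent \<open>2 * j\<close>.\<close>

lemma dquot_pow_scaled_bound:
 fixes x0 :: "'a::euclidean_space"
 assumes h: "h > 0" and v: "norm v \<le> 1" and x: "dist x0 x \<le> R + real i * h" and ij: "real (i + j) * h \<le> r" "r > 0"
  and u: "\<And>x. x \<in> ball x0 (R + 2 * r) \<Longrightarrow> \<bar>u x\<bar> \<le> M"
 shows "h ^ (2 * j) * ((dquot h v ^^ j) u x)\<^sup>2 \<le> 4 ^ j * M\<^sup>2"
proof -
 have "\<bar>(dquot h v ^^ j) u x\<bar> \<le> (2 / h) ^ j * M"
 proof (rule dquot_pow_local_bound[OF h])
  fix i' assume i': "i' \<le> j"
  have "norm (real i' *\<^sub>R (h *\<^sub>R v)) = real i' * h * norm v" using h by simp
  also have "\<dots> \<le> real j * h * 1" using i' h v by (intro mult_mono) auto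
  finally have "dist x0 (node x h v i') \<le> R + real i * h + real j * h"
   using x dist_triangle[of x0 "x + real i' *\<^sub>R (h *\<^sub>R v)" x] by (simp add: dist_norm)
  also have "\<dots> < R + 2 * r" using ij by (simp add: algebra_simps)
  finally show "\<bar>u (node x h v i')\<bar> \<le> M" by (intro u) simp
 qed
 hence "((dquot h v ^^ j) u x)\<^sup>2 \<le> ((2 / h) ^ j * M)\<^sup>2"
  by (metis abs_ge_zero power2_abs power_mono)
 hence "h ^ (2 * j) * ((dquot h v ^^ j) u x)\<^sup>2 \<le> h ^ (2 * j) * ((2 / h) ^ j * M)\<^sup>2"
  using h by (intro mult_left_mono) auto
 also have "((2 / h) ^ j * M)\<^sup>2 = (2 / h) ^ (2 * j) * M\<^sup>2"
  by (simp only: power_mult_distrib power_mult[symmetric] mult.commute[of j 2])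
 also have "h ^ (2 * j) * ((2 / h) ^ (2 * j) * M\<^sup>2) = (h * (2 / h)) ^ (2 * j) * M\<^sup>2"
  by (simp only: power_mult_distrib mult.assoc)
 also have "\<dots> = 4 ^ j * M\<^sup>2" using h by (simp add: power_mult)
 finally show ?thesis .
qed

text \<open>Only second derivatives of the approximations are controlled, whereas the tested
  equation contains \<open>m\<close> differences of first derivatives and of the function itself.
  One or two of these differences are exchanged for derivatives in the same direction, and the
  exponent of the cutoff matches the number of differences that remain.\<close>

lemma cutoff_dquot_pow_bound:
 fixes x0 :: "'a::euclidean_space"
 assumes c: "cutoff L x0 R \<zeta>" and h: "h > 0" "real m * h \<le> r" and v: "norm v \<le> 1" and g: "smooth g"
 shows "m \<ge> 2 \<Longrightarrow> (\<And>x. x \<in> ball x0 (R + 2 * r) \<Longrightarrow> \<bar>dderiv v g x\<bar> \<le> M) \<Longrightarrow>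
   (\<integral>x. \<zeta> x ^ (2 * (m - 1)) * ((dquot h v ^^ m) g x)\<^sup>2 \<partial>lborel) \<le>
   2 ^ (2 * (m - 1)) * (\<integral>x. \<zeta> x ^ (2 * (m - 1)) * ((dquot h v ^^ (m - 1)) (dderiv v g) x)\<^sup>2 \<partial>lborel)
   + 2 ^ (2 * (m - 1)) * L ^ (2 * (m - 1)) * (4 ^ (m - 1) * M\<^sup>2) * vol x0 R"
  and "m \<ge> 3 \<Longrightarrow> (\<And>x. x \<in> ball x0 (R + 2 * r) \<Longrightarrow> \<bar>dderiv v (dderiv v g) x\<bar> \<le> M) \<Longrightarrow>
   (\<integral>x. \<zeta> x ^ (2 * (m - 2)) * ((dquot h v ^^ m) g x)\<^sup>2 \<partial>lborel) \<le>
   2 ^ (2 * (m - 2)) * (\<integral>x. \<zeta> x ^ (2 * (m - 2)) * ((dquot h v ^^ (m - 2)) (dderiv v (dderiv v g)) x)\<^sup>2 \<partial>lborel)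
   + 2 ^ (2 * (m - 2)) * (L * 2) ^ (2 * (m - 2)) * (4 ^ (m - 2) * M\<^sup>2) * vol x0 R"
proof -
 note [measurable] = cutoff_measurable[OF c]
 have cz: "0 \<le> \<zeta> x" "L \<ge> 0" for x using c by (auto simp: cutoff_def)
 have gm [measurable]: "borel_fun ((dquot h v ^^ m) g)" by (intro smooth_borel smooth_dquot_pow g)
 have "bounded ((dquot h v ^^ m) g ` cball x0 R)"
  by (intro compact_imp_bounded compact_continuous_image smooth_continuous smooth_dquot_pow g) auto
 then obtain B where "\<forall>x\<in>cball x0 R. \<bar>(dquot h v ^^ m) g x\<bar> \<le> B" by (auto simp: bounded_iff)
 hence B: "\<bar>((dquot h v ^^ m) g x)\<^sup>2\<bar> \<le> B\<^sup>2" if "x \<in> cball x0 R" for x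
  using that power_mono[of "\<bar>(dquot h v ^^ m) g x\<bar>" B 2] by simp
 have conv: "(\<integral>\<^sup>+x. ennreal (\<zeta> x ^ q * ((dquot h v ^^ m) g x)\<^sup>2) \<partial>lborel) = ennreal (wsq q \<zeta> ((dquot h v ^^ m) g))"
  if "q > 0" for q
  by (rule nn_integral_eq_integral[OF cutoff_bounded_integrable[OF c that _ B]]) (use cz in auto)
 have small: "norm ((t * h) *\<^sub>R v) \<le> 1 * h" if "0 \<le> t" "t \<le> 1" for t
  using that h v mult_mono[of "t * h" "1 * h" "norm v" 1] by simp
 {
  assume m: "m \<ge> 2" and M: "\<And>x. x \<in> ball x0 (R + 2 * r) \<Longrightarrow> \<bar>dderiv v g x\<bar> \<le> M"
  let ?q = "2 * (m - 1)" and ?g = "(dquot h v ^^ (m - 1)) g"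
  have r: "r > 0" using h m by (intro less_le_trans[OF mult_pos_pos h(2)]) auto
  have Dm: "(dquot h v ^^ m) g = dquot h v ?g" using m by (cases m) auto
  have q: "?q > 0" using m by simp
  have "(\<integral>\<^sup>+x. ennreal (\<zeta> x ^ ?q * (dquot h v ?g (x + 0))\<^sup>2) \<partial>lborel) \<le>
   ennreal (2 ^ ?q * wsq ?q \<zeta> (dderiv v ?g) + 2 ^ ?q * (L * (0 + 1)) ^ ?q * (4 ^ (m - 1) * M\<^sup>2) * vol x0 R)"
  proof (rule cutoff_dquot_bound[OF c h(1) v q smooth_dquot_pow[OF g]])
   fix t :: real and x assume t: "0 \<le> t" "t \<le> 1" and x: "x \<in> cball x0 R"
   have "dist x0 (x + 0 + (t * h) *\<^sub>R v) \<le> R + real 1 * h"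
    using small[OF t] x dist_triangle[of x0 "x + (t * h) *\<^sub>R v" x] by (simp add: dist_norm)
   thus "h ^ ?q * (dderiv v ?g (x + 0 + (t * h) *\<^sub>R v))\<^sup>2 \<le> 4 ^ (m - 1) * M\<^sup>2"
    unfolding dderiv_dquot_pow[OF g] by (rule dquot_pow_scaled_bound[OF h(1) v _ _ r M]) (use m h in auto)
  qed auto
  hence "ennreal (wsq ?q \<zeta> ((dquot h v ^^ m) g)) \<le>
   ennreal (2 ^ ?q * wsq ?q \<zeta> ((dquot h v ^^ (m - 1)) (dderiv v g)) + 2 ^ ?q * L ^ ?q * (4 ^ (m - 1) * M\<^sup>2) * vol x0 R)"
   unfolding conv[OF q, symmetric] unfolding Dm dderiv_dquot_pow[OF g] add_0_right mult_1_right add_0_left .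
  thus "wsq ?q \<zeta> ((dquot h v ^^ m) g) \<le>
   2 ^ ?q * wsq ?q \<zeta> ((dquot h v ^^ (m - 1)) (dderiv v g)) + 2 ^ ?q * L ^ ?q * (4 ^ (m - 1) * M\<^sup>2) * vol x0 R"
   by (subst (asm) ennreal_le_iff) (auto intro!: add_nonneg_nonneg mult_nonneg_nonneg Bochner_Integration.integral_nonneg simp: cz)
 }
 {
  assume m: "m \<ge> 3" and M: "\<And>x. x \<in> ball x0 (R + 2 * r) \<Longrightarrow> \<bar>dderiv v (dderiv v g) x\<bar> \<le> M"
  let ?q = "2 * (m - 2)" and ?g = "dquot h v ((dquot h v ^^ (m - 2)) g)" and ?g' = "(dquot h v ^^ (m - 2)) (dderiv v g)"
  let ?C = "2 ^ ?q * wsq ?q \<zeta> ((dquot h v ^^ (m - 2)) (dderiv v (dderiv v g))) + 2 ^ ?q * (L * (1 + 1)) ^ ?q * (4 ^ (m - 2) * M\<^sup>2) * vol x0 R"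
  have r: "r > 0" using h m by (intro less_le_trans[OF mult_pos_pos h(2)]) auto
  define m' where "m' = m - 2"
  have m': "m = Suc (Suc m')" using m by (simp add: m'_def)
  have Dm: "(dquot h v ^^ m) g = dquot h v ?g" by (simp add: m')
  have q: "?q > 0" using m by simp
  have "(\<integral>\<^sup>+x. ennreal (\<zeta> x ^ ?q * (dquot h v ?g x)\<^sup>2) \<partial>lborel) \<le> ennreal ?C"
  proof (rule dquot_average_bound[OF smooth_dquot[OF smooth_dquot_pow[OF g]] _ _ h(1)])
   fix t :: real assume t: "0 \<le> t" "t \<le> 1"
   have "(\<integral>\<^sup>+x. ennreal (\<zeta> x ^ ?q * (dquot h v ?g' (x + (t * h) *\<^sub>R v))\<^sup>2) \<partial>lborel) \<le>
    ennreal (2 ^ ?q * wsq ?q \<zeta> (dderiv v ?g') + 2 ^ ?q * (L * (1 + 1)) ^ ?q * (4 ^ (m - 2) * M\<^sup>2) * vol x0 R)"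
   proof (rule cutoff_dquot_bound[OF c h(1) v q smooth_dquot_pow[OF smooth_dderiv[OF g]] _ small[OF t]])
    fix t' :: real and x assume t': "0 \<le> t'" "t' \<le> 1" and x: "x \<in> cball x0 R"
    have "dist x0 (x + (t * h) *\<^sub>R v + (t' * h) *\<^sub>R v) \<le> R + real 2 * h"
     using small[OF t] small[OF t'] x dist_triangle[of x0 "x + (t * h) *\<^sub>R v" x]
      dist_triangle[of x0 "x + (t * h) *\<^sub>R v + (t' * h) *\<^sub>R v" "x + (t * h) *\<^sub>R v"] by (simp add: dist_norm)
    thus "h ^ ?q * (dderiv v ?g' (x + (t * h) *\<^sub>R v + (t' * h) *\<^sub>R v))\<^sup>2 \<le> 4 ^ (m - 2) * M\<^sup>2"
     unfolding dderiv_dquot_pow[OF smooth_dderiv[OF g]] by (rule dquot_pow_scaled_bound[OF h(1) v _ _ r M]) (use m h in auto)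
   qed simp
   thus "(\<integral>\<^sup>+x. ennreal (\<zeta> x ^ ?q * (dderiv v ?g (x + (t * h) *\<^sub>R v))\<^sup>2) \<partial>lborel) \<le> ennreal ?C"
    unfolding dderiv_dquot[OF smooth_dquot_pow[OF g]] dderiv_dquot_pow[OF g] dderiv_dquot_pow[OF smooth_dderiv[OF g]] .
  qed (use cz in auto)
  hence "ennreal (wsq ?q \<zeta> ((dquot h v ^^ m) g)) \<le> ennreal ?C"
   unfolding conv[OF q, symmetric] unfolding Dm .
  thus "wsq ?q \<zeta> ((dquot h v ^^ m) g) \<le>
   2 ^ ?q * wsq ?q \<zeta> ((dquot h v ^^ (m - 2)) (dderiv v (dderiv v g)))
   + 2 ^ ?q * (L * 2) ^ ?q * (4 ^ (m - 2) * M\<^sup>2) * vol x0 R"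
   by (subst (asm) ennreal_le_iff) (auto intro!: add_nonneg_nonneg mult_nonneg_nonneg Bochner_Integration.integral_nonneg simp: cz)
 }
qed

text \<open>The weights are split as z^(2m-1) = z^m z^(m-1) and z^(2m-2) = z^m z^(m-2): the power
  z^m goes with \<open>a\<close>, the rest is the natural weight for \<open>m - 1\<close> and
  \<open>m - 2\<close> differences.\<close>

lemma weighted_cauchy:
 fixes a z \<alpha> \<beta> \<gamma> c \<kappa> :: real
 assumes "0 \<le> z" "0 \<le> c" "0 < \<kappa>" "m \<ge> 2"
 shows "\<bar>a\<bar> * (c * (z ^ (2 * m - 1) * \<bar>\<alpha>\<bar> + z ^ (2 * m - 1) * \<bar>\<beta>\<bar> + z ^ (2 * m - 2) * \<bar>\<gamma>\<bar>))
  \<le> \<kappa> * (z ^ (2 * m) * a\<^sup>2) + 3 * c\<^sup>2 / \<kappa> * (z ^ (2 * (m - 1)) * \<alpha>\<^sup>2 + z ^ (2 * (m - 1)) * \<beta>\<^sup>2 + z ^ (2 * (m - 2)) * \<gamma>\<^sup>2)"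
proof -
 have xy: "x * y \<le> \<kappa> / 3 * x\<^sup>2 + 3 / \<kappa> * y\<^sup>2" for x y :: real
 proof -
  have "0 \<le> (\<kappa> * x - 3 * y)\<^sup>2" by simp
  hence "6 * \<kappa> * (x * y) \<le> \<kappa>\<^sup>2 * x\<^sup>2 + 9 * y\<^sup>2" by (simp add: power2_eq_square algebra_simps)
  also have "\<dots> \<le> 2 * \<kappa>\<^sup>2 * x\<^sup>2 + 18 * y\<^sup>2" by simp
  finally have "6 * \<kappa> * (x * y) \<le> 6 * \<kappa> * (\<kappa> / 3 * x\<^sup>2 + 3 / \<kappa> * y\<^sup>2)"
   using assms(3) by (simp add: power2_eq_square algebra_simps)
  thus ?thesis using assms(3) by (simp add: mult_le_cancel_left_pos)
 qed
 have e1: "z ^ (2 * m - 1) = z ^ m * z ^ (m - 1)" "z ^ (2 * m - 2) = z ^ m * z ^ (m - 2)"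
 proof -
  have "2 * m - 1 = m + (m - 1)" "2 * m - 2 = m + (m - 2)" using assms(4) by linarith+
  thus "z ^ (2 * m - 1) = z ^ m * z ^ (m - 1)" "z ^ (2 * m - 2) = z ^ m * z ^ (m - 2)"
   by (simp_all only: power_add)
 qed
 have "\<bar>a\<bar> * (c * (z ^ (2 * m - 1) * \<bar>\<alpha>\<bar> + z ^ (2 * m - 1) * \<bar>\<beta>\<bar> + z ^ (2 * m - 2) * \<bar>\<gamma>\<bar>))
  = (z ^ m * \<bar>a\<bar>) * (c * (z ^ (m - 1) * \<bar>\<alpha>\<bar>)) + (z ^ m * \<bar>a\<bar>) * (c * (z ^ (m - 1) * \<bar>\<beta>\<bar>)) + (z ^ m * \<bar>a\<bar>) * (c * (z ^ (m - 2) * \<bar>\<gamma>\<bar>))"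
  unfolding e1 by (simp add: algebra_simps)
 also have "\<dots> \<le> (\<kappa> / 3 * (z ^ m * \<bar>a\<bar>)\<^sup>2 + 3 / \<kappa> * (c * (z ^ (m - 1) * \<bar>\<alpha>\<bar>))\<^sup>2) + (\<kappa> / 3 * (z ^ m * \<bar>a\<bar>)\<^sup>2 + 3 / \<kappa> * (c * (z ^ (m - 1) * \<bar>\<beta>\<bar>))\<^sup>2)
  + (\<kappa> / 3 * (z ^ m * \<bar>a\<bar>)\<^sup>2 + 3 / \<kappa> * (c * (z ^ (m - 2) * \<bar>\<gamma>\<bar>))\<^sup>2)"
  by (intro add_mono xy)
 also have "\<dots> = \<kappa> * (z ^ (2 * m) * a\<^sup>2) + 3 * c\<^sup>2 / \<kappa> * (z ^ (2 * (m - 1)) * \<alpha>\<^sup>2 + z ^ (2 * (m - 1)) * \<beta>\<^sup>2 + z ^ (2 * (m - 2)) * \<gamma>\<^sup>2)"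
 proof -
  have sq: "(z ^ k * \<bar>t\<bar>)\<^sup>2 = z ^ (2 * k) * t\<^sup>2" for k t
   by (simp only: power_mult_distrib power2_abs power_mult[symmetric] mult.commute[of k 2])
  have sqc: "(c * (z ^ k * \<bar>t\<bar>))\<^sup>2 = c\<^sup>2 * (z ^ (2 * k) * t\<^sup>2)" for k t
   by (simp only: power_mult_distrib[of c] sq)
  show ?thesis unfolding sq sqc by (simp add: algebra_simps)
 qed
 finally show ?thesis .
qed

section \<open>Matrix entries, powers of cutoffs and the tested equation\<close>

definition munit :: "'n \<times> 'n \<Rightarrow> real^'n^'n"
 where "munit p = axis (fst p) (axis (snd p) 1)"

definition ent :: "'n \<times> 'n \<Rightarrow> real^'n^'n \<Rightarrow> real"
 where "ent p A = A $ fst p $ snd p"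

definition pd2 :: "'n \<times> 'n \<Rightarrow> (real^'n \<Rightarrow> real) \<Rightarrow> real^'n \<Rightarrow> real"
 where "pd2 p f = dderiv (axis (fst p) 1) (dderiv (axis (snd p) 1) f)"

abbreviation ents :: "'n \<times> 'n \<Rightarrow> (real^'n \<Rightarrow> real^'n^'n) \<Rightarrow> real^'n \<Rightarrow> real"
 where "ents p H \<equiv> \<lambda>x. ent p (H x)"

abbreviation first_var :: "(real^'n^'n \<Rightarrow> real) \<Rightarrow> (real^'n \<Rightarrow> real^'n^'n) \<Rightarrow> (real^'n \<Rightarrow> real) \<Rightarrow> real"
 where "first_var F H \<eta> \<equiv> \<integral>x. (\<Sum>p\<in>UNIV. iter_dderiv [munit p] F (H x) * pd2 p \<eta> x) \<partial>lborel"

abbreviation osc_ent :: "real \<Rightarrow> (real^'n \<Rightarrow> real^'n^'n) \<Rightarrow> 'n \<times> 'n \<Rightarrow> real^'n \<Rightarrow> real"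
 where "osc_ent \<omega> H q \<equiv> \<lambda>x. (ent q (H x) - ent q (H 0)) / \<omega>"

abbreviation mollified_ent :: "(real^'n) set \<Rightarrow> (real^'n \<Rightarrow> real^'n^'n) \<Rightarrow> 'n \<times> 'n \<Rightarrow> real \<Rightarrow> real^'n \<Rightarrow> real"
 where "mollified_ent B H p e \<equiv> conv (\<lambda>y. indicator B y * ent p (H y)) (mollifier e)"

abbreviation pd2_tendsto :: "(real \<Rightarrow> real^'n \<Rightarrow> real) \<Rightarrow> (nat \<Rightarrow> real) \<Rightarrow> (real^'n \<Rightarrow> real^'n^'n) \<Rightarrow> real^'n \<Rightarrow> bool"
 where "pd2_tendsto w e H x \<equiv> \<forall>p. (\<lambda>k. pd2 p (w (e k)) x) \<longlonglongrightarrow> ent p (H x)"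

lemma smooth_pd2: "smooth f \<Longrightarrow> smooth (pd2 p f)"
 unfolding pd2_def by (intro smooth_dderiv)

lemma test_function_pd2: "test_function \<Omega> f \<Longrightarrow> test_function \<Omega> (pd2 p f)"
 unfolding pd2_def by (intro test_function_dderiv)

lemma pd2_dquot_pow: "smooth f \<Longrightarrow> pd2 p ((dquot h v ^^ j) f) = (dquot h v ^^ j) (pd2 p f)"
 by (simp add: pd2_def dderiv_dquot_pow smooth_dderiv)

lemma pd2_dquot_adj_pow: "smooth f \<Longrightarrow> pd2 p ((dquot_adj h v ^^ j) f) = (dquot_adj h v ^^ j) (pd2 p f)"
 by (simp add: pd2_def dderiv_dquot_adj_pow smooth_dderiv)

lemma pd2_mult:
 assumes f: "smooth f" and g: "smooth g"
 shows "pd2 p (\<lambda>x. f x * g x) = (\<lambda>x. f x * pd2 p g x + (dderiv (axis (fst p) 1) f x * dderiv (axis (snd p) 1) g x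
  + dderiv (axis (snd p) 1) f x * dderiv (axis (fst p) 1) g x + pd2 p f x * g x))"
proof -
 let ?i = "axis (fst p) 1" and ?j = "axis (snd p) 1"
 note d = smooth_dir_differentiable smooth_dderiv smooth_mult f g
 have "dderiv ?j (\<lambda>x. f x * g x) = (\<lambda>x. dderiv ?j f x * g x + f x * dderiv ?j g x)"
  by (intro dderiv_mult d)
 hence "pd2 p (\<lambda>x. f x * g x) = dderiv ?i (\<lambda>x. dderiv ?j f x * g x + f x * dderiv ?j g x)"
  by (simp add: pd2_def)
 also have "\<dots> = (\<lambda>x. dderiv ?i (\<lambda>x. dderiv ?j f x * g x) x + dderiv ?i (\<lambda>x. f x * dderiv ?j g x) x)"
  by (intro dderiv_add d)
 also have "dderiv ?i (\<lambda>x. dderiv ?j f x * g x) = (\<lambda>x. dderiv ?i (dderiv ?j f) x * g x + dderiv ?j f x * dderiv ?i g x)"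
  by (intro dderiv_mult d)
 also have "dderiv ?i (\<lambda>x. f x * dderiv ?j g x) = (\<lambda>x. dderiv ?i f x * dderiv ?j g x + f x * dderiv ?i (dderiv ?j g) x)"
  by (intro dderiv_mult d)
 finally show ?thesis by (simp add: pd2_def fun_eq_iff)
qed

lemma dderiv_power:
 assumes "smooth f"
 shows "dderiv v (\<lambda>x. f x ^ Suc k) = (\<lambda>x. real (Suc k) * (f x ^ k * dderiv v f x))"
 using dderiv_compose[OF smooth_dir_differentiable[OF assms], of "\<lambda>t. t ^ Suc k" "\<lambda>t. real (Suc k) * t ^ k" v]
  DERIV_pow[of "Suc k"] by (simp add: mult.assoc)

text \<open>Each derivative falling on \<zeta>^(2m) removes one power of \<zeta>. The common
  constant covers the factors 2m L1 and 2m(2m-1) L1^2 of the explicit formulas.\<close>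

lemma cutoff_power_derivatives:
 assumes z: "smooth \<zeta>" "0 \<le> \<zeta> x" "\<zeta> x \<le> 1" and m: "m \<ge> 2"
  and L1: "\<bar>dderiv (axis (fst p) 1) \<zeta> x\<bar> \<le> L1" "\<bar>dderiv (axis (snd p) 1) \<zeta> x\<bar> \<le> L1" "\<bar>pd2 p \<zeta> x\<bar> \<le> L1"
 shows "\<bar>dderiv (axis (fst p) 1) (\<lambda>x. \<zeta> x ^ (2 * m)) x\<bar> \<le> 4 * (real m)\<^sup>2 * (L1 + L1\<^sup>2) * \<zeta> x ^ (2 * m - 1)"
  "\<bar>dderiv (axis (snd p) 1) (\<lambda>x. \<zeta> x ^ (2 * m)) x\<bar> \<le> 4 * (real m)\<^sup>2 * (L1 + L1\<^sup>2) * \<zeta> x ^ (2 * m - 1)"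
  "\<bar>pd2 p (\<lambda>x. \<zeta> x ^ (2 * m)) x\<bar> \<le> 4 * (real m)\<^sup>2 * (L1 + L1\<^sup>2) * \<zeta> x ^ (2 * m - 2)"
proof -
 define k where "k = 2 * m - 2"
 have k: "2 * m = Suc (Suc k)" "2 * m - 1 = Suc k" "2 * m - 2 = k" using m by (auto simp: k_def)
 have L: "L1 \<ge> 0" using L1(1) by linarith
 have mk: "real (Suc (Suc k)) = 2 * real m" "real (Suc k) \<le> 2 * real m" "2 * real m \<le> 4 * (real m)\<^sup>2"
  using k m by (auto simp: power2_eq_square)
 have first: "\<bar>dderiv v (\<lambda>x. \<zeta> x ^ (2 * m)) x\<bar> \<le> 4 * (real m)\<^sup>2 * (L1 + L1\<^sup>2) * \<zeta> x ^ (2 * m - 1)"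
  if "\<bar>dderiv v \<zeta> x\<bar> \<le> L1" for v
 proof -
  have "\<bar>dderiv v (\<lambda>x. \<zeta> x ^ (2 * m)) x\<bar> = 2 * real m * \<bar>dderiv v \<zeta> x\<bar> * \<zeta> x ^ Suc k"
   unfolding k(1) dderiv_power[OF z(1)] mk(1) using z(2) by (simp add: abs_mult)
  also have "\<dots> \<le> 4 * (real m)\<^sup>2 * (L1 + L1\<^sup>2) * \<zeta> x ^ Suc k"
  proof (rule mult_right_mono)
   have "\<bar>dderiv v \<zeta> x\<bar> \<le> L1 + L1\<^sup>2" using that by (simp add: add_increasing2)
   thus "2 * real m * \<bar>dderiv v \<zeta> x\<bar> \<le> 4 * (real m)\<^sup>2 * (L1 + L1\<^sup>2)"
    by (rule mult_mono[OF mk(3)]) auto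
  qed (use z in simp)
  finally show ?thesis by (simp add: k)
 qed
 show "\<bar>dderiv (axis (fst p) 1) (\<lambda>x. \<zeta> x ^ (2 * m)) x\<bar> \<le> 4 * (real m)\<^sup>2 * (L1 + L1\<^sup>2) * \<zeta> x ^ (2 * m - 1)"
  "\<bar>dderiv (axis (snd p) 1) (\<lambda>x. \<zeta> x ^ (2 * m)) x\<bar> \<le> 4 * (real m)\<^sup>2 * (L1 + L1\<^sup>2) * \<zeta> x ^ (2 * m - 1)"
  by (rule first[OF L1(1)], rule first[OF L1(2)])
 let ?i = "axis (fst p) 1" and ?j = "axis (snd p) 1"
 note d = smooth_dir_differentiable smooth_dderiv smooth_mult smooth_power z(1)
 have "pd2 p (\<lambda>x. \<zeta> x ^ (2 * m)) = dderiv ?i (\<lambda>x. real (Suc (Suc k)) * (\<zeta> x ^ Suc k * dderiv ?j \<zeta> x))"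
  unfolding pd2_def k(1) dderiv_power[OF z(1)] ..
 also have "\<dots> = (\<lambda>x. real (Suc (Suc k)) * dderiv ?i (\<lambda>x. \<zeta> x ^ Suc k * dderiv ?j \<zeta> x) x)"
  by (intro dderiv_cmult d)
 also have "dderiv ?i (\<lambda>x. \<zeta> x ^ Suc k * dderiv ?j \<zeta> x) = (\<lambda>x. dderiv ?i (\<lambda>x. \<zeta> x ^ Suc k) x * dderiv ?j \<zeta> x + \<zeta> x ^ Suc k * dderiv ?i (dderiv ?j \<zeta>) x)"
  by (intro dderiv_mult d)
 finally have "\<bar>pd2 p (\<lambda>x. \<zeta> x ^ (2 * m)) x\<bar> = 2 * real m * \<bar>real (Suc k) * (\<zeta> x ^ k * dderiv ?i \<zeta> x) * dderiv ?j \<zeta> x + \<zeta> x ^ Suc k * pd2 p \<zeta> x\<bar>"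
  unfolding dderiv_power[OF z(1)] mk(1) pd2_def by (simp add: abs_mult)
 also have "\<dots> \<le> 2 * real m * (real (Suc k) * (\<zeta> x ^ k * L1) * L1 + \<zeta> x ^ k * L1)"
 proof (intro mult_left_mono order.trans[OF abs_triangle_ineq] add_mono)
  show "\<bar>real (Suc k) * (\<zeta> x ^ k * dderiv ?i \<zeta> x) * dderiv ?j \<zeta> x\<bar> \<le> real (Suc k) * (\<zeta> x ^ k * L1) * L1"
   unfolding abs_mult using L1 L z by (intro mult_mono) auto
  have "\<zeta> x ^ Suc k \<le> \<zeta> x ^ k" using z by (simp add: mult_left_le_one_le)
  thus "\<bar>\<zeta> x ^ Suc k * pd2 p \<zeta> x\<bar> \<le> \<zeta> x ^ k * L1"
   unfolding abs_mult using L1(3) L z by (intro mult_mono) auto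
 qed auto
 also have "\<dots> = (2 * real m * real (Suc k) * L1\<^sup>2 + 2 * real m * L1) * \<zeta> x ^ k"
  by (simp add: power2_eq_square algebra_simps)
 also have "\<dots> \<le> (4 * (real m)\<^sup>2 * L1\<^sup>2 + 4 * (real m)\<^sup>2 * L1) * \<zeta> x ^ k"
 proof (intro mult_right_mono add_mono)
  have "2 * real m * real (Suc k) \<le> 2 * real m * (2 * real m)" using mk by (intro mult_left_mono) auto
  thus "2 * real m * real (Suc k) \<le> 4 * (real m)\<^sup>2" by (simp add: power2_eq_square)
 qed (use mk L z in auto)
 finally show "\<bar>pd2 p (\<lambda>x. \<zeta> x ^ (2 * m)) x\<bar> \<le> 4 * (real m)\<^sup>2 * (L1 + L1\<^sup>2) * \<zeta> x ^ (2 * m - 2)"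
  unfolding k(3) by (simp add: algebra_simps)
qed

lemma integrable_mult_bounded:
 fixes f g :: "'a::euclidean_space \<Rightarrow> real"
 assumes "integrable lborel f" "borel_fun g" "\<And>x. \<bar>g x\<bar> \<le> B"
 shows "integrable lborel (\<lambda>x. g x * f x)"
proof (rule Bochner_Integration.integrable_bound[of _ "\<lambda>x. B * f x"])
 have "\<bar>g x * f x\<bar> \<le> \<bar>B * f x\<bar>" for x
  using mult_right_mono[OF order.trans[OF assms(3)[of x] abs_ge_self], of "\<bar>f x\<bar>"] by (simp add: abs_mult)
 thus "AE x in lborel. norm (g x * f x) \<le> norm (B * f x)" by simp
qed (use assms in auto)

definition good_cutoff :: "real \<Rightarrow> real \<Rightarrow> real^'n \<Rightarrow> real \<Rightarrow> (real^'n \<Rightarrow> real) \<Rightarrow> bool"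
 where "good_cutoff L L1 x0 R \<zeta> \<longleftrightarrow> cutoff L x0 R \<zeta> \<and> smooth \<zeta> \<and> L1 \<ge> 0 \<and>
  (\<forall>i x. \<bar>dderiv (axis i 1) \<zeta> x\<bar> \<le> L1) \<and> (\<forall>p x. \<bar>pd2 p \<zeta> x\<bar> \<le> L1)"

text \<open>The equation is tested with \<open>(\<delta>\<^sup>*)\<^sup>m (\<zeta>\<^bsup>2m\<^esup> \<delta>\<^sup>m w)\<close>, \<open>w\<close> running through smooth approximations.\<close>

lemma tested_equation:
 fixes x0 :: "real^'n"
 assumes z: "good_cutoff L L1 x0 R \<zeta>" and m: "m \<ge> 3" and R: "R > 0" and \<kappa>: "\<kappa> > 0"
  and v: "v = axis s 1" and h: "0 < h" "real m * h \<le> r" "R + 2 * r \<le> R'"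
  and A: "\<And>p. borel_fun (A p)" "\<And>p x. \<bar>A p x\<bar> \<le> BA"
  and eq: "\<And>\<eta>. test_function (ball x0 R') \<eta> \<Longrightarrow> (\<integral>x. (\<Sum>p\<in>UNIV. A p x * pd2 p \<eta> x) \<partial>lborel) = 0"
  and w: "smooth w" "\<And>p x. x \<in> ball x0 R' \<Longrightarrow> \<bar>pd2 p w x\<bar> \<le> M"
 defines "c1 \<equiv> 4 * (real m)\<^sup>2 * (L1 + L1\<^sup>2)"
 shows "(\<Sum>p\<in>UNIV. wint (2 * m) \<zeta> (\<lambda>x. ((dquot h v ^^ m) (A p) x * (dquot h v ^^ m) (pd2 p w) x)))
  \<le> (\<Sum>p\<in>UNIV. \<kappa> * wsq (2 * m) \<zeta> ((dquot h v ^^ m) (A p))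
   + 3 * c1\<^sup>2 / \<kappa> * (2 * (\<Sum>q\<in>UNIV. 4 ^ m * (\<integral>x. \<zeta> x ^ (2 * (m - 1)) * ((dquot h v ^^ (m - 1)) (pd2 q w) x)\<^sup>2 \<partial>lborel)
     + 4 ^ m * L ^ (2 * (m - 1)) * (4 ^ m * M\<^sup>2) * vol x0 R)
    + (\<Sum>q\<in>UNIV. 4 ^ m * (\<integral>x. \<zeta> x ^ (2 * (m - 2)) * ((dquot h v ^^ (m - 2)) (pd2 q w) x)\<^sup>2 \<partial>lborel)
     + 4 ^ m * (L * 2) ^ (2 * (m - 2)) * (4 ^ m * M\<^sup>2) * vol x0 R)))"
proof -
 have c: "cutoff L x0 R \<zeta>" and zs: "smooth \<zeta>" and L1: "L1 \<ge> 0" "\<And>i x. \<bar>dderiv (axis i 1) \<zeta> x\<bar> \<le> L1" "\<And>p x. \<bar>pd2 p \<zeta> x\<bar> \<le> L1"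
  using z by (auto simp: good_cutoff_def)
 have cz: "0 \<le> \<zeta> x" "\<zeta> x \<le> 1" "x \<notin> cball x0 R \<Longrightarrow> \<zeta> x = 0" for x using c by (auto simp: cutoff_def)
 have L0: "L \<ge> 0" using c by (auto simp: cutoff_def)
 note [measurable] = cutoff_measurable[OF c] A(1)
 have nv: "norm v \<le> 1" by (simp add: v)
 have r: "r > 0" by (rule less_le_trans[OF mult_pos_pos h(2)]) (use m h in auto)
 define \<theta> where "\<theta> x = \<zeta> x ^ (2 * m)" for x
 define W where "W = (dquot h v ^^ m) w"
 define a where "a p = (dquot h v ^^ m) (A p)" for p
 define I where "I p = (axis (fst p) 1 :: real^'n)" for p :: "'n \<times> 'n"
 define J where "J p = (axis (snd p) 1 :: real^'n)" for p :: "'n \<times> 'n"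
 \<comment> \<open>The part of the second derivative of \<open>\<theta> * W\<close> in which at
   least one derivative falls on the cutoff.\<close>
 define rr where "rr p x = dderiv (I p) \<theta> x * dderiv (J p) W x + dderiv (J p) \<theta> x * dderiv (I p) W x + pd2 p \<theta> x * W x" for p x
 have \<theta>s: "smooth \<theta>" unfolding \<theta>_def by (intro smooth_power zs)
 have Ws: "smooth W" unfolding W_def by (intro smooth_dquot_pow w)
 have am [measurable]: "borel_fun (a p)" for p unfolding a_def by (rule dquot_pow_measurable[OF A(1)])
 have ab: "\<bar>a p x\<bar> \<le> (2 / h) ^ m * BA" for p x unfolding a_def by (rule dquot_pow_bound[OF h(1) A(2)])
 have \<theta>0: "\<theta> x = 0" if "x \<notin> cball x0 R" for x using cz(3)[OF that] m by (simp add: \<theta>_def power_0_left)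
 have tf\<theta>W: "test_function UNIV (\<lambda>x. \<theta> x * W x)"
  unfolding test_function_def using \<theta>0 by (auto intro!: smooth_mult \<theta>s Ws exI[of _ "cball x0 R"])
 have pd: "pd2 p (\<lambda>x. \<theta> x * W x) = (\<lambda>x. \<theta> x * pd2 p W x + rr p x)" for p
  unfolding pd2_mult[OF \<theta>s Ws] rr_def I_def J_def by simp
 have bdint: "integrable lborel (\<lambda>x. a p x * f x)" if "test_function UNIV f" for p and f :: "real^'n \<Rightarrow> real"
  by (rule integrable_mult_bounded[OF test_function_integrable[OF that] am ab])
 have t1: "test_function UNIV (\<lambda>x. \<theta> x * pd2 p W x)" for p
  unfolding test_function_def using \<theta>0 by (auto intro!: smooth_mult \<theta>s smooth_pd2 Ws exI[of _ "cball x0 R"])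
 have t2: "test_function UNIV (pd2 p (\<lambda>x. \<theta> x * W x))" for p by (rule test_function_pd2[OF tf\<theta>W])
 have rr_eq: "a p x * rr p x = a p x * pd2 p (\<lambda>x. \<theta> x * W x) x - a p x * (\<theta> x * pd2 p W x)" for p x
  unfolding pd by (simp add: algebra_simps)
 have irr: "integrable lborel (\<lambda>x. a p x * rr p x)" for p
  unfolding rr_eq by (intro Bochner_Integration.integrable_diff bdint t1 t2)
 \<comment> \<open>Its support reaches at most \<open>m\<close> steps beyond
   \<open>cball x0 R\<close>, hence stays inside \<open>ball x0 R'\<close>. Moving the adjoint
   differences back turns the coefficient \<open>A p\<close> into its quotient
   \<open>a p\<close>.\<close>
 define \<eta> where "\<eta> = (dquot_adj h v ^^ m) (\<lambda>x. \<theta> x * W x)"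
 have \<eta>: "test_function (ball x0 R') \<eta>"
  unfolding test_function_def
 proof (intro conjI exI[of _ "cball x0 (R + real m * h)"] allI impI)
  show "smooth \<eta>" unfolding \<eta>_def by (intro smooth_dquot_adj_pow smooth_mult \<theta>s Ws)
  show "cball x0 (R + real m * h) \<subseteq> ball x0 R'" using h r by (auto simp: subset_iff)
  show "\<eta> x = 0" if "x \<notin> cball x0 (R + real m * h)" for x
   unfolding \<eta>_def by (rule dquot_adj_pow_support[OF _ h(1) nv that]) (simp add: \<theta>0)
 qed auto
 have "(\<Sum>p\<in>UNIV. \<integral>x. a p x * pd2 p (\<lambda>x. \<theta> x * W x) x \<partial>lborel) = (\<Sum>p\<in>UNIV. \<integral>x. A p x * pd2 p \<eta> x \<partial>lborel)"
 proof (rule sum.cong)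
  fix p :: "'n \<times> 'n"
  show "(\<integral>x. a p x * pd2 p (\<lambda>x. \<theta> x * W x) x \<partial>lborel) = (\<integral>x. A p x * pd2 p \<eta> x \<partial>lborel)"
   unfolding \<eta>_def pd2_dquot_adj_pow[OF smooth_mult[OF \<theta>s Ws]] a_def
   by (rule dquot_adj_pow_integral[OF A h(1) test_function_integrable[OF t2], symmetric])
 qed simp
 also have "\<dots> = (\<integral>x. (\<Sum>p\<in>UNIV. A p x * pd2 p \<eta> x) \<partial>lborel)"
 proof (rule Bochner_Integration.integral_sum[symmetric])
  fix p :: "'n \<times> 'n"
  have i: "integrable lborel (pd2 p \<eta>)" by (rule test_function_integrable[OF test_function_pd2[OF \<eta>]])
  show "integrable lborel (\<lambda>x. A p x * pd2 p \<eta> x)" by (rule integrable_mult_bounded[OF i A])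
 qed
 also have "\<dots> = 0" by (rule eq[OF \<eta>])
 finally have zero: "(\<Sum>p\<in>UNIV. \<integral>x. a p x * pd2 p (\<lambda>x. \<theta> x * W x) x \<partial>lborel) = 0" .
 have split: "(\<integral>x. a p x * pd2 p (\<lambda>x. \<theta> x * W x) x \<partial>lborel) = (\<integral>x. a p x * (\<theta> x * pd2 p W x) \<partial>lborel) + (\<integral>x. a p x * rr p x \<partial>lborel)" for p
  using bdint[OF t1, of p p] irr[of p] by (simp add: pd distrib_left)
 have main: "(\<Sum>p\<in>UNIV. \<integral>x. a p x * (\<theta> x * pd2 p W x) \<partial>lborel) = (\<Sum>p\<in>UNIV. - (\<integral>x. a p x * rr p x \<partial>lborel))"
  using zero unfolding split sum.distrib sum_negf by linarith
 define S1 where "S1 = (\<Sum>q\<in>UNIV. 4 ^ m * (\<integral>x. \<zeta> x ^ (2 * (m - 1)) * ((dquot h v ^^ (m - 1)) (pd2 q w) x)\<^sup>2 \<partial>lborel)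
     + 4 ^ m * L ^ (2 * (m - 1)) * (4 ^ m * M\<^sup>2) * vol x0 R)"
 define S2 where "S2 = (\<Sum>q\<in>UNIV. 4 ^ m * (\<integral>x. \<zeta> x ^ (2 * (m - 2)) * ((dquot h v ^^ (m - 2)) (pd2 q w) x)\<^sup>2 \<partial>lborel)
     + 4 ^ m * (L * 2) ^ (2 * (m - 2)) * (4 ^ m * M\<^sup>2) * vol x0 R)"
 have pow4: "2 ^ (2 * (m - 1)) \<le> (4::real) ^ m" "2 ^ (2 * (m - 2)) \<le> (4::real) ^ m" "(4::real) ^ (m - 1) \<le> 4 ^ m" "(4::real) ^ (m - 2) \<le> 4 ^ m"
  by (auto simp: power_mult intro: power_increasing)
 have D1: "(\<integral>x. \<zeta> x ^ (2 * (m - 1)) * (dderiv (axis i 1) W x)\<^sup>2 \<partial>lborel) \<le> S1" for i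
 proof -
  \<comment> \<open>Since \<open>v\<close> is a coordinate vector, a derivative along it combined
    with one more coordinate derivative is an entry of the Hessian of \<open>w\<close>.\<close>
  have pdq: "dderiv v (dderiv (axis i 1) w) = pd2 (s, i) w" by (simp add: pd2_def v)
  have "(\<integral>x. \<zeta> x ^ (2 * (m - 1)) * (dderiv (axis i 1) W x)\<^sup>2 \<partial>lborel) \<le>
   2 ^ (2 * (m - 1)) * (\<integral>x. \<zeta> x ^ (2 * (m - 1)) * ((dquot h v ^^ (m - 1)) (pd2 (s, i) w) x)\<^sup>2 \<partial>lborel)
   + 2 ^ (2 * (m - 1)) * L ^ (2 * (m - 1)) * (4 ^ (m - 1) * M\<^sup>2) * vol x0 R"
   unfolding W_def dderiv_dquot_pow[OF w(1)] pdq[symmetric]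
  proof (rule cutoff_dquot_pow_bound(1)[OF c h(1,2) nv smooth_dderiv[OF w(1)]])
   show "\<bar>dderiv v (dderiv (axis i 1) w) x\<bar> \<le> M" if "x \<in> ball x0 (R + 2 * r)" for x
    unfolding pdq using that h by (intro w(2)) simp
  qed (use m in simp)
  also have "\<dots> \<le> 4 ^ m * (\<integral>x. \<zeta> x ^ (2 * (m - 1)) * ((dquot h v ^^ (m - 1)) (pd2 (s, i) w) x)\<^sup>2 \<partial>lborel)
     + 4 ^ m * L ^ (2 * (m - 1)) * (4 ^ m * M\<^sup>2) * vol x0 R"
   using cz L0 by (intro add_mono mult_right_mono mult_mono pow4) (auto intro!: Bochner_Integration.integral_nonneg)
  also have "\<dots> \<le> S1" unfolding S1_def using cz L0
   by (intro member_le_sum) (auto intro!: add_nonneg_nonneg mult_nonneg_nonneg Bochner_Integration.integral_nonneg)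
  finally show ?thesis .
 qed
 have D2: "(\<integral>x. \<zeta> x ^ (2 * (m - 2)) * (W x)\<^sup>2 \<partial>lborel) \<le> S2"
 proof -
  have pdq: "dderiv v (dderiv v w) = pd2 (s, s) w" by (simp add: pd2_def v)
  have "(\<integral>x. \<zeta> x ^ (2 * (m - 2)) * (W x)\<^sup>2 \<partial>lborel) \<le>
   2 ^ (2 * (m - 2)) * (\<integral>x. \<zeta> x ^ (2 * (m - 2)) * ((dquot h v ^^ (m - 2)) (pd2 (s, s) w) x)\<^sup>2 \<partial>lborel)
   + 2 ^ (2 * (m - 2)) * (L * 2) ^ (2 * (m - 2)) * (4 ^ (m - 2) * M\<^sup>2) * vol x0 R"
   unfolding W_def pdq[symmetric]
  proof (rule cutoff_dquot_pow_bound(2)[OF c h(1,2) nv w(1)])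
   show "\<bar>dderiv v (dderiv v w) x\<bar> \<le> M" if "x \<in> ball x0 (R + 2 * r)" for x
    unfolding pdq using that h by (intro w(2)) simp
  qed (use m in simp)
  also have "\<dots> \<le> 4 ^ m * (\<integral>x. \<zeta> x ^ (2 * (m - 2)) * ((dquot h v ^^ (m - 2)) (pd2 (s, s) w) x)\<^sup>2 \<partial>lborel)
     + 4 ^ m * (L * 2) ^ (2 * (m - 2)) * (4 ^ m * M\<^sup>2) * vol x0 R"
   using cz L0 by (intro add_mono mult_right_mono mult_mono pow4) (auto intro!: Bochner_Integration.integral_nonneg)
  also have "\<dots> \<le> S2" unfolding S2_def using cz L0
   by (intro member_le_sum) (auto intro!: add_nonneg_nonneg mult_nonneg_nonneg Bochner_Integration.integral_nonneg)
  finally show ?thesis .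
 qed
 have sqint: "integrable lborel (\<lambda>x. \<zeta> x ^ q * (f x)\<^sup>2)" if "smooth f" "q > 0" for f q
 proof -
  have "bounded (f ` cball x0 R)" by (intro compact_imp_bounded compact_continuous_image smooth_continuous that) auto
  then obtain B where "\<forall>x\<in>cball x0 R. \<bar>f x\<bar> \<le> B" by (auto simp: bounded_iff)
  hence B: "\<bar>(f x)\<^sup>2\<bar> \<le> B\<^sup>2" if "x \<in> cball x0 R" for x
   using that power_mono[of "\<bar>f x\<bar>" B 2] by simp
  have "borel_fun f" by (rule smooth_borel[OF that(1)])
  thus ?thesis by (intro cutoff_bounded_integrable[OF c that(2) _ B]) auto
 qed
 have aint: "integrable lborel (\<lambda>x. \<zeta> x ^ (2 * m) * (a p x)\<^sup>2)" for p
  by (rule cutoff_power_integrable[OF c, of _ "((2 / h) ^ m * BA)\<^sup>2"])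
   (use ab m in \<open>auto intro: abs_le_square_iff[THEN iffD1] order.trans[OF ab abs_ge_self]\<close>)
 have each: "- (\<integral>x. a p x * rr p x \<partial>lborel) \<le> \<kappa> * wsq (2 * m) \<zeta> (a p) + 3 * c1\<^sup>2 / \<kappa> * (2 * S1 + S2)" for p
 proof -
  let ?\<alpha> = "dderiv (J p) W" and ?\<beta> = "dderiv (I p) W"
  note sm = smooth_dderiv[OF Ws] Ws
  have q: "2 * (m - 1) > 0" "2 * (m - 2) > 0" using m by auto
  have "- (\<integral>x. a p x * rr p x \<partial>lborel) = (\<integral>x. - (a p x * rr p x) \<partial>lborel)" by simp
  also have "\<dots> \<le> (\<integral>x. \<kappa> * (\<zeta> x ^ (2 * m) * (a p x)\<^sup>2) + 3 * c1\<^sup>2 / \<kappa> * (\<zeta> x ^ (2 * (m - 1)) * (?\<alpha> x)\<^sup>2 + \<zeta> x ^ (2 * (m - 1)) * (?\<beta> x)\<^sup>2 + \<zeta> x ^ (2 * (m - 2)) * (W x)\<^sup>2) \<partial>lborel)"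
  proof (rule integral_mono)
   show "integrable lborel (\<lambda>x. \<kappa> * (\<zeta> x ^ (2 * m) * (a p x)\<^sup>2) + 3 * c1\<^sup>2 / \<kappa> * (\<zeta> x ^ (2 * (m - 1)) * (?\<alpha> x)\<^sup>2 + \<zeta> x ^ (2 * (m - 1)) * (?\<beta> x)\<^sup>2 + \<zeta> x ^ (2 * (m - 2)) * (W x)\<^sup>2))"
    by (intro Bochner_Integration.integrable_add integrable_mult_right aint sqint sm q)
   fix x
   have cut: "\<bar>dderiv (I p) \<theta> x\<bar> \<le> c1 * \<zeta> x ^ (2 * m - 1)" "\<bar>dderiv (J p) \<theta> x\<bar> \<le> c1 * \<zeta> x ^ (2 * m - 1)" "\<bar>pd2 p \<theta> x\<bar> \<le> c1 * \<zeta> x ^ (2 * m - 2)"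
    unfolding \<theta>_def[abs_def] I_def J_def c1_def
    by (rule cutoff_power_derivatives[OF zs cz(1,2)]; use m L1 in simp)+
   have "\<bar>rr p x\<bar> \<le> \<bar>dderiv (I p) \<theta> x\<bar> * \<bar>?\<alpha> x\<bar> + \<bar>dderiv (J p) \<theta> x\<bar> * \<bar>?\<beta> x\<bar> + \<bar>pd2 p \<theta> x\<bar> * \<bar>W x\<bar>"
    unfolding rr_def by (intro order.trans[OF abs_triangle_ineq] add_mono) (auto simp: abs_mult abs_triangle_ineq[THEN order.trans])
   also have "\<dots> \<le> (c1 * \<zeta> x ^ (2 * m - 1)) * \<bar>?\<alpha> x\<bar> + (c1 * \<zeta> x ^ (2 * m - 1)) * \<bar>?\<beta> x\<bar> + (c1 * \<zeta> x ^ (2 * m - 2)) * \<bar>W x\<bar>"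
    by (intro add_mono mult_right_mono cut) auto
   also have "\<dots> = c1 * (\<zeta> x ^ (2 * m - 1) * \<bar>?\<alpha> x\<bar> + \<zeta> x ^ (2 * m - 1) * \<bar>?\<beta> x\<bar> + \<zeta> x ^ (2 * m - 2) * \<bar>W x\<bar>)"
    by (simp add: algebra_simps)
   finally have rb: "\<bar>rr p x\<bar> \<le> \<dots>" .
   have "- (a p x * rr p x) \<le> \<bar>a p x\<bar> * \<bar>rr p x\<bar>" unfolding abs_mult[symmetric] by (rule abs_ge_minus_self)
   also have "\<dots> \<le> \<bar>a p x\<bar> * (c1 * (\<zeta> x ^ (2 * m - 1) * \<bar>?\<alpha> x\<bar> + \<zeta> x ^ (2 * m - 1) * \<bar>?\<beta> x\<bar> + \<zeta> x ^ (2 * m - 2) * \<bar>W x\<bar>))"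
    by (intro mult_left_mono rb) auto
   also have "\<dots> \<le> \<kappa> * (\<zeta> x ^ (2 * m) * (a p x)\<^sup>2) + 3 * c1\<^sup>2 / \<kappa> * (\<zeta> x ^ (2 * (m - 1)) * (?\<alpha> x)\<^sup>2 + \<zeta> x ^ (2 * (m - 1)) * (?\<beta> x)\<^sup>2 + \<zeta> x ^ (2 * (m - 2)) * (W x)\<^sup>2)"
    by (rule weighted_cauchy) (use cz L1 \<kappa> m in \<open>auto simp: c1_def\<close>)
   finally show "- (a p x * rr p x) \<le> \<dots>" .
  qed (use irr in auto)
  also have "\<dots> = \<kappa> * wsq (2 * m) \<zeta> (a p) + 3 * c1\<^sup>2 / \<kappa> * ((\<integral>x. \<zeta> x ^ (2 * (m - 1)) * (?\<alpha> x)\<^sup>2 \<partial>lborel)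
   + (\<integral>x. \<zeta> x ^ (2 * (m - 1)) * (?\<beta> x)\<^sup>2 \<partial>lborel) + (\<integral>x. \<zeta> x ^ (2 * (m - 2)) * (W x)\<^sup>2 \<partial>lborel))"
   using aint[of p] sqint[OF sm(1) q(1)] sqint[OF sm(2) q(2)] by simp
  also have "\<dots> \<le> \<kappa> * wsq (2 * m) \<zeta> (a p) + 3 * c1\<^sup>2 / \<kappa> * (S1 + S1 + S2)"
   unfolding I_def J_def using \<kappa> by (intro add_left_mono mult_left_mono add_mono D1 D2) auto
  finally show ?thesis by simp
 qed
 have "(\<Sum>p\<in>UNIV. wint (2 * m) \<zeta> (\<lambda>x. (a p x * (dquot h v ^^ m) (pd2 p w) x))) = (\<Sum>p\<in>UNIV. - (\<integral>x. a p x * rr p x \<partial>lborel))"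
  unfolding main[symmetric] by (simp add: \<theta>_def W_def pd2_dquot_pow[OF w(1)] mult.left_commute)
 also have "\<dots> \<le> (\<Sum>p\<in>UNIV. \<kappa> * wsq (2 * m) \<zeta> (a p) + 3 * c1\<^sup>2 / \<kappa> * (2 * S1 + S2))"
  by (intro sum_mono each)
 finally show ?thesis unfolding a_def S1_def S2_def .
qed


lemma munit_inner: "A \<bullet> munit p = ent p A"
 by (simp add: munit_def ent_def inner_axis)

lemma bij_munit: "bij_betw munit UNIV (Basis :: (real^'n^'n) set)"
proof -
 have "inj (munit :: 'n \<times> 'n \<Rightarrow> real^'n^'n)"
 proof (rule injI)
  fix p q :: "'n \<times> 'n" assume "(munit p :: real^'n^'n) = munit q"
  hence "ent p (munit p) = ent p (munit q :: real^'n^'n)" by simp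
  thus "p = q" by (auto simp: ent_def munit_def axis_def prod_eq_iff split: if_splits)
 qed
 moreover have "range munit = (Basis :: (real^'n^'n) set)"
  by (auto simp: Basis_vec_def munit_def image_iff) (metis fst_conv snd_conv)
 ultimately show ?thesis by (simp add: bij_betw_def)
qed

lemma sum_Basis_munit: "(\<Sum>b\<in>Basis. f b) = (\<Sum>p\<in>UNIV. f (munit p :: real^'n^'n))"
 by (rule sum.reindex_bij_betw[OF bij_munit, symmetric])

lemma abs_ent_le_norm: "\<bar>ent p A\<bar> \<le> norm A"
 using component_le_norm_cart[of "A $ fst p" "snd p"] Finite_Cartesian_Product.norm_nth_le[of A "fst p"]
 by (simp add: ent_def)

lemma sum_power_le:
 fixes y :: "'i \<Rightarrow> real"
 assumes "finite I" "\<And>i. i \<in> I \<Longrightarrow> y i \<ge> 0" "k > 0"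
 shows "(\<Sum>i\<in>I. y i) ^ k \<le> real (card I) ^ k * (\<Sum>i\<in>I. y i ^ k)"
proof (cases "I = {}")
 case False
 obtain i where i: "i \<in> I" "\<And>i'. i' \<in> I \<Longrightarrow> y i' \<le> y i"
  using assms(1) False Max_in[of "y ` I"] Max_ge[of "y ` I"] by (metis (no_types, lifting) finite_imageI image_iff image_is_empty)
 have "(\<Sum>i\<in>I. y i) \<le> real (card I) * y i" using sum_bounded_above[of I y "y i"] i(2) by simp
 hence "(\<Sum>i\<in>I. y i) ^ k \<le> (real (card I) * y i) ^ k" using assms by (intro power_mono sum_nonneg) auto
 also have "\<dots> = real (card I) ^ k * y i ^ k" by (simp add: power_mult_distrib)
 also have "\<dots> \<le> real (card I) ^ k * (\<Sum>i\<in>I. y i ^ k)"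
  using assms i by (intro mult_left_mono member_le_sum) auto
 finally show ?thesis .
qed (use assms(3) in \<open>simp add: power_0_left\<close>)

section \<open>Interpolation for functions of small oscillation\<close>

lemma normalized_dquot:
 assumes "j > 0" "\<omega> \<noteq> 0"
 shows "(dquot h v ^^ j) (\<lambda>x. (u x - c) / \<omega>) x = (dquot h v ^^ j) u x / \<omega>"
proof -
 have "(dquot h v ^^ j) (\<lambda>x. (1 / \<omega>) * (u x - c)) = (\<lambda>x. (1 / \<omega>) * (dquot h v ^^ j) u x)"
  unfolding dquot_pow_cmult dquot_pow_minus_const[OF assms(1)] ..
 thus ?thesis by (simp add: fun_eq_iff)
qed

text \<open>At the top order p = 2m/m = 2, so the interpolation scale ends in the weighted energy;
  normalising the oscillation to 1 divides it by \<omega>^2.\<close>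

lemma wnorm_top:
 assumes "m > 0" "\<omega> \<noteq> 0"
 shows "wnorm m m \<zeta> h v (\<lambda>x. (u x - c) / \<omega>) = wsq (2 * m) \<zeta> ((dquot h v ^^ m) u) / \<omega>\<^sup>2"
proof -
 have "(\<zeta> x * root m \<bar>(dquot h v ^^ m) u x / \<omega>\<bar>) ^ (2 * m) = \<zeta> x ^ (2 * m) * ((dquot h v ^^ m) u x)\<^sup>2 / \<omega>\<^sup>2" for x
 proof -
  have "(\<zeta> x * root m \<bar>(dquot h v ^^ m) u x / \<omega>\<bar>) ^ (2 * m) = \<zeta> x ^ (2 * m) * (root m \<bar>(dquot h v ^^ m) u x / \<omega>\<bar> ^ m)\<^sup>2"
   by (simp only: power_mult_distrib power_mult[symmetric] mult.commute[of m 2])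
  also have "root m \<bar>(dquot h v ^^ m) u x / \<omega>\<bar> ^ m = \<bar>(dquot h v ^^ m) u x / \<omega>\<bar>"
   using assms(1) by (intro real_root_pow_pos2) auto
  finally show ?thesis by (simp add: power_divide)
 qed
 thus ?thesis unfolding wnorm_def normalized_dquot[OF assms] by simp
qed

definition admissible_osc :: "real \<Rightarrow> 'a::euclidean_space \<Rightarrow> real \<Rightarrow> real \<Rightarrow> real \<Rightarrow> 'a \<Rightarrow> ('a \<Rightarrow> real) \<Rightarrow> real \<Rightarrow> ('a \<Rightarrow> real) \<Rightarrow> bool"
 where "admissible_osc L x0 R \<omega> h v u c \<zeta> \<longleftrightarrow> 0 < h \<and> h \<le> 1 \<and> norm v \<le> 1 \<and>
  cutoff L x0 R \<zeta> \<and> borel_fun u \<and> (\<forall>x. \<bar>u x - c\<bar> \<le> \<omega>)"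

lemma admissible_osc_normalized:
 assumes "admissible_osc L x0 R \<omega> h v u c \<zeta>" "\<omega> > 0"
 shows "admissible L x0 R h v (\<lambda>x. (u x - c) / \<omega>) \<zeta>"
 using assms by (auto simp: admissible_osc_def admissible_def)

text \<open>Interpolation bounds the integral of the power \<open>2 * m\<close> of the weighted
  root, while here the power is \<open>2 * j\<close>. Young's inequality against the constant 1 on
  the support raises the exponent, and its parameter \<kappa> makes the leading factor as small as
  desired. The additive constant may depend on \<omega> and on the cutoff.\<close>

lemma lower_order_interpolation:
 assumes j: "0 < j" "j < m" and \<epsilon>: "\<epsilon> > 0" and \<omega>: "\<omega> > 0"
 shows "\<exists>C\<ge>0. \<forall>h v u c \<zeta>. admissible_osc L (x0::'a::euclidean_space) R \<omega> h v u c \<zeta> \<longrightarrow>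
  wsq (2 * j) \<zeta> ((dquot h v ^^ j) u) \<le> \<epsilon> * wsq (2 * m) \<zeta> ((dquot h v ^^ m) u) + C"
proof -
 obtain A where A: "A \<ge> 0" "\<And>L (x0::'a) R. \<exists>C\<ge>0. \<forall>h v f \<zeta>. admissible L x0 R h v f \<zeta> \<longrightarrow>
  wnorm m j \<zeta> h v f \<le> A * wnorm m m \<zeta> h v f + C" using interpolation[OF j(1) less_imp_le[OF j(2)]] by blast
 obtain C where C: "C \<ge> 0" "\<And>h v f \<zeta>. admissible L x0 R h v f \<zeta> \<Longrightarrow>
  wnorm m j \<zeta> h v f \<le> A * wnorm m m \<zeta> h v f + C" using A(2) by blast
 define \<kappa> where "\<kappa> = min 1 (\<epsilon> / (A + 1))"
 have "\<epsilon> / (A + 1) * A \<le> \<epsilon>" using A(1) \<epsilon> by (simp add: field_simps)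
 hence \<kappa>: "0 < \<kappa>" "\<kappa> \<le> 1" "\<kappa> * A \<le> \<epsilon>"
  using A(1) \<epsilon> mult_right_mono[of \<kappa> "\<epsilon> / (A + 1)" A] by (auto simp: \<kappa>_def)
 define C' where "C' = \<omega>\<^sup>2 * (\<kappa> * C + (1 / \<kappa>) ^ (2 * m) * vol x0 R)"
 show ?thesis
 proof (intro exI[of _ C'] conjI allI impI)
  show "C' \<ge> 0" using C \<kappa> by (simp add: C'_def)
  fix h v u c \<zeta> assume ad: "admissible_osc L x0 R \<omega> h v u c \<zeta>"
  define f where "f x = (u x - c) / \<omega>" for x
  have adf: "admissible L x0 R h v f \<zeta>" unfolding f_def by (rule admissible_osc_normalized[OF ad \<omega>])
  hence h: "0 < h" "h \<le> 1" and c: "cutoff L x0 R \<zeta>" and fm: "borel_fun f" and f1: "\<And>x. \<bar>f x\<bar> \<le> 1"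
   by (auto simp: admissible_def)
  have cz: "0 \<le> \<zeta> x" "x \<notin> cball x0 R \<Longrightarrow> \<zeta> x = 0" for x using c by (auto simp: cutoff_def)
  let ?t = "\<lambda>x. \<zeta> x * root j \<bar>(dquot h v ^^ j) f x\<bar>"
  have i1: "integrable lborel (\<lambda>x. ?t x ^ (2 * m))" by (rule wnorm_integrable[OF c h(1) fm f1]) (use j in simp)
  have iI: "integrable lborel (indicator (cball x0 R) :: 'a \<Rightarrow> real)" by (rule integrable_indicator_bounded) auto
  have eq: "\<zeta> x ^ (2 * j) * ((dquot h v ^^ j) u x)\<^sup>2 = \<omega>\<^sup>2 * ?t x ^ (2 * j)" for x
  proof -
   have "?t x ^ (2 * j) = \<zeta> x ^ (2 * j) * (root j \<bar>(dquot h v ^^ j) f x\<bar> ^ j)\<^sup>2"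
    by (simp only: power_mult_distrib power_mult[symmetric] mult.commute[of j 2])
   also have "root j \<bar>(dquot h v ^^ j) f x\<bar> ^ j = \<bar>(dquot h v ^^ j) u x / \<omega>\<bar>"
    unfolding f_def normalized_dquot[OF j(1) less_imp_neq[OF \<omega>, THEN not_sym]]
    using j(1) by (intro real_root_pow_pos2) auto
   finally show ?thesis using \<omega> by (simp add: power_divide)
  qed
  have "wsq (2 * j) \<zeta> ((dquot h v ^^ j) u) \<le> (\<integral>x. \<omega>\<^sup>2 * (\<kappa> * ?t x ^ (2 * m) + (1 / \<kappa>) ^ (2 * m) * indicator (cball x0 R) x) \<partial>lborel)"
  proof (rule integral_mono')
   show "integrable lborel (\<lambda>x. \<omega>\<^sup>2 * (\<kappa> * ?t x ^ (2 * m) + (1 / \<kappa>) ^ (2 * m) * indicator (cball x0 R) x))"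
    by (intro integrable_mult_right Bochner_Integration.integrable_add i1 iI)
   fix x
   have t0: "?t x \<ge> 0" using cz by (simp add: real_root_ge_zero)
   show "\<zeta> x ^ (2 * j) * ((dquot h v ^^ j) u x)\<^sup>2 \<le> \<omega>\<^sup>2 * (\<kappa> * ?t x ^ (2 * m) + (1 / \<kappa>) ^ (2 * m) * indicator (cball x0 R) x)"
    unfolding eq
   proof (rule mult_left_mono)
    show "?t x ^ (2 * j) \<le> \<kappa> * ?t x ^ (2 * m) + (1 / \<kappa>) ^ (2 * m) * indicator (cball x0 R) x"
    proof (cases "x \<in> cball x0 R")
     case True
     have "?t x ^ (2 * m - (2 * m - 2 * j)) * 1 ^ (2 * m - 2 * j) \<le> \<kappa> * ?t x ^ (2 * m) + (1 / \<kappa>) ^ (2 * m) * 1 ^ (2 * m)"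
      by (rule young_power) (use t0 \<kappa> j in auto)
     thus ?thesis using True j by simp
    next
     case False
     thus ?thesis using cz(2)[OF False] j by (simp add: power_0_left)
    qed
   qed simp
   show "0 \<le> \<omega>\<^sup>2 * (\<kappa> * ?t x ^ (2 * m) + (1 / \<kappa>) ^ (2 * m) * indicator (cball x0 R) x)"
    using \<kappa> t0 by (intro mult_nonneg_nonneg add_nonneg_nonneg) auto
  qed
  also have "\<dots> = \<omega>\<^sup>2 * (\<kappa> * wnorm m j \<zeta> h v f + (1 / \<kappa>) ^ (2 * m) * vol x0 R)"
   using i1 iI by (simp add: wnorm_def)
  also have "\<dots> \<le> \<omega>\<^sup>2 * (\<kappa> * (A * wnorm m m \<zeta> h v f + C) + (1 / \<kappa>) ^ (2 * m) * vol x0 R)"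
   using \<kappa> by (intro mult_left_mono add_right_mono C adf) auto
  also have "\<dots> = (\<kappa> * A) * (\<omega>\<^sup>2 * wnorm m m \<zeta> h v f) + C'" by (simp add: C'_def algebra_simps)
  also have "\<dots> \<le> \<epsilon> * (\<omega>\<^sup>2 * wnorm m m \<zeta> h v f) + C'"
   using \<kappa> wnorm_nonneg[of m m \<zeta> h v f] by (intro add_right_mono mult_right_mono) auto
  also have "\<omega>\<^sup>2 * wnorm m m \<zeta> h v f = wsq (2 * m) \<zeta> ((dquot h v ^^ m) u)"
   unfolding f_def using wnorm_top[of m \<omega> \<zeta> h v u c] \<omega> j by simp
  finally show "wsq (2 * j) \<zeta> ((dquot h v ^^ j) u) \<le> \<epsilon> * wsq (2 * m) \<zeta> ((dquot h v ^^ m) u) + C'" .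
 qed
qed

abbreviation osc_power :: "nat \<Rightarrow> real \<Rightarrow> real \<Rightarrow> 'a::euclidean_space \<Rightarrow> ('a \<Rightarrow> real) \<Rightarrow> real \<Rightarrow> nat \<Rightarrow> nat \<Rightarrow> 'a \<Rightarrow> real"
 where "osc_power m \<omega> h v u c j i \<equiv>
  \<lambda>x. root j \<bar>(dquot h v ^^ j) (\<lambda>x. (u x - c) / \<omega>) (node x h v i)\<bar> ^ (2 * m)"

text \<open>Here the leading constant \<open>A\<close> must not depend on the cutoff or on \<open>\<omega>\<close>.\<close>

lemma root_dquot_interpolation:
 assumes m: "m > 0"
 shows "\<exists>A\<ge>0. \<forall>L (x0::'a::euclidean_space) R \<omega>. \<omega> > 0 \<longrightarrow> (\<exists>C\<ge>0. \<forall>h v u c \<zeta> j i. admissible_osc L x0 R \<omega> h v u c \<zeta> \<longrightarrow> 0 < j \<longrightarrow> j \<le> m \<longrightarrow> i \<le> m \<longrightarrow>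
  wint (2 * m) \<zeta> (osc_power m \<omega> h v u c j i)
   \<le> A * (wsq (2 * m) \<zeta> ((dquot h v ^^ m) u) / \<omega>\<^sup>2) + C)"
proof -
 define P where "P j A \<longleftrightarrow> A \<ge> 0 \<and> (\<forall>L (x0::'a) R. \<exists>C\<ge>0. \<forall>h v f \<zeta>. admissible L x0 R h v f \<zeta> \<longrightarrow>
  wnorm m j \<zeta> h v f \<le> A * wnorm m m \<zeta> h v f + C)" for j A
 define a where "a j = (SOME A. P j A)" for j
 have P: "P j (a j)" if "0 < j" "j \<le> m" for j
  unfolding a_def by (rule someI_ex) (use interpolation[OF that, where 'a='a] in \<open>simp add: P_def\<close>)
 define A where "A = (\<Sum>j\<in>{0<..m}. a j)"
 have aA: "a j \<le> A" if "0 < j" "j \<le> m" for j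
  unfolding A_def using that P by (intro member_le_sum) (auto simp: P_def)
 have A0: "A \<ge> 0" unfolding A_def using P by (intro sum_nonneg) (auto simp: P_def)
 show ?thesis
 proof (rule exI[of _ "2 ^ (2 * m) * A"], intro conjI allI impI)
  fix L R \<omega> :: real and x0 :: 'a assume \<omega>: "\<omega> > 0"
  define Q where "Q j C \<longleftrightarrow> C \<ge> 0 \<and> (\<forall>h v f \<zeta>. admissible L x0 R h v f \<zeta> \<longrightarrow>
  wnorm m j \<zeta> h v f \<le> a j * wnorm m m \<zeta> h v f + C)" for j C
  define b where "b j = (SOME C. Q j C)" for j
  have Q: "Q j (b j)" if "0 < j" "j \<le> m" for j
   unfolding b_def by (rule someI_ex) (use P[OF that] in \<open>simp add: P_def Q_def\<close>)
  define B where "B = (\<Sum>j\<in>{0<..m}. b j)"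
  have bB: "b j \<le> B" if "0 < j" "j \<le> m" for j
   unfolding B_def using that Q by (intro member_le_sum) (auto simp: Q_def)
  have B0: "B \<ge> 0" unfolding B_def using Q by (intro sum_nonneg) (auto simp: Q_def)
  \<comment> \<open>The second summand is the price of shifting the argument by up to
    \<open>m\<close> nodes. The absolute value of \<open>L\<close> makes the constant nonnegative
    before any cutoff, and with it \<open>L \<ge> 0\<close>, is given.\<close>
  define C where "C = 2 ^ (2 * m) * B + 2 ^ (2 * m) * (\<bar>L\<bar> * real m) ^ (2 * m) * 2 ^ (2 * m) * vol x0 R"
  have C0: "C \<ge> 0" using B0 by (simp add: C_def)
  show "\<exists>C\<ge>0. \<forall>h v u c \<zeta> j i. admissible_osc L x0 R \<omega> h v u c \<zeta> \<longrightarrow> 0 < j \<longrightarrow> j \<le> m \<longrightarrow> i \<le> m \<longrightarrow>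
   wint (2 * m) \<zeta> (osc_power m \<omega> h v u c j i)
   \<le> 2 ^ (2 * m) * A * (wsq (2 * m) \<zeta> ((dquot h v ^^ m) u) / \<omega>\<^sup>2) + C"
  proof (intro exI[of _ C] conjI C0 allI impI)
   fix h v u c \<zeta> j i
   assume ad: "admissible_osc L x0 R \<omega> h v u c \<zeta>" and j: "0 < j" "j \<le> m" and i: "i \<le> m"
   define f where "f x = (u x - c) / \<omega>" for x
   have adf: "admissible L x0 R h v f \<zeta>" unfolding f_def by (rule admissible_osc_normalized[OF ad \<omega>])
   hence h: "0 < h" "h \<le> 1" and v: "norm v \<le> 1" and c: "cutoff L x0 R \<zeta>" and fm: "borel_fun f" and f1: "\<And>x. \<bar>f x\<bar> \<le> 1"
    by (auto simp: admissible_def)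
   have L: "L \<ge> 0" using c by (auto simp: cutoff_def)
   let ?r = "\<lambda>x. root j \<bar>(dquot h v ^^ j) f x\<bar>"
   note [measurable] = dquot_pow_measurable[OF fm]
   have rb: "h * ?r x \<le> 2" for x by (rule root_dquot_bound[OF h(1) f1])
   have r0: "?r x \<ge> 0" for x by (simp add: real_root_ge_zero)
   have hr: "h ^ (2 * m) * ?r x ^ (2 * m) \<le> 2 ^ (2 * m)" for x
    unfolding power_mult_distrib[symmetric] using rb[of x] r0[of x] h by (intro power_mono) auto
   have rbd: "\<bar>?r x ^ (2 * m)\<bar> \<le> (2 / h) ^ (2 * m)" for x
   proof -
    have "?r x \<le> 2 / h" using rb[of x] h by (simp add: field_simps)
    thus ?thesis unfolding power_abs using r0[of x] by (intro power_mono) auto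
   qed
   have i1: "integrable lborel (\<lambda>x. \<zeta> x ^ (2 * m) * ?r x ^ (2 * m))"
    by (rule cutoff_power_integrable[OF c _ rbd]) (use m in auto)
   have i2: "integrable lborel (\<lambda>x. \<zeta> x ^ (2 * m) * ?r (node x h v i) ^ (2 * m))"
    by (rule cutoff_power_integrable[OF c _ rbd]) (use m in auto)
   have y: "norm (real i *\<^sub>R (h *\<^sub>R v)) \<le> real m * h"
   proof -
    have "norm (real i *\<^sub>R (h *\<^sub>R v)) = real i * h * norm v" using h by simp
    also have "\<dots> \<le> real m * h * 1" using i h v by (intro mult_mono) auto
    finally show ?thesis by simp
   qed
   have W: "wint (2 * m) \<zeta> (\<lambda>x. ?r x ^ (2 * m)) = wnorm m j \<zeta> h v f"
    by (simp add: wnorm_def power_mult_distrib)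
   have "wint (2 * m) \<zeta> (\<lambda>x. ?r (node x h v i) ^ (2 * m)) \<le> 2 ^ (2 * m) * wint (2 * m) \<zeta> (\<lambda>x. ?r x ^ (2 * m))
    + 2 ^ (2 * m) * (L * real m) ^ (2 * m) * 2 ^ (2 * m) * vol x0 R"
    by (rule cutoff_shift[OF c _ y h(1) _ hr i1 i2]) (use m r0 in auto)
   also have "\<dots> \<le> 2 ^ (2 * m) * (A * wnorm m m \<zeta> h v f + B) + 2 ^ (2 * m) * (L * real m) ^ (2 * m) * 2 ^ (2 * m) * vol x0 R"
   proof (intro add_right_mono mult_left_mono)
    have "wnorm m j \<zeta> h v f \<le> a j * wnorm m m \<zeta> h v f + b j" using Q[OF j] adf by (simp add: Q_def)
    also have "\<dots> \<le> A * wnorm m m \<zeta> h v f + B"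
     by (intro add_mono mult_right_mono aA bB j wnorm_nonneg)
    finally show "wint (2 * m) \<zeta> (\<lambda>x. ?r x ^ (2 * m)) \<le> A * wnorm m m \<zeta> h v f + B" unfolding W .
   qed simp
   also have "\<dots> = 2 ^ (2 * m) * A * wnorm m m \<zeta> h v f + C" using L by (simp add: C_def algebra_simps)
   also have "wnorm m m \<zeta> h v f = wsq (2 * m) \<zeta> ((dquot h v ^^ m) u) / \<omega>\<^sup>2"
    unfolding f_def using wnorm_top[of m \<omega> \<zeta> h v u c] \<omega> m by simp
   finally show "wint (2 * m) \<zeta> (osc_power m \<omega> h v u c j i)
   \<le> 2 ^ (2 * m) * A * (wsq (2 * m) \<zeta> ((dquot h v ^^ m) u) / \<omega>\<^sup>2) + C" unfolding f_def .
  qed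
 qed (use A0 in simp)
qed

section \<open>Elliptic integrands: the remainder and the energy\<close>

declare iter_dderiv_Cons [simp del]

context bounded_smooth
begin

lemma measurable_compose_iter_dderiv:
 assumes "borel_fun H" "\<And>x. H x \<in> K0"
 shows "borel_fun (\<lambda>x. iter_dderiv vs F (H x))"
proof -
 have "H \<in> borel \<rightarrow>\<^sub>M restrict_space borel U"
  using assms U(2) by (intro measurable_restrict_space2) auto
 moreover have "iter_dderiv vs F \<in> restrict_space borel U \<rightarrow>\<^sub>M borel"
  by (rule borel_measurable_continuous_on_restrict[OF cont])
 ultimately show ?thesis by (rule measurable_compose)
qed

end

text \<open>Ellipticity is demanded in symmetric directions only. This is enough because difference
  quotients of a symmetric-valued Hessian are symmetric, and it is all that can hold for an
  integrand depending on the symmetric part alone.\<close>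

locale elliptic = bounded_smooth U K0 F for U K0 :: "(real^'n^'n) set" and F +
 fixes \<Lambda> :: real
 assumes \<Lambda>: "\<Lambda> > 0" and sym: "K0 \<subseteq> sym_matrices"
  and elliptic: "\<And>\<xi> \<sigma>. \<xi> \<in> K0 \<Longrightarrow> \<sigma> \<in> sym_matrices \<Longrightarrow>
   \<Lambda> * (\<Sum>p\<in>UNIV. (ent p \<sigma>)\<^sup>2) \<le> (\<Sum>p\<in>UNIV. \<Sum>q\<in>UNIV. ent p \<sigma> * ent q \<sigma> * iter_dderiv [munit q, munit p] F \<xi>)"
begin

text \<open>The values lie in one convex set of diameter at most \<omega> at every point, and not
  only almost everywhere, so that the values along any grid line form an admissible
  sequence.\<close>

definition osc_data :: "real \<Rightarrow> (real^'n \<Rightarrow> real^'n^'n) \<Rightarrow> bool"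
 where "osc_data \<omega> H \<longleftrightarrow> (\<exists>K. K \<subseteq> K0 \<and> convex K \<and> (\<forall>\<xi>\<in>K. \<forall>\<eta>\<in>K. norm (\<xi> - \<eta>) \<le> \<omega>) \<and> (\<forall>x. H x \<in> K)) \<and> borel_fun H"

definition energy :: "nat \<Rightarrow> (real^'n \<Rightarrow> real) \<Rightarrow> real \<Rightarrow> real^'n \<Rightarrow> (real^'n \<Rightarrow> real) \<Rightarrow> real"
 where "energy m \<zeta> h v u = wsq (2 * m) \<zeta> ((dquot h v ^^ m) u)"

lemma energy_nonneg: "energy m \<zeta> h v u \<ge> 0"
 unfolding energy_def by (intro Bochner_Integration.integral_nonneg) (simp add: power_mult)

definition remainder :: "nat \<Rightarrow> real \<Rightarrow> real^'n \<Rightarrow> (real^'n \<Rightarrow> real^'n^'n) \<Rightarrow> 'n \<times> 'n \<Rightarrow> real^'n \<Rightarrow> real"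
 where "remainder m h v H p x = (dquot h v ^^ m) (\<lambda>x. iter_dderiv [munit p] F (H x)) x
  - (\<Sum>q\<in>UNIV. iter_dderiv [munit q, munit p] F (H x) * (dquot h v ^^ m) (ents q H) x)"

lemma ent_measurable [measurable]:
 assumes [measurable]: "borel_fun H"
 shows "borel_fun (ents q H)"
 unfolding munit_inner[symmetric] by measurable

lemma remainder_measurable:
 assumes "osc_data \<omega> H"
 shows "borel_fun (remainder m h v H p)"
proof -
 have H: "borel_fun H" "\<And>x. H x \<in> K0" using assms by (auto simp: osc_data_def)
 note [measurable] = dquot_pow_measurable[OF measurable_compose_iter_dderiv[OF H]] measurable_compose_iter_dderiv[OF H]
  dquot_pow_measurable[OF ent_measurable[OF H(1)]]
 show ?thesis unfolding remainder_def by measurable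
qed

lemma osc_data_admissible:
 assumes "osc_data \<omega> H" "0 < h" "h \<le> 1" "norm v \<le> 1" "cutoff L x0 R \<zeta>"
 shows "admissible_osc L x0 R \<omega> h v (ents q H) (ent q (H 0)) \<zeta>"
proof -
 have "\<bar>ent q (H x) - ent q (H 0)\<bar> \<le> \<omega>" for x
 proof -
  have "norm (H x - H 0) \<le> \<omega>" using assms(1) by (auto simp: osc_data_def)
  moreover have "ent q (H x) - ent q (H 0) = ent q (H x - H 0)" by (simp add: ent_def)
  ultimately show ?thesis using abs_ent_le_norm[of q "H x - H 0"] by simp
 qed
 thus ?thesis using assms ent_measurable by (auto simp: admissible_osc_def osc_data_def)
qed

text \<open>The sum on the right, called \<open>Y\<close> below, collects the roots of the
  normalised quotients of all entries, at all orders and nodes involved. Differences of order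
  \<open>j\<close> along the grid are then at most \<open>\<omega> * (h * Y) ^ j\<close>, so the
  values of \<open>H\<close> form an admissible sequence and the quadratic remainder applies; the
  factor \<open>h ^ m\<close> cancels.\<close>

lemma remainder_pointwise:
 assumes m: "m > 0"
 shows "\<exists>C\<ge>0. \<forall>H \<omega> h v p x. osc_data \<omega> H \<longrightarrow> 0 < \<omega> \<longrightarrow> \<omega> \<le> 1 \<longrightarrow> 0 < h \<longrightarrow>
  \<bar>remainder m h v H p x\<bar> \<le> C * \<omega>\<^sup>2 *
   (\<Sum>(q, j, i)\<in>UNIV \<times> {0<..m} \<times> {..m}. root j \<bar>(dquot h v ^^ j) (osc_ent \<omega> H q) (node x h v i)\<bar>) ^ m"
proof -
 define P where "P p C \<longleftrightarrow> C \<ge> 0 \<and> (\<forall>X \<omega> Y K. admissible_seq m \<omega> Y K X \<longrightarrow>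
   \<bar>(fdiff 1 ^^ m) (\<lambda>k. iter_dderiv [munit p] F (X k)) 0
    - (\<Sum>b\<in>Basis. iter_dderiv (b # [munit p]) F (X 0) * (fdiff 1 ^^ m) (\<lambda>k. X k \<bullet> b) 0)\<bar> \<le> C * \<omega>\<^sup>2 * Y ^ m)" for p C
 define c where "c p = (SOME C. P p C)" for p
 have P: "P p (c p)" for p
  unfolding c_def by (rule someI_ex) (unfold P_def, rule composition_remainder[OF m])
 define C where "C = (\<Sum>p\<in>UNIV. c p)"
 have cC: "c p \<le> C" for p unfolding C_def using P by (intro member_le_sum) (auto simp: P_def)
 have C0: "C \<ge> 0" unfolding C_def using P by (intro sum_nonneg) (auto simp: P_def)
 show ?thesis
 proof (rule exI[of _ C], intro conjI allI impI C0)
  fix H \<omega> h v p x assume osc: "osc_data \<omega> H" and \<omega>: "0 < \<omega>" "\<omega> \<le> 1" and h: "0 < (h::real)"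
  obtain K where K: "K \<subseteq> K0" "convex K" "\<And>\<xi> \<eta>. \<xi> \<in> K \<Longrightarrow> \<eta> \<in> K \<Longrightarrow> norm (\<xi> - \<eta>) \<le> \<omega>" "\<And>x. H x \<in> K"
   using osc unfolding osc_data_def by metis
  define f where "f q x = (ent q (H x) - ent q (H 0)) / \<omega>" for q x
  define Y where "Y = (\<Sum>(q, j, i)\<in>UNIV \<times> {0<..m} \<times> {..m}. root j \<bar>(dquot h v ^^ j) (f q) (node x h v i)\<bar>)"
  define X where "X k = H (node x h v k)" for k
  have Y0: "Y \<ge> 0" unfolding Y_def by (intro sum_nonneg) (auto simp: real_root_ge_zero)
  have fd: "(fdiff 1 ^^ j) (\<lambda>k. g (node x h v k)) k = h ^ j * (dquot h v ^^ j) g (node x h v k)" for j g k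
   using dquot_pow_eq_fdiff[of h j v g x k] h by (simp add: power_divide)
  have ad: "admissible_seq m \<omega> (h * Y) K X"
   unfolding admissible_seq_def
  proof (intro conjI ballI allI impI)
   fix b :: "real^'n^'n" and j k assume b: "b \<in> Basis" and j: "1 \<le> j" "j + k \<le> m"
   have "b \<in> range munit" using b bij_munit[where 'n='n] by (simp add: bij_betw_def)
   then obtain q where q: "b = munit q" by auto
   have r0: "root j \<bar>(dquot h v ^^ j) (f q) (node x h v k)\<bar> \<le> Y"
    unfolding Y_def using j member_le_sum[of "(q, j, k)" "UNIV \<times> {0<..m} \<times> {..m}" "\<lambda>(q, j, i). root j \<bar>(dquot h v ^^ j) (f q) (node x h v i)\<bar>"]
    by (auto simp: real_root_ge_zero)
   have "\<bar>(dquot h v ^^ j) (f q) (node x h v k)\<bar> = root j \<bar>(dquot h v ^^ j) (f q) (node x h v k)\<bar> ^ j"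
    using j by simp
   also have "\<dots> \<le> Y ^ j" using r0 by (intro power_mono) (auto simp: real_root_ge_zero)
   finally have bd: "\<bar>(dquot h v ^^ j) (f q) (node x h v k)\<bar> \<le> Y ^ j" .
   have "(fdiff 1 ^^ j) (\<lambda>k. X k \<bullet> b) k = h ^ j * (dquot h v ^^ j) (ents q H) (node x h v k)"
    unfolding X_def q munit_inner by (rule fd)
   also have "\<dots> = \<omega> * (h ^ j * (dquot h v ^^ j) (f q) (node x h v k))"
    unfolding f_def using j \<omega> by (subst normalized_dquot) auto
   also have "\<bar>\<dots>\<bar> \<le> \<omega> * (h * Y) ^ j"
    using bd \<omega> h by (simp add: abs_mult power_mult_distrib mult_left_mono)
   finally show "\<bar>(fdiff 1 ^^ j) (\<lambda>k. X k \<bullet> b) k\<bar> \<le> \<omega> * (h * Y) ^ j" .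
  qed (use \<omega> Y0 h K in \<open>auto simp: X_def\<close>)
  have eq: "(fdiff 1 ^^ m) (\<lambda>k. iter_dderiv [munit p] F (X k)) 0
    - (\<Sum>b\<in>Basis. iter_dderiv (b # [munit p]) F (X 0) * (fdiff 1 ^^ m) (\<lambda>k. X k \<bullet> b) 0) = h ^ m * remainder m h v H p x"
  proof -
   have "(fdiff 1 ^^ m) (\<lambda>k. iter_dderiv [munit p] F (X k)) 0 = h ^ m * (dquot h v ^^ m) (\<lambda>x. iter_dderiv [munit p] F (H x)) x"
    unfolding X_def using fd[of m "\<lambda>x. iter_dderiv [munit p] F (H x)" 0] by simp
   moreover have "(fdiff 1 ^^ m) (\<lambda>k. X k \<bullet> munit q) 0 = h ^ m * (dquot h v ^^ m) (ents q H) x" for q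
    unfolding X_def munit_inner using fd[of m "\<lambda>x. ent q (H x)" 0] by simp
   ultimately show ?thesis
    unfolding sum_Basis_munit remainder_def by (simp add: X_def right_diff_distrib sum_distrib_left mult.left_commute)
  qed
  have "h ^ m * \<bar>remainder m h v H p x\<bar> = \<bar>h ^ m * remainder m h v H p x\<bar>" using h by (simp add: abs_mult)
  also have "\<dots> \<le> c p * \<omega>\<^sup>2 * (h * Y) ^ m" unfolding eq[symmetric] using P[of p] ad by (auto simp only: P_def)
  also have "\<dots> \<le> C * \<omega>\<^sup>2 * (h * Y) ^ m" using cC Y0 h by (intro mult_right_mono) auto
  finally have "h ^ m * \<bar>remainder m h v H p x\<bar> \<le> h ^ m * (C * \<omega>\<^sup>2 * Y ^ m)" by (simp add: power_mult_distrib mult.left_commute)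
  hence "\<bar>remainder m h v H p x\<bar> \<le> C * \<omega>\<^sup>2 * Y ^ m" using h by simp
  thus "\<bar>remainder m h v H p x\<bar> \<le> C * \<omega>\<^sup>2 *
   (\<Sum>(q, j, i)\<in>UNIV \<times> {0<..m} \<times> {..m}. root j \<bar>(dquot h v ^^ j) (osc_ent \<omega> H q) (node x h v i)\<bar>) ^ m"
   unfolding Y_def f_def .
 qed
qed

text \<open>Squaring the pointwise bound gives \<omega>^4 times powers \<open>2 * m\<close> of the
  roots. Interpolation bounds each of these by a multiple of the energy over \<omega>^2, plus a
  constant; the surviving factor \<omega>^2 makes the remainder absorbable.\<close>

lemma remainder_L2:
 assumes m: "m > 0"
 shows "\<exists>C1\<ge>0. \<forall>L x0 R \<omega>. 0 < \<omega> \<longrightarrow> \<omega> \<le> 1 \<longrightarrow> (\<exists>C2\<ge>0. \<forall>H h v \<zeta> p. osc_data \<omega> H \<longrightarrow> 0 < h \<longrightarrow> h \<le> 1 \<longrightarrow> norm v \<le> 1 \<longrightarrow>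
  cutoff L x0 R \<zeta> \<longrightarrow> integrable lborel (\<lambda>x. \<zeta> x ^ (2 * m) * (remainder m h v H p x)\<^sup>2) \<and>
  wsq (2 * m) \<zeta> (remainder m h v H p) \<le> C1 * \<omega>\<^sup>2 * (\<Sum>q\<in>UNIV. energy m \<zeta> h v (ents q H)) + C2)"
proof -
 let ?I = "(UNIV :: ('n \<times> 'n) set) \<times> {0<..m} \<times> {..m}"
 define N where "N = real (card ?I)"
 obtain C where C: "C \<ge> 0" and pw: "\<And>H \<omega> h v p x. osc_data \<omega> H \<Longrightarrow> 0 < \<omega> \<Longrightarrow> \<omega> \<le> 1 \<Longrightarrow> 0 < h \<Longrightarrow>
  \<bar>remainder m h v H p x\<bar> \<le> C * \<omega>\<^sup>2 * (\<Sum>(q, j, i)\<in>?I. root j \<bar>(dquot h v ^^ j) (osc_ent \<omega> H q) (node x h v i)\<bar>) ^ m"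
  using remainder_pointwise[OF m] by blast
 obtain A where A: "A \<ge> 0" and gn: "\<And>L (x0::real^'n) R \<omega>. \<omega> > 0 \<Longrightarrow> (\<exists>C\<ge>0. \<forall>h v u c \<zeta> j i. admissible_osc L x0 R \<omega> h v u c \<zeta> \<longrightarrow> 0 < j \<longrightarrow> j \<le> m \<longrightarrow> i \<le> m \<longrightarrow>
  wint (2 * m) \<zeta> (osc_power m \<omega> h v u c j i)
   \<le> A * (wsq (2 * m) \<zeta> ((dquot h v ^^ m) u) / \<omega>\<^sup>2) + C)"
  using root_dquot_interpolation[OF m] by blast
 have N0: "N \<ge> 0" by (simp add: N_def)
 show ?thesis
 proof (rule exI[of _ "C\<^sup>2 * N ^ (2 * m) * (N * A)"], intro conjI allI impI)
  fix L R \<omega> :: real and x0 :: "real^'n" assume \<omega>: "0 < \<omega>" "\<omega> \<le> 1"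
  obtain B where B: "B \<ge> 0" and gn': "\<And>h v u c \<zeta> j i. admissible_osc L x0 R \<omega> h v u c \<zeta> \<Longrightarrow> 0 < j \<Longrightarrow> j \<le> m \<Longrightarrow> i \<le> m \<Longrightarrow>
   wint (2 * m) \<zeta> (osc_power m \<omega> h v u c j i)
   \<le> A * (wsq (2 * m) \<zeta> ((dquot h v ^^ m) u) / \<omega>\<^sup>2) + B"
   using gn[OF \<omega>(1), of L x0 R] by blast
  define C2 where "C2 = C\<^sup>2 * (\<omega>\<^sup>2)\<^sup>2 * N ^ (2 * m) * (N * B)"
  have C2: "C2 \<ge> 0" using B N0 by (simp add: C2_def)
  show "\<exists>C2\<ge>0. \<forall>H h v \<zeta> p. osc_data \<omega> H \<longrightarrow> 0 < h \<longrightarrow> h \<le> 1 \<longrightarrow> norm v \<le> 1 \<longrightarrow>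
   cutoff L x0 R \<zeta> \<longrightarrow> integrable lborel (\<lambda>x. \<zeta> x ^ (2 * m) * (remainder m h v H p x)\<^sup>2) \<and>
   wsq (2 * m) \<zeta> (remainder m h v H p) \<le> C\<^sup>2 * N ^ (2 * m) * (N * A) * \<omega>\<^sup>2 * (\<Sum>q\<in>UNIV. energy m \<zeta> h v (ents q H)) + C2"
  proof (rule exI[of _ C2], intro conjI[OF C2] allI impI)
   fix H and h :: real and v :: "real^'n" and \<zeta> and p :: "'n \<times> 'n" assume osc: "osc_data \<omega> H" and h: "0 < h" "h \<le> (1::real)" and v: "norm v \<le> 1" and c: "cutoff L x0 R \<zeta>"
   define \<rho> where "\<rho> = (\<lambda>(q, j, i) x. root j \<bar>(dquot h v ^^ j) (osc_ent \<omega> H q) (node x h v i)\<bar>)"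
   define E where "E = (\<Sum>q\<in>UNIV. energy m \<zeta> h v (ents q H))"
   have cz: "0 \<le> \<zeta> x" for x using c by (auto simp: cutoff_def)
   have \<rho>0: "\<rho> i x \<ge> 0" for i x by (auto simp: \<rho>_def real_root_ge_zero split: prod.splits)
   have adq: "admissible_osc L x0 R \<omega> h v (ents q H) (ent q (H 0)) \<zeta>" for q
    by (rule osc_data_admissible[OF osc h v c])
   have ad: "borel_fun (osc_ent \<omega> H q)" "\<And>x. \<bar>(ent q (H x) - ent q (H 0)) / \<omega>\<bar> \<le> 1" for q
    using admissible_osc_normalized[OF adq \<omega>(1), of q] by (auto simp: admissible_def)
   have \<rho>i: "integrable lborel (\<lambda>x. \<zeta> x ^ (2 * m) * \<rho> t x ^ (2 * m))" for t
   proof -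
    obtain q j i where t: "t = (q, j, i)" by (metis prod_cases3)
    note [measurable] = dquot_pow_measurable[OF ad(1)[of q]]
    show ?thesis unfolding t \<rho>_def prod.case
    proof (rule cutoff_power_integrable[OF c, of _ "(2 / h) ^ (2 * m)"])
     fix x
     have "root j \<bar>(dquot h v ^^ j) (osc_ent \<omega> H q) (node x h v i)\<bar> \<le> 2 / h"
      using root_dquot_bound[OF h(1) ad(2)[of q], where j=j and v=v and x="x + real i *\<^sub>R (h *\<^sub>R v)"] h by (simp add: field_simps)
     thus "\<bar>root j \<bar>(dquot h v ^^ j) (osc_ent \<omega> H q) (node x h v i)\<bar> ^ (2 * m)\<bar> \<le> (2 / h) ^ (2 * m)"
      unfolding power_abs by (intro power_mono) (auto simp: real_root_ge_zero)
    qed (use m in auto)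
   qed
   have bd: "\<zeta> x ^ (2 * m) * (remainder m h v H p x)\<^sup>2 \<le> C\<^sup>2 * (\<omega>\<^sup>2)\<^sup>2 * N ^ (2 * m) * (\<Sum>t\<in>?I. \<zeta> x ^ (2 * m) * \<rho> t x ^ (2 * m))" for x
   proof -
    have "\<bar>remainder m h v H p x\<bar> \<le> C * \<omega>\<^sup>2 * (\<Sum>t\<in>?I. \<rho> t x) ^ m"
     using pw[OF osc \<omega> h(1), of v p x] by (simp add: \<rho>_def split_def)
    hence "(remainder m h v H p x)\<^sup>2 \<le> (C * \<omega>\<^sup>2 * (\<Sum>t\<in>?I. \<rho> t x) ^ m)\<^sup>2"
     using power_mono[of "\<bar>remainder m h v H p x\<bar>" _ 2] by simp
    also have "\<dots> = C\<^sup>2 * (\<omega>\<^sup>2)\<^sup>2 * (\<Sum>t\<in>?I. \<rho> t x) ^ (2 * m)"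
     by (simp only: power_mult_distrib power_mult[symmetric] mult.commute[of m 2])
    also have "\<dots> \<le> C\<^sup>2 * (\<omega>\<^sup>2)\<^sup>2 * (N ^ (2 * m) * (\<Sum>t\<in>?I. \<rho> t x ^ (2 * m)))"
     unfolding N_def using \<rho>0 m by (intro mult_left_mono sum_power_le) auto
    finally have "\<zeta> x ^ (2 * m) * (remainder m h v H p x)\<^sup>2 \<le> \<zeta> x ^ (2 * m) * (C\<^sup>2 * (\<omega>\<^sup>2)\<^sup>2 * (N ^ (2 * m) * (\<Sum>t\<in>?I. \<rho> t x ^ (2 * m))))"
     using cz by (intro mult_left_mono) auto
    thus ?thesis by (simp add: sum_distrib_left mult.assoc mult.left_commute)
   qed
   have domi: "integrable lborel (\<lambda>x. C\<^sup>2 * (\<omega>\<^sup>2)\<^sup>2 * N ^ (2 * m) * (\<Sum>t\<in>?I. \<zeta> x ^ (2 * m) * \<rho> t x ^ (2 * m)))"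
    by (intro integrable_mult_right Bochner_Integration.integrable_sum \<rho>i)
   have pos: "0 \<le> \<zeta> x ^ (2 * m) * (remainder m h v H p x)\<^sup>2" for x using cz by simp
   have i: "integrable lborel (\<lambda>x. \<zeta> x ^ (2 * m) * (remainder m h v H p x)\<^sup>2)"
   proof (rule Bochner_Integration.integrable_bound[OF domi])
    note [measurable] = cutoff_measurable[OF c] remainder_measurable[OF osc]
    show "(\<lambda>x. \<zeta> x ^ (2 * m) * (remainder m h v H p x)\<^sup>2) \<in> borel_measurable lborel" by measurable
    show "AE x in lborel. norm (\<zeta> x ^ (2 * m) * (remainder m h v H p x)\<^sup>2) \<le> norm (C\<^sup>2 * (\<omega>\<^sup>2)\<^sup>2 * N ^ (2 * m) * (\<Sum>t\<in>?I. \<zeta> x ^ (2 * m) * \<rho> t x ^ (2 * m)))"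
     unfolding real_norm_def abs_of_nonneg[OF pos] by (rule AE_I2, rule order.trans[OF bd abs_ge_self])
   qed
   have "wsq (2 * m) \<zeta> (remainder m h v H p) \<le> (\<integral>x. C\<^sup>2 * (\<omega>\<^sup>2)\<^sup>2 * N ^ (2 * m) * (\<Sum>t\<in>?I. \<zeta> x ^ (2 * m) * \<rho> t x ^ (2 * m)) \<partial>lborel)"
    by (rule integral_mono[OF i domi bd])
   also have "\<dots> = C\<^sup>2 * (\<omega>\<^sup>2)\<^sup>2 * N ^ (2 * m) * (\<Sum>t\<in>?I. wint (2 * m) \<zeta> (\<lambda>x. \<rho> t x ^ (2 * m)))"
    using \<rho>i by (simp add: Bochner_Integration.integral_sum)
   also have "\<dots> \<le> C\<^sup>2 * (\<omega>\<^sup>2)\<^sup>2 * N ^ (2 * m) * (\<Sum>t\<in>?I. A * (E / \<omega>\<^sup>2) + B)"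
   proof (intro mult_left_mono sum_mono)
    fix t assume "t \<in> ?I"
    then obtain q j i where t: "t = (q, j, i)" "0 < j" "j \<le> m" "i \<le> m" by auto
    have "wint (2 * m) \<zeta> (\<lambda>x. \<rho> t x ^ (2 * m)) \<le> A * (energy m \<zeta> h v (ents q H) / \<omega>\<^sup>2) + B"
     unfolding t(1) \<rho>_def prod.case energy_def by (rule gn'[OF adq t(2-4)])
    also have "\<dots> \<le> A * (E / \<omega>\<^sup>2) + B"
     unfolding E_def using A energy_nonneg by (intro add_right_mono mult_left_mono divide_right_mono member_le_sum) auto
    finally show "wint (2 * m) \<zeta> (\<lambda>x. \<rho> t x ^ (2 * m)) \<le> A * (E / \<omega>\<^sup>2) + B" .
   qed (use N0 in auto)
   also have "\<dots> = C\<^sup>2 * N ^ (2 * m) * (N * A) * \<omega>\<^sup>2 * E + C2"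
    unfolding sum_constant N_def[symmetric] C2_def using \<omega> by (simp add: field_simps power2_eq_square)
   finally show "integrable lborel (\<lambda>x. \<zeta> x ^ (2 * m) * (remainder m h v H p x)\<^sup>2) \<and>
    wsq (2 * m) \<zeta> (remainder m h v H p) \<le> C\<^sup>2 * N ^ (2 * m) * (N * A) * \<omega>\<^sup>2 * (\<Sum>q\<in>UNIV. energy m \<zeta> h v (ents q H)) + C2"
    unfolding E_def by (intro conjI i)
  qed
 qed (use N0 A in simp)
qed

text \<open>\<open>w k\<close> approximates a function whose Hessian is \<open>H\<close> on \<open>ball x0 R'\<close>.\<close>

definition solution_data :: "real^'n \<Rightarrow> real \<Rightarrow> real \<Rightarrow> (nat \<Rightarrow> real^'n \<Rightarrow> real) \<Rightarrow> (real^'n \<Rightarrow> real^'n^'n) \<Rightarrow> bool"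
 where "solution_data x0 R' M w H \<longleftrightarrow> (\<forall>k. smooth (w k)) \<and>
  (\<forall>k p. \<forall>x\<in>ball x0 R'. \<bar>pd2 p (w k) x\<bar> \<le> M) \<and>
  (\<forall>p. AE x in lborel. x \<in> ball x0 R' \<longrightarrow> (\<lambda>k. pd2 p (w k) x) \<longlonglongrightarrow> ent p (H x)) \<and>
  (\<forall>\<eta>. test_function (ball x0 R') \<eta> \<longrightarrow>
   first_var F H \<eta> = 0)"

text \<open>Ellipticity and Young's inequality against the remainder give
  \<open>3 * \<Lambda> / 4\<close> times the energy. The coefficient quotients, the lower order
  terms and the remainder are each allotted \<open>\<Lambda> / 8\<close> through \<kappa>,
  \<epsilon> and \<omega>, and \<open>3 * \<Lambda> / 8\<close> is left over. Here \<omega> depends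
  only on \<Lambda>, bounds of the integrand and the cutoff-free constant \<open>C1\<close>, whereas
  \<epsilon> is chosen once the cutoff is known.\<close>

theorem energy_bound:
 assumes m: "m \<ge> 3"
 obtains \<omega> where "0 < \<omega>" "\<omega> \<le> 1"
  "\<And>H R r R' L L1 x0 \<zeta> w M. osc_data \<omega> H \<Longrightarrow> R > 0 \<Longrightarrow> r > 0 \<Longrightarrow> R + 2 * r \<le> R' \<Longrightarrow>
   good_cutoff L L1 x0 R \<zeta> \<Longrightarrow> solution_data x0 R' M w H \<Longrightarrow>
   \<exists>C. \<forall>s h q. 0 < h \<longrightarrow> h \<le> 1 \<longrightarrow> real m * h \<le> r \<longrightarrow> energy m \<zeta> h (axis s 1) (ents q H) \<le> C"
proof -
 define n2 where "n2 = real CARD('n \<times> 'n)"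
 define b where "b = (\<Sum>p\<in>UNIV. \<Sum>q\<in>UNIV. bound [munit q, munit p :: real^'n^'n])"
 \<comment> \<open>Factor in the bound of the squared coefficient quotients by the energy:
   \<open>b\<close> bounds second derivatives of the integrand, one \<open>n2\<close> comes from
   Cauchy--Schwarz over the entries, the other from summing over \<open>p\<close>.\<close>
 define Ca where "Ca = n2 * (2 * b\<^sup>2 * n2)"
 define \<kappa> where "\<kappa> = \<Lambda> / (8 * (Ca + 1))"
 have m0: "m > 0" using m by simp
 obtain C1 where C1: "C1 \<ge> 0" and rem: "\<And>L x0 R \<omega>. 0 < \<omega> \<Longrightarrow> \<omega> \<le> 1 \<Longrightarrow> (\<exists>C2\<ge>0. \<forall>H h v \<zeta> p. osc_data \<omega> H \<longrightarrow> 0 < h \<longrightarrow> h \<le> 1 \<longrightarrow> norm v \<le> 1 \<longrightarrow>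
  cutoff L x0 R \<zeta> \<longrightarrow> integrable lborel (\<lambda>x. \<zeta> x ^ (2 * m) * (remainder m h v H p x)\<^sup>2) \<and>
  wsq (2 * m) \<zeta> (remainder m h v H p) \<le> C1 * \<omega>\<^sup>2 * (\<Sum>q\<in>UNIV. energy m \<zeta> h v (ents q H)) + C2)"
  using remainder_L2[OF m0] by blast
 have n2: "n2 \<ge> 0" by (simp add: n2_def)
 have b: "\<bar>iter_dderiv [munit q, munit p] F \<xi>\<bar> \<le> b" "b \<ge> 0" if "\<xi> \<in> K0" for p q :: "'n \<times> 'n" and \<xi>
 proof -
  have "bound [munit q, munit p] \<le> (\<Sum>q\<in>UNIV. bound [munit q, munit p])"
   by (intro member_le_sum bound) auto
  also have "\<dots> \<le> b" unfolding b_def by (intro member_le_sum sum_nonneg bound) auto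
  finally show "\<bar>iter_dderiv [munit q, munit p] F \<xi>\<bar> \<le> b" using bound(2)[OF that, of "[munit q, munit p]"] by linarith
  thus "b \<ge> 0" by linarith
 qed
 have Ca: "Ca \<ge> 0" using n2 by (simp add: Ca_def)
 have \<kappa>: "\<kappa> > 0" "\<kappa> * Ca \<le> \<Lambda> / 8" using \<Lambda> Ca by (auto simp: \<kappa>_def field_simps)
 \<comment> \<open>Total weight of the remainder integrals: \<open>1 / \<Lambda>\<close> from the
   lower bound and \<open>2 * \<kappa>\<close> from the coefficient quotients, summed over the
   \<open>n2\<close> entries.\<close>
 define T where "T = (1 / \<Lambda> + 2 * \<kappa>) * n2"
 have T: "T \<ge> 0" using \<Lambda> \<kappa> n2 by (simp add: T_def)
 define \<omega> where "\<omega> = min 1 (\<Lambda> / (8 * (T * C1 + 1)))"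
 have TC: "T * C1 \<ge> 0" using T C1 by simp
 have \<omega>: "0 < \<omega>" "\<omega> \<le> 1" using \<Lambda> TC by (auto simp: \<omega>_def)
 have \<omega>2: "T * (C1 * \<omega>\<^sup>2) \<le> \<Lambda> / 8"
 proof -
  have "\<omega>\<^sup>2 \<le> \<omega>" using \<omega> by (simp add: power2_eq_square mult_left_le)
  also have "\<omega> \<le> \<Lambda> / (8 * (T * C1 + 1))" by (simp add: \<omega>_def)
  finally have "T * C1 * \<omega>\<^sup>2 \<le> T * C1 * (\<Lambda> / (8 * (T * C1 + 1)))" using TC by (rule mult_left_mono)
  also have "\<dots> \<le> \<Lambda> / 8" using TC \<Lambda> by (simp add: field_simps)
  finally show ?thesis by (simp add: mult.assoc)
 qed
 show thesis
 proof (rule that[OF \<omega>])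
  fix H R r R' L L1 and x0 :: "real^'n" and \<zeta> w M
  assume osc: "osc_data \<omega> H" and R: "R > 0" and r: "r > 0" and R': "R + 2 * r \<le> R'"
   and z: "good_cutoff L L1 x0 R \<zeta>" and sol: "solution_data x0 R' M w H"
  have c: "cutoff L x0 R \<zeta>" and L1: "L1 \<ge> 0" using z by (auto simp: good_cutoff_def)
  have cz: "0 \<le> \<zeta> x" "L \<ge> 0" for x using c by (auto simp: cutoff_def)
  have Hm [measurable]: "borel_fun H" and HK: "\<And>x. H x \<in> K0" using osc by (auto simp: osc_data_def)
  have ws: "\<And>k. smooth (w k)" and wM: "\<And>k p x. x \<in> ball x0 R' \<Longrightarrow> \<bar>pd2 p (w k) x\<bar> \<le> M"
   and wlim: "\<And>p. AE x in lborel. x \<in> ball x0 R' \<longrightarrow> (\<lambda>k. pd2 p (w k) x) \<longlonglongrightarrow> ent p (H x)"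
   and eq: "\<And>\<eta>. test_function (ball x0 R') \<eta> \<Longrightarrow> first_var F H \<eta> = 0"
   using sol by (auto simp: solution_data_def)
  define Q where "Q = 3 * (4 * (real m)\<^sup>2 * (L1 + L1\<^sup>2))\<^sup>2 / \<kappa>"
  have Q: "Q \<ge> 0" using \<kappa> by (simp add: Q_def)
  define V1 where "V1 = 4 ^ m * L ^ (2 * (m - 1)) * (4 ^ m * M\<^sup>2) * vol x0 R"
  define V2 where "V2 = 4 ^ m * (L * 2) ^ (2 * (m - 2)) * (4 ^ m * M\<^sup>2) * vol x0 R"
  \<comment> \<open>The lower order sums enter with total factor \<open>n2 * Q * 3 * 4 ^ m\<close>:
    twice through first derivatives of the cutoff power, once through its second derivative.\<close>
  define \<epsilon> where "\<epsilon> = \<Lambda> / (8 * (n2 * Q * 3 * 4 ^ m + 1))"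
  have nQ: "n2 * Q * 3 * 4 ^ m \<ge> 0" using n2 Q by simp
  hence \<epsilon>: "\<epsilon> > 0" "n2 * Q * 3 * 4 ^ m * \<epsilon> \<le> \<Lambda> / 8" using \<Lambda> by (auto simp: \<epsilon>_def field_simps add_pos_nonneg)
  obtain C2 where C2: "C2 \<ge> 0" and rem': "\<And>h v \<zeta> p. 0 < h \<Longrightarrow> h \<le> 1 \<Longrightarrow> norm v \<le> 1 \<Longrightarrow>
   cutoff L x0 R \<zeta> \<Longrightarrow> integrable lborel (\<lambda>x. \<zeta> x ^ (2 * m) * (remainder m h v H p x)\<^sup>2) \<and>
   wsq (2 * m) \<zeta> (remainder m h v H p) \<le> C1 * \<omega>\<^sup>2 * (\<Sum>q\<in>UNIV. energy m \<zeta> h v (ents q H)) + C2"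
   using rem[OF \<omega>, of L x0 R] osc by blast
  obtain C3 where C3: "C3 \<ge> 0" and low1: "\<And>h v u c \<zeta>. admissible_osc L x0 R \<omega> h v u c \<zeta> \<Longrightarrow>
   (\<integral>x. \<zeta> x ^ (2 * (m - 1)) * ((dquot h v ^^ (m - 1)) u x)\<^sup>2 \<partial>lborel) \<le> \<epsilon> * energy m \<zeta> h v u + C3"
   using lower_order_interpolation[of "m - 1" m \<epsilon> \<omega> L x0 R] m \<epsilon>(1) \<omega>(1) unfolding energy_def by auto
  obtain C4 where C4: "C4 \<ge> 0" and low2: "\<And>h v u c \<zeta>. admissible_osc L x0 R \<omega> h v u c \<zeta> \<Longrightarrow>
   (\<integral>x. \<zeta> x ^ (2 * (m - 2)) * ((dquot h v ^^ (m - 2)) u x)\<^sup>2 \<partial>lborel) \<le> \<epsilon> * energy m \<zeta> h v u + C4"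
   using lower_order_interpolation[of "m - 2" m \<epsilon> \<omega> L x0 R] m \<epsilon>(1) \<omega>(1) unfolding energy_def by auto
  define D0 where "D0 = n2 * Q * (2 * (n2 * (4 ^ m * C3 + V1)) + n2 * (4 ^ m * C4 + V2))"
  define D where "D = T * C2 + D0"
  show "\<exists>C. \<forall>s h q. 0 < h \<longrightarrow> h \<le> 1 \<longrightarrow> real m * h \<le> r \<longrightarrow> energy m \<zeta> h (axis s 1) (ents q H) \<le> C"
  proof (intro exI[of _ "8 * D / (3 * \<Lambda>)"] allI impI)
   fix s :: 'n and h :: real and q :: "'n \<times> 'n"
   assume h: "0 < h" "h \<le> 1" "real m * h \<le> r"
   define v where "v = (axis s 1 :: real^'n)"
   have nv: "norm v \<le> 1" by (simp add: v_def)
   define A where "A p x = iter_dderiv [munit p] F (H x)" for p x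
   define a where "a p = (dquot h v ^^ m) (A p)" for p
   define \<sigma> where "\<sigma> p = (dquot h v ^^ m) (ents p H)" for p
   define RR where "RR p = remainder m h v H p" for p
   let ?i = "\<lambda>f. wint (2 * m) \<zeta> (\<lambda>x. f x)"
   let ?IA = "\<lambda>p. ?i (\<lambda>x. (a p x)\<^sup>2)" and ?IR = "\<lambda>p. ?i (\<lambda>x. (RR p x)\<^sup>2)" and ?IP = "\<lambda>p. ?i (\<lambda>x. a p x * \<sigma> p x)" and ?IS = "\<lambda>p. ?i (\<lambda>x. (\<sigma> p x)\<^sup>2)"
   define E where "E = (\<Sum>p\<in>UNIV. energy m \<zeta> h v (ents p H))"
   define Rs where "Rs = (\<Sum>p\<in>UNIV. ?IR p)"
   have Am: "borel_fun (A p)" for p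
    unfolding A_def by (rule measurable_compose_iter_dderiv[OF Hm HK])
   define BA where "BA = (\<Sum>p\<in>UNIV. bound [munit p :: real^'n^'n])"
   have Ab: "\<bar>A p x\<bar> \<le> BA" for p x
   proof -
    have "\<bar>A p x\<bar> \<le> bound [munit p]" unfolding A_def by (rule bound(2)[OF HK])
    also have "\<dots> \<le> BA" unfolding BA_def by (intro member_le_sum bound) auto
    finally show ?thesis .
   qed
   have am [measurable]: "borel_fun (a p)" for p unfolding a_def by (rule dquot_pow_measurable[OF Am])
   have ab: "\<bar>a p x\<bar> \<le> (2 / h) ^ m * BA" for p x unfolding a_def by (rule dquot_pow_bound[OF h(1) Ab])
   have adq: "admissible_osc L x0 R \<omega> h v (ents q H) (ent q (H 0)) \<zeta>" for q
    by (rule osc_data_admissible[OF osc h(1,2) nv c])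
   have \<sigma>m [measurable]: "borel_fun (\<sigma> p)" for p
    unfolding \<sigma>_def by (rule dquot_pow_measurable[OF ent_measurable[OF Hm]])
   have \<sigma>b: "\<exists>S. \<forall>x. \<bar>\<sigma> p x\<bar> \<le> S" for p
   proof -
    have "\<bar>\<sigma> p x\<bar> \<le> (2 / h) ^ m * (\<omega> + \<bar>ent p (H 0)\<bar>)" for x
     unfolding \<sigma>_def
    proof (rule dquot_pow_bound[OF h(1)])
     show "\<bar>ent p (H x)\<bar> \<le> \<omega> + \<bar>ent p (H 0)\<bar>" for x
     proof -
      have "\<bar>ent p (H x) - ent p (H 0)\<bar> \<le> \<omega>" using adq[of p] by (simp add: admissible_osc_def)
      thus ?thesis by linarith
     qed
    qed
    thus ?thesis by blast
   qed
   have prod_int: "integrable lborel (\<lambda>x. \<zeta> x ^ (2 * m) * (f x * g x))"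
    if "borel_fun f" "borel_fun g" "\<And>x. \<bar>f x\<bar> \<le> Bf" "\<And>x. \<bar>g x\<bar> \<le> Bg" for f g Bf Bg
   proof (rule cutoff_power_integrable[OF c, of _ "Bf * Bg"])
    show "\<bar>f x * g x\<bar> \<le> Bf * Bg" for x
     unfolding abs_mult using that(3,4) order.trans[OF abs_ge_zero that(3)[of x]] by (intro mult_mono) auto
   qed (use that m in auto)
   have ia: "integrable lborel (\<lambda>x. \<zeta> x ^ (2 * m) * (a p x)\<^sup>2)" for p
    using prod_int[OF am am ab ab] by (simp add: power2_eq_square)
   have i\<sigma>: "integrable lborel (\<lambda>x. \<zeta> x ^ (2 * m) * (\<sigma> p x)\<^sup>2)" for p
   proof -
    obtain S where "\<And>x. \<bar>\<sigma> p x\<bar> \<le> S" using \<sigma>b[of p] by blast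
    from prod_int[OF \<sigma>m \<sigma>m this this] show ?thesis by (simp add: power2_eq_square)
   qed
   have ia\<sigma>: "integrable lborel (\<lambda>x. \<zeta> x ^ (2 * m) * (a p x * \<sigma> p x))" for p
   proof -
    obtain S where "\<And>x. \<bar>\<sigma> p x\<bar> \<le> S" using \<sigma>b[of p] by blast
    from prod_int[OF am \<sigma>m ab this] show ?thesis .
   qed
   have iR: "integrable lborel (\<lambda>x. \<zeta> x ^ (2 * m) * (RR p x)\<^sup>2)"
    and R2: "?IR p \<le> C1 * \<omega>\<^sup>2 * E + C2" for p
    using rem'[OF h(1,2) nv c, of p] by (auto simp: RR_def E_def)
   have E\<sigma>: "E = (\<Sum>p\<in>UNIV. ?IS p)" by (simp add: E_def energy_def \<sigma>_def)
   have E0: "E \<ge> 0" unfolding E_def by (intro sum_nonneg energy_nonneg)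
   have Rs: "Rs \<le> n2 * (C1 * \<omega>\<^sup>2 * E + C2)"
    unfolding Rs_def n2_def using sum_bounded_above[of UNIV "\<lambda>p. ?IR p" "C1 * \<omega>\<^sup>2 * E + C2"] R2 by simp
   have a_eq: "a p x = (\<Sum>q\<in>UNIV. iter_dderiv [munit q, munit p] F (H x) * \<sigma> q x) + RR p x" for p x
    by (simp add: a_def A_def[abs_def] RR_def remainder_def \<sigma>_def del: iter_dderiv_Cons)
   let ?U = "\<lambda>x. \<Sum>p\<in>UNIV. 3 * \<Lambda> / 4 * (\<zeta> x ^ (2 * m) * (\<sigma> p x)\<^sup>2) - (\<zeta> x ^ (2 * m) * (RR p x)\<^sup>2) / \<Lambda>"
   have lower: "(\<Sum>p\<in>UNIV. ?IP p) \<ge> 3 * \<Lambda> / 4 * E - Rs / \<Lambda>"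
   proof -
    have "3 * \<Lambda> / 4 * E - Rs / \<Lambda> = (\<integral>x. ?U x \<partial>lborel)"
     using i\<sigma> iR by (simp add: E\<sigma> Rs_def sum_subtractf sum_distrib_left sum_divide_distrib Bochner_Integration.integral_sum)
    also have "\<dots> \<le> (\<integral>x. (\<Sum>p\<in>UNIV. \<zeta> x ^ (2 * m) * (a p x * \<sigma> p x)) \<partial>lborel)"
    proof (rule integral_mono)
     show "integrable lborel (\<lambda>x. ?U x)"
      using i\<sigma> iR by (intro Bochner_Integration.integrable_sum Bochner_Integration.integrable_diff) auto
     show "integrable lborel (\<lambda>x. \<Sum>p\<in>UNIV. \<zeta> x ^ (2 * m) * (a p x * \<sigma> p x))"
      by (intro Bochner_Integration.integrable_sum ia\<sigma>)
     fix x
     \<comment> \<open>Symmetry of the values passes to their difference quotients, so the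
       ellipticity condition is applicable.\<close>
     have symx: "(\<chi> i j. \<sigma> (i, j) x) \<in> sym_matrices"
     proof -
      have "ent (i, j) (H y) = ent (j, i) (H y)" for i j y
       using HK[of y] sym by (auto simp: sym_matrices_def ent_def transpose_def vec_eq_iff)
      hence "\<sigma> (i, j) = \<sigma> (j, i)" for i j unfolding \<sigma>_def by simp
      thus ?thesis by (simp add: sym_matrices_def transpose_def vec_eq_iff)
     qed
     have "\<Lambda> * (\<Sum>p\<in>UNIV. (\<sigma> p x)\<^sup>2) \<le> (\<Sum>p\<in>UNIV. \<Sum>q\<in>UNIV. \<sigma> p x * \<sigma> q x * iter_dderiv [munit q, munit p] F (H x))"
      using elliptic[OF HK symx, of x] by (simp add: ent_def)
     also have "\<dots> = (\<Sum>p\<in>UNIV. \<sigma> p x * (\<Sum>q\<in>UNIV. iter_dderiv [munit q, munit p] F (H x) * \<sigma> q x))"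
      by (simp add: sum_distrib_left mult.assoc mult.commute)
     also have "\<dots> = (\<Sum>p\<in>UNIV. a p x * \<sigma> p x) - (\<Sum>p\<in>UNIV. RR p x * \<sigma> p x)"
      unfolding sum_subtractf[symmetric] by (intro sum.cong refl) (simp add: a_eq algebra_simps)
     finally have l1: "\<Lambda> * (\<Sum>p\<in>UNIV. (\<sigma> p x)\<^sup>2) \<le> (\<Sum>p\<in>UNIV. a p x * \<sigma> p x) - (\<Sum>p\<in>UNIV. RR p x * \<sigma> p x)" .
     have l2: "- (\<Sum>p\<in>UNIV. RR p x * \<sigma> p x) \<le> (\<Sum>p\<in>UNIV. \<Lambda> / 4 * (\<sigma> p x)\<^sup>2 + (RR p x)\<^sup>2 / \<Lambda>)"
      unfolding sum_negf[symmetric]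
     proof (rule sum_mono)
      fix p
      have "0 \<le> (\<Lambda> * \<sigma> p x + 2 * RR p x)\<^sup>2" by simp
      hence "4 * \<Lambda> * (- (RR p x * \<sigma> p x)) \<le> 4 * \<Lambda> * (\<Lambda> / 4 * (\<sigma> p x)\<^sup>2 + (RR p x)\<^sup>2 / \<Lambda>)"
       using \<Lambda> by (simp add: power2_eq_square algebra_simps)
      thus "- (RR p x * \<sigma> p x) \<le> \<Lambda> / 4 * (\<sigma> p x)\<^sup>2 + (RR p x)\<^sup>2 / \<Lambda>"
       using \<Lambda> by (simp only: mult_le_cancel_left_pos mult_pos_pos zero_less_numeral)
     qed
     have l3: "(\<Sum>p\<in>UNIV. \<Lambda> / 4 * (\<sigma> p x)\<^sup>2 + (RR p x)\<^sup>2 / \<Lambda>) = \<Lambda> / 4 * (\<Sum>p\<in>UNIV. (\<sigma> p x)\<^sup>2) + (\<Sum>p\<in>UNIV. (RR p x)\<^sup>2) / \<Lambda>"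
      by (simp only: sum.distrib sum_distrib_left sum_divide_distrib)
     have pt: "3 * \<Lambda> / 4 * (\<Sum>p\<in>UNIV. (\<sigma> p x)\<^sup>2) - (\<Sum>p\<in>UNIV. (RR p x)\<^sup>2) / \<Lambda> \<le> (\<Sum>p\<in>UNIV. a p x * \<sigma> p x)"
      using l1 l2 unfolding l3 by (simp add: algebra_simps)
     have "?U x
      = \<zeta> x ^ (2 * m) * (3 * \<Lambda> / 4 * (\<Sum>p\<in>UNIV. (\<sigma> p x)\<^sup>2) - (\<Sum>p\<in>UNIV. (RR p x)\<^sup>2) / \<Lambda>)"
      by (simp add: sum_subtractf sum_distrib_left sum_divide_distrib right_diff_distrib mult.left_commute)
     also have "\<dots> \<le> \<zeta> x ^ (2 * m) * (\<Sum>p\<in>UNIV. a p x * \<sigma> p x)" using pt cz by (intro mult_left_mono) auto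
     finally show "?U x \<le> (\<Sum>p\<in>UNIV. \<zeta> x ^ (2 * m) * (a p x * \<sigma> p x))"
      by (simp add: sum_distrib_left)
    qed
    also have "\<dots> = (\<Sum>p\<in>UNIV. ?IP p)"
     by (rule Bochner_Integration.integral_sum[OF ia\<sigma>])
    finally show ?thesis .
   qed
   have a_bound: "(\<Sum>p\<in>UNIV. ?IA p) \<le> Ca * E + 2 * Rs"
   proof -
    have "?IA p \<le> 2 * b\<^sup>2 * n2 * E + 2 * ?IR p" for p
    proof -
     have "?IA p \<le> (\<integral>x. 2 * b\<^sup>2 * n2 * (\<Sum>q\<in>UNIV. \<zeta> x ^ (2 * m) * (\<sigma> q x)\<^sup>2) + 2 * (\<zeta> x ^ (2 * m) * (RR p x)\<^sup>2) \<partial>lborel)"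
     proof (rule integral_mono[OF ia])
      show "integrable lborel (\<lambda>x. 2 * b\<^sup>2 * n2 * (\<Sum>q\<in>UNIV. \<zeta> x ^ (2 * m) * (\<sigma> q x)\<^sup>2) + 2 * (\<zeta> x ^ (2 * m) * (RR p x)\<^sup>2))"
       by (intro Bochner_Integration.integrable_add integrable_mult_right Bochner_Integration.integrable_sum i\<sigma> iR)
      fix x
      let ?S = "\<Sum>q\<in>UNIV. iter_dderiv [munit q, munit p] F (H x) * \<sigma> q x"
      have "\<bar>?S\<bar> \<le> (\<Sum>q\<in>UNIV. b * \<bar>\<sigma> q x\<bar>)"
       by (rule order.trans[OF sum_abs sum_mono]) (simp only: abs_mult, intro mult_right_mono b HK abs_ge_zero)
      hence "?S\<^sup>2 \<le> (b * (\<Sum>q\<in>UNIV. \<bar>\<sigma> q x\<bar>))\<^sup>2"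
       using power_mono[of "\<bar>?S\<bar>" "b * (\<Sum>q\<in>UNIV. \<bar>\<sigma> q x\<bar>)" 2] by (simp add: sum_distrib_left)
      also have "\<dots> = b\<^sup>2 * (\<Sum>q\<in>UNIV. \<bar>\<sigma> q x\<bar>)\<^sup>2" by (simp add: power_mult_distrib)
      also have "\<dots> \<le> b\<^sup>2 * (n2 * (\<Sum>q\<in>UNIV. (\<sigma> q x)\<^sup>2))"
      proof (rule mult_left_mono)
       have "(\<Sum>q\<in>UNIV. \<bar>\<sigma> q x\<bar> * 1)\<^sup>2 \<le> (\<Sum>q\<in>UNIV. \<bar>\<sigma> q x\<bar>\<^sup>2) * (\<Sum>q\<in>(UNIV :: ('n \<times> 'n) set). 1\<^sup>2)"
        by (rule Cauchy_Schwarz_ineq_sum)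
       thus "(\<Sum>q\<in>UNIV. \<bar>\<sigma> q x\<bar>)\<^sup>2 \<le> n2 * (\<Sum>q\<in>UNIV. (\<sigma> q x)\<^sup>2)" by (simp add: n2_def mult.commute)
      qed simp
      finally have S2: "?S\<^sup>2 \<le> b\<^sup>2 * n2 * (\<Sum>q\<in>UNIV. (\<sigma> q x)\<^sup>2)" by simp
      have "(a p x)\<^sup>2 \<le> 2 * ?S\<^sup>2 + 2 * (RR p x)\<^sup>2"
       using zero_le_power2[of "?S - RR p x"] unfolding a_eq by (simp add: power2_eq_square algebra_simps)
      also have "\<dots> \<le> 2 * (b\<^sup>2 * n2 * (\<Sum>q\<in>UNIV. (\<sigma> q x)\<^sup>2)) + 2 * (RR p x)\<^sup>2" using S2 by simp
      finally have "\<zeta> x ^ (2 * m) * (a p x)\<^sup>2 \<le> \<zeta> x ^ (2 * m) * (2 * (b\<^sup>2 * n2 * (\<Sum>q\<in>UNIV. (\<sigma> q x)\<^sup>2)) + 2 * (RR p x)\<^sup>2)"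
       using cz by (intro mult_left_mono) auto
      also have "\<dots> = 2 * b\<^sup>2 * n2 * (\<Sum>q\<in>UNIV. \<zeta> x ^ (2 * m) * (\<sigma> q x)\<^sup>2) + 2 * (\<zeta> x ^ (2 * m) * (RR p x)\<^sup>2)"
       unfolding sum_distrib_left[symmetric] by (simp add: algebra_simps)
      finally show "\<zeta> x ^ (2 * m) * (a p x)\<^sup>2 \<le> \<dots>" .
     qed
     also have "\<dots> = 2 * b\<^sup>2 * n2 * E + 2 * ?IR p"
      using i\<sigma> iR by (simp add: E\<sigma> Bochner_Integration.integral_sum)
     finally show ?thesis .
    qed
    hence "(\<Sum>p\<in>UNIV. ?IA p) \<le> (\<Sum>p\<in>(UNIV :: ('n \<times> 'n) set). 2 * b\<^sup>2 * n2 * E + 2 * ?IR p)"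
     by (rule sum_mono)
    also have "\<dots> = Ca * E + 2 * Rs" by (simp add: sum.distrib Rs_def sum_distrib_left Ca_def n2_def)
    finally show ?thesis .
   qed
   define P1 where "P1 g = (\<integral>x. \<zeta> x ^ (2 * (m - 1)) * ((dquot h v ^^ (m - 1)) g x)\<^sup>2 \<partial>lborel)" for g
   define P2 where "P2 g = (\<integral>x. \<zeta> x ^ (2 * (m - 2)) * ((dquot h v ^^ (m - 2)) g x)\<^sup>2 \<partial>lborel)" for g
   have d: "R' = R + r + (R' - R - r)" "R' - R - r > 0" using R' r by auto
   have pm: "borel_fun (pd2 p (w k))" for p k by (intro smooth_borel smooth_pd2 ws)
   note T' = dquot_pow_square_integral_tendsto[OF c h(1) _ nv, where r=r and d="R' - R - r" and M=M, folded d(1), OF _ _ pm wM d(2) ent_measurable[OF Hm] wlim]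
   let ?Y = "\<lambda>g. \<Sum>p\<in>(UNIV :: ('n \<times> 'n) set). \<kappa> * ?IA p + Q * (2 * (\<Sum>q\<in>UNIV. 4 ^ m * P1 (g q) + V1) + (\<Sum>q\<in>UNIV. 4 ^ m * P2 (g q) + V2))"
   \<comment> \<open>The tested equation needs the smooth functions \<open>w k\<close>; at the fixed
     step both sides converge as \<open>k\<close> grows, which transfers the inequality to
     \<open>H\<close> itself.\<close>
   have upper: "(\<Sum>p\<in>UNIV. ?IP p) \<le>
    ?Y (\<lambda>q x. ent q (H x))"
   proof (rule LIMSEQ_le)
    show "(\<lambda>k. \<Sum>p\<in>UNIV. wint (2 * m) \<zeta> (\<lambda>x. (a p x * (dquot h v ^^ m) (pd2 p (w k)) x))) \<longlonglongrightarrow> (\<Sum>p\<in>UNIV. ?IP p)"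
     unfolding \<sigma>_def by (intro tendsto_sum T'(2)[OF _ _ _ am ab]) (use h m in auto)
    have mh: "real (m - 1) * h \<le> r" "real (m - 2) * h \<le> r"
     using h by (auto intro!: order.trans[OF mult_right_mono h(3)])
    have lim1: "(\<lambda>k. P1 (pd2 q (w k))) \<longlonglongrightarrow> P1 (ents q H)" for q
     unfolding P1_def by (rule T'(1)[OF mh(1)]) (use m in auto)
    have lim2: "(\<lambda>k. P2 (pd2 q (w k))) \<longlonglongrightarrow> P2 (ents q H)" for q
     unfolding P2_def by (rule T'(1)[OF mh(2)]) (use m in auto)
    show "(\<lambda>k. \<Sum>p\<in>(UNIV :: ('n \<times> 'n) set). \<kappa> * ?IA p
     + Q * (2 * (\<Sum>q\<in>UNIV. 4 ^ m * P1 (pd2 q (w k)) + V1) + (\<Sum>q\<in>UNIV. 4 ^ m * P2 (pd2 q (w k)) + V2))) \<longlonglongrightarrow>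
     ?Y (\<lambda>q x. ent q (H x))"
     by (intro tendsto_sum tendsto_add tendsto_mult_left tendsto_const lim1 lim2)
    have "(\<Sum>p\<in>UNIV. wint (2 * m) \<zeta> (\<lambda>x. (a p x * (dquot h v ^^ m) (pd2 p (w k)) x))) \<le>
     ?Y (\<lambda>q. pd2 q (w k))" for k
     unfolding P1_def P2_def a_def Q_def V1_def V2_def
    proof (rule tested_equation[OF z m R \<kappa>(1) v_def h(1,3) R' Am Ab _ ws wM])
     show "(\<integral>x. (\<Sum>p\<in>UNIV. A p x * pd2 p \<eta> x) \<partial>lborel) = 0" if "test_function (ball x0 R') \<eta>" for \<eta>
      unfolding A_def by (rule eq[OF that])
    qed
    thus "\<exists>N. \<forall>k\<ge>N. (\<Sum>p\<in>UNIV. wint (2 * m) \<zeta> (\<lambda>x. (a p x * (dquot h v ^^ m) (pd2 p (w k)) x))) \<le>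
     ?Y (\<lambda>q. pd2 q (w k))" by blast
   qed
   have PP1: "(\<Sum>q\<in>UNIV. 4 ^ m * P1 (ents q H) + V1) \<le> 4 ^ m * \<epsilon> * E + n2 * (4 ^ m * C3 + V1)"
   proof -
    have "(\<Sum>q\<in>UNIV. 4 ^ m * P1 (ents q H) + V1) \<le> (\<Sum>q\<in>(UNIV :: ('n \<times> 'n) set). 4 ^ m * (\<epsilon> * energy m \<zeta> h v (ents q H) + C3) + V1)"
     unfolding P1_def by (intro sum_mono add_right_mono mult_left_mono low1[OF adq]) simp
    also have "\<dots> = 4 ^ m * \<epsilon> * E + n2 * (4 ^ m * C3 + V1)"
     by (simp add: E_def n2_def sum.distrib sum_distrib_left algebra_simps)
    finally show ?thesis .
   qed
   have PP2: "(\<Sum>q\<in>UNIV. 4 ^ m * P2 (ents q H) + V2) \<le> 4 ^ m * \<epsilon> * E + n2 * (4 ^ m * C4 + V2)"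
   proof -
    have "(\<Sum>q\<in>UNIV. 4 ^ m * P2 (ents q H) + V2) \<le> (\<Sum>q\<in>(UNIV :: ('n \<times> 'n) set). 4 ^ m * (\<epsilon> * energy m \<zeta> h v (ents q H) + C4) + V2)"
     unfolding P2_def by (intro sum_mono add_right_mono mult_left_mono low2[OF adq]) simp
    also have "\<dots> = 4 ^ m * \<epsilon> * E + n2 * (4 ^ m * C4 + V2)"
     by (simp add: E_def n2_def sum.distrib sum_distrib_left algebra_simps)
    finally show ?thesis .
   qed
   have "3 * \<Lambda> / 4 * E - Rs / \<Lambda> \<le> (\<Sum>p\<in>UNIV. ?IP p)" by (rule lower)
   also have "\<dots> \<le> \<kappa> * (\<Sum>p\<in>UNIV. ?IA p)
     + n2 * (Q * (2 * (\<Sum>q\<in>UNIV. 4 ^ m * P1 (ents q H) + V1) + (\<Sum>q\<in>UNIV. 4 ^ m * P2 (ents q H) + V2)))"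
   proof -
    have "(\<Sum>p\<in>(UNIV :: ('n \<times> 'n) set). \<kappa> * X p + Z) = \<kappa> * (\<Sum>p\<in>UNIV. X p) + n2 * Z" for X Z
     by (simp add: sum.distrib sum_distrib_left n2_def)
    thus ?thesis using upper by (simp only:)
   qed
   also have "\<dots> \<le> \<kappa> * (Ca * E + 2 * Rs) + n2 * (Q * (2 * (4 ^ m * \<epsilon> * E + n2 * (4 ^ m * C3 + V1)) + (4 ^ m * \<epsilon> * E + n2 * (4 ^ m * C4 + V2))))"
    using \<kappa> n2 Q by (intro add_mono mult_left_mono a_bound PP1 PP2) auto
   also have "\<dots> = (\<kappa> * Ca) * E + 2 * \<kappa> * Rs + (n2 * Q * 3 * 4 ^ m * \<epsilon>) * E + D0"
    by (simp add: D0_def algebra_simps)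
   also have "\<dots> \<le> (\<Lambda> / 8) * E + 2 * \<kappa> * Rs + (\<Lambda> / 8) * E + D0"
    using mult_right_mono[OF \<kappa>(2) E0] mult_right_mono[OF \<epsilon>(2) E0] by linarith
   finally have "\<Lambda> / 2 * E \<le> (1 / \<Lambda> + 2 * \<kappa>) * Rs + D0"
   proof -
    have "(1 / \<Lambda> + 2 * \<kappa>) * Rs = Rs / \<Lambda> + 2 * \<kappa> * Rs" by (simp add: distrib_right)
    thus "3 * \<Lambda> / 4 * E - Rs / \<Lambda> \<le> \<Lambda> / 8 * E + 2 * \<kappa> * Rs + \<Lambda> / 8 * E + W \<Longrightarrow> \<Lambda> / 2 * E \<le> (1 / \<Lambda> + 2 * \<kappa>) * Rs + W" for W
     by linarith
   qed
   also have "(1 / \<Lambda> + 2 * \<kappa>) * Rs \<le> (1 / \<Lambda> + 2 * \<kappa>) * (n2 * (C1 * \<omega>\<^sup>2 * E + C2))"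
    using \<Lambda> \<kappa> by (intro mult_left_mono Rs) auto
   also have "\<dots> = (T * (C1 * \<omega>\<^sup>2)) * E + T * C2" by (simp add: T_def algebra_simps)
   also have "\<dots> \<le> (\<Lambda> / 8) * E + T * C2" using \<omega>2 E0 by (intro add_right_mono mult_right_mono)
   finally have "3 * \<Lambda> / 8 * E \<le> D" unfolding D_def by linarith
   hence "E \<le> 8 * D / (3 * \<Lambda>)" using \<Lambda> by (simp add: field_simps)
   moreover have "energy m \<zeta> h v (ents q H) \<le> E"
    unfolding E_def by (intro member_le_sum energy_nonneg) auto
   ultimately show "energy m \<zeta> h (axis s 1) (ents q H) \<le> 8 * D / (3 * \<Lambda>)" by (simp add: v_def)
  qed
 qed
qed

end


section \<open>From difference quotients to derivatives\<close>

text \<open>Convolving \<open>f\<close> with the indicator of a ball that contains the support with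
  margin 1 gives, near the origin, the constant integral of \<open>f\<close>. Its derivative at 0
  vanishes, and it is also the convolution with the derivative of \<open>f\<close>, that is, the
  integral in question.\<close>

lemma integral_dderiv_test_function:
 fixes f :: "'a::euclidean_space \<Rightarrow> real"
 assumes f: "test_function UNIV f"
 shows "(\<integral>x. dderiv v f x \<partial>lborel) = 0"
proof -
 obtain K where K: "compact K" "\<And>x. x \<notin> K \<Longrightarrow> f x = 0" using test_functionE[OF f] by metis
 obtain r where "\<And>x. x \<in> K \<Longrightarrow> norm x \<le> r" using compact_imp_bounded[OF K(1)] by (auto simp: bounded_iff)
 hence fr: "f x = 0" if "x \<notin> cball 0 r" for x using K(2)[of x] that by fastforce
 let ?i = "indicator (cball 0 (r + 1)) :: 'a \<Rightarrow> real"
 have const: "conv ?i g x = (\<integral>y. g y \<partial>lborel)"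
  if g: "borel_fun g" "\<And>x. x \<notin> cball 0 r \<Longrightarrow> g x = 0" and x: "x \<in> ball 0 1" for g :: "'a \<Rightarrow> real" and x
 proof -
  have "?i y * g (x - y) = g (x - y)" for y
  proof (cases "x - y \<in> cball 0 r")
   case True
   hence "norm y \<le> r + 1" using x norm_triangle_sub[of y x] by (simp add: norm_minus_commute)
   thus ?thesis by simp
  qed (simp add: g(2))
  thus ?thesis unfolding conv_def by (simp only: integral_reflect[OF g(1)])
 qed
 have fm: "borel_fun f" "borel_fun (dderiv v f)"
  using smooth_borel smooth_dderiv test_function_smooth[OF f] by blast+
 have i: "integrable lborel ?i" by (rule integrable_indicator_bounded) auto
 have "(\<integral>x. dderiv v f x \<partial>lborel) = conv ?i (dderiv v f) 0"
  using dderiv_vanish_outside[of "cball 0 r" f] fr by (intro const[symmetric] fm) auto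
 also have "\<dots> = dderiv v (conv ?i f) 0" unfolding dderiv_conv[OF i f] ..
 also have "\<dots> = dderiv v (\<lambda>x. \<integral>y. f y \<partial>lborel) 0"
  by (rule dderiv_local_cong[of "ball 0 1"]) (auto intro: const fm fr)
 finally show ?thesis by (simp add: dderiv_const)
qed

lemma test_function_mult:
 "test_function \<Omega> f \<Longrightarrow> test_function \<Omega> g \<Longrightarrow> test_function \<Omega> (\<lambda>x. f x * g x)"
 by (rule test_function_mult_left[OF _ test_function_smooth])

lemma integrable_test_function_mult:
 fixes f g :: "'a::euclidean_space \<Rightarrow> real"
 shows "test_function UNIV f \<Longrightarrow> test_function UNIV g \<Longrightarrow> integrable lborel (\<lambda>x. f x * g x)"
 by (rule test_function_integrable[OF test_function_mult])

lemma integration_by_parts: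
 fixes f g :: "'a::euclidean_space \<Rightarrow> real"
 assumes f: "test_function UNIV f" and g: "test_function UNIV g"
 shows "(\<integral>x. dderiv v f x * g x \<partial>lborel) = - (\<integral>x. f x * dderiv v g x \<partial>lborel)"
proof -
 have "dderiv v (\<lambda>x. f x * g x) = (\<lambda>x. dderiv v f x * g x + f x * dderiv v g x)"
  by (intro dderiv_mult smooth_dir_differentiable test_function_smooth[OF f] test_function_smooth[OF g])
 hence "0 = (\<integral>x. dderiv v f x * g x + f x * dderiv v g x \<partial>lborel)"
  using integral_dderiv_test_function[OF test_function_mult[OF f g], of v] by simp
 also have "\<dots> = (\<integral>x. dderiv v f x * g x \<partial>lborel) + (\<integral>x. f x * dderiv v g x \<partial>lborel)"
  by (intro Bochner_Integration.integral_add integrable_test_function_mult test_function_dderiv f g)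
 finally show ?thesis by linarith
qed

lemma integration_by_parts_iter:
 fixes f g :: "'a::euclidean_space \<Rightarrow> real"
 assumes f: "test_function UNIV f" and g: "test_function UNIV g"
 shows "\<bar>\<integral>x. iter_dderiv vs f x * g x \<partial>lborel\<bar> = \<bar>\<integral>x. f x * iter_dderiv vs g x \<partial>lborel\<bar>"
 using g
proof (induction vs arbitrary: g)
 case (Cons v vs)
 have "\<bar>\<integral>x. iter_dderiv (v # vs) f x * g x \<partial>lborel\<bar> = \<bar>\<integral>x. iter_dderiv vs f x * dderiv v g x \<partial>lborel\<bar>"
  using integration_by_parts[OF test_function_iter_dderiv[OF f] Cons.prems, of v vs] by (simp add: iter_dderiv_Cons)
 also have "\<dots> = \<bar>\<integral>x. f x * iter_dderiv vs (dderiv v g) x \<partial>lborel\<bar>"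
  by (rule Cons.IH[OF test_function_dderiv[OF Cons.prems]])
 finally show ?case
  using iter_dderiv_dderiv_commute[OF test_function_smooth[OF Cons.prems], of vs v] by (simp add: iter_dderiv_Cons)
qed simp

lemma iter_dderiv_mset:
 assumes "mset vs = mset ws" "smooth f"
 shows "iter_dderiv vs f = iter_dderiv ws f"
 using assms(1)
proof (induction vs arbitrary: ws)
 case (Cons v vs)
 hence "v \<in> set ws" by (metis list.set_intros(1) set_mset_mset)
 then obtain a b where ws: "ws = a @ v # b" by (meson split_list)
 hence "mset vs = mset (a @ b)" using Cons.prems by simp
 hence "iter_dderiv vs f = iter_dderiv (a @ b) f" by (rule Cons.IH)
 thus ?case
  using iter_dderiv_dderiv_commute[OF smooth_iter_dderiv[OF assms(2), of b], of a v]
  by (simp add: ws iter_dderiv_append iter_dderiv_Cons)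
qed simp

text \<open>Moving derivatives across, \<open>\<integral>(\<partial>\<^sub>s\<^sup>a \<partial>\<^sup>\<alpha> f)\<^sup>2 = \<plusminus>\<integral>\<partial>\<^sub>s\<^bsup>2a\<^esup>f \<partial>\<^bsup>2\<alpha>\<^esup>f\<close>: mixed derivatives are controlled by pure
 ones of higher order.\<close>

lemma mixed_derivative_bound:
 fixes f :: "'a::euclidean_space \<Rightarrow> real"
 assumes f: "test_function UNIV f"
  and pure: "\<And>s j. s \<in> D \<Longrightarrow> j \<le> 2 ^ k * A \<Longrightarrow> (\<integral>x. (iter_dderiv (replicate j s) f x)\<^sup>2 \<partial>lborel) \<le> B" and "D \<noteq> {}"
  and as: "length as = k" "\<And>s a. (s, a) \<in> set as \<Longrightarrow> s \<in> D \<and> a \<le> A"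
 shows "(\<integral>x. (iter_dderiv (concat (map (\<lambda>(s, a). replicate a s) as)) f x)\<^sup>2 \<partial>lborel) \<le> B"
 using as pure
proof (induction k arbitrary: as A)
 case 0
 obtain s where "s \<in> D" using assms(3) by blast
 from 0(3)[OF this, of 0] 0(1) show ?case by simp
next
 case (Suc k)
 obtain s a bs where as: "as = (s, a) # bs" and bs: "length bs = k" using Suc.prems(1) by (cases as) auto
 have sa: "s \<in> D" "a \<le> A" using Suc.prems(2)[of s a] by (auto simp: as)
 define ws where "ws = concat (map (\<lambda>(s, a). replicate a s) bs)"
 define ds where "ds = map (\<lambda>(s, a). (s, 2 * a)) bs"
 note sm = test_function_smooth[OF f]
 let ?W = "iter_dderiv (replicate a s) (iter_dderiv ws f)"
 have P: "(\<integral>x. (iter_dderiv (replicate (2 * a) s) f x)\<^sup>2 \<partial>lborel) \<le> B"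
  by (rule Suc.prems(3)[OF sa(1)]) (use mult_le_mono[OF one_le_power[of "2::nat" k] sa(2)] in simp)
 \<comment> \<open>Removing one factor doubles the exponents of the others while \<open>k\<close>
   drops by one, so the admissible order \<open>2 ^ k * A\<close> is preserved; this is the origin
   of the power of two.\<close>
 have Q: "(\<integral>x. (iter_dderiv (concat (map (\<lambda>(s, a). replicate a s) ds)) f x)\<^sup>2 \<partial>lborel) \<le> B"
 proof (rule Suc.IH[of ds "2 * A"])
  show "length ds = k" by (simp add: ds_def bs)
  show "s \<in> D \<and> a \<le> 2 * A" if sa: "(s, a) \<in> set ds" for s a
  proof -
   obtain a' where "(s, a') \<in> set bs" "a = 2 * a'" using sa by (auto simp: ds_def)
   thus ?thesis using Suc.prems(2)[of s a'] by (simp add: as)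
  qed
  show "(\<integral>x. (iter_dderiv (replicate j s) f x)\<^sup>2 \<partial>lborel) \<le> B" if "s \<in> D" "j \<le> 2 ^ k * (2 * A)" for s j
   using Suc.prems(3)[OF that(1)] that(2) by (simp add: mult.assoc mult.left_commute)
 qed
 have "mset (concat (map (\<lambda>(s, a). replicate a s) ds)) = mset (ws @ ws)"
  unfolding ds_def ws_def
 proof (induction bs)
  case (Cons sa bs)
  thus ?case by (cases sa) (simp add: mult_2 replicate_add)
 qed simp
 hence ds: "iter_dderiv (concat (map (\<lambda>(s, a). replicate a s) ds)) f = iter_dderiv ws (iter_dderiv ws f)"
  unfolding iter_dderiv_append[symmetric] by (rule iter_dderiv_mset[OF _ sm])
 have tf: "test_function UNIV (iter_dderiv vs f)" for vs by (rule test_function_iter_dderiv[OF f])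
 have "(\<integral>x. (?W x)\<^sup>2 \<partial>lborel) = \<bar>\<integral>x. iter_dderiv (replicate a s) (iter_dderiv ws f) x * ?W x \<partial>lborel\<bar>"
  unfolding power2_eq_square[symmetric] by (rule abs_of_nonneg[symmetric], rule Bochner_Integration.integral_nonneg, rule zero_le_power2)
 also have "\<dots> = \<bar>\<integral>x. iter_dderiv ws f x * iter_dderiv (replicate a s) ?W x \<partial>lborel\<bar>"
  by (intro integration_by_parts_iter test_function_iter_dderiv tf)
 also have "iter_dderiv (replicate a s) ?W = iter_dderiv ws (iter_dderiv (replicate (2 * a) s) f)"
  using iter_dderiv_commute[OF sm, of "replicate (2 * a) s" ws] by (simp add: mult_2 replicate_add iter_dderiv_append)
 also have "\<bar>\<integral>x. iter_dderiv ws f x * iter_dderiv ws (iter_dderiv (replicate (2 * a) s) f) x \<partial>lborel\<bar>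
   = \<bar>\<integral>x. iter_dderiv ws (iter_dderiv ws f) x * iter_dderiv (replicate (2 * a) s) f x \<partial>lborel\<bar>"
  by (rule integration_by_parts_iter[OF tf tf, symmetric])
 also have "\<dots> \<le> (\<integral>x. \<bar>iter_dderiv ws (iter_dderiv ws f) x * iter_dderiv (replicate (2 * a) s) f x\<bar> \<partial>lborel)"
  by (rule integral_abs_bound)
 also have "\<dots> \<le> (\<integral>x. ((iter_dderiv ws (iter_dderiv ws f) x)\<^sup>2 + (iter_dderiv (replicate (2 * a) s) f x)\<^sup>2) / 2 \<partial>lborel)"
 proof (rule integral_mono)
  show "\<bar>g * h\<bar> \<le> (g\<^sup>2 + h\<^sup>2) / 2" for g h :: real
   using zero_le_power2[of "\<bar>g\<bar> - \<bar>h\<bar>"] by (simp add: power2_eq_square abs_mult algebra_simps)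
  show "integrable lborel (\<lambda>x. \<bar>iter_dderiv ws (iter_dderiv ws f) x * iter_dderiv (replicate (2 * a) s) f x\<bar>)"
   by (intro integrable_abs integrable_test_function_mult test_function_iter_dderiv f)
  show "integrable lborel (\<lambda>x. ((iter_dderiv ws (iter_dderiv ws f) x)\<^sup>2 + (iter_dderiv (replicate (2 * a) s) f x)\<^sup>2) / 2)"
   unfolding power2_eq_square
   by (intro integrable_divide Bochner_Integration.integrable_add integrable_test_function_mult test_function_iter_dderiv f)
 qed
 also have "\<dots> = ((\<integral>x. (iter_dderiv ws (iter_dderiv ws f) x)\<^sup>2 \<partial>lborel) + (\<integral>x. (iter_dderiv (replicate (2 * a) s) f x)\<^sup>2 \<partial>lborel)) / 2"
  by (simp add: power2_eq_square integrable_test_function_mult test_function_iter_dderiv tf f)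
 also have "\<dots> \<le> B" using P Q unfolding ds by simp
 finally show ?case by (simp add: as ws_def iter_dderiv_append)
qed

subsection \<open>A Sobolev inequality\<close>

text \<open>The function vanishes at a far point of the line, so \<open>f z\<close> is minus the
  integral of its derivative up to that point.\<close>

lemma line_integral_bound:
 fixes f :: "'a::euclidean_space \<Rightarrow> real"
 assumes f: "test_function UNIV f" and v: "v \<noteq> 0"
 shows "ennreal \<bar>f z\<bar> \<le> (\<integral>\<^sup>+t. ennreal \<bar>dderiv v f (z + t *\<^sub>R v)\<bar> \<partial>lborel)"
proof -
 obtain K where K: "smooth f" "compact K" "\<And>x. x \<notin> K \<Longrightarrow> f x = 0" using test_functionE[OF f] by metis
 obtain r where r: "\<And>x. x \<in> K \<Longrightarrow> norm x \<le> r" using compact_imp_bounded[OF K(2)] by (auto simp: bounded_iff)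
 define T where "T = (\<bar>r\<bar> + norm z + 1) / norm v"
 have T: "T > 0" using v by (simp add: T_def add_nonneg_pos)
 have "norm (T *\<^sub>R v) = \<bar>r\<bar> + norm z + 1" using v by (simp add: T_def add_nonneg_pos)
 hence "norm (z + T *\<^sub>R v) > r" using norm_triangle_ineq4[of "z + T *\<^sub>R v" z] by simp
 hence fT: "f (z + T *\<^sub>R v) = 0" using K(3) r by fastforce
 have dc: "continuous_on UNIV (dderiv v f)" by (intro smooth_continuous smooth_dderiv K)
 let ?g = "\<lambda>t. dderiv v f (z + t *\<^sub>R v)"
 have c: "continuous_on {0..T} ?g" by (rule continuous_on_compose2[OF dc]) (auto intro!: continuous_intros)
 have "has_bochner_integral lborel (\<lambda>t. indicator {0..T} t *\<^sub>R ?g t) (f (z + T *\<^sub>R v) - f (z + 0 *\<^sub>R v))"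
  using T c dir_differentiable_line[OF smooth_dir_differentiable[OF K(1)], of z v]
  by (intro has_bochner_integral_FTC_Icc) (auto simp: has_real_derivative_iff_has_vector_derivative)
 hence i: "integrable lborel (\<lambda>t. indicator {0..T} t *\<^sub>R ?g t)" "\<bar>f z\<bar> = norm (\<integral>t. indicator {0..T} t *\<^sub>R ?g t \<partial>lborel)"
  using fT by (auto simp: has_bochner_integral_iff)
 have "ennreal \<bar>f z\<bar> \<le> (\<integral>\<^sup>+t. ennreal (norm (indicator {0..T} t *\<^sub>R ?g t)) \<partial>lborel)"
  unfolding i(2) by (rule integral_norm_bound_ennreal[OF i(1)])
 also have "\<dots> \<le> (\<integral>\<^sup>+t. ennreal \<bar>?g t\<bar> \<partial>lborel)"
  by (intro nn_integral_mono ennreal_leI) (auto simp: indicator_def)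
 finally show ?thesis .
qed

text \<open>The one-dimensional bound is applied once for each basis direction in \<open>I\<close>;
  every application adds one derivative and one variable of integration.\<close>

lemma sup_bound_partial:
 fixes f :: "'a::euclidean_space \<Rightarrow> real"
 assumes f: "test_function UNIV f" and "finite I" "I \<subseteq> Basis"
 shows "\<exists>bs. set bs = I \<and> distinct bs \<and> (\<forall>x. ennreal \<bar>f x\<bar> \<le>
  (\<integral>\<^sup>+y. ennreal \<bar>iter_dderiv bs f (x + (\<Sum>b\<in>I. y b *\<^sub>R b))\<bar> \<partial>(\<Pi>\<^sub>M b\<in>I. (lborel :: real measure))))"
 using assms(2,3)
proof (induction I rule: finite_induct)
 case empty
 interpret product_sigma_finite "\<lambda>_::'a. lborel :: real measure" by standard
 show ?case by (rule exI[of _ "[]"]) (simp add: PiM_empty nn_integral_count_space_finite)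
next
 case (insert b I)
 interpret product_sigma_finite "\<lambda>_::'a. lborel :: real measure" by standard
 obtain bs where bs: "set bs = I" "distinct bs" and le: "\<And>x. ennreal \<bar>f x\<bar> \<le>
  (\<integral>\<^sup>+y. ennreal \<bar>iter_dderiv bs f (x + (\<Sum>b\<in>I. y b *\<^sub>R b))\<bar> \<partial>(\<Pi>\<^sub>M b\<in>I. (lborel :: real measure)))"
  using insert by auto
 have b: "b \<noteq> 0" using insert.prems nonzero_Basis by auto
 let ?g = "iter_dderiv (b # bs) f"
 have [measurable]: "borel_fun ?g"
  by (intro smooth_borel smooth_iter_dderiv test_function_smooth[OF f])
 show ?case
 proof (intro exI[of _ "b # bs"] conjI allI)
  fix x
  have "ennreal \<bar>f x\<bar> \<le> (\<integral>\<^sup>+y. ennreal \<bar>iter_dderiv bs f (x + (\<Sum>b\<in>I. y b *\<^sub>R b))\<bar> \<partial>(\<Pi>\<^sub>M b\<in>I. lborel))" by (rule le)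
  also have "\<dots> \<le> (\<integral>\<^sup>+y. (\<integral>\<^sup>+t. ennreal \<bar>?g (x + (\<Sum>b'\<in>I. y b' *\<^sub>R b') + t *\<^sub>R b)\<bar> \<partial>lborel) \<partial>(\<Pi>\<^sub>M b\<in>I. lborel))"
   using line_integral_bound[OF test_function_iter_dderiv[OF f] b, of bs] by (intro nn_integral_mono) (simp add: iter_dderiv_Cons)
  also have "\<dots> = (\<integral>\<^sup>+y. (\<integral>\<^sup>+t. ennreal \<bar>?g (x + (\<Sum>b'\<in>insert b I. (y(b := t)) b' *\<^sub>R b'))\<bar> \<partial>lborel) \<partial>(\<Pi>\<^sub>M b\<in>I. lborel))"
  proof -
   have "(\<Sum>b'\<in>insert b I. (y(b := t)) b' *\<^sub>R b') = t *\<^sub>R b + (\<Sum>b'\<in>I. y b' *\<^sub>R b')" for y and t :: real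
    using insert.hyps by (auto intro!: sum.cong)
   thus ?thesis by (simp add: add.commute add.left_commute)
  qed
  also have "\<dots> = (\<integral>\<^sup>+y. ennreal \<bar>?g (x + (\<Sum>b'\<in>insert b I. y b' *\<^sub>R b'))\<bar> \<partial>(\<Pi>\<^sub>M b\<in>insert b I. lborel))"
   using insert.hyps by (intro product_nn_integral_insert[symmetric]) measurable
  finally show "ennreal \<bar>f x\<bar> \<le> \<dots>" .
 qed (use bs insert.hyps in auto)
qed

text \<open>Once every basis direction has been used, the product measure is Lebesgue measure. The
  sup norm is thus controlled by the L1 norm of a mixed derivative whose order is the
  dimension.\<close>

lemma sup_bound:
 fixes f :: "'a::euclidean_space \<Rightarrow> real"
 assumes f: "test_function UNIV f"
 obtains bs where "set bs = Basis" "distinct bs" "\<And>x. \<bar>f x\<bar> \<le> (\<integral>y. \<bar>iter_dderiv bs f y\<bar> \<partial>lborel)"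
proof -
 obtain bs where bs: "set bs = Basis" "distinct bs" and le: "\<And>x. ennreal \<bar>f x\<bar> \<le>
  (\<integral>\<^sup>+y. ennreal \<bar>iter_dderiv bs f (x + (\<Sum>b\<in>Basis. y b *\<^sub>R b))\<bar> \<partial>(\<Pi>\<^sub>M b\<in>Basis. (lborel :: real measure)))"
  using sup_bound_partial[OF f finite_Basis subset_refl] by blast
 have gm [measurable]: "borel_fun (iter_dderiv bs f)"
  by (intro smooth_borel smooth_iter_dderiv test_function_smooth[OF f])
 have int: "integrable lborel (iter_dderiv bs f)" by (intro test_function_integrable[OF test_function_iter_dderiv[OF f]])
 have "\<bar>f x\<bar> \<le> (\<integral>y. \<bar>iter_dderiv bs f y\<bar> \<partial>lborel)" for x
 proof -
  have "ennreal \<bar>f x\<bar> \<le> (\<integral>\<^sup>+y. ennreal \<bar>iter_dderiv bs f (x + (\<Sum>b\<in>Basis. y b *\<^sub>R b))\<bar> \<partial>(\<Pi>\<^sub>M b\<in>Basis. lborel))" by (rule le)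
  also have "\<dots> = (\<integral>\<^sup>+z. ennreal \<bar>iter_dderiv bs f (x + z)\<bar> \<partial>distr (\<Pi>\<^sub>M b\<in>Basis. lborel) borel (\<lambda>y. \<Sum>b\<in>Basis. y b *\<^sub>R b))"
   by (rule nn_integral_distr[symmetric]) measurable
  also have "distr (\<Pi>\<^sub>M b\<in>Basis. lborel) borel (\<lambda>y. \<Sum>b\<in>(Basis :: 'a set). y b *\<^sub>R b) = lborel"
   unfolding lborel_def[where 'a='a] lborel_eq_real ..
  also have "(\<integral>\<^sup>+z. ennreal \<bar>iter_dderiv bs f (x + z)\<bar> \<partial>lborel) = (\<integral>\<^sup>+z. ennreal \<bar>iter_dderiv bs f z\<bar> \<partial>lborel)"
   using nn_integral_translate[of "\<lambda>z. ennreal \<bar>iter_dderiv bs f z\<bar>" x] by (simp add: add.commute)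
  also have "\<dots> = ennreal (\<integral>y. \<bar>iter_dderiv bs f y\<bar> \<partial>lborel)" using int by (intro nn_integral_eq_integral) auto
  finally show ?thesis by (subst (asm) ennreal_le_iff) auto
 qed
 with bs that show ?thesis by blast
qed


section \<open>Interior bounds for derivatives\<close>

lemma dquot_pow_MVT:
 assumes "smooth g" "h > 0"
 shows "\<exists>t. 0 \<le> t \<and> t \<le> real j * h \<and> (dquot h v ^^ j) g x = iter_dderiv (replicate j v) g (x + t *\<^sub>R v)"
 using assms(1)
proof (induction j arbitrary: g x)
 case 0
 thus ?case by auto
next
 case (Suc j)
 obtain z where z: "0 < z" "z < h" "fdiff (h *\<^sub>R v) ((dquot h v ^^ j) g) x = h * dderiv v ((dquot h v ^^ j) g) (x + z *\<^sub>R v)"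
  using fdiff_MVT[OF smooth_dquot_pow[OF Suc.prems] assms(2)] by blast
 obtain t where t: "0 \<le> t" "t \<le> real j * h"
  "(dquot h v ^^ j) (dderiv v g) (x + z *\<^sub>R v) = iter_dderiv (replicate j v) (dderiv v g) (x + z *\<^sub>R v + t *\<^sub>R v)"
  using Suc.IH[OF smooth_dderiv[OF Suc.prems], of v "x + z *\<^sub>R v"] by blast
 have "(dquot h v ^^ Suc j) g x = (dquot h v ^^ j) (dderiv v g) (x + z *\<^sub>R v)"
  using z(3) assms(2) by (simp add: dquot_def fdiff_def dderiv_dquot_pow[OF Suc.prems])
 also have "\<dots> = iter_dderiv (replicate (Suc j) v) g (x + (z + t) *\<^sub>R v)"
  unfolding t(3) iter_dderiv_dderiv_commute[OF Suc.prems] by (simp add: iter_dderiv_Cons scaleR_left_distrib add.assoc)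
 finally show ?case using z t by (intro exI[of _ "z + t"]) (auto simp: algebra_simps)
qed

lemma dquot_pow_tendsto_iter_dderiv:
 assumes g: "smooth g" and h: "\<And>k::nat. h k > 0" "h \<longlonglongrightarrow> 0"
 shows "(\<lambda>k. (dquot (h k) v ^^ j) g x) \<longlonglongrightarrow> iter_dderiv (replicate j v) g x"
proof -
 have "\<forall>k. \<exists>t. 0 \<le> t \<and> t \<le> real j * h k \<and> (dquot (h k) v ^^ j) g x = iter_dderiv (replicate j v) g (x + t *\<^sub>R v)"
  using dquot_pow_MVT[OF g h(1)] by blast
 then obtain t where t: "\<And>k. 0 \<le> t k" "\<And>k. t k \<le> real j * h k"
  "\<And>k. (dquot (h k) v ^^ j) g x = iter_dderiv (replicate j v) g (x + t k *\<^sub>R v)"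
  by metis
 have "(\<lambda>k. real j * h k) \<longlonglongrightarrow> real j * 0" by (intro tendsto_intros h)
 hence "t \<longlonglongrightarrow> 0" using t by (intro tendsto_sandwich[of "\<lambda>_. 0" t sequentially "\<lambda>k. real j * h k" 0]) auto
 hence "(\<lambda>k. x + t k *\<^sub>R v) \<longlonglongrightarrow> x + 0 *\<^sub>R v" by (intro tendsto_intros)
 hence "(\<lambda>k. iter_dderiv (replicate j v) g (x + t k *\<^sub>R v)) \<longlonglongrightarrow> iter_dderiv (replicate j v) g (x + 0 *\<^sub>R v)"
  by (rule continuous_on_tendsto_compose[OF smooth_continuous[OF smooth_iter_dderiv[OF g], where S = UNIV]]) auto
 thus ?thesis using t(3) by simp
qed

text \<open>Fatou's lemma along steps tending to 0; smoothness of \<open>g\<close> gives pointwise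
  convergence of its difference quotients to the derivative.\<close>

lemma iter_dderiv_square_le:
 fixes g :: "'a::euclidean_space \<Rightarrow> real"
 assumes g: "smooth g" and [measurable]: "S \<in> sets borel" and h0: "h0 > 0"
  and le: "\<And>h. 0 < h \<Longrightarrow> h < h0 \<Longrightarrow> (\<integral>\<^sup>+x. ennreal (indicator S x * ((dquot h v ^^ j) g x)\<^sup>2) \<partial>lborel) \<le> C"
 shows "(\<integral>\<^sup>+x. ennreal (indicator S x * (iter_dderiv (replicate j v) g x)\<^sup>2) \<partial>lborel) \<le> C"
proof -
 define h where "h k = h0 / (real k + 2)" for k
 have h: "h k > 0" "h k < h0" for k using h0 by (auto simp: h_def divide_less_eq)
 have "h \<longlonglongrightarrow> 0" unfolding h_def using LIMSEQ_ignore_initial_segment[OF lim_const_over_n, of h0 2] by (simp add: add.commute)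
 note lim = dquot_pow_tendsto_iter_dderiv[OF g h(1) this, where v = v and j = j]
 have [measurable]: "borel_fun ((dquot (h k) v ^^ j) g)" for k
  by (rule smooth_borel[OF smooth_dquot_pow[OF g]])
 have "(\<integral>\<^sup>+x. ennreal (indicator S x * (iter_dderiv (replicate j v) g x)\<^sup>2) \<partial>lborel)
   = (\<integral>\<^sup>+x. liminf (\<lambda>k. ennreal (indicator S x * ((dquot (h k) v ^^ j) g x)\<^sup>2)) \<partial>lborel)"
  by (intro nn_integral_cong lim_imp_Liminf[symmetric] tendsto_ennrealI tendsto_mult tendsto_power tendsto_const lim) simp
 also have "\<dots> \<le> liminf (\<lambda>k. \<integral>\<^sup>+x. ennreal (indicator S x * ((dquot (h k) v ^^ j) g x)\<^sup>2) \<partial>lborel)"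
  by (rule nn_integral_liminf) measurable
 also have "\<dots> \<le> liminf (\<lambda>k::nat. C)" by (intro Liminf_mono always_eventually allI le h)
 finally show ?thesis by (simp add: Liminf_const)
qed

lemma dquot_pow_conv:
 fixes f g :: "'a::euclidean_space \<Rightarrow> real"
 assumes f: "integrable lborel f" and g: "test_function UNIV g"
 shows "integrable lborel ((dquot h v ^^ j) f) \<and> (dquot h v ^^ j) (conv f g) = conv ((dquot h v ^^ j) f) g"
proof (induction j)
 case (Suc j)
 let ?F = "(dquot h v ^^ j) f"
 have F: "integrable lborel ?F" using Suc by simp
 have [measurable]: "borel_fun ?F" "borel_fun g"
  using borel_measurable_integrable[OF F] smooth_borel[OF test_function_smooth[OF g]] by auto
 have i: "integrable lborel (\<lambda>x. ?F (x + h *\<^sub>R v))" by (rule integrable_translate[OF F])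
 have "dquot h v (conv ?F g) x = conv (dquot h v ?F) g x" for x
 proof -
  have "conv ?F g (x + h *\<^sub>R v) = (\<integral>y. ?F (y + h *\<^sub>R v) * g (x - y) \<partial>lborel)"
   unfolding conv_def using integral_translate[of "\<lambda>y. ?F y * g (x + h *\<^sub>R v - y)" "h *\<^sub>R v"] by (simp add: algebra_simps)
  moreover have "conv (dquot h v ?F) g x = ((\<integral>y. ?F (y + h *\<^sub>R v) * g (x - y) \<partial>lborel) - conv ?F g x) / h"
   using integrable_conv_integrand[OF i g, of x] integrable_conv_integrand[OF F g, of x]
   by (simp add: conv_def dquot_def left_diff_distrib diff_divide_distrib)
  ultimately show ?thesis by (simp add: dquot_def)
 qed
 moreover have "integrable lborel (dquot h v ?F)" using i F by (simp add: dquot_def)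
 ultimately show ?case using Suc by (simp add: fun_eq_iff[of "dquot h v (conv _ _)"])
qed (use f in simp)

text \<open>Jensen's inequality for the probability kernel bounds the square of the mollification by
  the mollification of the square. On \<open>ball x0 r\<close> the kernel sees only
  \<open>ball x0 R\<close>, so the square may be cut off there before the L1 bound is used. The
  estimate does not deteriorate as \<open>e\<close> tends to 0.\<close>

lemma conv_mollifier_square_le:
 fixes f :: "'a::euclidean_space \<Rightarrow> real"
 assumes f: "integrable lborel f" and B: "\<And>x. \<bar>f x\<bar> \<le> B" and e: "e > 0" "r + e \<le> R"
 shows "(\<integral>\<^sup>+x. ennreal (indicator (ball x0 r) x * (conv f (mollifier e) x)\<^sup>2) \<partial>lborel) \<le> ennreal (\<integral>x. indicator (ball x0 R) x * (f x)\<^sup>2 \<partial>lborel)"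
proof -
 let ?\<rho> = "mollifier e :: 'a \<Rightarrow> real"
 note [measurable] = borel_measurable_integrable[OF f, simplified]
 have f2: "integrable lborel (\<lambda>x. (f x)\<^sup>2)"
  unfolding power2_eq_square by (rule integrable_mult_bounded[where B = B]) (use f B in auto)
 have If2: "integrable lborel (\<lambda>x. indicator (ball x0 R) x * (f x)\<^sup>2)"
  by (rule integrable_mult_bounded[OF f2, where B = 1]) (auto simp: indicator_def)
 have jensen: "(conv f ?\<rho> x)\<^sup>2 \<le> conv (\<lambda>x. (f x)\<^sup>2) ?\<rho> x" for x
 proof -
  define c where "c = conv f ?\<rho> x"
  note i = integrable_conv_integrand[OF f test_function_mollifier[OF e(1)], of x]
   integrable_conv_integrand[OF f2 test_function_mollifier[OF e(1)], of x] mollifier_translate_integral[OF e(1), of x]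
  have "0 \<le> (\<integral>y. (f y - c)\<^sup>2 * ?\<rho> (x - y) \<partial>lborel)"
   by (intro Bochner_Integration.integral_nonneg mult_nonneg_nonneg mollifier_nonneg e) auto
  also have "\<dots> = (\<integral>y. (f y)\<^sup>2 * ?\<rho> (x - y) - 2 * c * (f y * ?\<rho> (x - y)) + c\<^sup>2 * ?\<rho> (x - y) \<partial>lborel)"
   by (rule arg_cong[where f="integral\<^sup>L lborel"]) (simp add: fun_eq_iff power2_eq_square algebra_simps)
  also have "\<dots> = conv (\<lambda>x. (f x)\<^sup>2) ?\<rho> x - c\<^sup>2" using i by (simp add: conv_def c_def power2_eq_square)
  finally show ?thesis by (simp add: c_def)
 qed
 have loc: "indicator (ball x0 r) x * (conv f ?\<rho> x)\<^sup>2 \<le> \<bar>conv (\<lambda>x. indicator (ball x0 R) x * (f x)\<^sup>2) ?\<rho> x\<bar>" for x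
 proof (cases "x \<in> ball x0 r")
  case True
  have *: "indicator (ball x0 R) y * (f y)\<^sup>2 * ?\<rho> (x - y) = (f y)\<^sup>2 * ?\<rho> (x - y)" for y
  proof (cases "y \<in> ball x0 R")
   case False
   hence "norm (x - y) \<ge> e" using True e(2) dist_triangle[of x0 y x] by (simp add: dist_norm)
   thus ?thesis using mollifier_eq_0[OF e(1), of "x - y"] by simp
  qed simp
  have "conv (\<lambda>x. indicator (ball x0 R) x * (f x)\<^sup>2) ?\<rho> x = conv (\<lambda>x. (f x)\<^sup>2) ?\<rho> x" unfolding conv_def * ..
  thus ?thesis using True jensen[of x] by simp
 qed simp
 have "(\<integral>\<^sup>+x. ennreal (indicator (ball x0 r) x * (conv f ?\<rho> x)\<^sup>2) \<partial>lborel)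
   \<le> (\<integral>\<^sup>+x. ennreal \<bar>conv (\<lambda>x. indicator (ball x0 R) x * (f x)\<^sup>2) ?\<rho> x\<bar> \<partial>lborel)"
  by (intro nn_integral_mono ennreal_leI loc)
 also have "\<dots> \<le> ennreal ((\<integral>x. \<bar>indicator (ball x0 R) x * (f x)\<^sup>2\<bar> \<partial>lborel) * (\<integral>x. ?\<rho> x \<partial>lborel))"
  by (rule conv_nn_integral_le[OF If2 test_function_mollifier[OF e(1)] mollifier_nonneg[OF e(1)]])
 finally show ?thesis by (simp add: mollifier_integral[OF e(1)])
qed

text \<open>The indicator of the ball of intermediate radius is mollified at half the width of the
  annulus. Comparison with the centre 1/2 gives the range [0, 1].\<close>

lemma plateau:
 fixes x0 :: "'a::euclidean_space"
 assumes "r < R"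
 obtains \<psi> where "test_function UNIV \<psi>" "\<And>x. 0 \<le> \<psi> x \<and> \<psi> x \<le> 1" "\<And>x. x \<in> cball x0 r \<Longrightarrow> \<psi> x = 1" "\<And>x. x \<notin> cball x0 R \<Longrightarrow> \<psi> x = 0"
proof -
 define s where "s = (r + R) / 2"
 define d where "d = (R - r) / 2"
 have d: "d > 0" "r + d = s" "s + d = R" using assms by (auto simp: s_def d_def field_simps)
 define \<psi> where "\<psi> = conv (indicator (ball x0 s)) (mollifier d)"
 have i: "integrable lborel (indicator (ball x0 s) :: 'a \<Rightarrow> real)" by (rule integrable_indicator_bounded) auto
 have "\<bar>\<psi> x - 1 / 2\<bar> \<le> 1 / 2" for x
  unfolding \<psi>_def by (rule conv_mollifier_bound[OF i d(1)]) (simp add: indicator_def)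
 hence 1: "0 \<le> \<psi> x \<and> \<psi> x \<le> 1" for x unfolding abs_le_iff by (smt (verit) field_sum_of_halves)
 have "\<bar>\<psi> x - 1\<bar> \<le> 0" if "x \<in> cball x0 r" for x
  unfolding \<psi>_def
 proof (rule conv_mollifier_bound[OF i d(1)])
  fix y assume "dist x y < d"
  hence "y \<in> ball x0 s" using that d(2) dist_triangle[of x0 y x] by simp
  thus "\<bar>indicator (ball x0 s) y - 1\<bar> \<le> (0::real)" by simp
 qed
 hence 2: "\<psi> x = 1" if "x \<in> cball x0 r" for x using that by fastforce
 have "\<bar>\<psi> x - 0\<bar> \<le> 0" if "x \<notin> cball x0 R" for x
  unfolding \<psi>_def
 proof (rule conv_mollifier_bound[OF i d(1)])
  fix y assume "dist x y < d"
  hence "y \<notin> ball x0 s" using that d(3) dist_triangle[of x0 x y] by (simp add: dist_commute)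
  thus "\<bar>indicator (ball x0 s) y - 0\<bar> \<le> (0::real)" by simp
 qed
 hence 3: "\<psi> x = 0" if "x \<notin> cball x0 R" for x using that by fastforce
 have "smooth \<psi>" unfolding \<psi>_def by (rule smooth_conv[OF i test_function_mollifier[OF d(1)]])
 hence "test_function UNIV \<psi>" unfolding test_function_def using 3 by (auto intro!: exI[of _ "cball x0 R"])
 from that[OF this 1 2 3] show thesis .
qed

lemma test_functions_bounded:
 fixes f :: "'i \<Rightarrow> 'a::euclidean_space \<Rightarrow> real"
 assumes "\<And>i. test_function \<Omega> (f i)"
 obtains B where "\<And>i. B i \<ge> 0" "\<And>i x. \<bar>f i x\<bar> \<le> B i"
proof -
 have "\<forall>i. \<exists>B\<ge>0. \<forall>x. \<bar>f i x\<bar> \<le> B" using test_function_bounded[OF assms] by blast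
 with that show thesis by metis
qed

lemma smooth_Lipschitz:
 fixes g :: "'a::euclidean_space \<Rightarrow> real"
 assumes g: "smooth g" and S: "convex S" "x \<in> S" "y \<in> S"
  and C: "\<And>b z. b \<in> Basis \<Longrightarrow> z \<in> S \<Longrightarrow> \<bar>dderiv b g z\<bar> \<le> C"
 shows "\<bar>g x - g y\<bar> \<le> real DIM('a) * C * dist x y"
proof -
 obtain z where z: "0 < z" "z < 1" "fdiff (1 *\<^sub>R (x - y)) g y = 1 * dderiv (x - y) g (y + z *\<^sub>R (x - y))"
  by (rule fdiff_MVT[OF g, of 1 "x - y" y]) simp
 let ?z = "y + z *\<^sub>R (x - y)"
 have "(1 - z) *\<^sub>R y + z *\<^sub>R x \<in> S" using z S by (intro convexD) auto
 hence zS: "?z \<in> S" by (simp add: algebra_simps)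
 have "\<bar>g x - g y\<bar> = \<bar>dderiv (x - y) g ?z\<bar>" using z(3) by (simp add: fdiff_def)
 also have "\<dots> \<le> (\<Sum>b\<in>Basis. \<bar>((x - y) \<bullet> b) * dderiv b g ?z\<bar>)"
  unfolding smooth_dderiv_Basis[OF g, of "x - y"] by (rule sum_abs)
 also have "\<dots> \<le> (\<Sum>b\<in>(Basis::'a set). norm (x - y) * C)"
  unfolding abs_mult by (intro sum_mono mult_mono C zS Basis_le_norm) auto
 finally show ?thesis by (simp add: dist_norm ac_simps)
qed

lemma test_function_Lipschitz:
 fixes \<psi> :: "'a::euclidean_space \<Rightarrow> real"
 assumes t: "test_function UNIV \<psi>"
 obtains L where "L \<ge> 0" "\<And>x y. \<bar>\<psi> x - \<psi> y\<bar> \<le> L * dist x y"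
proof -
 obtain B where B: "\<And>b. B b \<ge> 0" "\<And>b x. \<bar>dderiv b \<psi> x\<bar> \<le> B b"
  using test_functions_bounded[of _ "\<lambda>v. dderiv v \<psi>", OF test_function_dderiv[OF t]] by blast
 have "\<bar>dderiv b \<psi> x\<bar> \<le> (\<Sum>b\<in>Basis. B b)" if "b \<in> Basis" for b x
  using B(2)[of b x] member_le_sum[OF that, of B] B(1) by fastforce
 hence "\<bar>\<psi> x - \<psi> y\<bar> \<le> real DIM('a) * (\<Sum>b\<in>Basis. B b) * dist x y" for x y
  by (intro smooth_Lipschitz[OF test_function_smooth[OF t], of UNIV]) auto
 moreover have "real DIM('a) * (\<Sum>b\<in>Basis. B b) \<ge> 0" by (intro mult_nonneg_nonneg sum_nonneg B) auto
 ultimately show thesis using that by blast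
qed

lemma test_function_good_cutoff:
 fixes \<psi> :: "real^'n \<Rightarrow> real"
 assumes t: "test_function UNIV \<psi>" and "\<And>x. 0 \<le> \<psi> x \<and> \<psi> x \<le> 1" "\<And>x. x \<notin> cball x0 R \<Longrightarrow> \<psi> x = 0"
 obtains L L1 where "good_cutoff L L1 x0 R \<psi>"
proof -
 obtain L where L: "L \<ge> 0" "\<And>x y. \<bar>\<psi> x - \<psi> y\<bar> \<le> L * dist x y" by (rule test_function_Lipschitz[OF t]) blast
 obtain B where B: "\<And>v. B v \<ge> 0" "\<And>v x. \<bar>dderiv v \<psi> x\<bar> \<le> B v"
  using test_functions_bounded[of _ "\<lambda>v. dderiv v \<psi>", OF test_function_dderiv[OF t]] by blast
 obtain B2 where B2: "\<And>p. B2 p \<ge> 0" "\<And>p x. \<bar>pd2 p \<psi> x\<bar> \<le> B2 p"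
  using test_functions_bounded[of _ "\<lambda>p. pd2 p \<psi>", OF test_function_pd2[OF t]] by blast
 define L1 where "L1 = (\<Sum>i\<in>UNIV. B (axis i 1)) + (\<Sum>p\<in>UNIV. B2 p)"
 have "B (axis i 1) \<le> (\<Sum>i\<in>UNIV. B (axis i 1))" for i by (rule member_le_sum) (auto simp: B)
 moreover have "B2 p \<le> (\<Sum>p\<in>UNIV. B2 p)" for p by (rule member_le_sum) (auto simp: B2)
 moreover have "(\<Sum>i\<in>UNIV. B (axis i 1)) \<ge> 0" "(\<Sum>p\<in>UNIV. B2 p) \<ge> 0" by (auto intro!: sum_nonneg B B2)
 ultimately have "L1 \<ge> 0" "\<bar>dderiv (axis i 1) \<psi> x\<bar> \<le> L1" "\<bar>pd2 p \<psi> x\<bar> \<le> L1" for i x p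
  using B(2)[of "axis i 1" x] B2(2)[of p x] unfolding L1_def by (smt (verit))+
 hence "good_cutoff L L1 x0 R \<psi>"
  using assms L test_function_smooth[OF t] by (auto simp: good_cutoff_def cutoff_def)
 thus thesis by (rule that)
qed

text \<open>Induction through the product rule, with the innermost derivative taken first: it falls
  on \<psi> or on \<open>g\<close>, and \<psi> is arbitrary in the induction since its derivative is
  again a test function vanishing off \<open>S\<close>. That \<open>C\<close> does not depend on
  \<open>g\<close> is what bounds uniform over mollifications require.\<close>

lemma product_derivative_bound:
 fixes \<psi> :: "'a::euclidean_space \<Rightarrow> real"
 assumes "test_function UNIV \<psi>" "closed S" "\<And>x. x \<notin> S \<Longrightarrow> \<psi> x = 0"
 shows "\<exists>C\<ge>0. \<forall>g x. smooth g \<longrightarrow> (iter_dderiv (replicate j v) (\<lambda>x. \<psi> x * g x) x)\<^sup>2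
  \<le> C * (\<Sum>i\<le>j. indicator S x * (iter_dderiv (replicate i v) g x)\<^sup>2)"
 using assms(1,3)
proof (induction j arbitrary: \<psi>)
 case 0
 obtain B where B: "B \<ge> 0" "\<And>x. \<bar>\<psi> x\<bar> \<le> B" using test_function_bounded[OF 0(1)] by blast
 have "(\<psi> x * g x)\<^sup>2 \<le> B\<^sup>2 * (indicator S x * (g x)\<^sup>2)" for g x
 proof (cases "x \<in> S")
  case True
  have "(\<psi> x)\<^sup>2 \<le> B\<^sup>2" using B(2)[of x] by (rule power2_le_iff_abs_le[OF B(1), THEN iffD2])
  thus ?thesis using True by (simp add: power_mult_distrib mult_right_mono)
 qed (simp add: 0)
 thus ?case by (intro exI[of _ "B\<^sup>2"]) auto
next
 case (Suc j)
 obtain C1 where C1: "C1 \<ge> 0" "\<And>g x. smooth g \<Longrightarrow> (iter_dderiv (replicate j v) (\<lambda>x. dderiv v \<psi> x * g x) x)\<^sup>2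
  \<le> C1 * (\<Sum>i\<le>j. indicator S x * (iter_dderiv (replicate i v) g x)\<^sup>2)"
  using Suc.IH[OF test_function_dderiv[OF Suc.prems(1)] dderiv_vanish_outside[of S \<psi>]] assms(2) Suc.prems(2) by blast
 obtain C2 where C2: "C2 \<ge> 0" "\<And>g x. smooth g \<Longrightarrow> (iter_dderiv (replicate j v) (\<lambda>x. \<psi> x * g x) x)\<^sup>2
  \<le> C2 * (\<Sum>i\<le>j. indicator S x * (iter_dderiv (replicate i v) g x)\<^sup>2)"
  using Suc.IH[OF Suc.prems] by blast
 have "(iter_dderiv (replicate (Suc j) v) (\<lambda>x. \<psi> x * g x) x)\<^sup>2
  \<le> (2 * C1 + 2 * C2) * (\<Sum>i\<le>Suc j. indicator S x * (iter_dderiv (replicate i v) g x)\<^sup>2)" (is "_ \<le> _ * ?S")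
  if g: "smooth g" for g x
 proof -
  have sm: "smooth \<psi>" by (rule test_function_smooth[OF Suc.prems(1)])
  let ?a = "iter_dderiv (replicate j v) (\<lambda>x. dderiv v \<psi> x * g x) x"
  let ?b = "iter_dderiv (replicate j v) (\<lambda>x. \<psi> x * dderiv v g x) x"
  have "iter_dderiv (replicate (Suc j) v) (\<lambda>x. \<psi> x * g x) = iter_dderiv (replicate j v) (dderiv v (\<lambda>x. \<psi> x * g x))"
   using iter_dderiv_dderiv_commute[OF smooth_mult[OF sm g], of "replicate j v" v] by (simp add: iter_dderiv_Cons)
  also have "dderiv v (\<lambda>x. \<psi> x * g x) = (\<lambda>x. dderiv v \<psi> x * g x + \<psi> x * dderiv v g x)"
   by (intro dderiv_mult smooth_dir_differentiable sm g)
  finally have eq: "iter_dderiv (replicate (Suc j) v) (\<lambda>x. \<psi> x * g x) x = ?a + ?b"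
   by (simp add: iter_dderiv_add smooth_mult smooth_dderiv sm g)
  have "(\<Sum>i\<le>j. indicator S x * (iter_dderiv (replicate i v) g x)\<^sup>2) \<le> ?S" by simp
  hence a: "?a\<^sup>2 \<le> C1 * ?S" using C1(2)[OF g, of x] mult_left_mono[OF _ C1(1)] by (meson order_trans)
  have "(\<Sum>i\<le>j. indicator S x * (iter_dderiv (replicate i v) (dderiv v g) x)\<^sup>2)
    = (\<Sum>i\<le>j. indicator S x * (iter_dderiv (replicate (Suc i) v) g x)\<^sup>2)"
   by (simp add: iter_dderiv_dderiv_commute[OF g] iter_dderiv_Cons)
  also have "\<dots> \<le> ?S" unfolding sum.atMost_Suc_shift by simp
  finally have b: "?b\<^sup>2 \<le> C2 * ?S" using C2(2)[OF smooth_dderiv[OF g], of v x] mult_left_mono[OF _ C2(1)] by (meson order_trans)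
  have "(?a + ?b)\<^sup>2 \<le> 2 * ?a\<^sup>2 + 2 * ?b\<^sup>2" using zero_le_power2[of "?a - ?b"] by (simp add: power2_sum power2_diff)
  thus ?thesis unfolding eq distrib_right using a b by linarith
 qed
 thus ?case using C1 C2 by (intro exI[of _ "2 * C1 + 2 * C2"]) auto
qed

lemma Basis_axis: "(Basis :: (real^'n) set) = range (\<lambda>i. axis i 1)"
 by (auto simp: Basis_vec_def)

text \<open>After multiplication by a plateau function, the sup bound costs \<open>CARD('n)\<close>
  derivatives beyond the \<open>N\<close> wanted, and passing from mixed to pure derivatives doubles
  the order for each of them; hence \<open>2 ^ (N + CARD('n))\<close>. On the bounded support L1 is
  reduced to L2 by |t| \<le> (t^2 + 1) / 2.\<close>

lemma local_sobolev:
 fixes x0 :: "real^'n"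
 assumes r: "r < R" and C: "C \<ge> 0"
 shows "\<exists>C'. \<forall>g. smooth g \<longrightarrow> (\<forall>s j. j \<le> 2 ^ (N + CARD('n)) \<longrightarrow>
   (\<integral>\<^sup>+x. ennreal (indicator (ball x0 R) x * (iter_dderiv (replicate j (axis s 1)) g x)\<^sup>2) \<partial>lborel) \<le> ennreal C) \<longrightarrow>
  (\<forall>\<alpha> x. length \<alpha> \<le> N \<longrightarrow> x \<in> ball x0 r \<longrightarrow> \<bar>partials \<alpha> g x\<bar> \<le> C')"
proof -
 define J where "J = (2::nat) ^ (N + CARD('n))"
 define R' where "R' = (r + R) / 2"
 have R': "r < R'" "R' < R" using r by (auto simp: R'_def)
 obtain \<psi> :: "real^'n \<Rightarrow> real" where \<psi>: "test_function UNIV \<psi>" "\<And>x. x \<in> cball x0 r \<Longrightarrow> \<psi> x = 1" "\<And>x. x \<notin> cball x0 R' \<Longrightarrow> \<psi> x = 0"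
  using plateau[OF R'(1), of x0] by metis
 define P where "P s j K \<longleftrightarrow> K \<ge> 0 \<and> (\<forall>g x. smooth g \<longrightarrow> (iter_dderiv (replicate j (axis s 1)) (\<lambda>x. \<psi> x * g x) x)\<^sup>2
  \<le> K * (\<Sum>i\<le>j. indicator (cball x0 R') x * (iter_dderiv (replicate i (axis s 1)) g x)\<^sup>2))" for s j K
 define k where "k s j = (SOME K. P s j K)" for s j
 have k: "P s j (k s j)" for s j
  unfolding k_def by (rule someI_ex) (unfold P_def, rule product_derivative_bound[OF \<psi>(1) closed_cball \<psi>(3)])
 define K where "K = (\<Sum>(s, j)\<in>UNIV \<times> {..J}. k s j)"
 have kK: "k s j \<le> K" if "j \<le> J" for s j
  unfolding K_def using that k member_le_sum[of "(s, j)" "UNIV \<times> {..J}" "\<lambda>(s, j). k s j"] by (auto simp: P_def)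
 have K0: "K \<ge> 0" unfolding K_def using k by (auto intro!: sum_nonneg simp: P_def)
 define B where "B = K * (real (J + 1) * C)"
 show ?thesis
 proof (intro exI[of _ "(B + measure lborel (cball x0 R')) / 2"] allI impI)
  fix g :: "real^'n \<Rightarrow> real" and \<alpha> :: "'n list" and x assume g: "smooth g"
   and L2: "\<forall>s j. j \<le> 2 ^ (N + CARD('n)) \<longrightarrow>
    (\<integral>\<^sup>+x. ennreal (indicator (ball x0 R) x * (iter_dderiv (replicate j (axis s 1)) g x)\<^sup>2) \<partial>lborel) \<le> ennreal C"
   and \<alpha>: "length \<alpha> \<le> N" and x: "x \<in> ball x0 r"
  have gm [measurable]: "borel_fun (iter_dderiv vs g)" for vs by (rule smooth_borel[OF smooth_iter_dderiv[OF g]])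
  define f where "f x = \<psi> x * g x" for x
  have f: "test_function UNIV f" unfolding f_def by (rule test_function_mult_left[OF \<psi>(1) g])
  have pure: "(\<integral>x. (iter_dderiv (replicate j b) f x)\<^sup>2 \<partial>lborel) \<le> B" if b: "b \<in> Basis" and j: "j \<le> J" for b j
  proof -
   obtain s where s: "b = axis s 1" using b by (auto simp: Basis_axis)
   let ?I = "\<lambda>i x. indicator (cball x0 R') x * (iter_dderiv (replicate i b) g x)\<^sup>2"
   have "ennreal (\<integral>x. (iter_dderiv (replicate j b) f x)\<^sup>2 \<partial>lborel) = (\<integral>\<^sup>+x. ennreal ((iter_dderiv (replicate j b) f x)\<^sup>2) \<partial>lborel)"
    unfolding power2_eq_square
    by (intro nn_integral_eq_integral[symmetric] integrable_test_function_mult test_function_iter_dderiv f) auto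
   also have "\<dots> \<le> (\<integral>\<^sup>+x. ennreal K * (\<Sum>i\<le>j. ennreal (?I i x)) \<partial>lborel)"
   proof (rule nn_integral_mono)
    fix x
    have "(iter_dderiv (replicate j b) f x)\<^sup>2 \<le> k s j * (\<Sum>i\<le>j. ?I i x)"
     using k[of s j] g by (simp add: P_def s f_def[abs_def])
    also have "\<dots> \<le> K * (\<Sum>i\<le>j. ?I i x)" by (intro mult_right_mono kK j sum_nonneg) auto
    finally show "ennreal ((iter_dderiv (replicate j b) f x)\<^sup>2) \<le> ennreal K * (\<Sum>i\<le>j. ennreal (?I i x))"
     using K0 by (simp add: sum_ennreal ennreal_mult'[symmetric] ennreal_leI)
   qed
   also have "\<dots> = ennreal K * (\<Sum>i\<le>j. (\<integral>\<^sup>+x. ennreal (?I i x) \<partial>lborel))"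
   proof -
    have "(\<integral>\<^sup>+x. (\<Sum>i\<le>j. ennreal (?I i x)) \<partial>lborel) = (\<Sum>i\<le>j. (\<integral>\<^sup>+x. ennreal (?I i x) \<partial>lborel))" by (rule nn_integral_sum) measurable
    thus ?thesis by (subst nn_integral_cmult) auto
   qed
   also have "\<dots> \<le> ennreal K * (\<Sum>i\<le>j. ennreal C)"
   proof (intro mult_left_mono sum_mono)
    fix i assume "i \<in> {..j}"
    hence "i \<le> J" using j by simp
    have "(\<integral>\<^sup>+x. ennreal (?I i x) \<partial>lborel) \<le> (\<integral>\<^sup>+x. ennreal (indicator (ball x0 R) x * (iter_dderiv (replicate i b) g x)\<^sup>2) \<partial>lborel)"
     using R'(2) by (intro nn_integral_mono ennreal_leI mult_right_mono) (auto simp: indicator_def)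
    also have "\<dots> \<le> ennreal C" using L2 \<open>i \<le> J\<close> by (simp add: J_def s)
    finally show "(\<integral>\<^sup>+x. ennreal (?I i x) \<partial>lborel) \<le> ennreal C" .
   qed simp
   also have "\<dots> = ennreal (K * (real (j + 1) * C))" using K0 C by (simp add: ennreal_mult' ennreal_of_nat_eq_real_of_nat)
   also have "\<dots> \<le> ennreal B" unfolding B_def using K0 C j by (intro ennreal_leI mult_left_mono mult_right_mono) auto
   finally show ?thesis by (subst (asm) ennreal_le_iff) (use K0 C in \<open>auto simp: B_def\<close>)
  qed
  let ?a = "map (\<lambda>i. axis i 1) \<alpha> :: (real^'n) list"
  obtain bs where bs: "set bs = Basis" "distinct bs"
   "\<And>x. \<bar>iter_dderiv ?a f x\<bar> \<le> (\<integral>y. \<bar>iter_dderiv bs (iter_dderiv ?a f) y\<bar> \<partial>lborel)"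
   using sup_bound[OF test_function_iter_dderiv[OF f]] by metis
  have lbs: "length bs = CARD('n)" using distinct_card[OF bs(2)] bs(1) by simp
  define l where "l = bs @ ?a"
  let ?G = "iter_dderiv l f"
  have tG: "test_function UNIV ?G" by (rule test_function_iter_dderiv[OF f])
  have "concat (map (\<lambda>(s, a). replicate a s) (map (\<lambda>b. (b, 1)) l)) = l" by (induction l) auto
  moreover have "(\<integral>x. (iter_dderiv (concat (map (\<lambda>(s, a). replicate a s) (map (\<lambda>b. (b, 1)) l))) f x)\<^sup>2 \<partial>lborel) \<le> B"
  proof (rule mixed_derivative_bound[OF f, where D = Basis and k = "length l" and A = 1])
   fix b :: "real^'n" and j :: nat assume "b \<in> Basis" and j: "j \<le> 2 ^ length l * 1"
   have "length l \<le> N + CARD('n)" using \<alpha> lbs by (simp add: l_def)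
   hence "2 ^ length l \<le> J" unfolding J_def by (intro power_increasing) auto
   thus "(\<integral>x. (iter_dderiv (replicate j b) f x)\<^sup>2 \<partial>lborel) \<le> B" using pure[OF \<open>b \<in> Basis\<close>, of j] j by linarith
  qed (use bs(1) in \<open>auto simp: l_def Basis_axis\<close>)
  ultimately have G2: "(\<integral>x. (?G x)\<^sup>2 \<partial>lborel) \<le> B" by (simp only:)
  have Gi: "integrable lborel (\<lambda>x. (?G x)\<^sup>2)" unfolding power2_eq_square by (rule integrable_test_function_mult[OF tG tG])
  have Ii: "integrable lborel (indicator (cball x0 R') :: real^'n \<Rightarrow> real)" by (rule integrable_indicator_bounded) auto
  have "\<bar>iter_dderiv ?a f x\<bar> \<le> (\<integral>y. \<bar>?G y\<bar> \<partial>lborel)" using bs(3) by (simp add: l_def iter_dderiv_append)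
  also have "\<dots> \<le> (\<integral>y. ((?G y)\<^sup>2 + indicator (cball x0 R') y) / 2 \<partial>lborel)"
  proof (rule integral_mono)
   fix y
   have "?G y = 0" if "y \<notin> cball x0 R'"
    by (rule iter_dderiv_vanish_outside[OF closed_cball _ that]) (simp add: f_def \<psi>(3))
   moreover have "\<bar>t\<bar> \<le> (t\<^sup>2 + 1) / 2" for t :: real
    using zero_le_power2[of "\<bar>t\<bar> - 1"] by (simp add: power2_diff)
   ultimately show "\<bar>?G y\<bar> \<le> ((?G y)\<^sup>2 + indicator (cball x0 R') y) / 2" by (cases "y \<in> cball x0 R'") auto
  qed (use Gi Ii test_function_integrable[OF tG] in auto)
  also have "\<dots> \<le> (B + measure lborel (cball x0 R')) / 2" using G2 Gi Ii by simp
  finally show "\<bar>partials \<alpha> g x\<bar> \<le> (B + measure lborel (cball x0 R')) / 2"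
   using iter_dderiv_local_cong[of "ball x0 r" f g x ?a] x \<psi>(2) by (simp add: partials_def f_def)
 qed
qed

text \<open>The constant is uniform in \<open>e\<close>. The radii come from
  \<open>derivative_bound\<close>: at points of \<open>ball x0 (R / 8)\<close> and for
  \<open>e < R / 8\<close> the mollification sees only \<open>ball x0 (R / 4)\<close>, where the
  cutoff of the energy estimate is 1; the Sobolev estimate halves the radius once more.\<close>

abbreviation partials_bounded :: "nat \<Rightarrow> real^'n \<Rightarrow> real \<Rightarrow> ('n \<times> 'n \<Rightarrow> real \<Rightarrow> real^'n \<Rightarrow> real) \<Rightarrow> bool"
 where "partials_bounded N x0 R g \<equiv> \<exists>C. \<forall>\<alpha> p e x. length \<alpha> \<le> N \<longrightarrow> 0 < e \<longrightarrow> e < R / 8 \<longrightarrow>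
  x \<in> ball x0 (R / 16) \<longrightarrow> \<bar>partials \<alpha> (g p e) x\<bar> \<le> C"

section \<open>Uniform interior bounds for mollified Hessians\<close>

context elliptic
begin

text \<open>One energy bound, at the order demanded by the local Sobolev estimate, controls all
  lower orders by interpolation. Differences commute with mollification, so the mollified entries
  inherit bounds that are uniform in the step, and hence bounds on their derivatives.\<close>

theorem derivative_bound:
 obtains \<omega> where "0 < \<omega>" "\<omega> \<le> 1" "\<And>H x0 R w M. osc_data \<omega> H \<Longrightarrow> R > 0 \<Longrightarrow> solution_data x0 R M w H \<Longrightarrow>
  partials_bounded N x0 R (mollified_ent (ball x0 R) H)"
proof -
 define m :: nat where "m = max 3 (2 ^ (N + CARD('n)))"
 have m: "m \<ge> 3" "m \<ge> 2 ^ (N + CARD('n))" by (auto simp: m_def)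
 obtain \<omega> where \<omega>: "0 < \<omega>" "\<omega> \<le> 1" and en: "\<And>H R r R' L L1 x0 \<zeta> w M. osc_data \<omega> H \<Longrightarrow> R > 0 \<Longrightarrow> r > 0 \<Longrightarrow> R + 2 * r \<le> R' \<Longrightarrow>
   good_cutoff L L1 x0 R \<zeta> \<Longrightarrow> solution_data x0 R' M w H \<Longrightarrow>
   \<exists>C. \<forall>s h q. 0 < h \<longrightarrow> h \<le> 1 \<longrightarrow> real m * h \<le> r \<longrightarrow> energy m \<zeta> h (axis s 1) (ents q H) \<le> C"
  using energy_bound[OF m(1)] by metis
 show thesis
 proof (rule that[OF \<omega>])
  fix H x0 R w M assume osc: "osc_data \<omega> H" and R: "R > 0" and sol: "solution_data x0 R M w H"
  have Hm [measurable]: "borel_fun H" using osc by (simp add: osc_data_def)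
  have Hb: "\<bar>ent q (H x)\<bar> \<le> norm (H 0) + 1" for q x
  proof -
   have "norm (H x - H 0) \<le> \<omega>" using osc by (auto simp: osc_data_def)
   thus ?thesis using abs_ent_le_norm[of q "H x"] norm_triangle_ineq2[of "H x" "H 0"] \<omega>(2) by linarith
  qed
  \<comment> \<open>The outer radius \<open>R / 2\<close> and the margin \<open>r = R / 4\<close>
    satisfy \<open>R / 2 + 2 * (R / 4) = R\<close>, the room that the energy bound asks for.\<close>
  obtain \<zeta> where \<zeta>: "test_function UNIV \<zeta>" "\<And>x. 0 \<le> \<zeta> x \<and> \<zeta> x \<le> 1" "\<And>x. x \<in> cball x0 (R / 4) \<Longrightarrow> \<zeta> x = 1" "\<And>x. x \<notin> cball x0 (R / 2) \<Longrightarrow> \<zeta> x = 0"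
   using plateau[of "R / 4" "R / 2" x0] R by auto
  obtain L L1 where gc: "good_cutoff L L1 x0 (R / 2) \<zeta>" using test_function_good_cutoff[OF \<zeta>(1,2,4)] by blast
  hence c: "cutoff L x0 (R / 2) \<zeta>" by (simp add: good_cutoff_def)
  obtain E where E: "\<And>s h q. 0 < h \<Longrightarrow> h \<le> 1 \<Longrightarrow> real m * h \<le> R / 4 \<Longrightarrow> energy m \<zeta> h (axis s 1) (ents q H) \<le> E"
   using en[OF osc _ _ _ gc sol, of "R / 4"] R by (auto simp del: split_paired_All split_paired_all)
  let ?I = "\<lambda>j h s q. \<integral>x. indicator (ball x0 (R / 4)) x * ((dquot h (axis s 1) ^^ j) (ents q H) x)\<^sup>2 \<partial>lborel"
  have sq: "\<exists>B. \<forall>x. \<bar>((dquot h v ^^ j) (ents q H) x)\<^sup>2\<bar> \<le> B" if "h > 0" for h v j q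
  proof (intro exI allI)
   fix x
   have "\<bar>(dquot h v ^^ j) (ents q H) x\<bar>\<^sup>2 \<le> ((2 / h) ^ j * (norm (H 0) + 1))\<^sup>2"
    by (intro power_mono dquot_pow_bound[OF that Hb]) auto
   thus "\<bar>((dquot h v ^^ j) (ents q H) x)\<^sup>2\<bar> \<le> ((2 / h) ^ j * (norm (H 0) + 1))\<^sup>2" by simp
  qed
  \<comment> \<open>Three sources: order 0 from boundedness of \<open>H\<close>, order
    \<open>m\<close> from the energy bound, the orders in between from interpolation with factor
    1.\<close>
  have ex: "\<exists>C\<ge>0. \<forall>h s q. 0 < h \<longrightarrow> h \<le> 1 \<longrightarrow> real m * h \<le> R / 4 \<longrightarrow> ?I j h s q \<le> C" if j: "j \<le> m" for j
  proof (cases "j = 0")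
   case True
   have "?I j h s q \<le> (\<integral>x. indicator (ball x0 (R / 4)) x * (norm (H 0) + 1)\<^sup>2 \<partial>lborel)" for h s q
   proof (rule integral_mono_AE')
    show "integrable lborel (\<lambda>x. indicator (ball x0 (R / 4)) x * (norm (H 0) + 1)\<^sup>2)"
     by (intro integrable_mult_left integrable_indicator_bounded) auto
    show "AE x in lborel. indicator (ball x0 (R / 4)) x * ((dquot h (axis s 1) ^^ j) (ents q H) x)\<^sup>2
      \<le> indicator (ball x0 (R / 4)) x * (norm (H 0) + 1)\<^sup>2"
     using Hb power_mono[OF Hb abs_ge_zero, of _ _ 2] by (intro always_eventually allI mult_left_mono) (auto simp: True)
   qed auto
   thus ?thesis
    by (intro exI[of _ "\<integral>x. indicator (ball x0 (R / 4)) x * (norm (H 0) + 1)\<^sup>2 \<partial>lborel"]) (auto intro!: Bochner_Integration.integral_nonneg)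
  next
   case False
   have "\<exists>C\<ge>0. \<forall>h s q. 0 < h \<longrightarrow> h \<le> 1 \<longrightarrow> real m * h \<le> R / 4 \<longrightarrow>
    wsq (2 * j) \<zeta> ((dquot h (axis s 1) ^^ j) (ents q H)) \<le> C"
   proof (cases "j = m")
    case True
    thus ?thesis using E by (intro exI[of _ "max E 0"]) (auto simp: energy_def le_max_iff_disj)
   next
    case False
    obtain C where C: "C \<ge> 0" "\<And>h v u c \<zeta>. admissible_osc L x0 (R / 2) \<omega> h v u c \<zeta> \<Longrightarrow>
     wsq (2 * j) \<zeta> ((dquot h v ^^ j) u) \<le> 1 * wsq (2 * m) \<zeta> ((dquot h v ^^ m) u) + C"
     using lower_order_interpolation[where j = j and m = m and \<epsilon> = 1 and \<omega> = \<omega> and ?x0.0 = x0 and L = L and R = "R / 2"] \<open>j \<noteq> 0\<close> False j \<omega>(1) by auto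
    have "wsq (2 * j) \<zeta> ((dquot h (axis s 1) ^^ j) (ents q H)) \<le> max E 0 + C"
     if "0 < h" "h \<le> 1" "real m * h \<le> R / 4" for h s q
    proof -
     have "norm (axis s 1 :: real^'n) \<le> 1" by simp
     from C(2)[OF osc_data_admissible[OF osc that(1,2) this c], of q] E[OF that, of s q]
     show ?thesis unfolding energy_def by linarith
    qed
    thus ?thesis using C(1) by (intro exI[of _ "max E 0 + C"]) auto
   qed
   moreover have "?I j h s q \<le> wsq (2 * j) \<zeta> ((dquot h (axis s 1) ^^ j) (ents q H))" if h: "h > 0" for h s q
   proof (rule integral_mono_AE')
    obtain B where B: "\<And>x. \<bar>((dquot h (axis s 1) ^^ j) (ents q H) x)\<^sup>2\<bar> \<le> B" using sq[OF h] by blast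
    show "integrable lborel (\<lambda>x. \<zeta> x ^ (2 * j) * ((dquot h (axis s 1) ^^ j) (ents q H) x)\<^sup>2)"
     by (rule cutoff_power_integrable[OF c _ B]) (use False in \<open>auto intro!: borel_measurable_power dquot_pow_measurable ent_measurable\<close>)
    show "AE x in lborel. indicator (ball x0 (R / 4)) x * ((dquot h (axis s 1) ^^ j) (ents q H) x)\<^sup>2
      \<le> \<zeta> x ^ (2 * j) * ((dquot h (axis s 1) ^^ j) (ents q H) x)\<^sup>2"
     using \<zeta>(2,3) by (intro always_eventually allI mult_right_mono) (auto simp: indicator_def)
   qed (simp add: power_mult)
   ultimately show ?thesis by (meson order_trans)
  qed
  define c where "c j = (SOME C. C \<ge> 0 \<and> (\<forall>h s q. 0 < h \<longrightarrow> h \<le> 1 \<longrightarrow> real m * h \<le> R / 4 \<longrightarrow> ?I j h s q \<le> C))" for j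
  have c: "c j \<ge> 0 \<and> (\<forall>h s q. 0 < h \<longrightarrow> h \<le> 1 \<longrightarrow> real m * h \<le> R / 4 \<longrightarrow> ?I j h s q \<le> c j)" if "j \<le> m" for j
   unfolding c_def by (rule someI_ex[OF ex[OF that]])
  hence c0: "\<And>j. j \<le> m \<Longrightarrow> c j \<ge> 0" and c1: "\<And>j h s q. j \<le> m \<Longrightarrow> 0 < h \<Longrightarrow> h \<le> 1 \<Longrightarrow> real m * h \<le> R / 4 \<Longrightarrow> ?I j h s q \<le> c j"
   by blast+
  define C where "C = (\<Sum>j\<le>m. c j)"
  have cC: "c j \<le> C" if "j \<le> m" for j unfolding C_def using c0 that by (intro member_le_sum) auto
  have C0: "C \<ge> 0" unfolding C_def using c0 by (intro sum_nonneg) auto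
  define h0 where "h0 = min 1 (R / (4 * real m))"
  have h0: "h0 > 0" "h \<le> 1 \<and> real m * h \<le> R / 4" if "h < h0" for h
   using R m that by (auto simp: h0_def field_simps)
  define G where "G p y = indicator (ball x0 R) y * ent p (H y)" for p y
  have Gb: "\<bar>G p y\<bar> \<le> norm (H 0) + 1" for p y using Hb[of p y] by (auto simp: G_def indicator_def)
  have Gm [measurable]: "borel_fun (G p)" for p
   unfolding G_def by (intro borel_measurable_times ent_measurable Hm) auto
  have Gi: "integrable lborel (G p)" for p
   by (rule integrable_bounded_support[OF Gm bounded_ball[of x0 R], where B = "norm (H 0) + 1"]) (use Gb in \<open>auto simp: G_def\<close>)
  have L2: "(\<integral>\<^sup>+x. ennreal (indicator (ball x0 (R / 8)) x * (iter_dderiv (replicate j (axis s 1)) (conv (G p) (mollifier e)) x)\<^sup>2) \<partial>lborel) \<le> ennreal C"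
   if e: "0 < e" "e < R / 8" and j: "j \<le> m" for e j s p
  proof (rule iter_dderiv_square_le[OF smooth_conv[OF Gi test_function_mollifier[OF e(1)]]])
   \<comment> \<open>Both parts of the fact \<open>h0\<close> carry the premise
     \<open>h < h0\<close>; the value \<open>h0 - 1\<close> satisfies it.\<close>
   show "h0 > 0" using h0(1)[of "h0 - 1"] by simp
   fix h assume h: "0 < h" "h < h0"
   let ?D = "dquot h (axis s 1) ^^ j"
   have Db: "\<bar>?D (G p) x\<bar> \<le> (2 / h) ^ j * (norm (H 0) + 1)" for x by (rule dquot_pow_bound[OF h(1) Gb])
   note DG = dquot_pow_conv[OF Gi test_function_mollifier[OF e(1)], where h = h and v = "axis s 1" and j = j]
   have "(\<integral>\<^sup>+x. ennreal (indicator (ball x0 (R / 8)) x * (?D (conv (G p) (mollifier e)) x)\<^sup>2) \<partial>lborel)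
    \<le> ennreal (\<integral>x. indicator (ball x0 (R / 4)) x * (?D (G p) x)\<^sup>2 \<partial>lborel)"
    unfolding DG[THEN conjunct2] by (rule conv_mollifier_square_le[OF DG[THEN conjunct1] Db]) (use e in auto)
   \<comment> \<open>From points of \<open>ball x0 (R / 4)\<close> all nodes stay in
     \<open>ball x0 R\<close>, so the truncation in \<open>G\<close> is invisible to the difference
     quotient.\<close>
   also have "(\<lambda>x. indicator (ball x0 (R / 4)) x * (?D (G p) x)\<^sup>2) = (\<lambda>x. indicator (ball x0 (R / 4)) x * (?D (ents p H) x)\<^sup>2)"
   proof
    fix x
    show "indicator (ball x0 (R / 4)) x * (?D (G p) x)\<^sup>2 = indicator (ball x0 (R / 4)) x * (?D (ents p H) x)\<^sup>2"
    proof (cases "x \<in> ball x0 (R / 4)")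
     case True
     have "x + real i *\<^sub>R (h *\<^sub>R axis s 1) \<in> ball x0 R" if "i \<le> j" for i
     proof -
      have "real i * h \<le> real m * h" using that j h by (intro mult_right_mono) auto
      moreover have "norm (real i *\<^sub>R (h *\<^sub>R axis s (1::real)) :: real^'n) = real i * h" using h by simp
      ultimately have "norm (real i *\<^sub>R (h *\<^sub>R axis s (1::real)) :: real^'n) \<le> R / 4" using h0(2)[OF h(2)] by linarith
      thus ?thesis using True R dist_triangle[of x0 "x + real i *\<^sub>R (h *\<^sub>R axis s 1)" x] by (simp add: dist_norm)
     qed
     \<comment> \<open>The convergence lemma is applied to a constant sequence: quotients agree when
       the values at the nodes agree.\<close>
     hence "(\<lambda>k::nat. ?D (G p) x) \<longlonglongrightarrow> ?D (ents p H) x" by (intro dquot_pow_tendsto) (simp add: G_def)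
     thus ?thesis by (simp add: LIMSEQ_const_iff)
    qed simp
   qed
   also have "ennreal (?I j h s p) \<le> ennreal C" using c1[OF j h(1), of s p] cC[OF j] h0(2)[OF h(2)] by (intro ennreal_leI) linarith
   finally show "(\<integral>\<^sup>+x. ennreal (indicator (ball x0 (R / 8)) x * (?D (conv (G p) (mollifier e)) x)\<^sup>2) \<partial>lborel) \<le> ennreal C" .
  qed simp
  obtain C' where C': "\<And>g \<alpha> x. smooth g \<Longrightarrow> (\<And>s j. j \<le> 2 ^ (N + CARD('n)) \<Longrightarrow>
   (\<integral>\<^sup>+x. ennreal (indicator (ball x0 (R / 8)) x * (iter_dderiv (replicate j (axis s 1)) g x)\<^sup>2) \<partial>lborel) \<le> ennreal C) \<Longrightarrow>
   length \<alpha> \<le> N \<Longrightarrow> x \<in> ball x0 (R / 16) \<Longrightarrow> \<bar>partials \<alpha> g x\<bar> \<le> C'"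
  proof -
   have "R / 16 < R / 8" using R by simp
   from local_sobolev[OF this C0, of N x0] that show thesis by blast
  qed
  show "partials_bounded N x0 R (mollified_ent (ball x0 R) H)"
  proof (intro exI[of _ C'] allI impI)
   fix \<alpha> :: "'n list" and p and e :: real and x assume "length \<alpha> \<le> N" and e: "0 < e" "e < R / 8" and "x \<in> ball x0 (R / 16)"
   thus "\<bar>partials \<alpha> (mollified_ent (ball x0 R) H p e) x\<bar> \<le> C'"
    unfolding G_def[symmetric] using m(2)
    by (intro C' smooth_conv[OF Gi test_function_mollifier[OF e(1)]] L2) auto
  qed
 qed
qed

end


subsection \<open>Limits of locally bounded families of smooth functions\<close>

lemma AE_ball_witness:
 fixes a :: "'a::euclidean_space"
 assumes "AE x in lborel. x \<in> ball a r \<longrightarrow> P x" "r > 0"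
 shows "\<exists>x\<in>ball a r. P x"
proof (rule ccontr)
 assume "\<not> ?thesis"
 hence "AE x in lborel. x \<notin> ball a r" using assms(1) by (auto elim!: eventually_mono)
 hence "ball a r \<in> null_sets lborel" by (subst AE_iff_null_sets) auto
 thus False using content_ball_pos[OF assms(2), of a] by (simp add: measure_def null_sets_def)
qed

text \<open>Bounded derivatives make the family locally equi-Lipschitz, so convergence at almost
  every point spreads to every point. It then passes to the next derivative, because a difference
  quotient at a fixed small step approximates that derivative with an error linear in the step,
  uniformly in \<open>k\<close>. The same quadratic estimate identifies the derivatives of the
  limit.\<close>

theorem smooth_limit:
 fixes f :: "nat \<Rightarrow> 'a::euclidean_space \<Rightarrow> real"
 assumes \<Omega>: "open \<Omega>" and sm: "\<And>k. smooth (f k)"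
  and bd: "\<And>vs x0. x0 \<in> \<Omega> \<Longrightarrow> \<exists>r>0. \<exists>C k0. \<forall>k\<ge>k0. \<forall>x\<in>ball x0 r. \<bar>iter_dderiv vs (f k) x\<bar> \<le> C"
  and lim: "AE x in lborel. x \<in> \<Omega> \<longrightarrow> (\<lambda>k. f k x) \<longlonglongrightarrow> u x"
 obtains v where "smooth_on \<Omega> v" "AE x in lborel. x \<in> \<Omega> \<longrightarrow> u x = v x"
proof -
 define G where "G vs k x = iter_dderiv vs (f k) x" for vs k x
 have smG: "smooth (G vs k)" for vs k unfolding G_def by (rule smooth_iter_dderiv[OF sm])
 have dG: "dderiv v (G vs k) = G (v # vs) k" for v vs k by (simp add: G_def[abs_def] iter_dderiv_Cons)
 have lip: "\<exists>r>0. \<exists>L>0. \<exists>k0. \<forall>k\<ge>k0. \<forall>x\<in>ball x0 r. \<forall>y\<in>ball x0 r. \<bar>G vs k x - G vs k y\<bar> \<le> L * dist x y" if x0: "x0 \<in> \<Omega>" for vs x0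
 proof -
  have "\<forall>b. \<exists>r C k0. r > 0 \<and> (\<forall>k\<ge>k0. \<forall>x\<in>ball x0 r. \<bar>G (b # vs) k x\<bar> \<le> C)" using bd[OF x0] unfolding G_def by blast
  then obtain r C k0 where rC: "\<And>b. r b > 0" "\<And>b k x. k \<ge> k0 b \<Longrightarrow> x \<in> ball x0 (r b) \<Longrightarrow> \<bar>G (b # vs) k x\<bar> \<le> C b"
   by metis
  define R where "R = Min (r ` (Basis :: 'a set))"
  define A where "A = (\<Sum>b\<in>(Basis :: 'a set). \<bar>C b\<bar>)"
  define L where "L = real DIM('a) * A + 1"
  have "real DIM('a) * A \<ge> 0" by (simp add: A_def sum_nonneg)
  hence "L > 0" unfolding L_def by linarith
  moreover have "R > 0" using rC(1) by (simp add: R_def)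
  moreover have "\<bar>G vs k x - G vs k y\<bar> \<le> L * dist x y"
   if k: "k \<ge> Max (k0 ` Basis)" and xy: "x \<in> ball x0 R" "y \<in> ball x0 R" for k x y
  proof -
   have "\<bar>G vs k x - G vs k y\<bar> \<le> real DIM('a) * A * dist x y"
   proof (rule smooth_Lipschitz[OF smG convex_ball xy])
    fix b z :: 'a assume b: "b \<in> Basis" and z: "z \<in> ball x0 R"
    have "k \<ge> k0 b" "z \<in> ball x0 (r b)" using b k z by (auto simp: R_def)
    hence "\<bar>dderiv b (G vs k) z\<bar> \<le> C b" unfolding dG by (rule rC(2))
    moreover have "\<bar>C b\<bar> \<le> A" unfolding A_def using b by (intro member_le_sum) auto
    ultimately show "\<bar>dderiv b (G vs k) z\<bar> \<le> A" by linarith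
   qed
   thus ?thesis unfolding L_def distrib_right using zero_le_dist[of x y] by linarith
  qed
  ultimately show ?thesis by blast
 qed
 have quad: "\<exists>d>0. \<exists>C>0. \<exists>k0. \<forall>k\<ge>k0. \<forall>s. \<bar>s\<bar> < d \<longrightarrow> x + s *\<^sub>R v \<in> \<Omega> \<and> \<bar>G vs k (x + s *\<^sub>R v) - G vs k x - s * G (v # vs) k x\<bar> \<le> C * s\<^sup>2"
  if x: "x \<in> \<Omega>" for vs x v
 proof -
  obtain r C k0 where r: "r > 0" "\<And>k y. k \<ge> k0 \<Longrightarrow> y \<in> ball x r \<Longrightarrow> \<bar>G (v # v # vs) k y\<bar> \<le> C"
   using bd[OF x, of "v # v # vs"] unfolding G_def by blast
  obtain r' where r': "r' > 0" "ball x r' \<subseteq> \<Omega>" using \<Omega> x open_contains_ball by blast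
  define d where "d = min r r' / (norm v + 1)"
  have v: "norm v + 1 > 0" using norm_ge_zero[of v] by linarith
  have d: "d > 0" using r r' v by (simp add: d_def)
  have in_ball: "x + s *\<^sub>R v \<in> ball x r \<inter> ball x r'" if s: "\<bar>s\<bar> < d" for s
  proof -
   have "\<bar>s\<bar> * (norm v + 1) < min r r'" using s unfolding d_def pos_less_divide_eq[OF v] .
   moreover have "\<bar>s\<bar> * norm v \<le> \<bar>s\<bar> * (norm v + 1)" by (intro mult_left_mono) auto
   ultimately show ?thesis by (simp add: dist_norm)
  qed
  have "\<bar>G vs k (x + s *\<^sub>R v) - G vs k x - s * G (v # vs) k x\<bar> \<le> (\<bar>C\<bar> + 1) * s\<^sup>2" if "k \<ge> k0" "\<bar>s\<bar> < d" for k s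
   unfolding dG[symmetric]
  proof (rule smooth_quadratic_remainder[OF smG])
   fix t assume "\<bar>t\<bar> \<le> \<bar>s\<bar>"
   thus "\<bar>dderiv v (dderiv v (G vs k)) (x + t *\<^sub>R v)\<bar> \<le> \<bar>C\<bar> + 1"
    using r(2)[OF that(1), of "x + t *\<^sub>R v"] in_ball[of t] that(2) unfolding dG by fastforce
  qed
  thus ?thesis using d in_ball r'(2) by (intro exI[of _ d] conjI exI[of _ "\<bar>C\<bar> + 1"] exI[of _ k0] allI impI) auto
 qed
 have conv: "convergent (\<lambda>k. G vs k x)" if "x \<in> \<Omega>" for vs x
  using that
 proof (induction vs arbitrary: x)
  case Nil
  obtain r L k0 where r: "r > 0" "L > 0" "\<And>k x' y. k \<ge> k0 \<Longrightarrow> x' \<in> ball x r \<Longrightarrow> y \<in> ball x r \<Longrightarrow> \<bar>G [] k x' - G [] k y\<bar> \<le> L * dist x' y"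
   using lip[OF Nil, of "[]"] by blast
  obtain r' where r': "r' > 0" "ball x r' \<subseteq> \<Omega>" using \<Omega> Nil open_contains_ball by blast
  have "Cauchy (\<lambda>k. G [] k x)"
   unfolding Cauchy_def
  proof (intro allI impI)
   fix e :: real assume e: "e > 0"
   define d where "d = min (min r r') (e / (4 * L))"
   have d: "d > 0" using r r' e by (simp add: d_def)
   have "AE y in lborel. y \<in> ball x d \<longrightarrow> (\<lambda>k. f k y) \<longlonglongrightarrow> u y"
    using lim r'(2) by (auto elim!: eventually_mono simp: d_def)
   from AE_ball_witness[OF this d] obtain y where y: "y \<in> ball x d" "(\<lambda>k. f k y) \<longlonglongrightarrow> u y" by blast
   obtain K where K: "\<And>k l. k \<ge> K \<Longrightarrow> l \<ge> K \<Longrightarrow> dist (f k y) (f l y) < e / 2"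
    using LIMSEQ_imp_Cauchy[OF y(2)] e unfolding Cauchy_def by (meson half_gt_zero)
   show "\<exists>K. \<forall>k\<ge>K. \<forall>l\<ge>K. dist (G [] k x) (G [] l x) < e"
   proof (intro exI[of _ "max K k0"] allI impI)
    fix k l assume kl: "k \<ge> max K k0" "l \<ge> max K k0"
    have "L * dist x y \<le> e / 4"
     using mult_left_mono[of "dist x y" "e / (4 * L)" L] y(1) r(2) by (simp add: d_def)
    hence "\<bar>G [] k x - G [] k y\<bar> \<le> e / 4" "\<bar>G [] l x - G [] l y\<bar> \<le> e / 4"
     using r(3)[of k x y] r(3)[of l x y] y(1) kl r(1) by (auto simp: d_def)
    moreover have "\<bar>G [] k y - G [] l y\<bar> < e / 2" using K[of k l] kl by (simp add: G_def dist_real_def)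
    ultimately show "dist (G [] k x) (G [] l x) < e" unfolding dist_real_def by linarith
   qed
  qed
  thus ?case by (rule Cauchy_convergent)
 next
  case (Cons v vs)
  obtain d C k0 where d: "d > 0" "C > 0" "\<And>k s. k \<ge> k0 \<Longrightarrow> \<bar>s\<bar> < d \<Longrightarrow> x + s *\<^sub>R v \<in> \<Omega> \<and> \<bar>G vs k (x + s *\<^sub>R v) - G vs k x - s * G (v # vs) k x\<bar> \<le> C * s\<^sup>2"
   using quad[OF Cons.prems, of v vs] by blast
  have "Cauchy (\<lambda>k. G (v # vs) k x)"
   unfolding Cauchy_def
  proof (intro allI impI)
   fix e :: real assume e: "e > 0"
   \<comment> \<open>At step \<open>s\<close> the quadratic error divided by \<open>s\<close> is at
     most \<open>e / 4\<close> for each of the two indices; the remaining \<open>e / 2\<close> is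
     spent on the convergence of \<open>G vs\<close> at the two end points.\<close>
   define s where "s = min (d / 2) (e / (4 * C))"
   have s: "0 < s" "s < d" "C * s \<le> e / 4" using d e mult_left_mono[of s "e / (4 * C)" C] by (auto simp: s_def)
   have "x + s *\<^sub>R v \<in> \<Omega>" using d(3)[of k0 s] s by auto
   hence "Cauchy (\<lambda>k. G vs k (x + s *\<^sub>R v) - G vs k x)"
    using Cons by (intro convergent_Cauchy convergent_diff) auto
   then obtain K where K: "\<And>k l. k \<ge> K \<Longrightarrow> l \<ge> K \<Longrightarrow> dist (G vs k (x + s *\<^sub>R v) - G vs k x) (G vs l (x + s *\<^sub>R v) - G vs l x) < s * (e / 2)"
    using s e unfolding Cauchy_def by (meson half_gt_zero mult_pos_pos)
   show "\<exists>K. \<forall>k\<ge>K. \<forall>l\<ge>K. dist (G (v # vs) k x) (G (v # vs) l x) < e"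
   proof (intro exI[of _ "max K k0"] allI impI)
    fix k l assume kl: "k \<ge> max K k0" "l \<ge> max K k0"
    have q: "C * s\<^sup>2 \<le> s * (e / 4)" using mult_left_mono[OF s(3), of s] s(1) by (simp add: power2_eq_square mult.left_commute)
    have "\<bar>s * G (v # vs) k x - s * G (v # vs) l x\<bar> < s * e"
    proof -
     have "\<bar>G vs i (x + s *\<^sub>R v) - G vs i x - s * G (v # vs) i x\<bar> \<le> C * s\<^sup>2" if "i \<ge> k0" for i
      using d(3)[OF that, of s] s by simp
     from this[of k] this[of l] have "\<bar>G vs k (x + s *\<^sub>R v) - G vs k x - s * G (v # vs) k x\<bar> \<le> C * s\<^sup>2"
      "\<bar>G vs l (x + s *\<^sub>R v) - G vs l x - s * G (v # vs) l x\<bar> \<le> C * s\<^sup>2" using kl by auto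
     moreover have "\<bar>G vs k (x + s *\<^sub>R v) - G vs k x - (G vs l (x + s *\<^sub>R v) - G vs l x)\<bar> < s * (e / 2)"
      using K[of k l] kl by (simp add: dist_real_def)
     ultimately show ?thesis using q by linarith
    qed
    hence "s * \<bar>G (v # vs) k x - G (v # vs) l x\<bar> < s * e"
     using s(1) by (simp add: right_diff_distrib[symmetric] abs_mult)
    thus "dist (G (v # vs) k x) (G (v # vs) l x) < e" using s(1) by (simp add: dist_real_def)
   qed
  qed
  thus ?case by (rule Cauchy_convergent)
 qed
 define V where "V vs x = Topological_Spaces.lim (\<lambda>k. G vs k x)" for vs x
 have V: "(\<lambda>k. G vs k x) \<longlonglongrightarrow> V vs x" if "x \<in> \<Omega>" for vs x
  using conv[OF that] unfolding V_def by (simp add: convergent_LIMSEQ_iff)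
 have DV: "((\<lambda>s. V vs (x + s *\<^sub>R v)) has_real_derivative V (v # vs) x) (at 0)" if x: "x \<in> \<Omega>" for vs v x
 proof -
  obtain d C k0 where d: "d > 0" "\<And>k s. k \<ge> k0 \<Longrightarrow> \<bar>s\<bar> < d \<Longrightarrow> x + s *\<^sub>R v \<in> \<Omega> \<and> \<bar>G vs k (x + s *\<^sub>R v) - G vs k x - s * G (v # vs) k x\<bar> \<le> C * s\<^sup>2"
   using quad[OF x, of v vs] by blast
  show ?thesis
  proof (rule DERIV_quadratic_remainder[OF d(1)])
   fix s assume s: "\<bar>s\<bar> < d"
   have "(\<lambda>k. \<bar>G vs k (x + s *\<^sub>R v) - G vs k x - s * G (v # vs) k x\<bar>) \<longlonglongrightarrow> \<bar>V vs (x + s *\<^sub>R v) - V vs x - s * V (v # vs) x\<bar>"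
    using d(2)[OF le_refl s] by (intro tendsto_intros V x) auto
   hence "\<bar>V vs (x + s *\<^sub>R v) - V vs x - s * V (v # vs) x\<bar> \<le> C * s\<^sup>2"
    using d(2)[OF _ s] by (intro LIMSEQ_le_const2) auto
   thus "\<bar>V vs (x + s *\<^sub>R v) - V vs (x + 0 *\<^sub>R v) - s * V (v # vs) x\<bar> \<le> C * s\<^sup>2" by simp
  qed
 qed
 have VV: "iter_dderiv vs (V []) x = V vs x" if "x \<in> \<Omega>" for vs x
  using that
 proof (induction vs arbitrary: x)
  case (Cons v vs)
  have "iter_dderiv (v # vs) (V []) x = dderiv v (V vs) x"
   unfolding iter_dderiv_Cons by (rule dderiv_local_cong[OF \<Omega> Cons.IH Cons.prems])
  also have "\<dots> = V (v # vs) x" by (rule dderivI[OF DV[OF Cons.prems]])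
  finally show ?case .
 qed simp
 have cV: "continuous_on \<Omega> (V vs)" for vs
 proof (rule continuous_at_imp_continuous_on, rule ballI)
  fix x assume x: "x \<in> \<Omega>"
  obtain r L k0 where r: "r > 0" "L > 0" "\<And>k y. k \<ge> k0 \<Longrightarrow> y \<in> ball x r \<Longrightarrow> \<bar>G vs k y - G vs k x\<bar> \<le> L * dist y x"
   using lip[OF x, of vs] by (metis centre_in_ball)
  obtain r' where r': "r' > 0" "ball x r' \<subseteq> \<Omega>" using \<Omega> x open_contains_ball by blast
  have le: "\<bar>V vs y - V vs x\<bar> \<le> L * dist y x" if "y \<in> ball x r \<inter> ball x r'" for y
  proof (rule LIMSEQ_le_const2)
   show "(\<lambda>k. \<bar>G vs k y - G vs k x\<bar>) \<longlonglongrightarrow> \<bar>V vs y - V vs x\<bar>" using that r'(2) x by (intro tendsto_intros V) auto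
  qed (use r(3) that in auto)
  show "isCont (V vs) x"
   unfolding continuous_at_eps_delta
  proof (intro allI impI)
   fix e :: real assume e: "e > 0"
   show "\<exists>d>0. \<forall>y. dist y x < d \<longrightarrow> dist (V vs y) (V vs x) < e"
   proof (intro exI[of _ "min (min r r') (e / L)"] conjI allI impI)
    fix y assume y: "dist y x < min (min r r') (e / L)"
    hence "L * dist y x < e" using r(2) by (simp add: pos_less_divide_eq mult.commute)
    thus "dist (V vs y) (V vs x) < e" using le[of y] y by (simp add: dist_real_def dist_commute)
   qed (use r r' e in auto)
  qed
 qed
 have "smooth_on \<Omega> (V [])"
  unfolding smooth_along_def
 proof (intro ballI conjI)
  fix vs
  show "continuous_on \<Omega> (iter_dderiv vs (V []))" by (rule continuous_on_eq[OF cV]) (simp add: VV)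
  fix v x assume x: "x \<in> \<Omega>"
  have "((\<lambda>s. x + s *\<^sub>R v) \<longlongrightarrow> x + 0 *\<^sub>R v) (nhds 0)" by (intro tendsto_intros filterlim_ident)
  hence "eventually (\<lambda>s. x + s *\<^sub>R v \<in> \<Omega>) (nhds 0)" using x \<Omega> by (intro topological_tendstoD) auto
  hence "eventually (\<lambda>s. iter_dderiv vs (V []) (x + s *\<^sub>R v) = V vs (x + s *\<^sub>R v)) (nhds 0)"
   by eventually_elim (rule VV)
  from DERIV_cong_ev[OF refl this refl, of "V (v # vs) x"] DV[OF x, of vs v]
  show "(\<lambda>s. iter_dderiv vs (V []) (x + s *\<^sub>R v)) field_differentiable at 0"
   unfolding field_differentiable_def by blast
 qed
 moreover have "AE x in lborel. x \<in> \<Omega> \<longrightarrow> u x = V [] x"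
  using lim
 proof eventually_elim
  case (elim x)
  show ?case
  proof
   assume x: "x \<in> \<Omega>"
   thus "u x = V [] x" using LIMSEQ_unique[of "\<lambda>k. f k x"] elim V[OF x, of "[]"] by (simp add: G_def)
  qed
 qed
 ultimately show thesis by (rule that)
qed


subsection \<open>From small oscillation to bounds of all orders\<close>

lemma conv_mollifier_local_cong:
 fixes f f' :: "'a::euclidean_space \<Rightarrow> real"
 assumes [measurable]: "borel_fun f" "borel_fun f'"
  and e: "e > 0" and eq: "AE y in lborel. dist x y < e \<longrightarrow> f y = f' y"
 shows "conv f (mollifier e) x = conv f' (mollifier e) x"
 unfolding conv_def
proof (rule integral_cong_AE)
 have [measurable]: "borel_fun (mollifier e :: 'a \<Rightarrow> real)"
  by (rule smooth_borel[OF test_function_smooth[OF test_function_mollifier[OF e]]])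
 show "(\<lambda>y. f y * mollifier e (x - y)) \<in> borel_measurable lborel" "(\<lambda>y. f' y * mollifier e (x - y)) \<in> borel_measurable lborel"
  by measurable
 show "AE y in lborel. f y * mollifier e (x - y) = f' y * mollifier e (x - y)"
  using eq
 proof eventually_elim
  case (elim y)
  thus ?case using mollifier_eq_0[OF e, of "x - y"] by (cases "dist x y < e") (auto simp: dist_norm)
 qed
qed

text \<open>Only parameters \<open>e\<close> below a radius depending on the point count: a
  mollification of radius \<open>e\<close> is tied to the solution only away from the
  boundary.\<close>

definition locally_bounded :: "'a::metric_space set \<Rightarrow> (real \<Rightarrow> 'a \<Rightarrow> real) \<Rightarrow> bool"
 where "locally_bounded \<Omega> f \<longleftrightarrow> (\<forall>x0\<in>\<Omega>. \<exists>r>0. \<exists>C. \<forall>e x. 0 < e \<longrightarrow> e < r \<longrightarrow> x \<in> ball x0 r \<longrightarrow> \<bar>f e x\<bar> \<le> C)"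

lemma locally_bounded_combination:
 assumes "\<And>b. b \<in> I \<Longrightarrow> locally_bounded \<Omega> (f b)" "finite I"
 shows "locally_bounded \<Omega> (\<lambda>e x. \<Sum>b\<in>I. c b * f b e x)"
 using assms(2,1)
proof (induction I rule: finite_induct)
 case empty
 thus ?case by (auto simp: locally_bounded_def intro!: exI[of _ 1])
next
 case (insert b I)
 show ?case
  unfolding locally_bounded_def
 proof
  fix x0 assume x0: "x0 \<in> \<Omega>"
  obtain r C where r: "r > 0" "\<And>e x. 0 < e \<Longrightarrow> e < r \<Longrightarrow> x \<in> ball x0 r \<Longrightarrow> \<bar>f b e x\<bar> \<le> C"
   using insert.prems[of b] x0 unfolding locally_bounded_def by blast
  have "locally_bounded \<Omega> (\<lambda>e x. \<Sum>b\<in>I. c b * f b e x)" using insert.prems by (intro insert.IH) auto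
  then obtain s D where s: "s > 0" "\<And>e x. 0 < e \<Longrightarrow> e < s \<Longrightarrow> x \<in> ball x0 s \<Longrightarrow> \<bar>\<Sum>b\<in>I. c b * f b e x\<bar> \<le> D"
   using x0 unfolding locally_bounded_def by blast
  have "\<bar>\<Sum>b\<in>insert b I. c b * f b e x\<bar> \<le> \<bar>c b\<bar> * C + D" if "0 < e" "e < min r s" "x \<in> ball x0 (min r s)" for e x
  proof -
   have "\<bar>c b * f b e x\<bar> \<le> \<bar>c b\<bar> * C" unfolding abs_mult using r(2)[of e x] that by (intro mult_left_mono) auto
   moreover have "\<bar>\<Sum>b\<in>I. c b * f b e x\<bar> \<le> D" using s(2)[of e x] that by auto
   ultimately show ?thesis using insert.hyps by simp
  qed
  thus "\<exists>r>0. \<exists>C. \<forall>e x. 0 < e \<longrightarrow> e < r \<longrightarrow> x \<in> ball x0 r \<longrightarrow> \<bar>\<Sum>b\<in>insert b I. c b * f b e x\<bar> \<le> C"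
   using r(1) s(1) by (intro exI[of _ "min r s"]) auto
 qed
qed

text \<open>Interior bounds concern coordinate directions, \<open>smooth_limit\<close> all
  directions. The innermost direction is the one expanded in the basis, which is why the induction
  peels the list from its end and lets \<beta> grow.\<close>

lemma locally_bounded_iter_dderiv:
 fixes w :: "real \<Rightarrow> real^'n \<Rightarrow> real"
 assumes w: "\<And>e. smooth (w e)" and lb: "\<And>\<beta>. locally_bounded \<Omega> (\<lambda>e. partials \<beta> (w e))"
 shows "locally_bounded \<Omega> (\<lambda>e. iter_dderiv vs (w e))"
proof -
 have "locally_bounded \<Omega> (\<lambda>e. iter_dderiv vs (partials \<beta> (w e)))" for \<beta>
 proof (induction vs arbitrary: \<beta> rule: rev_induct)
  case (snoc v vs)
  have sm: "smooth (partials \<beta> (w e))" for e unfolding partials_def by (rule smooth_iter_dderiv[OF w])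
  have "iter_dderiv (vs @ [v]) (partials \<beta> (w e)) = (\<lambda>x. \<Sum>b\<in>Basis. (v \<bullet> b) * iter_dderiv vs (dderiv b (partials \<beta> (w e))) x)" for e
  proof -
   have "iter_dderiv (vs @ [v]) (partials \<beta> (w e)) = iter_dderiv vs (\<lambda>x. \<Sum>b\<in>Basis. (v \<bullet> b) * dderiv b (partials \<beta> (w e)) x)"
    using smooth_dderiv_Basis[OF sm, of v e] by (simp add: iter_dderiv_append iter_dderiv_Cons)
   also have "\<dots> = (\<lambda>x. \<Sum>b\<in>Basis. (v \<bullet> b) * iter_dderiv vs (dderiv b (partials \<beta> (w e))) x)"
    by (simp add: iter_dderiv_sum iter_dderiv_cmult smooth_cmult smooth_dderiv sm)
   finally show ?thesis .
  qed
  moreover have "locally_bounded \<Omega> (\<lambda>e. iter_dderiv vs (dderiv b (partials \<beta> (w e))))" if "b \<in> Basis" for b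
  proof -
   obtain i where "b = axis i 1" using \<open>b \<in> Basis\<close> by (auto simp: Basis_axis)
   thus ?thesis using snoc.IH[of "i # \<beta>"] by (simp add: partials_def iter_dderiv_Cons)
  qed
  ultimately show ?case by (simp add: locally_bounded_combination)
 qed (use lb in simp)
 from this[of "[]"] show ?thesis by (simp add: partials_def)
qed

text \<open>Taylor's formula at a fixed step \<open>s\<close> expresses the first derivative by two
  values of \<open>w e\<close> and the second derivative. It supplies the one order that neither the
  sup bound nor the Hessian bounds cover.\<close>

lemma gradient_locally_bounded:
 fixes w :: "real \<Rightarrow> 'a::euclidean_space \<Rightarrow> real"
 assumes w: "\<And>e. smooth (w e)" and C0: "\<And>e x. \<bar>w e x\<bar> \<le> C0"
  and lb: "locally_bounded \<Omega> (\<lambda>e. dderiv v (dderiv v (w e)))" and v: "norm v \<le> 1"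
 shows "locally_bounded \<Omega> (\<lambda>e. dderiv v (w e))"
 unfolding locally_bounded_def
proof
 fix x0 assume "x0 \<in> \<Omega>"
 then obtain r C where r: "r > 0" "\<And>e x. 0 < e \<Longrightarrow> e < r \<Longrightarrow> x \<in> ball x0 r \<Longrightarrow> \<bar>dderiv v (dderiv v (w e)) x\<bar> \<le> C"
  using lb unfolding locally_bounded_def by blast
 define s where "s = r / 2"
 have s: "s > 0" using r(1) by (simp add: s_def)
 have "\<bar>dderiv v (w e) x\<bar> \<le> (C * s\<^sup>2 + 2 * C0) / s" if e: "0 < e" "e < s" and x: "x \<in> ball x0 s" for e x
 proof -
  have "\<bar>w e (x + s *\<^sub>R v) - w e x - s * dderiv v (w e) x\<bar> \<le> C * s\<^sup>2"
  proof (rule smooth_quadratic_remainder[OF w])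
   fix t assume t: "\<bar>t\<bar> \<le> \<bar>s\<bar>"
   have "norm (t *\<^sub>R v) \<le> s" using t s v mult_mono[of "\<bar>t\<bar>" s "norm v" 1] by simp
   hence "x + t *\<^sub>R v \<in> ball x0 r" using x dist_triangle[of x0 "x + t *\<^sub>R v" x] by (simp add: dist_norm s_def)
   thus "\<bar>dderiv v (dderiv v (w e)) (x + t *\<^sub>R v)\<bar> \<le> C" using r e by (intro r(2)) (auto simp: s_def)
  qed
  hence "\<bar>s * dderiv v (w e) x\<bar> \<le> C * s\<^sup>2 + 2 * C0"
   using C0[of e x] C0[of e "x + s *\<^sub>R v"] by linarith
  thus ?thesis using s by (simp add: abs_mult pos_le_divide_eq mult.commute)
 qed
 thus "\<exists>r>0. \<exists>C. \<forall>e x. 0 < e \<longrightarrow> e < r \<longrightarrow> x \<in> ball x0 r \<longrightarrow> \<bar>dderiv v (w e) x\<bar> \<le> C" using s by blast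
qed

context elliptic
begin

text \<open>The family \<open>w\<close> stands for mollifications of the solution: its Hessian
  agrees with the mollified \<open>H\<close> wherever the kernel stays inside the unit ball, and
  elsewhere \<open>w e\<close> is merely smooth. The pointwise conditions on \<open>H\<close> hold
  everywhere, as the grid arguments require.\<close>

definition weak_solution :: "real \<Rightarrow> (real \<Rightarrow> real^'n \<Rightarrow> real) \<Rightarrow> (real^'n \<Rightarrow> real^'n^'n) \<Rightarrow> bool"
 where "weak_solution M w H \<longleftrightarrow> borel_fun H \<and> (\<forall>x. H x \<in> K0 \<and> norm (H x) \<le> M) \<and> (\<forall>e. smooth (w e)) \<and>
  (\<forall>e>0. \<forall>p x. cball x e \<subseteq> ball 0 1 \<longrightarrow> pd2 p (w e) x = mollified_ent (ball 0 1) H p e x) \<and>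
  (\<forall>\<eta>. test_function (ball 0 1) \<eta> \<longrightarrow> first_var F H \<eta> = 0)"

lemma weak_solution_pd2:
 assumes "weak_solution M w H" "e > 0" "cball x e \<subseteq> ball 0 1"
 shows "pd2 p (w e) x = mollified_ent (ball 0 1) H p e x"
 using assms unfolding weak_solution_def by blast

lemma weak_solution_entries:
 assumes "weak_solution M w H"
 defines "f \<equiv> \<lambda>p y. indicator (ball 0 1) y * ent p (H y)"
 shows "borel_fun (f p)" "\<bar>f p y\<bar> \<le> M" "norm y > 1 \<Longrightarrow> f p y = 0" "integrable lborel (f p)"
proof -
 have H: "borel_fun H" "norm (H y) \<le> M" for y using assms(1) by (auto simp: weak_solution_def)
 show m: "borel_fun (f p)" unfolding f_def by (intro borel_measurable_times ent_measurable H) auto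
 show b: "\<bar>f p y\<bar> \<le> M" for y
  using H(2)[of y] abs_ent_le_norm[of p "H y"] order_trans[OF norm_ge_zero H(2)] by (auto simp: f_def indicator_def)
 show "f p y = 0" if "norm y > 1" using that by (simp add: f_def)
 show "integrable lborel (f p)"
  by (rule integrable_bounded_support[OF m bounded_ball[of 0 1], where B = M]) (use b in \<open>auto simp: f_def\<close>)
qed

lemma weak_solution_approximation:
 assumes "weak_solution M w H"
 obtains e where "\<And>k. e k > 0" "e \<longlonglongrightarrow> 0"
  "AE x in lborel. x \<in> ball 0 1 \<longrightarrow> pd2_tendsto w e H x"
proof -
 let ?f = "\<lambda>p y. indicator (ball 0 1) y * ent p (H y)"
 obtain e where e: "\<And>k. e k > 0" "e \<longlonglongrightarrow> 0" "AE x in lborel. \<forall>p\<in>UNIV. (\<lambda>k. conv (?f p) (mollifier (e k)) x) \<longlonglongrightarrow> ?f p x"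
  by (rule conv_mollifier_AE[of UNIV ?f M 1]) (use weak_solution_entries[OF assms] in auto)
 have "AE x in lborel. x \<in> ball 0 1 \<longrightarrow> pd2_tendsto w e H x"
  using e(3)
 proof eventually_elim
  case (elim x)
  show ?case
  proof (intro impI allI)
   fix p assume x: "x \<in> ball 0 1"
   have ev: "eventually (\<lambda>k. conv (?f p) (mollifier (e k)) x = pd2 p (w (e k)) x) sequentially"
   proof -
    have "eventually (\<lambda>k. e k < 1 - norm x) sequentially" using order_tendstoD(2)[OF e(2), of "1 - norm x"] x by simp
    thus ?thesis
    proof eventually_elim
     case (elim k)
     have "cball x (e k) \<subseteq> ball 0 1"
     proof
      fix y assume "y \<in> cball x (e k)"
      thus "y \<in> ball 0 1" using elim norm_triangle_sub[of y x] by (simp add: dist_norm norm_minus_commute)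
     qed
     thus ?case by (rule weak_solution_pd2[OF assms e(1), symmetric])
    qed
   qed
   from elim[THEN bspec, OF UNIV_I, of p] x have "(\<lambda>k. conv (?f p) (mollifier (e k)) x) \<longlonglongrightarrow> ent p (H x)" by simp
   thus "(\<lambda>k. pd2 p (w (e k)) x) \<longlonglongrightarrow> ent p (H x)" by (rule Lim_transform_eventually[OF _ ev])
  qed
 qed
 with e(1,2) show thesis by (rule that)
qed

text \<open>Localisation: small oscillation on one ball suffices. Off that ball \<open>H\<close> is
  replaced by one of its values in \<open>K\<close>, which changes neither the equation for test
  functions supported in the ball nor the mollifications near its centre.\<close>

lemma solution_bounds:
 obtains \<omega> where "0 < \<omega>" "\<And>w H M x0 R K. weak_solution M w H \<Longrightarrow> R > 0 \<Longrightarrow> norm x0 + R < 1 \<Longrightarrow>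
  K \<subseteq> K0 \<Longrightarrow> convex K \<Longrightarrow> K \<in> sets borel \<Longrightarrow> (\<And>\<xi> \<eta>. \<xi> \<in> K \<Longrightarrow> \<eta> \<in> K \<Longrightarrow> norm (\<xi> - \<eta>) \<le> \<omega>) \<Longrightarrow>
  AE x in lborel. x \<in> ball x0 R \<longrightarrow> H x \<in> K \<Longrightarrow>
  partials_bounded N x0 R (\<lambda>p e. pd2 p (w e))"
proof (rule derivative_bound[of N])
 fix \<omega> :: real assume \<omega>: "0 < \<omega>" "\<omega> \<le> 1" and bound: "\<And>H x0 R w M. osc_data \<omega> H \<Longrightarrow> R > 0 \<Longrightarrow> solution_data x0 R M w H \<Longrightarrow>
  partials_bounded N x0 R (mollified_ent (ball x0 R) H)"
 show thesis
 proof (rule that[OF \<omega>(1)])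
  fix w H M x0 R K
  assume ws: "weak_solution M w H" and R: "R > 0" "norm x0 + R < 1" and K: "K \<subseteq> K0" "convex K" "K \<in> sets borel"
   and diam: "\<And>\<xi> \<eta>. \<xi> \<in> K \<Longrightarrow> \<eta> \<in> K \<Longrightarrow> norm (\<xi> - \<eta>) \<le> \<omega>" and HK: "AE x in lborel. x \<in> ball x0 R \<longrightarrow> H x \<in> K"
  note [measurable] = K(3)
  have Hm [measurable]: "borel_fun H" and HK0: "\<And>x. H x \<in> K0" and sw: "\<And>e. smooth (w e)"
   using ws by (auto simp: weak_solution_def)
  obtain y0 where y0: "H y0 \<in> K" using AE_ball_witness[OF HK R(1)] by blast
  define H' where "H' x = (if x \<in> ball x0 R \<and> H x \<in> K then H x else H y0)" for x
  have H'm [measurable]: "borel_fun H'" unfolding H'_def by measurable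
  have H'K: "H' x \<in> K" for x using y0 by (simp add: H'_def)
  have HH': "AE x in lborel. x \<in> ball x0 R \<longrightarrow> H x = H' x" using HK by (auto elim!: eventually_mono simp: H'_def)
  have osc: "osc_data \<omega> H'" using K diam H'K H'm unfolding osc_data_def by blast
  have inB: "cball x e \<subseteq> ball 0 1" if "x \<in> ball x0 R" "norm x0 + R + e \<le> 1" for x e
  proof
   fix y assume "y \<in> cball x e"
   hence "norm y < norm x0 + R + e"
    using that norm_triangle_sub[of y x] norm_triangle_sub[of x x0] by (simp add: dist_norm norm_minus_commute)
   thus "y \<in> ball 0 1" using that by simp
  qed
  have sub: "ball x0 R \<subseteq> ball 0 1" using inB[of _ 0] R(2) by fastforce
  let ?f = "\<lambda>p y. indicator (ball 0 1) y * ent p (H y)"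
  note w2 = weak_solution_pd2[OF ws]
  obtain e where e: "\<And>k. e k > 0" "e \<longlonglongrightarrow> 0" "AE x in lborel. x \<in> ball 0 1 \<longrightarrow> pd2_tendsto w e H x"
   using weak_solution_approximation[OF ws] by blast
  \<comment> \<open>Starting the sequence at \<open>k0\<close> keeps the kernels at points of
    \<open>ball x0 R\<close> inside the unit ball, as the Hessian identity requires.\<close>
  obtain k0 where k0: "\<And>k. k \<ge> k0 \<Longrightarrow> e k < 1 - norm x0 - R"
   using order_tendstoD(2)[OF e(2), of "1 - norm x0 - R"] R(2) by (auto simp: eventually_sequentially)
  have "solution_data x0 R M (\<lambda>k. w (e (k + k0))) H'"
   unfolding solution_data_def
  proof (intro conjI allI ballI impI sw)
   fix k p x assume x: "x \<in> ball x0 R"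
   have sub: "cball x (e (k + k0)) \<subseteq> ball 0 1" using k0[of "k + k0"] by (intro inB[OF x]) auto
   have "\<bar>conv (?f p) (mollifier (e (k + k0))) x - 0\<bar> \<le> M"
    by (rule conv_mollifier_bound[OF weak_solution_entries(4)[OF ws] e(1)]) (simp only: diff_0_right weak_solution_entries(2)[OF ws])
   thus "\<bar>pd2 p (w (e (k + k0))) x\<bar> \<le> M"
    unfolding w2[OF e(1) sub] diff_0_right .
  next
   fix p
   show "AE x in lborel. x \<in> ball x0 R \<longrightarrow> (\<lambda>k. pd2 p (w (e (k + k0))) x) \<longlonglongrightarrow> ent p (H' x)"
    using e(3) HH'
   proof eventually_elim
    case (elim x)
    show ?case
    proof
     assume "x \<in> ball x0 R"
     hence "(\<lambda>k. pd2 p (w (e k)) x) \<longlonglongrightarrow> ent p (H' x)" using elim sub by (auto simp del: split_paired_All)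
     thus "(\<lambda>k. pd2 p (w (e (k + k0))) x) \<longlonglongrightarrow> ent p (H' x)" by (rule LIMSEQ_ignore_initial_segment)
    qed
   qed
  next
   fix \<eta> assume \<eta>: "test_function (ball x0 R) \<eta>"
   have [measurable]: "borel_fun (pd2 p \<eta>)" for p
    by (rule smooth_borel[OF test_function_smooth[OF test_function_pd2[OF \<eta>]]])
   have "H' x \<in> K0" for x using H'K K(1) by blast
   note [measurable] = measurable_compose_iter_dderiv[OF Hm HK0] measurable_compose_iter_dderiv[OF H'm this]
   have "first_var F H' \<eta> = first_var F H \<eta>"
   proof (rule integral_cong_AE)
    show "AE x in lborel. (\<Sum>p\<in>UNIV. iter_dderiv [munit p] F (H' x) * pd2 p \<eta> x) = (\<Sum>p\<in>UNIV. iter_dderiv [munit p] F (H x) * pd2 p \<eta> x)"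
     using HH'
    proof eventually_elim
     case (elim x)
     have "pd2 p \<eta> x = 0" if "x \<notin> ball x0 R" for p
      using test_function_pd2[OF \<eta>, of p] that by (auto simp: test_function_def)
     thus ?case using elim by (cases "x \<in> ball x0 R") auto
    qed
   qed measurable
   also have "\<dots> = 0" using ws test_function_mono[OF \<eta> sub] by (simp add: weak_solution_def)
   finally show "first_var F H' \<eta> = 0" .
  qed
  from bound[OF osc R(1) this] have "partials_bounded N x0 R (mollified_ent (ball x0 R) H')" .
  then obtain C where C: "\<And>\<alpha> p e x. length \<alpha> \<le> N \<Longrightarrow> 0 < e \<Longrightarrow> e < R / 8 \<Longrightarrow> x \<in> ball x0 (R / 16) \<Longrightarrow>
   \<bar>partials \<alpha> (mollified_ent (ball x0 R) H' p e) x\<bar> \<le> C" by blast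
  show "partials_bounded N x0 R (\<lambda>p e. pd2 p (w e))"
  proof (intro exI[of _ C] allI impI)
   fix \<alpha> :: "'n list" and p and e :: real and x
   assume \<alpha>: "length \<alpha> \<le> N" and e: "0 < e" "e < R / 8" and x: "x \<in> ball x0 (R / 16)"
   have "pd2 p (w e) z = mollified_ent (ball x0 R) H' p e z" if z: "z \<in> ball x0 (R / 16)" for z
   proof -
    have near: "y \<in> ball x0 R" if "dist z y \<le> e" for y
     using that z e dist_triangle[of x0 y z] by simp
    hence "cball z e \<subseteq> ball 0 1" using sub by auto
    hence "pd2 p (w e) z = conv (?f p) (mollifier e) z" by (rule w2[OF e(1)])
    also have "\<dots> = mollified_ent (ball x0 R) H' p e z"
    proof (rule conv_mollifier_local_cong[OF weak_solution_entries(1)[OF ws] _ e(1)])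
     show "borel_fun (\<lambda>y. indicator (ball x0 R) y * ent p (H' y))"
      by (intro borel_measurable_times ent_measurable H'm) auto
     show "AE y in lborel. dist z y < e \<longrightarrow> ?f p y = indicator (ball x0 R) y * ent p (H' y)"
      using HH'
     proof eventually_elim
      case (elim y)
      show ?case
      proof
       assume "dist z y < e"
       hence "y \<in> ball x0 R" by (intro near) simp
       thus "?f p y = indicator (ball x0 R) y * ent p (H' y)" using elim sub by (auto simp: indicator_def)
      qed
     qed
    qed
    finally show ?thesis .
   qed
   hence "partials \<alpha> (pd2 p (w e)) x = partials \<alpha> (mollified_ent (ball x0 R) H' p e) x"
    unfolding partials_def by (rule iter_dderiv_local_cong[OF open_ball _ x])
   thus "\<bar>partials \<alpha> (pd2 p (w e)) x\<bar> \<le> C" using C[OF \<alpha> e x] by simp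
  qed
 qed
qed

text \<open>\<omega> is fixed by the bounds with \<open>N = 1\<close> alone and is therefore the
  same for every \<alpha>; the threshold \<omega>' for \<open>length \<alpha>\<close> is met by
  shrinking the ball. Halving \<omega> turns the radius about \<open>c\<close> into a
  diameter.\<close>

theorem interior_bounds:
 assumes K0: "K0 \<in> sets borel"
 obtains \<omega> where "0 < \<omega>" "\<And>w H M c \<alpha> p. weak_solution M w H \<Longrightarrow> (\<And>x. norm (H x - c) \<le> \<omega>) \<Longrightarrow>
  locally_bounded (ball 0 1) (\<lambda>e. partials \<alpha> (pd2 p (w e)))"
proof (rule solution_bounds[of 1])
 fix \<omega> :: real
 assume \<omega>: "0 < \<omega>" and B1: "\<And>w H M x0 R K. weak_solution M w H \<Longrightarrow> R > 0 \<Longrightarrow> norm x0 + R < 1 \<Longrightarrow>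
  K \<subseteq> K0 \<Longrightarrow> convex K \<Longrightarrow> K \<in> sets borel \<Longrightarrow> (\<And>\<xi> \<eta>. \<xi> \<in> K \<Longrightarrow> \<eta> \<in> K \<Longrightarrow> norm (\<xi> - \<eta>) \<le> \<omega>) \<Longrightarrow>
  AE x in lborel. x \<in> ball x0 R \<longrightarrow> H x \<in> K \<Longrightarrow>
  partials_bounded 1 x0 R (\<lambda>p e. pd2 p (w e))"
 have diam: "norm (\<xi> - \<eta>) \<le> t" if "\<xi> \<in> K0 \<inter> cball c (t / 2)" "\<eta> \<in> K0 \<inter> cball c (t / 2)" for \<xi> \<eta> c :: "real^'n^'n" and t
  using that dist_triangle2[of \<xi> \<eta> c] by (simp add: dist_norm norm_minus_commute)
 have cv: "convex (K0 \<inter> cball c t)" for c t using U(3) by (intro convex_Int) auto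
 have bl: "K0 \<inter> cball c t \<in> sets borel" for c t using K0 by auto
 show thesis
 proof (rule that[of "\<omega> / 2"])
  show "0 < \<omega> / 2" using \<omega> by simp
  fix w H M c and \<alpha> :: "'n list" and p
  assume ws: "weak_solution M w H" and osc: "\<And>x. norm (H x - c) \<le> \<omega> / 2"
  have HK0: "\<And>x. H x \<in> K0" and sw: "\<And>e. smooth (w e)" using ws by (auto simp: weak_solution_def)
  show "locally_bounded (ball 0 1) (\<lambda>e. partials \<alpha> (pd2 p (w e)))"
  proof (rule solution_bounds[of "length \<alpha>"])
   fix \<omega>' :: real
   assume \<omega>': "0 < \<omega>'" and B2: "\<And>w H M x0 R K. weak_solution M w H \<Longrightarrow> R > 0 \<Longrightarrow> norm x0 + R < 1 \<Longrightarrow>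
    K \<subseteq> K0 \<Longrightarrow> convex K \<Longrightarrow> K \<in> sets borel \<Longrightarrow> (\<And>\<xi> \<eta>. \<xi> \<in> K \<Longrightarrow> \<eta> \<in> K \<Longrightarrow> norm (\<xi> - \<eta>) \<le> \<omega>') \<Longrightarrow>
    AE x in lborel. x \<in> ball x0 R \<longrightarrow> H x \<in> K \<Longrightarrow>
    partials_bounded (length \<alpha>) x0 R (\<lambda>p e. pd2 p (w e))"
   show ?thesis
    unfolding locally_bounded_def
   proof
    fix x0 :: "real^'n" assume "x0 \<in> ball 0 1"
    hence x0: "norm x0 < 1" by simp
    define R where "R = (1 - norm x0) / 2"
    have R: "R > 0" "norm x0 + R < 1" using x0 by (auto simp: R_def field_simps)
    have AE1: "AE x in lborel. x \<in> ball x0 R \<longrightarrow> H x \<in> K0 \<inter> cball c (\<omega> / 2)"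
     using HK0 osc by (intro always_eventually allI impI) (auto simp: dist_norm norm_minus_commute)
    have "partials_bounded 1 x0 R (\<lambda>p e. pd2 p (w e))"
     by (rule B1[OF ws R _ cv bl diam AE1]) auto
    then obtain C where C: "\<And>\<alpha> p e x. length \<alpha> \<le> 1 \<Longrightarrow> 0 < e \<Longrightarrow> e < R / 8 \<Longrightarrow> x \<in> ball x0 (R / 16) \<Longrightarrow> \<bar>partials \<alpha> (pd2 p (w e)) x\<bar> \<le> C"
     by blast
    obtain e where e: "\<And>k. e k > 0" "e \<longlonglongrightarrow> 0"
     and AE: "AE x in lborel. x \<in> ball 0 1 \<longrightarrow> pd2_tendsto w e H x"
     using weak_solution_approximation[OF ws] by blast
    \<comment> \<open>The Lipschitz bound passes from the mollifications to \<open>H\<close> only at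
      points where they converge; almost every point of the unit ball is one.\<close>
    define good where "good x \<longleftrightarrow> pd2_tendsto w e H x" for x
    define D where "D = real DIM(real^'n) * \<bar>C\<bar>"
    define n2 where "n2 = real CARD('n \<times> 'n)"
    have lip: "norm (H x - H y) \<le> n2 * (D * dist x y)"
     if xy: "x \<in> ball x0 (R / 16)" "y \<in> ball x0 (R / 16)" "good x" "good y" for x y
    proof -
     have "\<bar>ent p (H x) - ent p (H y)\<bar> \<le> D * dist x y" for p
     proof (rule LIMSEQ_le_const2)
      show "(\<lambda>k. \<bar>pd2 p (w (e k)) x - pd2 p (w (e k)) y\<bar>) \<longlonglongrightarrow> \<bar>ent p (H x) - ent p (H y)\<bar>"
       using xy(3,4) unfolding good_def by (intro tendsto_intros) blast+
      obtain k0 where k0: "\<And>k. k \<ge> k0 \<Longrightarrow> e k < R / 8"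
       using order_tendstoD(2)[OF e(2), of "R / 8"] R(1) by (auto simp: eventually_sequentially)
      have "\<bar>pd2 p (w (e k)) x - pd2 p (w (e k)) y\<bar> \<le> D * dist x y" if k: "k \<ge> k0" for k
       unfolding D_def
      proof (rule smooth_Lipschitz[OF smooth_pd2[OF sw] convex_ball xy(1,2)])
       fix b z :: "real^'n" assume "b \<in> Basis" and z: "z \<in> ball x0 (R / 16)"
       then obtain i where i: "b = axis i 1" by (auto simp: Basis_axis)
       show "\<bar>dderiv b (pd2 p (w (e k))) z\<bar> \<le> \<bar>C\<bar>"
        using C[of "[i]" "e k" z p] e(1) k0[OF k] z by (simp add: partials_def iter_dderiv_Cons i)
      qed
      thus "\<exists>N. \<forall>k\<ge>N. \<bar>pd2 p (w (e k)) x - pd2 p (w (e k)) y\<bar> \<le> D * dist x y" by blast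
     qed
     hence "(\<Sum>p\<in>UNIV. \<bar>ent p (H x - H y)\<bar>) \<le> n2 * (D * dist x y)"
      using sum_bounded_above[of "UNIV :: ('n \<times> 'n) set" "\<lambda>p. \<bar>ent p (H x - H y)\<bar>" "D * dist x y"] by (simp add: ent_def n2_def)
     moreover have "norm (H x - H y) \<le> (\<Sum>p\<in>UNIV. \<bar>ent p (H x - H y)\<bar>)"
      using norm_le_l1[of "H x - H y"] unfolding sum_Basis_munit munit_inner .
     ultimately show ?thesis by linarith
    qed
    have nD: "n2 * D \<ge> 0" by (simp add: n2_def D_def)
    \<comment> \<open>Two points of a ball of radius \<rho> are less than \<open>2 * \<rho>\<close>
      apart; the second entry of the minimum keeps the variation of \<open>H\<close> within
      \<open>\<omega>' / 2\<close>, the radius allowed around \<open>H y0\<close>.\<close>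
    define \<rho> where "\<rho> = min (R / 16) (\<omega>' / (4 * (n2 * D + 1)))"
    have "\<rho> \<le> R / 16" unfolding \<rho>_def by (rule min.cobounded1)
    moreover have "\<rho> > 0" using R \<omega>' nD by (auto simp: \<rho>_def)
    ultimately have \<rho>: "\<rho> > 0" "\<rho> \<le> R / 16" "norm x0 + \<rho> < 1" using R by auto
    have \<rho>D: "n2 * D * (2 * \<rho>) \<le> \<omega>' / 2"
    proof -
     have "n2 * D * (2 * \<rho>) \<le> (n2 * D + 1) * (2 * (\<omega>' / (4 * (n2 * D + 1))))"
      using nD \<rho>(1) by (intro mult_mono) (auto simp: \<rho>_def)
     also have "\<dots> = \<omega>' / 2" using nD by (simp add: field_simps)
     finally show ?thesis .
    qed
    have g: "AE x in lborel. x \<in> ball x0 \<rho> \<longrightarrow> good x"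
     using AE
    proof eventually_elim
     case (elim x)
     show ?case
     proof
      assume "x \<in> ball x0 \<rho>"
      hence "x \<in> ball 0 1" using \<rho>(3) norm_triangle_sub[of x x0] by (simp add: dist_norm norm_minus_commute)
      thus "good x" using elim unfolding good_def by blast
     qed
    qed
    obtain y0 where y0: "y0 \<in> ball x0 \<rho>" "good y0" using AE_ball_witness[OF g \<rho>(1)] by blast
    have AE2: "AE x in lborel. x \<in> ball x0 \<rho> \<longrightarrow> H x \<in> K0 \<inter> cball (H y0) (\<omega>' / 2)"
     using g
    proof eventually_elim
     case (elim x)
     show ?case
     proof
      assume x: "x \<in> ball x0 \<rho>"
      have "norm (H x - H y0) \<le> n2 * (D * dist x y0)" using x y0 elim \<rho>(2) by (intro lip) auto
      also have "\<dots> = n2 * D * dist x y0" by simp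
      also have "\<dots> \<le> n2 * D * (2 * \<rho>)"
       using nD x y0(1) dist_triangle3[of x y0 x0] by (intro mult_left_mono) auto
      finally show "H x \<in> K0 \<inter> cball (H y0) (\<omega>' / 2)" using HK0 \<rho>D by (simp add: dist_norm norm_minus_commute)
     qed
    qed
    have "partials_bounded (length \<alpha>) x0 \<rho> (\<lambda>p e. pd2 p (w e))"
     by (rule B2[OF ws \<rho>(1,3) _ cv bl diam AE2]) auto
    thus "\<exists>r>0. \<exists>C. \<forall>e x. 0 < e \<longrightarrow> e < r \<longrightarrow> x \<in> ball x0 r \<longrightarrow> \<bar>partials \<alpha> (pd2 p (w e)) x\<bar> \<le> C"
     using \<rho>(1) by (intro exI[of _ "\<rho> / 16"]) fastforce
   qed
  qed
 qed
qed

text \<open>Derivatives of order at least two are derivatives of Hessian entries; order 0 is covered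
  by the sup bound and order 1 by Taylor's formula. With all orders bounded,
  \<open>smooth_limit\<close> applies.\<close>

theorem regularity:
 assumes K0: "K0 \<in> sets borel"
 obtains \<omega> where "0 < \<omega>" "\<And>w H M c C0 e u. weak_solution M w H \<Longrightarrow> (\<And>x. norm (H x - c) \<le> \<omega>) \<Longrightarrow> (\<And>e x. \<bar>w e x\<bar> \<le> C0) \<Longrightarrow>
  (\<And>k::nat. e k > 0) \<Longrightarrow> e \<longlonglongrightarrow> 0 \<Longrightarrow> AE x in lborel. x \<in> ball 0 1 \<longrightarrow> (\<lambda>k. w (e k) x) \<longlonglongrightarrow> u x \<Longrightarrow>
  \<exists>v. smooth_on (ball 0 1) v \<and> (AE x in lborel. x \<in> ball 0 1 \<longrightarrow> u x = v x)"
proof (rule interior_bounds[OF K0])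
 fix \<omega> :: real
 assume \<omega>: "0 < \<omega>" and ib: "\<And>w H M c \<alpha> p. weak_solution M w H \<Longrightarrow> (\<And>x. norm (H x - c) \<le> \<omega>) \<Longrightarrow>
  locally_bounded (ball 0 1) (\<lambda>e. partials \<alpha> (pd2 p (w e)))"
 show thesis
 proof (rule that[OF \<omega>])
  fix w H M c C0 u and e :: "nat \<Rightarrow> real"
  assume ws: "weak_solution M w H" and osc: "\<And>x. norm (H x - c) \<le> \<omega>" and C0: "\<And>e x. \<bar>w e x\<bar> \<le> C0"
   and e: "\<And>k. e k > 0" "e \<longlonglongrightarrow> 0" and lim: "AE x in lborel. x \<in> ball 0 1 \<longrightarrow> (\<lambda>k. w (e k) x) \<longlonglongrightarrow> u x"
  have sw: "smooth (w e)" for e using ws by (auto simp: weak_solution_def)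
  note ib' = ib[OF ws osc]
  have lb: "locally_bounded (ball 0 1) (\<lambda>e. partials \<beta> (w e))" for \<beta>
  proof (cases \<beta> rule: rev_cases)
   case Nil
   thus ?thesis using C0 unfolding locally_bounded_def partials_def by (intro ballI exI[of _ 1] conjI exI[of _ C0]) auto
  next
   case (snoc \<alpha> i)
   show ?thesis
   proof (cases \<alpha> rule: rev_cases)
    case Nil
    have "locally_bounded (ball 0 1) (\<lambda>e. dderiv (axis i 1) (w e))"
     by (rule gradient_locally_bounded[OF sw C0]) (use ib'[of "[]" "(i, i)"] in \<open>auto simp: partials_def pd2_def\<close>)
    thus ?thesis by (simp add: snoc Nil partials_def iter_dderiv_Cons)
   next
    case (snoc \<gamma> j)
    thus ?thesis using ib'[of \<gamma> "(j, i)"] \<open>\<beta> = \<alpha> @ [i]\<close> by (simp add: partials_def pd2_def iter_dderiv_append iter_dderiv_Cons)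
   qed
  qed
  have "\<exists>r>0. \<exists>C k0. \<forall>k\<ge>k0. \<forall>x\<in>ball x0 r. \<bar>iter_dderiv vs (w (e k)) x\<bar> \<le> C" if x0: "x0 \<in> ball 0 1" for vs x0
  proof -
   have "locally_bounded (ball 0 1) (\<lambda>e. iter_dderiv vs (w e))" by (rule locally_bounded_iter_dderiv[OF sw lb])
   then obtain r C where r: "r > 0" "\<And>e x. 0 < e \<Longrightarrow> e < r \<Longrightarrow> x \<in> ball x0 r \<Longrightarrow> \<bar>iter_dderiv vs (w e) x\<bar> \<le> C"
    using x0 unfolding locally_bounded_def by blast
   moreover obtain k0 where "\<And>k. k \<ge> k0 \<Longrightarrow> e k < r"
    using order_tendstoD(2)[OF e(2) r(1)] by (auto simp: eventually_sequentially)
   ultimately show ?thesis using e(1) by blast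
  qed
  from smooth_limit[OF open_ball sw this lim] show "\<exists>v. smooth_on (ball 0 1) v \<and> (AE x in lborel. x \<in> ball 0 1 \<longrightarrow> u x = v x)" by blast
 qed
qed

end


section \<open>Borel representatives and symmetrization\<close>

lemma AE_lebesgue_on:
 assumes "S \<in> sets borel"
 shows "(AE x in lebesgue_on S. P x) \<longleftrightarrow> (AE x in lborel. x \<in> S \<longrightarrow> P x)"
 using assms by (subst AE_restrict_space_iff) (auto simp: AE_completion_iff)

lemma Borel_representative:
 fixes f :: "'a::euclidean_space \<Rightarrow> real"
 assumes f: "f \<in> borel_measurable (lebesgue_on S)" and S: "S \<in> sets borel"
 obtains g where "borel_fun g" "AE x in lborel. x \<in> S \<longrightarrow> f x = g x"
proof -
 have "(\<lambda>x. if x \<in> S then f x else 0) \<in> borel_measurable lebesgue" using f S by (intro borel_measurable_if_I) auto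
 then obtain g where g: "g \<in> borel_measurable lborel" "AE x in lborel. (if x \<in> S then f x else 0) = g x"
  using completion_ex_borel_measurable_real by blast
 from g(2) have "AE x in lborel. x \<in> S \<longrightarrow> f x = g x" by eventually_elim auto
 with g(1) show thesis by (intro that) auto
qed

text \<open>Passes from integrals over a set with Lebesgue measure to integrals of Borel functions
  on the whole space, where translation and Tonelli are available.\<close>

lemma integral_lebesgue_on_eq:
 fixes f g :: "'a::euclidean_space \<Rightarrow> real"
 assumes S: "S \<in> sets borel" and g: "borel_fun g" "\<And>x. x \<notin> S \<Longrightarrow> g x = 0"
  and eq: "AE x in lborel. x \<in> S \<longrightarrow> f x = g x"
 shows "(\<integral>x. f x \<partial>lebesgue_on S) = (\<integral>x. g x \<partial>lborel)"
proof -
 have S': "S \<inter> space lebesgue \<in> sets lebesgue" using S by auto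
 have gl: "g \<in> borel_measurable lebesgue" using g(1) by (simp add: measurable_completion)
 have AE: "AE x in lebesgue. g x = indicator S x *\<^sub>R f x"
  unfolding AE_completion_iff using eq by eventually_elim (use g(2) in \<open>auto simp: indicator_def\<close>)
 have "(\<integral>x. f x \<partial>lebesgue_on S) = (\<integral>x. indicator S x *\<^sub>R f x \<partial>lebesgue)" by (rule integral_restrict_space[OF S'])
 also have "\<dots> = (\<integral>x. g x \<partial>lebesgue)"
  using AE by (intro integral_cong_AE borel_measurable_AE[OF gl AE] gl) (auto elim: eventually_mono)
 also have "\<dots> = (\<integral>x. g x \<partial>lborel)" using g(1) by (intro integral_completion) auto
 finally show ?thesis .
qed

text \<open>The open ball is exhausted by closed balls of radius 1 - 1/(n + 1), on each of which
  integrability gives measurability; the truncations converge pointwise.\<close>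

lemma locally_integrable_measurable:
 fixes f :: "'a::euclidean_space \<Rightarrow> real"
 assumes "locally_integrable (ball 0 1) f"
 shows "f \<in> borel_measurable (lebesgue_on (ball 0 1))"
proof -
 define r where "r n = 1 - 1 / real (Suc n)" for n
 have r1: "r n < 1" for n by (simp add: r_def)
 have "cball 0 (r n) \<subseteq> ball 0 1" for n using r1[of n] by auto
 hence "f \<in> borel_measurable (lebesgue_on (cball 0 (r n)))" for n
  using assms unfolding locally_integrable_def by (meson borel_measurable_integrable compact_cball)
 hence m: "(\<lambda>x. if x \<in> cball 0 (r n) then f x else 0) \<in> borel_measurable lebesgue" for n
  by (intro borel_measurable_if_I) auto
 have "(\<lambda>x. if x \<in> ball 0 1 then f x else 0) \<in> borel_measurable lebesgue"
 proof (rule borel_measurable_LIMSEQ_real[OF _ m])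
  fix x :: 'a
  show "(\<lambda>n. if x \<in> cball 0 (r n) then f x else 0) \<longlonglongrightarrow> (if x \<in> ball 0 1 then f x else 0)"
  proof (cases "x \<in> ball 0 1")
   case True
   have "r \<longlonglongrightarrow> 1 - 0" unfolding r_def by (intro tendsto_diff tendsto_const LIMSEQ_Suc lim_inverse_n'[unfolded inverse_eq_divide])
   hence "eventually (\<lambda>n. norm x < r n) sequentially" using True by (intro order_tendstoD) auto
   hence "eventually (\<lambda>n. (if x \<in> cball 0 (r n) then f x else 0) = (if x \<in> ball 0 1 then f x else 0)) sequentially"
    by eventually_elim (use True in auto)
   thus ?thesis by (rule tendsto_eventually)
  next
   case False
   hence "x \<notin> cball 0 (r n)" for n using r1[of n] by simp
   thus ?thesis using False by simp
  qed
 qed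
 thus ?thesis by (subst borel_measurable_if[symmetric]) auto
qed

text \<open>The orthogonal projection onto symmetric matrices. Composing with it extends
  \<open>F\<close> from the relatively open set \<open>U\<close> to an open set of matrices, where
  directional derivatives in every direction make sense.\<close>

definition symmetrize :: "real^'n^'n \<Rightarrow> real^'n^'n"
 where "symmetrize A = (1 / 2) *\<^sub>R (A + transpose A)"

lemma linear_symmetrize: "linear symmetrize"
 by (rule linearI) (auto simp: symmetrize_def transpose_def vec_eq_iff algebra_simps)

lemma symmetrize_in: "symmetrize A \<in> sym_matrices"
 by (simp add: symmetrize_def sym_matrices_def transpose_def vec_eq_iff)

lemma symmetrize_id: "A \<in> sym_matrices \<Longrightarrow> symmetrize A = A"
 by (simp add: symmetrize_def sym_matrices_def scaleR_2[symmetric])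

lemma symmetrize_line: "symmetrize (A + s *\<^sub>R B) = symmetrize A + s *\<^sub>R symmetrize B"
 by (simp add: linear_add linear_scale linear_symmetrize)

lemma iter_dderiv_symmetrize:
 "iter_dderiv vs (\<lambda>A. F (symmetrize A)) = (\<lambda>A. iter_dderiv (map symmetrize vs) F (symmetrize A))"
proof (induction vs)
 case (Cons v vs)
 thus ?case by (simp add: iter_dderiv_Cons dderiv_def symmetrize_line)
qed simp

lemma deriv_line: "deriv (\<lambda>s. f (x + s *\<^sub>R v)) t = dderiv v f (x + t *\<^sub>R v)"
proof -
 have "dderiv v f (x + t *\<^sub>R v) = deriv (\<lambda>s. f (x + (t + s) *\<^sub>R v)) 0"
  by (simp add: dderiv_def scaleR_left_distrib add.assoc)
 thus ?thesis unfolding deriv_def by (simp add: deriv_shift[of "\<lambda>s. f (x + s *\<^sub>R v)"])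
qed

lemma (in bounded_smooth) second_dderiv_expand:
 assumes x: "x \<in> U"
 shows "dderiv v (dderiv v F) x = (\<Sum>b\<in>Basis. \<Sum>c\<in>Basis. (v \<bullet> b) * (v \<bullet> c) * iter_dderiv [c, b] F x)"
proof -
 have "dderiv v (dderiv v F) x = dderiv v (\<lambda>y. \<Sum>b\<in>Basis. (v \<bullet> b) * iter_dderiv [b] F y) x"
  by (rule dderiv_local_cong[OF U(1) _ x]) (use dderiv_expand[of _ v "[]"] in simp)
 also have "\<dots> = (\<Sum>b\<in>Basis. (v \<bullet> b) * dderiv v (iter_dderiv [b] F) x)"
 proof (intro dderivI DERIV_sum DERIV_cmult)
  fix b
  show "((\<lambda>s. iter_dderiv [b] F (x + s *\<^sub>R v)) has_real_derivative dderiv v (iter_dderiv [b] F) x) (at 0)"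
   using line_derivative[of "iter_dderiv [b] F" x 0 v] diff[OF x] by simp
 qed
 also have "\<dots> = (\<Sum>b\<in>Basis. \<Sum>c\<in>Basis. (v \<bullet> b) * (v \<bullet> c) * iter_dderiv [c, b] F x)"
  unfolding dderiv_expand[OF x] by (simp add: sum_distrib_left mult.assoc)
 finally show ?thesis .
qed

text \<open>At symmetric arguments and in symmetric directions the extension has the same
  derivatives as \<open>F\<close>, so smoothness, bounds and convexity carry over. Intersecting with
  \<open>cball 0 M\<close> gives a bounded set, where the hypothesis on \<open>F\<close> bounds each
  derivative.\<close>

lemma elliptic_symmetrization:
 fixes U :: "(real^'n^'n) set" and F :: "real^'n^'n \<Rightarrow> real" and \<Lambda> M :: real
 assumes asm: "U \<subseteq> sym_matrices" "openin (top_of_set sym_matrices) U" "convex U"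
  and F: "smooth_integrand U F" and L: "\<Lambda> > 0" "uniformly_convex U \<Lambda> F"
 shows "elliptic (symmetrize -` U) (U \<inter> cball 0 M) (\<lambda>A. F (symmetrize A)) \<Lambda>"
proof -
 let ?U = "symmetrize -` U" and ?K = "U \<inter> cball 0 M" and ?F = "\<lambda>A. F (symmetrize A)"
 have cs: "continuous_on S symmetrize" for S :: "(real^'n^'n) set"
  by (rule linear_continuous_on[OF linear_conv_bounded_linear[THEN iffD1, OF linear_symmetrize]])
 have ls: "map symmetrize vs \<in> lists sym_matrices" for vs :: "(real^'n^'n) list"
  by (auto simp: in_lists_conv_set symmetrize_in)
 have sm: "smooth_along sym_matrices U F" using F by (simp add: smooth_integrand_def)
 interpret bounded_smooth ?U ?K ?F
 proof
  obtain V where V: "open V" "U = sym_matrices \<inter> V" using asm(2) unfolding openin_open by blast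
  \<comment> \<open>A symmetrized matrix is symmetric, so its membership in \<open>U\<close> reduces
    to membership in the open set \<open>V\<close>.\<close>
  have "?U = symmetrize -` V" using V(2) symmetrize_in by blast
  thus "open ?U" using cs[of UNIV] V(1) by (simp add: continuous_on_open_vimage)
  show "?K \<subseteq> ?U" using asm(1) symmetrize_id by auto
  show "convex ?K" using asm(3) by (intro convex_Int) auto
  show "smooth_on ?U ?F"
   unfolding smooth_along_def iter_dderiv_symmetrize
  proof (intro ballI conjI)
   fix vs :: "(real^'n^'n) list"
   have c: "continuous_on U (iter_dderiv (map symmetrize vs) F)" and d: "\<And>v x. v \<in> sym_matrices \<Longrightarrow> x \<in> U \<Longrightarrow>
     (\<lambda>s::real. iter_dderiv (map symmetrize vs) F (x + s *\<^sub>R v)) field_differentiable at 0"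
    using sm ls unfolding smooth_along_def by blast+
   show "continuous_on ?U (\<lambda>A. iter_dderiv (map symmetrize vs) F (symmetrize A))"
    by (rule continuous_on_compose2[OF c cs]) auto
   show "(\<lambda>s. iter_dderiv (map symmetrize vs) F (symmetrize (x + s *\<^sub>R v))) field_differentiable at 0" if "x \<in> ?U" for v x
    unfolding symmetrize_line using that by (intro d symmetrize_in) auto
  qed
  fix vs :: "(real^'n^'n) list"
  have "bounded (iter_dderiv (map symmetrize vs) F ` ?K)"
   using F ls bounded_subset[OF bounded_cball, of ?K] unfolding smooth_integrand_def by blast
  then obtain C where C: "\<forall>\<xi>\<in>?K. \<bar>iter_dderiv (map symmetrize vs) F \<xi>\<bar> \<le> C" by (auto simp: bounded_iff)
  have "symmetrize \<xi> = \<xi>" if "\<xi> \<in> ?K" for \<xi> using that asm(1) symmetrize_id by blast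
  thus "\<exists>C. \<forall>\<xi>\<in>?K. \<bar>iter_dderiv vs ?F \<xi>\<bar> \<le> C"
   unfolding iter_dderiv_symmetrize using C by (intro exI[of _ C]) auto
 qed
 show ?thesis
 proof
  show "\<Lambda> > 0" by (rule L)
  show "?K \<subseteq> sym_matrices" using asm(1) by auto
  fix \<xi> \<sigma> :: "real^'n^'n" assume \<xi>: "\<xi> \<in> ?K" and \<sigma>: "\<sigma> \<in> sym_matrices"
  have "symmetrize \<xi> = \<xi>" using \<xi> asm(1) by (intro symmetrize_id) auto
  hence \<xi>': "symmetrize \<xi> = \<xi>" "\<xi> \<in> ?U" using \<xi> by auto
  have "\<Lambda> * (\<Sum>p\<in>UNIV. (ent p \<sigma>)\<^sup>2) = \<Lambda> * (norm \<sigma>)\<^sup>2"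
   unfolding power2_norm_eq_inner euclidean_inner[of \<sigma> \<sigma>] sum_Basis_munit munit_inner by (simp add: power2_eq_square)
  also have "\<dots> \<le> (deriv ^^ 2) (\<lambda>s. F (\<xi> + s *\<^sub>R \<sigma>)) 0" using L(2) \<xi> \<sigma> by (auto simp: uniformly_convex_def)
  also have "\<dots> = iter_dderiv [\<sigma>, \<sigma>] F \<xi>"
  proof -
   have "deriv (\<lambda>s. F (\<xi> + s *\<^sub>R \<sigma>)) = (\<lambda>t. dderiv \<sigma> F (\<xi> + t *\<^sub>R \<sigma>))" by (rule ext) (rule deriv_line)
   thus ?thesis using deriv_line[of "dderiv \<sigma> F" \<xi> \<sigma> 0] by (simp add: numeral_2_eq_2 iter_dderiv_Cons)
  qed
  also have "\<dots> = iter_dderiv [\<sigma>, \<sigma>] ?F \<xi>" unfolding iter_dderiv_symmetrize by (simp add: \<xi>' symmetrize_id[OF \<sigma>])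
  also have "\<dots> = (\<Sum>p\<in>UNIV. \<Sum>q\<in>UNIV. ent p \<sigma> * ent q \<sigma> * iter_dderiv [munit q, munit p] ?F \<xi>)"
   using second_dderiv_expand[OF \<xi>'(2), of \<sigma>] unfolding sum_Basis_munit munit_inner by (simp add: iter_dderiv_Cons)
  finally show "\<Lambda> * (\<Sum>p\<in>UNIV. (ent p \<sigma>)\<^sup>2) \<le> (\<Sum>p\<in>UNIV. \<Sum>q\<in>UNIV. ent p \<sigma> * ent q \<sigma> * iter_dderiv [munit q, munit p] ?F \<xi>)" .
 qed
qed

section \<open>Mollification as testing, and the conclusion\<close>

lemma partials_pd2: "partials [i, j] f = pd2 (i, j) f"
 by (simp add: partials_def pd2_def iter_dderiv_Cons)

lemma hessian_sym:
 assumes "smooth \<eta>"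
 shows "hessian \<eta> x \<in> sym_matrices"
 using dderiv_commute[OF assms] by (simp add: sym_matrices_def hessian_def transpose_def vec_eq_iff partials_pd2 pd2_def)

text \<open>Evaluating a mollification at \<open>x\<close> amounts to testing against this reflected
  kernel. The two sign changes of the chain rule cancel in second derivatives.\<close>

lemma reflected_mollifier:
 fixes x :: "real^'n"
 assumes e: "e > 0" "cball x e \<subseteq> \<Omega>"
 shows "test_function \<Omega> (\<lambda>y. mollifier e (x - y))"
  and "pd2 p (\<lambda>y. mollifier e (x - y)) y = pd2 p (mollifier e) (x - y)"
proof -
 have sm: "smooth (mollifier e :: real^'n \<Rightarrow> real)" by (rule test_function_smooth[OF test_function_mollifier[OF e(1)]])
 have eq: "(\<lambda>y. f (x - y)) = (\<lambda>y. f ((-1) *\<^sub>R y + x))" for f :: "real^'n \<Rightarrow> real" by simp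
 have sr: "smooth (\<lambda>y. f (x - y))" if "smooth f" for f :: "real^'n \<Rightarrow> real"
  unfolding eq by (rule smooth_affine[OF that])
 have dr: "dderiv v (\<lambda>y. f (x - y)) = (\<lambda>y. - 1 * dderiv v f (x - y))" if f: "smooth f" for v and f :: "real^'n \<Rightarrow> real"
 proof -
  have "dderiv ((-1) *\<^sub>R v) f y = - 1 * dderiv v f y" for y
   using smooth_dir_differentiable[OF f] by (intro dderiv_scaleR) (auto simp: dir_differentiable_def)
  thus ?thesis unfolding eq dderiv_affine by simp
 qed
 show "test_function \<Omega> (\<lambda>y. mollifier e (x - y))"
  unfolding test_function_def
 proof (intro conjI exI[of _ "cball x e"] allI impI)
  fix y assume "y \<notin> cball x e"
  thus "mollifier e (x - y) = 0" by (intro mollifier_eq_0[OF e(1)]) (simp add: dist_norm)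
 qed (use sr[OF sm] e in auto)
 show "pd2 p (\<lambda>y. mollifier e (x - y)) y = pd2 p (mollifier e) (x - y)"
  unfolding pd2_def dr[OF sm] dderiv_cmult[OF smooth_dir_differentiable[OF sr[OF smooth_dderiv[OF sm]]]] dr[OF smooth_dderiv[OF sm]] by simp
qed

lemma pd2_conv:
 fixes f :: "real^'n \<Rightarrow> real"
 assumes "integrable lborel f" "test_function UNIV g"
 shows "pd2 p (conv f g) = conv f (pd2 p g)"
 using iter_dderiv_conv[OF assms, of "[axis (fst p) 1, axis (snd p) 1]"] by (simp add: pd2_def iter_dderiv_Cons)

lemma Linf_norm_bound: "AE x in lebesgue_on \<Omega>. ereal (norm (f x)) \<le> Linf_norm \<Omega> f"
 unfolding Linf_norm_def by (rule esssup_AE)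

text \<open>The data satisfy their conditions almost everywhere and are Lebesgue-measurable, whereas
  \<open>regularity\<close> works with Borel functions bounded at every point. \<open>H\<close> and
  \<open>w0\<close> are representatives corrected on null sets.\<close>

theorem theorem1p1:
  fixes U :: "(real^'n^'n) set" and F :: "real^'n^'n \<Rightarrow> real" and \<Lambda> M :: real
  assumes "U \<subseteq> sym_matrices" "openin (top_of_set sym_matrices) U" "convex U" "U \<noteq> {}"
    and "smooth_integrand U F"
    and "\<Lambda> > 0" "uniformly_convex U \<Lambda> F"
    and "M \<ge> 0"
  shows "\<exists>\<omega>>0. \<forall>(u :: real^'n \<Rightarrow> real) D2u.
    u \<in> W_inf 2 (ball 0 1) \<and> weak_hessian (ball 0 1) u D2u
    \<and> (AE x in lebesgue_on (ball 0 1). D2u x \<in> U)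
    \<and> Linf_norm (ball 0 1) D2u = ereal M
    \<and> critical_point (ball 0 1) F D2u
    \<and> Linf_norm (ball 0 1) (\<lambda>x. D2u x - average (ball 0 1) D2u) \<le> ereal \<omega>
    \<longrightarrow> (\<exists>v. smooth_on (ball 0 1) v \<and> (AE x in lebesgue_on (ball 0 1). u x = v x))"
proof -
 let ?B = "ball (0 :: real^'n) 1" and ?F = "\<lambda>A. F (symmetrize A)"
 interpret E: elliptic "symmetrize -` U" "U \<inter> cball 0 M" ?F \<Lambda>
  by (rule elliptic_symmetrization[OF assms(1-3,5-7)])
 obtain V where V: "open V" "U = sym_matrices \<inter> V" using assms(2) unfolding openin_open by blast
 have "A \<in> sym_matrices \<longleftrightarrow> symmetrize A = A" for A :: "real^'n^'n"
  using symmetrize_id[of A] symmetrize_in[of A] by auto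
 hence "(sym_matrices :: (real^'n^'n) set) = {A. symmetrize A = A}" by blast
 moreover have "closed {A. symmetrize A = (A :: real^'n^'n)}"
  by (intro closed_Collect_eq linear_continuous_on[OF linear_conv_bounded_linear[THEN iffD1, OF linear_symmetrize]] continuous_on_id)
 ultimately have "sym_matrices \<in> sets (borel :: (real^'n^'n) measure)" by simp
 hence UB: "U \<in> sets borel" using V by auto
 hence KB: "U \<inter> cball 0 M \<in> sets borel" by auto
 show ?thesis
 proof (rule E.regularity[OF KB])
  fix \<omega> :: real
  assume \<omega>: "0 < \<omega>" and reg: "\<And>w H M' c C0 e u. E.weak_solution M' w H \<Longrightarrow> (\<And>x. norm (H x - c) \<le> \<omega>) \<Longrightarrow> (\<And>e x. \<bar>w e x\<bar> \<le> C0) \<Longrightarrow>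
   (\<And>k::nat. e k > 0) \<Longrightarrow> e \<longlonglongrightarrow> 0 \<Longrightarrow> AE x in lborel. x \<in> ?B \<longrightarrow> (\<lambda>k. w (e k) x) \<longlonglongrightarrow> u x \<Longrightarrow>
   \<exists>v. smooth_on ?B v \<and> (AE x in lborel. x \<in> ?B \<longrightarrow> u x = v x)"
  show ?thesis
  proof (intro exI[of _ \<omega>] conjI \<omega> allI impI, elim conjE)
   fix u :: "real^'n \<Rightarrow> real" and D2u :: "real^'n \<Rightarrow> real^'n^'n"
   assume u: "u \<in> W_inf 2 ?B" and wh: "weak_hessian ?B u D2u" and DU: "AE x in lebesgue_on ?B. D2u x \<in> U"
    and DM: "Linf_norm ?B D2u = ereal M" and cp: "critical_point ?B F D2u"
    and Dw: "Linf_norm ?B (\<lambda>x. D2u x - average ?B D2u) \<le> ereal \<omega>"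
   define c where "c = average ?B D2u"
   \<comment> \<open>The values allowed by all three almost-everywhere conditions: membership in
     \<open>U\<close>, the bound \<open>M\<close>, and oscillation \<omega> about the mean.\<close>
   define K where "K = U \<inter> cball 0 M \<inter> cball c \<omega>"
   have K [measurable]: "K \<in> sets borel" using UB by (auto simp: K_def)
   have AEB: "(AE x in lebesgue_on ?B. P x) \<longleftrightarrow> (AE x in lborel. x \<in> ?B \<longrightarrow> P x)" for P by (rule AE_lebesgue_on) simp
   have "AE x in lebesgue_on ?B. D2u x \<in> K"
    using DU Linf_norm_bound[of D2u ?B] Linf_norm_bound[of "\<lambda>x. D2u x - average ?B D2u" ?B]
   proof eventually_elim
    case (elim x)
    from elim(3) have "ereal (norm (D2u x - c)) \<le> ereal \<omega>" unfolding c_def using Dw by (rule order_trans)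
    thus ?case using elim(1,2) unfolding DM by (simp add: K_def dist_norm norm_minus_commute)
   qed
   hence DK: "AE x in lborel. x \<in> ?B \<longrightarrow> D2u x \<in> K" unfolding AEB .
   obtain y0 where y0: "D2u y0 \<in> K" using AE_ball_witness[OF DK] by auto
   have wp: "weak_partials ?B [fst p, snd p] u (\<lambda>x. ent p (D2u x))" for p using wh by (simp add: weak_hessian_def ent_def)
   have "\<forall>p. \<exists>g. borel_fun g \<and> (AE x in lborel. x \<in> ?B \<longrightarrow> ent p (D2u x) = g x)"
   proof
    fix p
    have "(\<lambda>x. ent p (D2u x)) \<in> borel_measurable (lebesgue_on ?B)"
     by (rule locally_integrable_measurable) (use wp[of p] in \<open>simp add: weak_partials_def\<close>)
    from Borel_representative[OF this]
    show "\<exists>g. borel_fun g \<and> (AE x in lborel. x \<in> ?B \<longrightarrow> ent p (D2u x) = g x)" by auto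
   qed
   from choice[OF this] obtain g where "\<forall>p. borel_fun (g p) \<and> (AE x in lborel. x \<in> ?B \<longrightarrow> ent p (D2u x) = g p x)" ..
   hence g: "\<And>p. borel_fun (g p)" and gD: "\<And>p. AE x in lborel. x \<in> ?B \<longrightarrow> ent p (D2u x) = g p x"
    by blast+
   define H0 :: "real^'n \<Rightarrow> real^'n^'n" where "H0 x = (\<chi> i j. g (i, j) x)" for x
   have H0e: "ent p (H0 x) = g p x" for p x by (simp add: H0_def ent_def)
   have H0 [measurable]: "borel_fun H0"
   proof (rule borel_measurable_euclidean_space[THEN iffD2], rule ballI)
    fix b :: "real^'n^'n" assume "b \<in> Basis"
    then obtain p where "b = munit p" using bij_betw_imp_surj_on[OF bij_munit] by blast
    thus "borel_fun (\<lambda>x. H0 x \<bullet> b)" using g[of p] by (simp add: munit_inner H0e)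
   qed
   \<comment> \<open>At exceptional points the admissible value \<open>D2u y0\<close> is
     substituted, so that \<open>H\<close> takes values in \<open>K\<close> everywhere.\<close>
   define H where "H x = (if H0 x \<in> K then H0 x else D2u y0)" for x
   have H [measurable]: "borel_fun H" unfolding H_def by measurable
   have HK: "H x \<in> K" for x using y0 by (simp add: H_def)
   have "AE x in lborel. \<forall>p\<in>UNIV. x \<in> ?B \<longrightarrow> ent p (D2u x) = g p x" using gD by (subst AE_finite_all) auto
   with DK have DH: "AE x in lborel. x \<in> ?B \<longrightarrow> D2u x = H x"
   proof eventually_elim
    case (elim x)
    show ?case
    proof
     assume "x \<in> ?B"
     hence "ent p (D2u x) = ent p (H0 x)" for p using elim(2)[THEN bspec, OF UNIV_I, of p] by (simp add: H0e)
     from this[of "(_, _)"] have "D2u x = H0 x" by (simp add: vec_eq_iff ent_def)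
     thus "D2u x = H x" using elim \<open>x \<in> ?B\<close> by (simp add: H_def)
    qed
   qed
   have uL: "u \<in> borel_measurable (lebesgue_on ?B)" "Linf_norm ?B u < \<infinity>" using u by (auto simp: W_inf_def Linf_def)
   obtain u0 where u0 [measurable]: "borel_fun u0" and uu0: "AE x in lborel. x \<in> ?B \<longrightarrow> u x = u0 x"
    using Borel_representative[OF uL(1)] by auto
   define C0 where "C0 = \<bar>real_of_ereal (Linf_norm ?B u)\<bar>"
   \<comment> \<open>The representative of \<open>u\<close> extended by 0 outside the ball and
     cleared where the essential bound \<open>C0\<close> fails; it is bounded with bounded support,
     so it can be mollified.\<close>
   define w0 where "w0 x = (if x \<in> ?B \<and> \<bar>u0 x\<bar> \<le> C0 then u0 x else 0)" for x
   have w0 [measurable]: "borel_fun w0" unfolding w0_def by measurable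
   have C0: "C0 \<ge> 0" unfolding C0_def by (rule abs_ge_zero)
   have w0b: "\<bar>w0 x\<bar> \<le> C0" and w00: "x \<notin> ?B \<Longrightarrow> w0 x = 0" for x using C0 by (auto simp: w0_def)
   have w0i: "integrable lborel w0" by (rule integrable_bounded_support[OF w0 bounded_ball[of 0 1], where B = C0]) (use w0b w00 in auto)
   have "AE x in lborel. x \<in> ?B \<longrightarrow> ereal (norm (u x)) \<le> Linf_norm ?B u" using Linf_norm_bound[of u ?B] unfolding AEB .
   with uu0 have uw: "AE x in lborel. x \<in> ?B \<longrightarrow> u x = w0 x"
   proof eventually_elim
    case (elim x)
    show ?case
    proof
     assume x: "x \<in> ?B"
     hence "\<bar>u x\<bar> \<le> C0" using elim(2) uL(2) unfolding C0_def by (cases "Linf_norm ?B u") auto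
     thus "u x = w0 x" using x elim(1) by (simp add: w0_def)
    qed
   qed
   \<comment> \<open>The value 0 for nonpositive \<open>e\<close> is a default that keeps smoothness
     and the sup bound valid for every real \<open>e\<close>.\<close>
   define w where "w e = (if e > 0 then conv w0 (mollifier e) else (\<lambda>x. 0))" for e
   have KU: "K \<subseteq> U" "K \<subseteq> U \<inter> cball 0 M" by (auto simp: K_def)
   have HK0: "H x \<in> U \<inter> cball 0 M" for x using HK KU(2) by blast
   \<comment> \<open>The first variation in a symmetric direction, written with partial derivatives
     of the extended integrand; Hessians of test functions are such directions.\<close>
   have fv: "dderiv A F \<xi> = (\<Sum>p\<in>UNIV. iter_dderiv [munit p] ?F \<xi> * ent p A)" if "\<xi> \<in> U" "A \<in> sym_matrices" for \<xi> A
   proof -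
    have "symmetrize \<xi> = \<xi>" using that(1) assms(1) symmetrize_id by blast
    hence "dderiv A F \<xi> = dderiv A (iter_dderiv [] ?F) \<xi>"
     using iter_dderiv_symmetrize[of "[A]" F] by (simp add: iter_dderiv_Cons symmetrize_id[OF that(2)])
    also have "\<dots> = (\<Sum>p\<in>UNIV. iter_dderiv [munit p] ?F \<xi> * ent p A)"
     using E.dderiv_expand[of \<xi> A "[]"] \<open>symmetrize \<xi> = \<xi>\<close> that(1) unfolding sum_Basis_munit munit_inner by (simp add: mult.commute)
    finally show ?thesis .
   qed
   have ws: "E.weak_solution M w H"
    unfolding E.weak_solution_def
   proof (intro conjI allI impI)
    show "H x \<in> U \<inter> cball 0 M" for x by (rule HK0)
    show "norm (H x) \<le> M" for x using HK0[of x] by simp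
    show "smooth (w e)" for e
     unfolding w_def using smooth_conv[OF w0i test_function_mollifier] smooth_const by auto
    fix e :: real and p and x :: "real^'n" assume e: "e > 0" and xe: "cball x e \<subseteq> ?B"
    \<comment> \<open>The definition of the distributional Hessian is used with this kernel as test
      function, which turns second derivatives of the mollified \<open>u\<close> into mollified
      entries.\<close>
    let ?\<eta> = "\<lambda>y. mollifier e (x - y) :: real"
    note \<eta> = reflected_mollifier(1)[OF e xe] and d\<eta> = reflected_mollifier(2)[OF e xe]
    have [measurable]: "borel_fun ?\<eta>" "borel_fun (pd2 p ?\<eta>)"
     using smooth_borel[OF test_function_smooth[OF \<eta>]] smooth_borel[OF test_function_smooth[OF test_function_pd2[OF \<eta>]]] by auto
    have [measurable]: "borel_fun (\<lambda>y. ent p (H y))" by (rule E.ent_measurable[OF H])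
    have "pd2 p (w e) x = (\<integral>y. w0 y * pd2 p ?\<eta> y \<partial>lborel)"
     unfolding d\<eta> using e pd2_conv[OF w0i test_function_mollifier[OF e]] by (simp add: w_def conv_def)
    also have "\<dots> = (\<integral>y. u y * partials [fst p, snd p] ?\<eta> y \<partial>lebesgue_on ?B)"
    proof (rule integral_lebesgue_on_eq[symmetric])
     show "AE y in lborel. y \<in> ?B \<longrightarrow> u y * partials [fst p, snd p] ?\<eta> y = w0 y * pd2 p ?\<eta> y"
      using uw by eventually_elim (simp add: partials_pd2)
    qed (use w00 in auto)
    also have "\<dots> = (\<integral>y. ent p (D2u y) * ?\<eta> y \<partial>lebesgue_on ?B)"
     using wp[of p] \<eta> by (simp add: weak_partials_def)
    also have "\<dots> = (\<integral>y. indicator ?B y * ent p (H y) * ?\<eta> y \<partial>lborel)"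
    proof (rule integral_lebesgue_on_eq)
     show "AE y in lborel. y \<in> ?B \<longrightarrow> ent p (D2u y) * ?\<eta> y = indicator ?B y * ent p (H y) * ?\<eta> y"
      using DH by eventually_elim auto
     show "borel_fun (\<lambda>y. indicator ?B y * ent p (H y) * ?\<eta> y)" by measurable
    qed auto
    finally show "pd2 p (w e) x = mollified_ent ?B H p e x" by (simp add: conv_def)
   next
    fix \<eta> :: "real^'n \<Rightarrow> real" assume \<eta>: "test_function ?B \<eta>"
    have [measurable]: "borel_fun (pd2 p \<eta>)" for p
     by (rule smooth_borel[OF test_function_smooth[OF test_function_pd2[OF \<eta>]]])
    note [measurable] = E.measurable_compose_iter_dderiv[OF H HK0]
    have "(\<integral>x. dderiv (hessian \<eta> x) F (D2u x) \<partial>lebesgue_on ?B) = first_var ?F H \<eta>"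
    proof (rule integral_lebesgue_on_eq)
     show "borel_fun (\<lambda>x. \<Sum>p\<in>UNIV. iter_dderiv [munit p] ?F (H x) * pd2 p \<eta> x)" by measurable
     show "(\<Sum>p\<in>UNIV. iter_dderiv [munit p] ?F (H x) * pd2 p \<eta> x) = 0" if "x \<notin> ?B" for x
     proof -
      have "pd2 p \<eta> x = 0" for p using test_function_pd2[OF \<eta>, of p] that by (auto simp: test_function_def)
      thus ?thesis by simp
     qed
     show "AE x in lborel. x \<in> ?B \<longrightarrow> dderiv (hessian \<eta> x) F (D2u x) = (\<Sum>p\<in>UNIV. iter_dderiv [munit p] ?F (H x) * pd2 p \<eta> x)"
      using DH
     proof eventually_elim
      case (elim x)
      have "ent p (hessian \<eta> x) = pd2 p \<eta> x" for p by (simp add: ent_def hessian_def partials_pd2)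
      thus ?case using elim fv[OF _ hessian_sym[OF test_function_smooth[OF \<eta>]], of "H x" x] HK[of x] KU by auto
     qed
    qed simp
    thus "first_var ?F H \<eta> = 0"
     using cp \<eta> by (simp add: critical_point_def)
   qed (use H in auto)
   have osc: "norm (H x - c) \<le> \<omega>" for x using HK[of x] by (simp add: K_def dist_norm norm_minus_commute)
   have wb: "\<bar>w e x\<bar> \<le> C0" for e x
   proof (cases "e > 0")
    case True
    have "\<bar>conv w0 (mollifier e) x - 0\<bar> \<le> C0" by (rule conv_mollifier_bound[OF w0i True]) (simp add: w0b)
    thus ?thesis using True by (simp add: w_def)
   qed (simp add: w_def C0)
   \<comment> \<open>Almost everywhere convergence of the mollifications of a single function: the
     index set is a singleton.\<close>
   obtain e where e: "\<And>k. e k > 0" "e \<longlonglongrightarrow> 0" "AE x in lborel. \<forall>i\<in>{()}. (\<lambda>k. conv w0 (mollifier (e k)) x) \<longlonglongrightarrow> w0 x"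
    by (rule conv_mollifier_AE[of "{()}" "\<lambda>_. w0" C0 1]) (use w0b w00 in auto)
   have "AE x in lborel. x \<in> ?B \<longrightarrow> (\<lambda>k. w (e k) x) \<longlonglongrightarrow> w0 x"
    using e(3) by eventually_elim (simp add: w_def e(1))
   from reg[OF ws osc wb e(1,2) this]
   obtain v where v: "smooth_on ?B v" "AE x in lborel. x \<in> ?B \<longrightarrow> w0 x = v x" by blast
   have "AE x in lborel. x \<in> ?B \<longrightarrow> u x = v x" using uw v(2) by eventually_elim auto
   thus "\<exists>v. smooth_on ?B v \<and> (AE x in lebesgue_on ?B. u x = v x)" using v(1) unfolding AEB by blast
  qed
 qed
qed

end
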